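(* For every $T>0$ the following hold uniformly with respect to $\varepsilon\in(0,1/2]$: $\rho^\varepsilon$ is bounded in $L^\infty((0,T)\times\Omega)$, and $\partial_t\rho^\varepsilon$ is bounded in $L^1((0,T);W^{-1,1}(\Omega))$. In particular, $\{\rho^\varepsilon\}_{\varepsilon>0}$ is relatively compact in $L^p((0,T);W^{-1,1}(\Omega))$ for any $p\in[1,\infty)$ and any $T>0$.
   Context: $W^{-1,1}(\Omega)$ is the space of distributions $f_0+\partial_xf_1$ with $f_0,f_1\in L^1(\Omega)$, with the usual (infimum) norm. Let $\Omega\subset\mathbb R$ be a bounded open interval, $n\in(0,3)$, and $u_{in}\in H^1(\Omega)$ with $u_{in}\ge 0$, $\int_\Omega u_{in}\,dx=1$. For $\varepsilon\in(0,1/2]$ the thin film problem is $|\ln\varepsilon|^{-1}\partial_t u+\partial_x\big((\varepsilon^{3-n}u^n+u^3)\partial_{xxx}u\big)=0$ in $(0,\infty)\times\Omega$, with $(\varepsilon^{3-n}u^n+u^3)u_{xxx}=0$ and $u_x=0$ on $(0,\infty)\times\partial\Omega$, and $u(0,\cdot)=u_{in}$. (Weak form: $|\ln\varepsilon|^{-1}\big(\int_0^\infty\!\int_\Omega u\psi_t+\int_\Omega u_{in}\psi(0,\cdot)\big)+\iint_{\{u>0\}}(\varepsilon^{3-n}u^n+u^3)u_{xxx}\psi_x=0$ for all $\psi\in C_c^\infty([0,\infty)\times\overline\Omega)$.) Let $B(s)=\int_0^s\int_r^\infty\frac{1}{v^{n-1}+v^2}\,dv\,dr$ and $B^\varepsilon(s)=|\ln\varepsilon|^{-1}B(s/\varepsilon)$.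 For each $\varepsilon$, $u^\varepsilon$ denotes a fixed continuous non-negative weak solution such that, with $\rho^\varepsilon:=B^\varepsilon(u^\varepsilon)$, for every $T>0$: (i) $u^\varepsilon\in L^\infty((0,T);H^1(\Omega))$, $u^\varepsilon u^\varepsilon_{xxx}\in L^2((0,T)\times\Omega)$; (ii) $\int_\Omega u^\varepsilon(t)\,dx=\int_\Omega u_{in}\,dx$ for all $t>0$; (iii) $\frac12\int_\Omega|u^\varepsilon_x(t)|^2dx+\int_0^t\int_{\{u^\varepsilon>0\}}|\ln\varepsilon|(\varepsilon^{3-n}(u^\varepsilon)^n+(u^\varepsilon)^3)|u^\varepsilon_{xxx}|^2dx\,ds\le\frac12\int_\Omega|\partial_xu_{in}|^2dx$ for all $t>0$; (iv) $\int_\Omega\rho^\varepsilon(t)\,dx\ge\int_0^t\int_\Omega u^\varepsilon|u^\varepsilon_{xx}|^2dx\,ds+\int_\Omega\rho^\varepsilon(0)\,dx$ for all $t>0$ (with $u^\varepsilon|u^\varepsilon_{xx}|^2:=0$ on $\{u^\varepsilon=0\}$); (v) $u^\varepsilon\in L^2((0,T);H^2(\Omega))$ if $n<2$, and $(u^\varepsilon)^{3/2}\in L^2((0,T);H^2(\Omega))$, $((u^\varepsilon)^{3/4})_x\in L^4((0,T)\times\Omega)$ if $n\ge2$; for a.e. $t$, $u^\varepsilon(t,\cdot)\in C^1(\overline\Omega)$ with $u^\varepsilon_x=0$ on $\partial\Omega$; (vi) $\partial_t\rho^\varepsilon=T^\varepsilon+\partial_xR^\varepsilon$ in the sense of distributions,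 where $T^\varepsilon=-u^\varepsilon_x\,u^\varepsilon u^\varepsilon_{xxx}\in L^2((0,T);L^1(\Omega))$, $R^\varepsilon=-|\ln\varepsilon|(B^\varepsilon)'(u^\varepsilon)(\varepsilon^{3-n}(u^\varepsilon)^{n-1}+(u^\varepsilon)^2)u^\varepsilon u^\varepsilon_{xxx}$, and for a.e. $t$ and all $\varphi\in C^\infty(\overline\Omega)$, $\langle T^\varepsilon(t),\varphi\rangle=\int_\Omega u^\varepsilon(u^\varepsilon_{xx})^2\varphi\,dx-\frac56\int_\Omega(u^\varepsilon_x)^3\varphi'\,dx-\frac12\int_\Omega u^\varepsilon(u^\varepsilon_x)^2\varphi''\,dx$. *)

theory Defs
  imports "HOL-Analysis.Analysis"
begin

section \<open>Test functions\<close>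

definition dir_deriv :: "'a::euclidean_space \<Rightarrow> ('a \<Rightarrow> real) \<Rightarrow> 'a \<Rightarrow> real" where
  "dir_deriv v f = (\<lambda>z. frechet_derivative f (at z) v)"

primrec Ck :: "nat \<Rightarrow> ('a::euclidean_space \<Rightarrow> real) \<Rightarrow> bool" where
  "Ck 0 f \<longleftrightarrow> continuous_on UNIV f"
| "Ck (Suc k) f \<longleftrightarrow> (\<forall>z. f differentiable (at z)) \<and> (\<forall>v\<in>Basis. Ck k (dir_deriv v f))"

definition smooth :: "('a::euclidean_space \<Rightarrow> real) \<Rightarrow> bool" where
  "smooth f \<longleftrightarrow> (\<forall>k. Ck k f)"

text \<open>\<open>C\<^sub>c\<^sup>\<infinity>(U)\<close> for open \<open>U\<close>; its elements are extended by zero to the whole space.\<close>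

definition test_functions :: "'a::euclidean_space set \<Rightarrow> ('a \<Rightarrow> real) set" where
  "test_functions U = {\<phi>. smooth \<phi> \<and> (\<exists>K. compact K \<and> K \<subseteq> U \<and> (\<forall>z. z \<notin> K \<longrightarrow> \<phi> z = 0))}"

text \<open>A point of space-time is a pair \<open>(t, x)\<close>.\<close>

abbreviation partial_t :: "(real \<times> real \<Rightarrow> real) \<Rightarrow> real \<times> real \<Rightarrow> real" where
  "partial_t \<equiv> dir_deriv (1, 0)"

abbreviation partial_x :: "(real \<times> real \<Rightarrow> real) \<Rightarrow> real \<times> real \<Rightarrow> real" where
  "partial_x \<equiv> dir_deriv (0, 1)"

section \<open>Lebesgue and Sobolev spaces\<close>

text \<open>Elements of \<open>L\<^sup>p\<close> are represented by Borel functions.\<close>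

definition Lp_on :: "real \<Rightarrow> 'a::euclidean_space set \<Rightarrow> ('a \<Rightarrow> real) set" where
  "Lp_on p U = {f. set_borel_measurable lborel U f \<and>
      set_integrable lborel U (\<lambda>x. \<bar>f x\<bar> powr p)}"

definition L1_norm :: "'a::euclidean_space set \<Rightarrow> ('a \<Rightarrow> real) \<Rightarrow> real" where
  "L1_norm U f = (LINT x:U|lborel. \<bar>f x\<bar>)"

definition ess_bounded_by :: "'a::euclidean_space set \<Rightarrow> ('a \<Rightarrow> real) \<Rightarrow> real \<Rightarrow> bool" where
  "ess_bounded_by U f C \<longleftrightarrow> set_borel_measurable lborel U f \<and>
     (AE z in lborel. z \<in> U \<longrightarrow> \<bar>f z\<bar> \<le> C)"

definition loc_integrable :: "real set \<Rightarrow> (real \<Rightarrow> real) \<Rightarrow> bool" where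
  "loc_integrable U f \<longleftrightarrow> (\<forall>K. compact K \<and> K \<subseteq> U \<longrightarrow> set_integrable lborel K f)"

definition weak_deriv :: "real set \<Rightarrow> (real \<Rightarrow> real) \<Rightarrow> (real \<Rightarrow> real) \<Rightarrow> bool" where
  "weak_deriv U f g \<longleftrightarrow> loc_integrable U f \<and> loc_integrable U g \<and>
     (\<forall>\<phi>\<in>test_functions U.
        (LINT x:U|lborel. f x * deriv \<phi> x) = - (LINT x:U|lborel. g x * \<phi> x))"

text \<open>The weak derivative of a weakly differentiable function (an arbitrary representative).\<close>

definition wd :: "real set \<Rightarrow> (real \<Rightarrow> real) \<Rightarrow> real \<Rightarrow> real" where
  "wd U f = (SOME g. weak_deriv U f g)"

primrec Hk :: "nat \<Rightarrow> real set \<Rightarrow> (real \<Rightarrow> real) set" where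
  "Hk 0 U = Lp_on 2 U"
| "Hk (Suc k) U = {f \<in> Lp_on 2 U. \<exists>g\<in>Hk k U. weak_deriv U f g}"

definition Hk_norm :: "nat \<Rightarrow> real set \<Rightarrow> (real \<Rightarrow> real) \<Rightarrow> real" where
  "Hk_norm k U f = sqrt (\<Sum>j\<le>k. (LINT x:U|lborel. ((wd U ^^ j) f x)\<^sup>2))"

section \<open>The space \<open>W\<^sup>-\<^sup>1\<^sup>,\<^sup>1\<close>\<close>

text \<open>A distribution on \<open>U\<close> is a functional on \<open>test_functions U\<close>, set to zero
  outside \<open>test_functions U\<close> so that equality of distributions is equality in HOL.\<close>

type_synonym distr = "(real \<Rightarrow> real) \<Rightarrow> real"

definition distr_of :: "real set \<Rightarrow> (real \<Rightarrow> real) \<Rightarrow> distr" where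
  "distr_of U f = (\<lambda>\<phi>. if \<phi> \<in> test_functions U then (LINT x:U|lborel. f x * \<phi> x) else 0)"

definition distr_deriv :: "real set \<Rightarrow> distr \<Rightarrow> distr" where
  "distr_deriv U F = (\<lambda>\<phi>. if \<phi> \<in> test_functions U then - F (deriv \<phi>) else 0)"

definition W11_dual_rep :: "real set \<Rightarrow> distr \<Rightarrow> (real \<Rightarrow> real) \<Rightarrow> (real \<Rightarrow> real) \<Rightarrow> bool" where
  "W11_dual_rep U F f0 f1 \<longleftrightarrow> f0 \<in> Lp_on 1 U \<and> f1 \<in> Lp_on 1 U \<and>
     F = (\<lambda>\<phi>. distr_of U f0 \<phi> + distr_deriv U (distr_of U f1) \<phi>)"

definition Wm11 :: "real set \<Rightarrow> distr set" where
  "Wm11 U = {F. \<exists>f0 f1. W11_dual_rep U F f0 f1}"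

definition Wm11_norm :: "real set \<Rightarrow> distr \<Rightarrow> real" where
  "Wm11_norm U F = Inf {L1_norm U f0 + L1_norm U f1 | f0 f1. W11_dual_rep U F f0 f1}"

section \<open>Bochner spaces\<close>

text \<open>The target space is a set \<open>X\<close> with a (semi)norm \<open>N\<close>. Functions are not identified
  when they agree almost everywhere, so the spaces below carry seminorms. The time integrals use the
  complete measure \<open>lebesgue\<close>, as the values on a null set are arbitrary.\<close>

definition strongly_measurable ::
    "real set \<Rightarrow> 'v::minus set \<Rightarrow> ('v \<Rightarrow> real) \<Rightarrow> (real \<Rightarrow> 'v) \<Rightarrow> bool" where
  "strongly_measurable I X N F \<longleftrightarrow>
     (\<exists>s :: nat \<Rightarrow> real \<Rightarrow> 'v.
        (\<forall>k. finite (s k ` I) \<and> s k ` I \<subseteq> X \<and> (\<forall>v. {t \<in> I. s k t = v} \<in> sets lebesgue)) \<and>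
        (AE t in lebesgue. t \<in> I \<longrightarrow> F t \<in> X \<and> (\<lambda>k. N (s k t - F t)) \<longlonglongrightarrow> 0))"

definition bochner_Lp ::
    "real \<Rightarrow> real set \<Rightarrow> 'v::minus set \<Rightarrow> ('v \<Rightarrow> real) \<Rightarrow> (real \<Rightarrow> 'v) set" where
  "bochner_Lp p I X N =
     {F. strongly_measurable I X N F \<and> set_integrable lebesgue I (\<lambda>t. N (F t) powr p)}"

definition bochner_norm :: "real \<Rightarrow> real set \<Rightarrow> ('v \<Rightarrow> real) \<Rightarrow> (real \<Rightarrow> 'v) \<Rightarrow> real" where
  "bochner_norm p I N F = (LINT t:I|lebesgue. N (F t) powr p) powr (1 / p)"

definition bochner_Linf ::
    "real set \<Rightarrow> 'v::minus set \<Rightarrow> ('v \<Rightarrow> real) \<Rightarrow> (real \<Rightarrow> 'v) set" where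
  "bochner_Linf I X N =
     {F. strongly_measurable I X N F \<and> (\<exists>C. AE t in lebesgue. t \<in> I \<longrightarrow> N (F t) \<le> C)}"

definition bochner_topology ::
    "real \<Rightarrow> real set \<Rightarrow> 'v::minus set \<Rightarrow> ('v \<Rightarrow> real) \<Rightarrow> (real \<Rightarrow> 'v) topology" where
  "bochner_topology p I X N = topology (\<lambda>V. V \<subseteq> bochner_Lp p I X N \<and>
     (\<forall>F\<in>V. \<exists>r>0. \<forall>G\<in>bochner_Lp p I X N. bochner_norm p I N (\<lambda>t. G t - F t) < r \<longrightarrow> G \<in> V))"

definition relatively_compact :: "'a topology \<Rightarrow> 'a set \<Rightarrow> bool" where
  "relatively_compact S A \<longleftrightarrow> A \<subseteq> topspace S \<and> compactin S (S closure_of A)"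

section \<open>The thin film problem\<close>

definition B :: "real \<Rightarrow> real \<Rightarrow> real" where
  "B n s = (LINT r:{0<..<s}|lborel. (LINT v:{r<..}|lborel. 1 / (v powr (n - 1) + v\<^sup>2)))"

definition B_eps :: "real \<Rightarrow> real \<Rightarrow> real \<Rightarrow> real" where
  "B_eps n \<epsilon> s = B n (s / \<epsilon>) / \<bar>ln \<epsilon>\<bar>"

definition rho :: "real \<Rightarrow> real \<Rightarrow> (real \<times> real \<Rightarrow> real) \<Rightarrow> real \<times> real \<Rightarrow> real" where
  "rho n \<epsilon> u z = B_eps n \<epsilon> (u z)"

definition mobility :: "real \<Rightarrow> real \<Rightarrow> real \<Rightarrow> real" where
  "mobility n \<epsilon> s = \<epsilon> powr (3 - n) * s powr n + s ^ 3"

definition on_pos :: "('a \<Rightarrow> real) \<Rightarrow> ('a \<Rightarrow> real) \<Rightarrow> 'a \<Rightarrow> real" where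
  "on_pos u f = (\<lambda>z. if u z > 0 then f z else 0)"

text \<open>Spatial derivatives are taken at fixed times: \<open>ux(t)\<close> is the weak derivative of \<open>u(t)\<close> on the
  interval, while \<open>uxx(t)\<close> and \<open>uxxx(t)\<close> are weak derivatives on the open set \<open>{u(t) > 0}\<close> only.\<close>

definition x_derivatives :: "real \<Rightarrow> real \<Rightarrow> (real \<times> real \<Rightarrow> real) \<Rightarrow>
    (real \<times> real \<Rightarrow> real) \<Rightarrow> (real \<times> real \<Rightarrow> real) \<Rightarrow> (real \<times> real \<Rightarrow> real) \<Rightarrow> bool" where
  "x_derivatives a b u ux uxx uxxx \<longleftrightarrow>
     ux \<in> borel_measurable borel \<and> uxx \<in> borel_measurable borel \<and> uxxx \<in> borel_measurable borel \<and>
     (\<forall>t>0. weak_deriv {a<..<b} (curry u t) (curry ux t)) \<and>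
     (AE t in lborel. t > 0 \<longrightarrow>
        weak_deriv {x \<in> {a<..<b}. u (t, x) > 0} (curry ux t) (curry uxx t) \<and>
        weak_deriv {x \<in> {a<..<b}. u (t, x) > 0} (curry uxx t) (curry uxxx t))"

definition weak_solution :: "real \<Rightarrow> real \<Rightarrow> real \<Rightarrow> (real \<Rightarrow> real) \<Rightarrow> real \<Rightarrow>
    (real \<times> real \<Rightarrow> real) \<Rightarrow> (real \<times> real \<Rightarrow> real) \<Rightarrow> bool" where
  "weak_solution a b n uin \<epsilon> u uxxx \<longleftrightarrow>
     (AE x in lborel. x \<in> {a<..<b} \<longrightarrow> u (0, x) = uin x) \<and>
     (\<forall>\<psi>\<in>test_functions UNIV.
        1 / \<bar>ln \<epsilon>\<bar> * ((LINT z:{0<..} \<times> {a<..<b}|lborel. u z * partial_t \<psi> z)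
                    + (LINT x:{a<..<b}|lborel. uin x * \<psi> (0, x)))
        + (LINT z:{z \<in> {0<..} \<times> {a<..<b}. u z > 0}|lborel.
             mobility n \<epsilon> (u z) * uxxx z * partial_x \<psi> z) = 0)"

text \<open>The terms of the equation \<open>\<partial>\<^sub>t \<rho> = T + \<partial>\<^sub>x R\<close>.\<close>

definition T_eps :: "(real \<times> real \<Rightarrow> real) \<Rightarrow> (real \<times> real \<Rightarrow> real) \<Rightarrow>
    (real \<times> real \<Rightarrow> real) \<Rightarrow> real \<times> real \<Rightarrow> real" where
  "T_eps u ux uxxx = on_pos u (\<lambda>z. - ux z * (u z * uxxx z))"

definition R_eps :: "real \<Rightarrow> real \<Rightarrow> (real \<times> real \<Rightarrow> real) \<Rightarrow>
    (real \<times> real \<Rightarrow> real) \<Rightarrow> real \<times> real \<Rightarrow> real" where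
  "R_eps n \<epsilon> u uxxx = on_pos u (\<lambda>z. - \<bar>ln \<epsilon>\<bar> * deriv (B_eps n \<epsilon>) (u z)
       * (\<epsilon> powr (3 - n) * u z powr (n - 1) + (u z)\<^sup>2) * (u z * uxxx z))"

definition prop_i :: "real \<Rightarrow> real \<Rightarrow> (real \<times> real \<Rightarrow> real) \<Rightarrow> (real \<times> real \<Rightarrow> real) \<Rightarrow> real \<Rightarrow> bool" where
  "prop_i a b u uxxx \<tau> \<longleftrightarrow>
     curry u \<in> bochner_Linf {0<..<\<tau>} (Hk 1 {a<..<b}) (Hk_norm 1 {a<..<b}) \<and>
     on_pos u (\<lambda>z. u z * uxxx z) \<in> Lp_on 2 ({0<..<\<tau>} \<times> {a<..<b})"

definition prop_ii :: "real \<Rightarrow> real \<Rightarrow> (real \<Rightarrow> real) \<Rightarrow> (real \<times> real \<Rightarrow> real) \<Rightarrow> bool" where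
  "prop_ii a b uin u \<longleftrightarrow>
     (\<forall>t>0. (LINT x:{a<..<b}|lborel. u (t, x)) = (LINT x:{a<..<b}|lborel. uin x))"

definition prop_iii :: "real \<Rightarrow> real \<Rightarrow> real \<Rightarrow> (real \<Rightarrow> real) \<Rightarrow> real \<Rightarrow> (real \<times> real \<Rightarrow> real) \<Rightarrow>
    (real \<times> real \<Rightarrow> real) \<Rightarrow> (real \<times> real \<Rightarrow> real) \<Rightarrow> bool" where
  "prop_iii a b n uin \<epsilon> u ux uxxx \<longleftrightarrow>
     (\<forall>t>0. curry ux t \<in> Lp_on 2 {a<..<b} \<and>
        set_integrable lborel {z \<in> {0<..<t} \<times> {a<..<b}. u z > 0}
          (\<lambda>z. \<bar>ln \<epsilon>\<bar> * mobility n \<epsilon> (u z) * (uxxx z)\<^sup>2) \<and>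
        1 / 2 * (LINT x:{a<..<b}|lborel. (ux (t, x))\<^sup>2)
        + (LINT z:{z \<in> {0<..<t} \<times> {a<..<b}. u z > 0}|lborel.
             \<bar>ln \<epsilon>\<bar> * mobility n \<epsilon> (u z) * (uxxx z)\<^sup>2)
        \<le> 1 / 2 * (LINT x:{a<..<b}|lborel. (wd {a<..<b} uin x)\<^sup>2))"

definition prop_iv :: "real \<Rightarrow> real \<Rightarrow> real \<Rightarrow> real \<Rightarrow> (real \<times> real \<Rightarrow> real) \<Rightarrow>
    (real \<times> real \<Rightarrow> real) \<Rightarrow> bool" where
  "prop_iv a b n \<epsilon> u uxx \<longleftrightarrow>
     (\<forall>t>0. set_integrable lborel ({0<..<t} \<times> {a<..<b}) (on_pos u (\<lambda>z. u z * (uxx z)\<^sup>2)) \<and>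
        (LINT x:{a<..<b}|lborel. rho n \<epsilon> u (t, x))
        \<ge> (LINT z:{0<..<t} \<times> {a<..<b}|lborel. on_pos u (\<lambda>z. u z * (uxx z)\<^sup>2) z)
           + (LINT x:{a<..<b}|lborel. rho n \<epsilon> u (0, x)))"

definition prop_v :: "real \<Rightarrow> real \<Rightarrow> real \<Rightarrow> (real \<times> real \<Rightarrow> real) \<Rightarrow> real \<Rightarrow> bool" where
  "prop_v a b n u \<tau> \<longleftrightarrow>
     (n < 2 \<longrightarrow> curry u \<in> bochner_Lp 2 {0<..<\<tau>} (Hk 2 {a<..<b}) (Hk_norm 2 {a<..<b})) \<and>
     (n \<ge> 2 \<longrightarrow>
        curry (\<lambda>z. u z powr (3/2)) \<in> bochner_Lp 2 {0<..<\<tau>} (Hk 2 {a<..<b}) (Hk_norm 2 {a<..<b}) \<and>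
        (\<exists>g\<in>Lp_on 4 ({0<..<\<tau>} \<times> {a<..<b}). AE t in lborel. t \<in> {0<..<\<tau>} \<longrightarrow>
           weak_deriv {a<..<b} (curry (\<lambda>z. u z powr (3/4)) t) (curry g t))) \<and>
     (AE t in lborel. t \<in> {0<..<\<tau>} \<longrightarrow>
        (\<exists>g. continuous_on {a..b} g \<and> g a = 0 \<and> g b = 0 \<and>
           (\<forall>x\<in>{a..b}. (curry u t has_real_derivative g x) (at x within {a..b}))))"

text \<open>\<open>C\<^sup>\<infinity>\<close> functions on the closed interval are restrictions of smooth functions on the line.\<close>

definition prop_vi :: "real \<Rightarrow> real \<Rightarrow> real \<Rightarrow> real \<Rightarrow> (real \<times> real \<Rightarrow> real) \<Rightarrow>
    (real \<times> real \<Rightarrow> real) \<Rightarrow> (real \<times> real \<Rightarrow> real) \<Rightarrow> (real \<times> real \<Rightarrow> real) \<Rightarrow> real \<Rightarrow> bool" where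
  "prop_vi a b n \<epsilon> u ux uxx uxxx \<tau> \<longleftrightarrow>
     curry (T_eps u ux uxxx) \<in> bochner_Lp 2 {0<..<\<tau>} (Lp_on 1 {a<..<b}) (L1_norm {a<..<b}) \<and>
     (\<forall>\<phi>\<in>test_functions ({0<..<\<tau>} \<times> {a<..<b}).
        - (LINT z:{0<..<\<tau>} \<times> {a<..<b}|lborel. rho n \<epsilon> u z * partial_t \<phi> z)
        = (LINT z:{0<..<\<tau>} \<times> {a<..<b}|lborel. T_eps u ux uxxx z * \<phi> z)
          - (LINT z:{0<..<\<tau>} \<times> {a<..<b}|lborel. R_eps n \<epsilon> u uxxx z * partial_x \<phi> z)) \<and>
     (AE t in lborel. t \<in> {0<..<\<tau>} \<longrightarrow> (\<forall>\<phi>. smooth \<phi> \<longrightarrow>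
        (LINT x:{a<..<b}|lborel. T_eps u ux uxxx (t, x) * \<phi> x)
        = (LINT x:{a<..<b}|lborel. on_pos u (\<lambda>z. u z * (uxx z)\<^sup>2) (t, x) * \<phi> x)
          - 5/6 * (LINT x:{a<..<b}|lborel. (ux (t, x)) ^ 3 * deriv \<phi> x)
          - 1/2 * (LINT x:{a<..<b}|lborel. u (t, x) * (ux (t, x))\<^sup>2 * deriv (deriv \<phi>) x)))"

definition thin_film_solution :: "real \<Rightarrow> real \<Rightarrow> real \<Rightarrow> (real \<Rightarrow> real) \<Rightarrow> real \<Rightarrow>
    (real \<times> real \<Rightarrow> real) \<Rightarrow> (real \<times> real \<Rightarrow> real) \<Rightarrow> (real \<times> real \<Rightarrow> real) \<Rightarrow>
    (real \<times> real \<Rightarrow> real) \<Rightarrow> bool" where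
  "thin_film_solution a b n uin \<epsilon> u ux uxx uxxx \<longleftrightarrow>
     continuous_on ({0..} \<times> {a..b}) u \<and> (\<forall>z\<in>{0..} \<times> {a..b}. 0 \<le> u z) \<and>
     x_derivatives a b u ux uxx uxxx \<and>
     weak_solution a b n uin \<epsilon> u uxxx \<and>
     prop_ii a b uin u \<and>
     prop_iii a b n uin \<epsilon> u ux uxxx \<and>
     prop_iv a b n \<epsilon> u uxx \<and>
     (\<forall>\<tau>>0. prop_i a b u uxxx \<tau> \<and> prop_v a b n u \<tau> \<and> prop_vi a b n \<epsilon> u ux uxx uxxx \<tau>)"

text \<open>\<open>G\<close> is the distributional time derivative of \<open>f\<close> on \<open>I \<times> U\<close>.\<close>

definition time_deriv ::
    "real set \<Rightarrow> real set \<Rightarrow> (real \<times> real \<Rightarrow> real) \<Rightarrow> (real \<Rightarrow> distr) \<Rightarrow> bool" where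
  "time_deriv I U f G \<longleftrightarrow>
     (\<forall>\<phi>\<in>test_functions (I \<times> U).
        set_integrable lebesgue I (\<lambda>t. G t (curry \<phi> t)) \<and>
        - (LINT z:I \<times> U|lborel. f z * partial_t \<phi> z) = (LINT t:I|lebesgue. G t (curry \<phi> t)))"

end

theory Submission
  imports Defs "HOL-Complex_Analysis.Great_Picard" "HOL-Library.Diagonal_Subsequence"
begin

text \<open>The energy inequality bounds \<open>u\<close> uniformly, and \<open>B(s) \<le> B(1) + ln s\<close> for \<open>s \<ge> 1\<close>, so the
  factor \<open>1/|ln \<epsilon>|\<close> makes \<open>\<rho>\<close> bounded; the entropy inequality then bounds \<open>\<integral>\<integral> u u\<^sub>x\<^sub>x\<^sup>2\<close>.
  Integrating by parts on \<open>{u > 0}\<close> at a fixed time controls \<open>\<integral>\<integral> |u\<^sub>x|\<^sup>3\<close> by the same quantity and rewrites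
  the weak form of \<open>T\<close> as \<open>T = u u\<^sub>x\<^sub>x\<^sup>2 + \<partial>\<^sub>x(u\<^sub>x\<^sup>3/3 - u u\<^sub>x u\<^sub>x\<^sub>x)\<close>, which bounds \<open>\<partial>\<^sub>t \<rho>\<close>. For the compactness,
  the values of \<open>\<rho>\<close> lie in the image of bounded densities, which is relatively compact in \<open>W\<^sup>-\<^sup>1\<^sup>,\<^sup>1\<close> because their
  primitives are equi-Lipschitz, and the curves \<open>t \<mapsto> \<rho>(t)\<close> have uniformly bounded variation there.
  Helly's selection argument gives a subsequence that converges for almost every time, and dominated
  convergence upgrades this to \<open>L\<^sup>p\<close> in time.\<close>

section \<open>Smooth functions\<close>

text \<open>Three obstacles shape the argument. The given formula for \<open>T\<close> puts two
  derivatives on the test function, one more than the dual norm allows. They sit on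
  \<open>u u_x^2\<close>, and one of them can be moved only where \<open>u_xx\<close> exists, that
  is on {u > 0}, possibly an infinite union of intervals. No boundary terms survive, because
  \<open>u_x\<close> vanishes at interior zeros of \<open>u\<close> and at the ends of the interval.
  The flux \<open>R\<close> must be bounded without loss in \<epsilon>. After the scaling v =
  u/\<epsilon>, its square is the energy dissipation density times a factor that the two decay rates
  v^(-n/3) and 1/v of B' keep bounded. Completeness of the dual space is never established: limits
  in the selection come from relative compactness of the set of values.\<close>

lemma Ck_mono_Suc: "Ck (Suc k) f \<Longrightarrow> Ck k f"
proof (induction k arbitrary: f)
  case 0
  then show ?case
    by (auto intro!: continuous_at_imp_continuous_on differentiable_imp_continuous_within)
qed auto

lemma dir_deriv_eq:
  assumes "\<And>z. (f has_derivative f' z) (at z)"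
  shows "dir_deriv v f = (\<lambda>z. f' z v)"
  using assms frechet_derivative_at unfolding dir_deriv_def by metis

lemma Ck_SucI:
  assumes "\<And>z. (f has_derivative f' z) (at z)" "\<And>v. v \<in> Basis \<Longrightarrow> Ck k (\<lambda>z. f' z v)"
  shows "Ck (Suc k) f"
  using assms dir_deriv_eq[OF assms(1)] by (auto simp: differentiable_def)

lemma Ck_SucD:
  assumes "Ck (Suc k) f"
  shows "(f has_derivative frechet_derivative f (at z)) (at z)"
    "v \<in> Basis \<Longrightarrow> Ck k (\<lambda>z. frechet_derivative f (at z) v)"
  using assms by (auto simp: frechet_derivative_works[symmetric] dir_deriv_def[symmetric])

lemma Ck_const: "Ck k (\<lambda>z. c)"
  by (induction k arbitrary: c) (auto simp: dir_deriv_eq[OF has_derivative_const])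

lemma Ck_add: "Ck k f \<Longrightarrow> Ck k g \<Longrightarrow> Ck k (\<lambda>z. f z + g z)"
proof (induction k arbitrary: f g)
  case (Suc k)
  show ?case
    by (rule Ck_SucI[OF has_derivative_add[OF Ck_SucD(1)[OF Suc.prems(1)] Ck_SucD(1)[OF Suc.prems(2)]]])
      (use Suc.IH Ck_SucD(2) Suc.prems in blast)
qed (auto intro: continuous_intros)

lemma Ck_mult: "Ck k f \<Longrightarrow> Ck k g \<Longrightarrow> Ck k (\<lambda>z. f z * g z)"
proof (induction k arbitrary: f g)
  case (Suc k)
  show ?case
  proof (rule Ck_SucI[OF has_derivative_mult[OF Ck_SucD(1)[OF Suc.prems(1)] Ck_SucD(1)[OF Suc.prems(2)]]])
    fix v :: 'a assume "v \<in> Basis"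
    then show "Ck k (\<lambda>z. f z * frechet_derivative g (at z) v + frechet_derivative f (at z) v * g z)"
      using Suc.IH Suc.prems Ck_mono_Suc Ck_SucD(2) by (intro Ck_add) blast+
  qed
qed (auto intro: continuous_intros)

text \<open>The class is what the cutoffs need: rescalings of the line and the two coordinate
  projections of space-time. The derivative in direction \<open>v\<close> is the constant
  \<open>l v\<close> times the same composition with the derivative of \<open>f\<close>, so the
  induction on \<open>k\<close> does not leave the class.\<close>

lemma Ck_compose_affine:
  fixes f :: "real \<Rightarrow> real" and l :: "'a::euclidean_space \<Rightarrow> real"
  assumes "bounded_linear l"
  shows "Ck k f \<Longrightarrow> Ck k (\<lambda>z. f (l z + c))"
proof (induction k arbitrary: f)
  case 0
  then have "continuous_on UNIV f" by simp
  moreover have "continuous_on UNIV (\<lambda>z. l z + c)"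
    by (intro continuous_intros linear_continuous_on assms)
  ultimately show ?case
    by (auto intro: continuous_on_compose2)
next
  case (Suc k)
  have der: "((\<lambda>z. f (l z + c)) has_derivative (\<lambda>v. frechet_derivative f (at (l z + c)) (l v))) (at z)" for z
    by (rule has_derivative_compose[OF _ Ck_SucD(1)[OF Suc.prems], where f = "\<lambda>z. l z + c"])
      (auto intro!: derivative_eq_intros bounded_linear_imp_has_derivative assms)
  have lin: "frechet_derivative f (at (l z + c)) (l v) = l v * frechet_derivative f (at (l z + c)) 1" for z v
  proof -
    have "linear (frechet_derivative f (at (l z + c)))"
      using Ck_SucD(1)[OF Suc.prems] has_derivative_linear by blast
    from linear_scale[OF this, of "l v" 1] show ?thesis by simp
  qed
  have D: "((\<lambda>z. f (l z + c)) has_derivative (\<lambda>v. l v * frechet_derivative f (at (l z + c)) 1)) (at z)" for z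
    using der[of z] by (simp only: lin)
  have "Ck k (\<lambda>z. frechet_derivative f (at (l z + c)) 1)"
    using Suc.IH[OF Ck_SucD(2)[OF Suc.prems]] by simp
  then show ?case
    by (intro Ck_SucI[OF D] Ck_mult Ck_const)
qed

lemma smooth_const: "smooth (\<lambda>z. c)"
  and smooth_add: "smooth f \<Longrightarrow> smooth g \<Longrightarrow> smooth (\<lambda>z. f z + g z)"
  and smooth_mult: "smooth f \<Longrightarrow> smooth g \<Longrightarrow> smooth (\<lambda>z. f z * g z)"
  by (auto simp: smooth_def Ck_const Ck_add Ck_mult)

lemma smooth_diff: "smooth f \<Longrightarrow> smooth g \<Longrightarrow> smooth (\<lambda>z. f z - g z)"
  using smooth_add[OF _ smooth_mult[OF smooth_const[of "-1"]], of f g] by simp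

lemma smooth_compose_affine:
  fixes f :: "real \<Rightarrow> real" and l :: "'a::euclidean_space \<Rightarrow> real"
  shows "smooth f \<Longrightarrow> bounded_linear l \<Longrightarrow> smooth (\<lambda>z. f (l z + c))"
  by (simp add: smooth_def Ck_compose_affine)

lemma smooth_imp_continuous: "smooth f \<Longrightarrow> continuous_on UNIV f"
  by (metis Ck.simps(1) smooth_def)

lemma smooth_imp_differentiable: "smooth f \<Longrightarrow> f differentiable (at z)"
  using smooth_def Ck.simps(2) by blast

lemma smooth_dir_deriv: "smooth f \<Longrightarrow> v \<in> Basis \<Longrightarrow> smooth (dir_deriv v f)"
  unfolding smooth_def using Ck.simps(2) by blast

lemma dir_deriv_real:
  fixes f :: "real \<Rightarrow> real"
  assumes "\<And>z. (f has_real_derivative f' z) (at z)"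
  shows "dir_deriv v f = (\<lambda>z. f' z * v)"
  by (rule dir_deriv_eq) (use assms in \<open>simp add: has_field_derivative_def\<close>)

lemma Ck_Suc_realI:
  fixes f :: "real \<Rightarrow> real"
  assumes "\<And>z. (f has_real_derivative f' z) (at z)" "Ck k f'"
  shows "Ck (Suc k) f"
  using assms by (intro Ck_SucI[where f' = "\<lambda>z. (*) (f' z)"]) (auto simp: has_field_derivative_def)

lemma smooth_real_DERIV:
  fixes f :: "real \<Rightarrow> real"
  assumes "smooth f"
  shows "(f has_real_derivative deriv f z) (at z)"
  using smooth_imp_differentiable[OF assms]
  by (simp add: DERIV_deriv_iff_real_differentiable)

lemma smooth_deriv:
  fixes f :: "real \<Rightarrow> real"
  assumes "smooth f"
  shows "smooth (deriv f)"
proof -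
  have "dir_deriv 1 f = deriv f"
    using dir_deriv_real[OF smooth_real_DERIV[OF assms], of 1] by simp
  then show ?thesis
    using smooth_dir_deriv[OF assms, of 1] by simp
qed

lemma smooth_realI:
  fixes f :: "real \<Rightarrow> real"
  assumes "\<And>z. (f has_real_derivative f' z) (at z)" "smooth f'"
  shows "smooth f"
  unfolding smooth_def
proof
  fix k show "Ck k f"
    using Ck_Suc_realI[OF assms(1), of k] assms(2) Ck_mono_Suc[of k f] unfolding smooth_def by blast
qed

section \<open>A smooth step function\<close>

definition flat_exp :: "nat \<Rightarrow> real \<Rightarrow> real" where
  "flat_exp m x = (if x > 0 then (1 / x) ^ m * exp (- (1 / x)) else 0)"

lemma flat_exp_tendsto: "(flat_exp m \<longlongrightarrow> 0) (at_right 0)"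
proof -
  have "((\<lambda>x. (1 / x) ^ m / exp (1 / x)) \<longlongrightarrow> (0::real)) (at_right 0)"
    using filterlim_compose[OF tendsto_power_div_exp_0 filterlim_inverse_at_top_right, of m]
    by (simp add: divide_inverse)
  then show ?thesis
    by (rule Lim_transform_eventually)
      (auto simp: eventually_at_right_less flat_exp_def exp_minus divide_inverse
        intro!: eventually_mono[OF eventually_at_right_less])
qed

text \<open>The powers of \<open>1 / x\<close> make the family closed under differentiation, which
  \<open>exp (- (1 / x))\<close> alone is not. At \<open>0\<close> the right difference quotient of
  \<open>flat_exp m\<close> is \<open>flat_exp (Suc m)\<close>, which tends to \<open>0\<close>; the
  left one is \<open>0\<close>.\<close>

lemma flat_exp_DERIV:
  "(flat_exp m has_real_derivative flat_exp (m + 2) x - real m * flat_exp (m + 1) x) (at x)"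
proof -
  consider "x > 0" | "x < 0" | "x = 0" by linarith
  then show ?thesis
  proof cases
    case 1
    have "((\<lambda>x. (1 / x) ^ m * exp (- (1 / x))) has_real_derivative
        flat_exp (m + 2) x - real m * flat_exp (m + 1) x) (at x)"
    proof -
      define y where "y = 1 / x"
      have d: "((\<lambda>x. 1 / x) has_real_derivative - (y * y)) (at x)"
        by (rule DERIV_cong[OF DERIV_divide[OF DERIV_const DERIV_ident]]) (use 1 in \<open>auto simp: y_def\<close>)
      have "((\<lambda>y. y ^ m * exp (- y)) has_real_derivative real m * y ^ (m - Suc 0) * exp (- y) - y ^ m * exp (- y)) (at (1 / x))"
        by (rule DERIV_cong[OF DERIV_mult[OF DERIV_pow DERIV_chain2[OF DERIV_exp DERIV_minus[OF DERIV_ident]]]]) (simp add: y_def)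
      from DERIV_chain2[OF this d] have D: "((\<lambda>x. (1 / x) ^ m * exp (- (1 / x))) has_real_derivative
          (real m * y ^ (m - Suc 0) * exp (- y) - y ^ m * exp (- y)) * - (y * y)) (at x)"
        by (simp add: y_def)
      \<comment> \<open>For \<open>m = 0\<close> the truncated exponent \<open>m - Suc 0\<close> is
        \<open>0\<close>, and both sides vanish because of the factor \<open>real m\<close>.\<close>
      have m: "real m * y ^ (m - Suc 0) * y = real m * y ^ m"
        by (cases m) simp_all
      have alg: "(A * e - p * e) * - (y * y) = p * y * y * e - (A * y) * y * e" for A p e
        by (simp add: algebra_simps)
      have "(real m * y ^ (m - Suc 0) * exp (- y) - y ^ m * exp (- y)) * - (y * y) =
          y ^ m * y * y * exp (- y) - real m * y ^ m * y * exp (- y)"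
        unfolding alg m ..
      also have "\<dots> = flat_exp (m + 2) x - real m * flat_exp (m + 1) x"
        using 1 by (simp add: flat_exp_def y_def)
      finally show ?thesis using D by simp
    qed
    moreover have "\<forall>\<^sub>F y in nhds x. (1 / y) ^ m * exp (- (1 / y)) = flat_exp m y"
      using eventually_nhds_in_open[of "{0<..}" x] 1
      by (auto elim!: eventually_mono simp: flat_exp_def)
    ultimately show ?thesis
      using DERIV_cong_ev[of x x "\<lambda>y. (1 / y) ^ m * exp (- (1 / y))" "flat_exp m"] by auto
  next
    case 2
    have "\<forall>\<^sub>F y in nhds x. 0 = flat_exp m y"
      using eventually_nhds_in_open[of "{..<0}" x] 2
      by (auto elim!: eventually_mono simp: flat_exp_def)
    then show ?thesis
      using DERIV_cong_ev[of x x "\<lambda>y. 0" "flat_exp m" 0] 2 by (auto simp: flat_exp_def)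
  next
    case 3
    have "((\<lambda>h. flat_exp m h / h) \<longlongrightarrow> 0) (at_right 0)"
      by (rule Lim_transform_eventually[OF flat_exp_tendsto[of "Suc m"]])
        (auto simp: flat_exp_def intro!: eventually_mono[OF eventually_at_right_less])
    moreover have "((\<lambda>h. flat_exp m h / h) \<longlongrightarrow> 0) (at_left 0)"
      by (rule Lim_transform_eventually[OF tendsto_const])
        (auto simp: flat_exp_def eventually_at_filter)
    ultimately have "((\<lambda>h. flat_exp m h / h) \<longlongrightarrow> 0) (at 0)"
      using filterlim_split_at by blast
    then show ?thesis
      unfolding DERIV_def using 3 by (simp add: flat_exp_def)
  qed
qed

lemma smooth_flat_exp: "smooth (flat_exp m)"
  unfolding smooth_def
proof
  fix k show "Ck k (flat_exp m)"
  proof (induction k arbitrary: m)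
    case 0
    show ?case
      using flat_exp_DERIV DERIV_isCont
      by (simp add: continuous_on_eq_continuous_at) blast
  next
    case (Suc k)
    have "Ck k (\<lambda>x. flat_exp (m + 2) x + - real m * flat_exp (m + 1) x)"
      by (intro Ck_add Ck_mult Ck_const Suc.IH)
    then show ?case
      by (intro Ck_Suc_realI[OF flat_exp_DERIV]) simp
  qed
qed

text \<open>The product of two flat exponentials is a bump on the unit interval; it is divided by
  its mass, and \<open>H\<close> is the primitive. Both functions are kept: differences of rescaled
  copies of \<open>H\<close> are cutoffs, while rescaled copies of \<open>\<eta>\<close> are
  mollifiers of mass one supported to the right of their base point.\<close>

lemma smooth_step_exists:
  obtains \<eta> H :: "real \<Rightarrow> real" where "smooth \<eta>" "smooth H"
    "\<And>x. (H has_real_derivative \<eta> x) (at x)" "\<And>x. 0 \<le> \<eta> x" "\<And>x. x \<notin> {0..1} \<Longrightarrow> \<eta> x = 0"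
    "\<And>x. x \<le> 0 \<Longrightarrow> H x = 0" "\<And>x. x \<ge> 1 \<Longrightarrow> H x = 1" "\<And>x. H x \<in> {0..1}"
proof -
  define e where "e x = flat_exp 0 x * flat_exp 0 (1 - x)" for x
  have sm: "smooth e"
    using smooth_mult[OF smooth_flat_exp[of 0] smooth_compose_affine[OF smooth_flat_exp[of 0] bounded_linear_minus[OF bounded_linear_ident], of 1]]
    by (simp add: e_def[abs_def])
  then have cont: "continuous_on A e" for A
    using smooth_imp_continuous continuous_on_subset by blast
  have nonneg: "0 \<le> e x" and supp: "x \<notin> {0..1} \<Longrightarrow> e x = 0" for x
    by (auto simp: e_def flat_exp_def)
  \<comment> \<open>An oriented integral from the base point \<open>-1\<close>, which lies to the
    left of the support of \<open>e\<close>; for each \<open>x\<close> at least one of the two terms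
    vanishes.\<close>
  define E where "E x = integral {-1..x} e - integral {x..-1} e" for x
  have E: "(E has_real_derivative e x) (at x)" for x
  proof -
    \<comment> \<open>Near \<open>x\<close>, a base point to the left of both \<open>x\<close> and
      \<open>-1\<close> replaces the oriented integral by an ordinary one, up to a constant.\<close>
    define c where "c = min x (-1) - 1"
    have int: "e integrable_on {p..q}" for p q
      by (intro integrable_continuous_interval cont)
    have eq: "E y = integral {c..y} e - integral {c..-1} e" if "y > c" for y
    proof (cases "y \<ge> -1")
      case True
      have "integral {c..-1} e + integral {-1..y} e = integral {c..y} e"
        by (rule Henstock_Kurzweil_Integration.integral_combine) (use True int in \<open>auto simp: c_def\<close>)
      moreover have "integral {y..-1} e = 0" using True by (cases "y = -1") auto
      ultimately show ?thesis by (simp add: E_def)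
    next
      case False
      have "integral {c..y} e + integral {y..-1} e = integral {c..-1} e"
        by (rule Henstock_Kurzweil_Integration.integral_combine) (use False that int in auto)
      then show ?thesis using False by (simp add: E_def)
    qed
    have "((\<lambda>y. integral {c..y} e) has_real_derivative e x) (at x within {c..x+1})"
      by (rule integral_has_real_derivative) (use cont in \<open>auto simp: c_def\<close>)
    then have "((\<lambda>y. integral {c..y} e) has_real_derivative e x) (at x)"
      by (metis (no_types, lifting) at_within_Icc_at c_def less_add_one min.cobounded1 diff_less_eq add.commute order_le_less_trans zero_less_one)
    then have "((\<lambda>y. integral {c..y} e - integral {c..-1} e) has_real_derivative e x) (at x)"
      by (auto intro!: derivative_eq_intros)
    moreover have "\<forall>\<^sub>F y in nhds x. integral {c..y} e - integral {c..-1} e = E y"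
      by (rule eventually_mono[OF eventually_nhds_in_open[of "{c<..}" x]])
        (use eq in \<open>auto simp: c_def\<close>)
    ultimately show ?thesis
      using DERIV_cong_ev[of x x "\<lambda>y. integral {c..y} e - integral {c..-1} e" E] by auto
  qed
  have mono: "E x \<le> E y" if "x \<le> y" for x y
    using DERIV_nonneg_imp_nondecreasing[OF that] E nonneg by blast
  have const: "E x = E y" if e0: "\<And>z. z \<in> {x<..<y} \<Longrightarrow> e z = 0" and le: "x \<le> y" for x y
  proof (cases "x = y")
    case False
    then obtain z where "z \<in> {x<..<y}" "E y - E x = (y - x) * e z"
      using MVT2[of x y E e] E le by (metis greaterThanLessThan_iff less_eq_real_def)
    then show ?thesis using e0 by simp
  qed simp
  have E0: "E x = 0" if "x \<le> 0" for x
  proof -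
    have "E (-1) = 0" by (simp add: E_def)
    then show ?thesis
      using const[of x "-1"] const[of "-1" x] supp that by (cases "x \<le> -1") auto
  qed
  have E1: "E x = E 1" if "x \<ge> 1" for x
    using const[of 1 x] supp that by auto
  have "E 1 > 0"
  proof -
    \<comment> \<open>The mass of the bump is positive: \<open>e\<close> is positive inside the unit
      interval, and the mean value theorem gives strict growth of \<open>E\<close> across its middle
      half.\<close>
    obtain z where z: "z \<in> {1/4<..<3/4}" "E (3/4) - E (1/4) = (3/4 - 1/4) * e z"
      using MVT2[of "1/4" "3/4" E e] E by auto
    then have "e z > 0" by (auto simp: e_def flat_exp_def)
    then have "E (3/4) > E (1/4)" using z by auto
    then show ?thesis using mono[of "3/4" 1] mono[of 0 "1/4"] E0[of 0] by auto
  qed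
  show thesis
  proof (rule that[of "\<lambda>x. 1 / E 1 * e x" "\<lambda>x. 1 / E 1 * E x"])
    show "smooth (\<lambda>x. 1 / E 1 * e x)" by (intro smooth_mult smooth_const sm)
    show "smooth (\<lambda>x. 1 / E 1 * E x)"
      by (intro smooth_mult smooth_const smooth_realI[OF E] sm)
    show "((\<lambda>x. 1 / E 1 * E x) has_real_derivative 1 / E 1 * e x) (at x)" for x
      by (rule DERIV_cmult[OF E])
    show "1 / E 1 * E x \<in> {0..1}" for x
      using mono[of 0 x] mono[of x 0] mono[of x 1] mono[of 1 x] E0[of 0] E0[of x] E1[of x] \<open>E 1 > 0\<close>
      by (cases "x \<le> 0"; cases "x \<ge> 1") (auto simp: divide_simps)
    show "1 / E 1 * E x = 1" if "x \<ge> 1" for x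
      using E1[OF that] \<open>E 1 > 0\<close> by simp
  qed (use \<open>E 1 > 0\<close> nonneg supp E0 in auto)
qed

section \<open>Test functions and weak derivatives\<close>

lemma test_functions_smooth: "\<phi> \<in> test_functions U \<Longrightarrow> smooth \<phi>"
  and test_functions_continuous: "\<phi> \<in> test_functions U \<Longrightarrow> continuous_on A \<phi>"
  unfolding test_functions_def using smooth_imp_continuous continuous_on_subset by blast+

lemma test_functions_measurable [measurable_dest]:
  "\<phi> \<in> test_functions U \<Longrightarrow> \<phi> \<in> borel_measurable borel"
  by (intro borel_measurable_continuous_onI test_functions_continuous)

lemma test_functions_support:
  assumes "\<phi> \<in> test_functions U"
  obtains K where "compact K" "K \<subseteq> U" "\<And>z. z \<notin> K \<Longrightarrow> \<phi> z = 0"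
  using assms unfolding test_functions_def by blast

lemma test_functions_bounded:
  assumes "\<phi> \<in> test_functions U"
  obtains M where "0 < M" "\<And>z. \<bar>\<phi> z\<bar> \<le> M"
proof -
  obtain K where K: "compact K" "\<And>z. z \<notin> K \<Longrightarrow> \<phi> z = 0"
    using test_functions_support[OF assms] by metis
  have "bounded (\<phi> ` K)"
    by (intro compact_imp_bounded compact_continuous_image test_functions_continuous[OF assms] K)
  then obtain M where "\<And>z. z \<in> K \<Longrightarrow> \<bar>\<phi> z\<bar> \<le> M"
    unfolding bounded_iff by auto
  then have "\<bar>\<phi> z\<bar> \<le> max 1 M" for z
    using K(2)[of z] by (cases "z \<in> K") (auto simp: le_max_iff_disj)
  then show thesis by (intro that[of "max 1 M"]) auto
qed

lemma test_functions_deriv: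
  fixes \<phi> :: "real \<Rightarrow> real"
  assumes "\<phi> \<in> test_functions U"
  shows "deriv \<phi> \<in> test_functions U"
proof -
  obtain K where K: "compact K" "K \<subseteq> U" "\<And>z. z \<notin> K \<Longrightarrow> \<phi> z = 0"
    using test_functions_support[OF assms] by metis
  have "deriv \<phi> z = 0" if "z \<notin> K" for z
  proof -
    have "\<forall>\<^sub>F y in nhds z. \<phi> y = 0"
      by (rule eventually_mono[OF eventually_nhds_in_open[of "- K" z]])
        (use K that in \<open>auto intro: compact_imp_closed\<close>)
    from deriv_cong_ev[OF this refl] show ?thesis by simp
  qed
  then show ?thesis
    using K smooth_deriv[OF test_functions_smooth[OF assms]] unfolding test_functions_def by blast
qed

lemma Ck_slice:
  "Ck k \<Phi> \<Longrightarrow> Ck k (\<lambda>x. \<Phi> (t :: real, x :: real))"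
proof (induction k arbitrary: \<Phi>)
  case 0
  then show ?case by (auto intro!: continuous_on_compose2[of UNIV \<Phi>] continuous_intros)
next
  case (Suc k)
  have der: "((\<lambda>x. \<Phi> (t, x)) has_derivative (\<lambda>v. frechet_derivative \<Phi> (at (t, x)) (0, v))) (at x)" for x
    by (rule has_derivative_compose[OF _ Ck_SucD(1)[OF Suc.prems], where f = "\<lambda>x. (t, x)"])
      (auto intro!: derivative_eq_intros)
  have "Ck k (\<lambda>z. frechet_derivative \<Phi> (at z) (0, 1))"
    by (intro Ck_SucD(2)[OF Suc.prems]) (auto simp: Basis_prod_def)
  from Suc.IH[OF this] show ?case
    by (intro Ck_SucI[OF der]) auto
qed

lemma deriv_slice:
  assumes "smooth \<Phi>"
  shows "deriv (curry \<Phi> t) x = partial_x \<Phi> (t, x)"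
proof -
  let ?D = "frechet_derivative \<Phi> (at (t, x))"
  have D: "(\<Phi> has_derivative ?D) (at (t, x))"
    using smooth_imp_differentiable[OF assms] by (simp add: frechet_derivative_works)
  have "((\<lambda>y. \<Phi> (t, y)) has_derivative (\<lambda>v. ?D (0, v))) (at x)"
    by (rule has_derivative_compose[where g = \<Phi> and g' = ?D and f = "\<lambda>x. (t, x)", OF _ D])
      (auto intro!: derivative_eq_intros)
  moreover have "(\<lambda>v. ?D (0, v)) = (*) (?D (0, 1))"
  proof
    fix v
    have "?D (v *\<^sub>R (0, 1)) = v *\<^sub>R ?D (0, 1)"
      by (rule linear_scale[OF has_derivative_linear[OF D]])
    moreover have "v *\<^sub>R (0, 1) = (0, v)" for v :: real by simp
    ultimately show "?D (0, v) = ?D (0, 1) * v" by (metis mult.commute real_scaleR_def)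
  qed
  ultimately have "((\<lambda>y. \<Phi> (t, y)) has_real_derivative ?D (0, 1)) (at x)"
    by (simp add: has_field_derivative_def)
  then show ?thesis by (auto simp: dir_deriv_def curry_def intro!: DERIV_imp_deriv)
qed

lemma test_functions_slice:
  fixes \<Phi> :: "real \<times> real \<Rightarrow> real"
  assumes "\<Phi> \<in> test_functions (I \<times> U)"
  shows "curry \<Phi> t \<in> test_functions U"
proof -
  obtain K where K: "compact K" "K \<subseteq> I \<times> U" "\<And>z. z \<notin> K \<Longrightarrow> \<Phi> z = 0"
    using test_functions_support[OF assms] by metis
  have "compact (snd ` K)" "snd ` K \<subseteq> U" "\<And>x. x \<notin> snd ` K \<Longrightarrow> \<Phi> (t, x) = 0"
    using K by (force intro: compact_continuous_image continuous_intros)+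
  moreover have "smooth (curry \<Phi> t)"
    using test_functions_smooth[OF assms] Ck_slice by (auto simp: smooth_def curry_def)
  ultimately show ?thesis by (auto simp: test_functions_def)
qed

lemma test_functions_partial:
  fixes \<Phi> :: "real \<times> real \<Rightarrow> real"
  assumes "\<Phi> \<in> test_functions U" "v \<in> Basis"
  shows "dir_deriv v \<Phi> \<in> test_functions U"
proof -
  obtain K where K: "compact K" "K \<subseteq> U" "\<And>z. z \<notin> K \<Longrightarrow> \<Phi> z = 0"
    using test_functions_support[OF assms(1)] by metis
  have "dir_deriv v \<Phi> z = 0" if "z \<notin> K" for z
  proof -
    have "((\<lambda>_. 0) has_derivative (\<lambda>_. 0)) (at z)" by simp
    then have "(\<Phi> has_derivative (\<lambda>_. 0)) (at z)"
      by (rule has_derivative_transform_within_open[where s = "- K"])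
        (use K that in \<open>auto intro: compact_imp_closed\<close>)
    from frechet_derivative_at[OF this, symmetric] show ?thesis by (simp add: dir_deriv_def)
  qed
  then show ?thesis
    using K smooth_dir_deriv[OF test_functions_smooth[OF assms(1)] assms(2)]
    unfolding test_functions_def by blast
qed

lemma test_functions_tensor:
  fixes \<theta> \<psi> :: "real \<Rightarrow> real"
  assumes "\<theta> \<in> test_functions I" "\<psi> \<in> test_functions U"
  defines "\<Phi> \<equiv> \<lambda>z. \<theta> (fst z) * \<psi> (snd z)"
  shows "\<Phi> \<in> test_functions (I \<times> U)" "partial_t \<Phi> = (\<lambda>z. deriv \<theta> (fst z) * \<psi> (snd z))"
proof -
  obtain K where K: "compact K" "K \<subseteq> I" "\<And>z. z \<notin> K \<Longrightarrow> \<theta> z = 0"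
    using test_functions_support[OF assms(1)] by metis
  obtain L where L: "compact L" "L \<subseteq> U" "\<And>z. z \<notin> L \<Longrightarrow> \<psi> z = 0"
    using test_functions_support[OF assms(2)] by metis
  have "smooth \<Phi>"
    unfolding \<Phi>_def
    using smooth_compose_affine[OF test_functions_smooth[OF assms(1)] bounded_linear_fst, of 0]
      smooth_compose_affine[OF test_functions_smooth[OF assms(2)] bounded_linear_snd, of 0]
    by (intro smooth_mult) auto
  then show "\<Phi> \<in> test_functions (I \<times> U)"
    unfolding test_functions_def using K L
    by (auto intro!: exI[of _ "K \<times> L"] compact_Times simp: \<Phi>_def)
  show "partial_t \<Phi> = (\<lambda>z. deriv \<theta> (fst z) * \<psi> (snd z))"
  proof
    fix z :: "real \<times> real"
    have 1: "(\<theta> has_derivative (*) (deriv \<theta> (fst z))) (at (fst z))"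
      and 2: "(\<psi> has_derivative (*) (deriv \<psi> (snd z))) (at (snd z))"
      using smooth_real_DERIV test_functions_smooth assms by (auto simp: has_field_derivative_def)
    have "((\<lambda>z. \<theta> (fst z)) has_derivative (\<lambda>v. deriv \<theta> (fst z) * fst v)) (at z)"
      by (rule has_derivative_compose[where g = \<theta> and g' = "(*) (deriv \<theta> (fst z))" and f = fst, OF _ 1]) (auto intro!: derivative_eq_intros)
    moreover have "((\<lambda>z. \<psi> (snd z)) has_derivative (\<lambda>v. deriv \<psi> (snd z) * snd v)) (at z)"
      by (rule has_derivative_compose[where g = \<psi> and g' = "(*) (deriv \<psi> (snd z))" and f = snd, OF _ 2]) (auto intro!: derivative_eq_intros)
    ultimately have "(\<Phi> has_derivative (\<lambda>v. \<theta> (fst z) * (deriv \<psi> (snd z) * snd v) + deriv \<theta> (fst z) * fst v * \<psi> (snd z))) (at z)"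
      unfolding \<Phi>_def by (rule has_derivative_mult)
    from frechet_derivative_at[OF this, symmetric]
    show "partial_t \<Phi> z = deriv \<theta> (fst z) * \<psi> (snd z)"
      by (simp add: dir_deriv_def)
  qed
qed

section \<open>One-sided mollification and the fundamental theorem for weak derivatives\<close>

lemma DERIV_rescale:
  assumes "\<And>x. (H has_real_derivative \<eta> x) (at x)" "0 < (h::real)"
  shows "((\<lambda>x. H ((x - c) / h)) has_real_derivative \<eta> ((x - c) / h) / h) (at x)"
proof -
  have "((\<lambda>x. (x - c) / h) has_real_derivative 1 / h) (at x)"
    using assms(2) by (auto intro!: derivative_eq_intros)
  then show ?thesis
    using DERIV_chain2[where f = H and g = "\<lambda>x. (x - c) / h" and Db = "1 / h" and x = x and s = UNIV, OF assms(1)]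
    by simp
qed

text \<open>The mollifier lives on \<open>{s..s + h k}\<close> and has mass
  \<open>H 1 - H 0 = 1\<close>, so the integral is an average of the values of \<open>f\<close> just
  to the right of \<open>s\<close>. One-sidedness keeps the averaging inside \<open>U\<close> under
  the single condition \<open>{s..s + h k} \<subseteq> U\<close>.\<close>

lemma set_integral_mollify_right:
  fixes f \<eta> H :: "real \<Rightarrow> real"
  assumes U: "open U" "continuous_on U f" "s \<in> U"
    and \<eta>: "continuous_on UNIV \<eta>" "\<And>x. (H has_real_derivative \<eta> x) (at x)" "\<And>x. 0 \<le> \<eta> x"
      "\<And>x. x \<notin> {0..1} \<Longrightarrow> \<eta> x = 0" "H 0 = 0" "H 1 = 1"
    and h: "h \<longlonglongrightarrow> 0" "\<And>k. 0 < h k" "\<And>k. {s..s + h k} \<subseteq> U"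
  shows "set_integrable lborel U (\<lambda>x. f x * (\<eta> ((x - s) / h k) / h k))"
    "(\<lambda>k. LINT x:U|lborel. f x * (\<eta> ((x - s) / h k) / h k)) \<longlonglongrightarrow> f s"
proof -
  define e where "e k x = \<eta> ((x - s) / h k) / h k" for k x
  have e0: "e k x = 0" if "x \<notin> {s..s + h k}" for k x
    using that \<eta>(4)[of "(x - s) / h k"] h(2)[of k] by (auto simp: e_def field_simps)
  have epos: "0 \<le> e k x" for k x
    using \<eta>(3) h(2)[of k] by (simp add: e_def)
  have ce: "continuous_on A (e k)" for k A
    unfolding e_def by (rule continuous_on_subset[of UNIV])
      (use h(2)[of k] in \<open>auto intro!: continuous_intros continuous_on_compose2[OF \<eta>(1)]\<close>)
  have cf: "continuous_on {s..s + h k} f" for k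
    using U(2) h(3) continuous_on_subset by blast
  have int1: "set_integrable lborel {s..s + h k} (e k)" for k
    unfolding set_integrable_def by (rule borel_integrable_compact) (auto intro: ce)
  have int2: "set_integrable lborel {s..s + h k} (\<lambda>x. f x * e k x)" for k
    unfolding set_integrable_def by (rule borel_integrable_compact) (auto intro!: continuous_intros ce cf)
  have I1: "(LINT x:{s..s + h k}|lborel. e k x) = 1" for k
  proof -
    have "((\<lambda>x. H ((x - s) / h k)) has_real_derivative e k x) (at x)" for x
      unfolding e_def by (rule DERIV_rescale[OF \<eta>(2) h(2)])
    then have "(LINT x|lborel. indicator {s..s + h k} x *\<^sub>R e k x) = H ((s + h k - s) / h k) - H ((s - s) / h k)"
      by (intro integral_FTC_atLeastAtMost)
        (use h(2)[of k] ce in \<open>auto simp: has_real_derivative_iff_has_vector_derivative[symmetric] intro: DERIV_subset\<close>)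
    then show ?thesis using h(2)[of k] \<eta> by (simp add: set_lebesgue_integral_def)
  qed
  have ind: "(\<lambda>x. indicator U x *\<^sub>R (f x * e k x)) = (\<lambda>x. indicator {s..s + h k} x *\<^sub>R (f x * e k x))" for k
    using e0[of _ k] h(3)[of k] by (auto simp: indicator_def fun_eq_iff)
  show "set_integrable lborel U (\<lambda>x. f x * (\<eta> ((x - s) / h k) / h k))"
    using int2[of k] ind[of k] by (simp add: set_integrable_def e_def)
  have eq: "(LINT x:U|lborel. f x * e k x) = (LINT x:{s..s + h k}|lborel. f x * e k x)" for k
    unfolding set_lebesgue_integral_def ind ..
  have "(\<lambda>k. LINT x:U|lborel. f x * e k x) \<longlonglongrightarrow> f s"
  proof (rule tendstoI)
    fix d :: real assume "d > 0"
    obtain r where r: "r > 0" "\<And>x. x \<in> U \<Longrightarrow> dist x s < r \<Longrightarrow> dist (f x) (f s) < d / 2"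
      using U \<open>d > 0\<close> unfolding continuous_on_iff by (metis half_gt_zero)
    have "\<forall>\<^sub>F k in sequentially. h k < r"
      using order_tendstoD(2)[OF h(1) r(1)] .
    then show "\<forall>\<^sub>F k in sequentially. dist (LINT x:U|lborel. f x * e k x) (f s) < d"
    proof eventually_elim
      case (elim k)
      have "(LINT x:U|lborel. f x * e k x) - f s = (LINT x:{s..s + h k}|lborel. f x * e k x) - (LINT x:{s..s + h k}|lborel. f s * e k x)"
        using I1[of k] by (simp add: eq)
      also have "\<dots> = (LINT x:{s..s + h k}|lborel. (f x - f s) * e k x)"
        using set_integral_diff(2)[OF int2[of k] set_integrable_mult_right[of "f s", OF int1[of k]]]
        by (simp add: left_diff_distrib)
      finally have *: "(LINT x:U|lborel. f x * e k x) - f s = (LINT x:{s..s + h k}|lborel. (f x - f s) * e k x)" .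
      have "\<bar>LINT x:{s..s + h k}|lborel. (f x - f s) * e k x\<bar> \<le> (LINT x:{s..s + h k}|lborel. d / 2 * e k x)"
        unfolding set_lebesgue_integral_def
      proof (rule integral_abs_bound[THEN order_trans], rule integral_mono)
        show "integrable lborel (\<lambda>x. indicator {s..s + h k} x *\<^sub>R (d / 2 * e k x))"
          using set_integrable_mult_right[of "d / 2", OF int1[of k]] by (simp add: set_integrable_def)
        have "set_integrable lborel {s..s + h k} (\<lambda>x. (f x - f s) * e k x)"
          unfolding set_integrable_def by (rule borel_integrable_compact) (auto intro!: continuous_intros ce cf)
        then show "integrable lborel (\<lambda>x. \<bar>indicator {s..s + h k} x *\<^sub>R ((f x - f s) * e k x)\<bar>)"
          unfolding set_integrable_def by (rule integrable_abs)
        fix x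
        show "\<bar>indicator {s..s + h k} x *\<^sub>R ((f x - f s) * e k x)\<bar> \<le> indicator {s..s + h k} x *\<^sub>R (d / 2 * e k x)"
        proof (cases "x \<in> {s..s + h k}")
          case True
          then have "\<bar>f x - f s\<bar> \<le> d / 2"
            using r(2)[of x] h(3)[of k] elim by (force simp: dist_real_def)
          from mult_right_mono[OF this epos[of k x]] show ?thesis
            using True epos[of k x] by (simp add: abs_mult)
        qed simp
      qed
      also have "\<dots> = d / 2" using I1[of k] by simp
      finally show ?case using * \<open>d > 0\<close> by (simp add: dist_real_def)
    qed
  qed
  then show "(\<lambda>k. LINT x:U|lborel. f x * (\<eta> ((x - s) / h k) / h k)) \<longlonglongrightarrow> f s"
    by (simp add: e_def)
qed

text \<open>The cutoff is a difference of two smooth steps, one rising just right of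
  \<open>s\<close> and one just right of \<open>t\<close>. Its derivative is a difference of two
  mollifiers, hence the limit \<open>f s - f t\<close>. Since the steps vanish at their base points,
  the pointwise limit is the indicator of a half-open interval; the supports overshoot
  \<open>t\<close>, which is why \<open>t'\<close> appears.\<close>

lemma interval_cutoff:
  fixes U :: "real set"
  assumes "open U" "s \<le> t" "{s..t} \<subseteq> U"
  obtains \<theta> :: "nat \<Rightarrow> real \<Rightarrow> real" and t' where "t < t'" "{s..t'} \<subseteq> U"
    "\<And>k. \<theta> k \<in> test_functions U" "\<And>k x. \<bar>\<theta> k x\<bar> \<le> indicator {s..t'} x"
    "\<And>x. (\<lambda>k. \<theta> k x) \<longlonglongrightarrow> indicator {s<..t} x"
    "\<And>f. continuous_on U f \<Longrightarrow> (\<lambda>k. LINT x:U|lborel. f x * deriv (\<theta> k) x) \<longlonglongrightarrow> f s - f t"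
proof -
  obtain \<eta> H :: "real \<Rightarrow> real" where \<eta>: "smooth \<eta>" "smooth H"
    "\<And>x. (H has_real_derivative \<eta> x) (at x)" "\<And>x. 0 \<le> \<eta> x" "\<And>x. x \<notin> {0..1} \<Longrightarrow> \<eta> x = 0"
    "\<And>x. x \<le> 0 \<Longrightarrow> H x = 0" "\<And>x. x \<ge> 1 \<Longrightarrow> H x = 1" "\<And>x. H x \<in> {0..1}"
    using smooth_step_exists by metis
  have "t \<in> U" "s \<in> U" using assms by auto
  then obtain r where r: "r > 0" "cball t r \<subseteq> U"
    using assms(1) open_contains_cball by blast
  have tr: "{s..t + r} \<subseteq> U"
  proof
    fix x assume "x \<in> {s..t + r}"
    then show "x \<in> U" using assms(3) r(2) by (cases "x \<le> t") (auto simp: subset_eq dist_real_def)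
  qed
  \<comment> \<open>The widths never exceed \<open>r\<close>, so that all cutoffs are supported in
    the one interval \<open>{s..t + r}\<close> inside \<open>U\<close>.\<close>
  define h where "h k = r / real (Suc k)" for k
  have h: "h \<longlonglongrightarrow> 0" "\<And>k. 0 < h k" "\<And>k. h k \<le> r"
    unfolding h_def using r(1) LIMSEQ_Suc[OF lim_const_over_n[of r]] by (auto simp: field_simps)
  define \<theta> where "\<theta> k x = H ((x - s) / h k) - H ((x - t) / h k)" for k x
  have outside: "\<theta> k x = 0" if "x \<notin> {s..t + r}" for k x
  proof (cases "x < s")
    case True
    then have "(x - s) / h k \<le> 0" "(x - t) / h k \<le> 0"
      using assms(2) h(2)[of k] by (simp_all add: divide_nonpos_pos)
    then show ?thesis by (simp add: \<theta>_def \<eta>)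
  next
    case False
    then have "(x - s) / h k \<ge> 1" "(x - t) / h k \<ge> 1"
      using that assms(2) h(2,3)[of k] by (auto simp: field_simps)
    then show ?thesis by (simp add: \<theta>_def \<eta>)
  qed
  have "smooth (\<lambda>x. H ((x - c) / h k))" for c k
    using smooth_compose_affine[OF \<eta>(2) bounded_linear_divide[of "h k"], of "- c / h k"]
    by (simp add: diff_divide_distrib)
  then have "smooth (\<theta> k)" for k
    unfolding \<theta>_def[abs_def] by (intro smooth_diff)
  then have test: "\<theta> k \<in> test_functions U" for k
    unfolding test_functions_def using outside tr by (auto intro!: exI[of _ "{s..t + r}"])
  have d: "((\<lambda>x. H ((x - c) / h k)) has_real_derivative \<eta> ((x - c) / h k) / h k) (at x)" for c k x
    by (rule DERIV_rescale[OF \<eta>(3) h(2)])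
  have dchi: "deriv (\<theta> k) x = \<eta> ((x - s) / h k) / h k - \<eta> ((x - t) / h k) / h k" for k x
    unfolding \<theta>_def[abs_def] by (intro DERIV_imp_deriv DERIV_diff d)
  have lim: "(\<lambda>k. H ((x - c) / h k)) \<longlonglongrightarrow> indicator {c<..} x" for x c
  proof (cases "x > c")
    case True
    have "\<forall>\<^sub>F k in sequentially. h k < x - c"
      using order_tendstoD(2)[OF h(1), of "x - c"] True by simp
    then have "\<forall>\<^sub>F k in sequentially. H ((x - c) / h k) = 1"
      by eventually_elim (use h(2) in \<open>auto intro!: \<eta>(7) simp: field_simps\<close>)
    then show ?thesis using True by (simp add: tendsto_eventually)
  next
    case False
    then have "H ((x - c) / h k) = 0" for k
      using h(2)[of k] by (intro \<eta>(6)) (simp add: divide_nonpos_pos)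
    then show ?thesis using False by simp
  qed
  show thesis
  proof (rule that[of "t + r" \<theta>])
    show "\<bar>\<theta> k x\<bar> \<le> indicator {s..t + r} x" for k x
      using outside[of x k] \<eta>(8)[of "(x - s) / h k"] \<eta>(8)[of "(x - t) / h k"]
      by (cases "x \<in> {s..t + r}") (auto simp: \<theta>_def)
    show "(\<lambda>k. \<theta> k x) \<longlonglongrightarrow> indicator {s<..t} x" for x
      using tendsto_diff[OF lim[of x s] lim[of x t]] assms(2)
      by (auto simp: \<theta>_def indicator_def split: if_splits)
    fix f :: "real \<Rightarrow> real" assume f: "continuous_on U f"
    have c: "continuous_on UNIV \<eta>" using \<eta>(1) smooth_imp_continuous by blast
    have "{s..s + h k} \<subseteq> U" "{t..t + h k} \<subseteq> U" for k
      using tr h(3)[of k] assms(2) by (auto simp: subset_eq)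
    then have m: "set_integrable lborel U (\<lambda>x. f x * (\<eta> ((x - c) / h k) / h k))"
      "(\<lambda>k. LINT x:U|lborel. f x * (\<eta> ((x - c) / h k) / h k)) \<longlonglongrightarrow> f c" if "c \<in> {s, t}" for c k
      using set_integral_mollify_right[OF assms(1) f _ c \<eta>(3,4,5) \<eta>(6)[of 0] \<eta>(7)[of 1] h(1,2), of c] that
        \<open>s \<in> U\<close> \<open>t \<in> U\<close> by auto
    have "(LINT x:U|lborel. f x * deriv (\<theta> k) x) = (LINT x:U|lborel. f x * (\<eta> ((x - s) / h k) / h k))
        - (LINT x:U|lborel. f x * (\<eta> ((x - t) / h k) / h k))" for k
      using set_integral_diff(2)[OF m(1)[of s k] m(1)[of t k]] by (simp add: dchi right_diff_distrib)
    then show "(\<lambda>k. LINT x:U|lborel. f x * deriv (\<theta> k) x) \<longlonglongrightarrow> f s - f t"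
      using tendsto_diff[OF m(2)[of s] m(2)[of t]] by simp
  qed (use r tr test in auto)
qed

text \<open>The cutoffs are admissible in the weak formulation. One side tends to
  \<open>f s - f t\<close> by continuity of \<open>f\<close>, the other by domination with
  \<open>\<bar>g\<bar>\<close> on \<open>{s..t'}\<close>. Local integrability of \<open>g\<close>
  suffices for this, so the result applies to \<open>uxx\<close> inside the positivity set and to
  time derivatives of pairings.\<close>

lemma weak_deriv_FTC:
  assumes U: "open U" and f: "continuous_on U f" and w: "weak_deriv U f g"
    and st: "s \<le> t" "{s..t} \<subseteq> U"
  shows "f t - f s = (LINT x:{s..t}|lborel. g x)"
proof (rule interval_cutoff[OF U st])
  fix \<theta> :: "nat \<Rightarrow> real \<Rightarrow> real" and t'
  assume *: "t < t'" "{s..t'} \<subseteq> U"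
    "\<And>k. \<theta> k \<in> test_functions U" "\<And>k x. \<bar>\<theta> k x\<bar> \<le> indicator {s..t'} x"
    "\<And>x. (\<lambda>k. \<theta> k x) \<longlonglongrightarrow> indicator {s<..t} x"
    "\<And>f. continuous_on U f \<Longrightarrow> (\<lambda>k. LINT x:U|lborel. f x * deriv (\<theta> k) x) \<longlonglongrightarrow> f s - f t"
  have [measurable]: "\<theta> k \<in> borel_measurable borel" for k
    using test_functions_measurable[OF *(3)] .
  have g: "set_integrable lborel {s..t'} g"
    using w *(2) unfolding weak_deriv_def loc_integrable_def by blast
  then have gm[measurable]: "(\<lambda>x. indicator {s..t'} x * g x) \<in> borel_measurable borel"
    using borel_measurable_integrable unfolding set_integrable_def by fastforce
  have eq: "indicator U x *\<^sub>R (g x * \<theta> k x) = indicator {s..t'} x *\<^sub>R g x * \<theta> k x" for x k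
    using *(2) *(4)[of k x] by (auto simp: indicator_def split: if_splits)
  have "(\<lambda>k. LINT x|lborel. indicator {s..t'} x *\<^sub>R g x * \<theta> k x) \<longlonglongrightarrow>
      (LINT x|lborel. indicator {s..t'} x *\<^sub>R g x * indicator {s<..t} x)"
  proof (rule integral_dominated_convergence[where w = "\<lambda>x. \<bar>indicator {s..t'} x *\<^sub>R g x\<bar>"])
    show "integrable lborel (\<lambda>x. \<bar>indicator {s..t'} x *\<^sub>R g x\<bar>)"
      using g unfolding set_integrable_def by (rule integrable_abs)
    show "AE x in lborel. (\<lambda>k. indicator {s..t'} x *\<^sub>R g x * \<theta> k x) \<longlonglongrightarrow> indicator {s..t'} x *\<^sub>R g x * indicator {s<..t} x"
      by (intro AE_I2 tendsto_mult tendsto_const *(5))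
    have "\<bar>\<theta> k x\<bar> \<le> 1" for k x
      by (rule order_trans[OF *(4) indicator_le_1])
    then have "\<bar>indicator {s..t'} x * g x\<bar> * \<bar>\<theta> k x\<bar> \<le> \<bar>indicator {s..t'} x * g x\<bar> * 1" for k x
      by (intro mult_left_mono) auto
    then show "AE x in lborel. norm (indicator {s..t'} x *\<^sub>R g x * \<theta> k x) \<le> \<bar>indicator {s..t'} x *\<^sub>R g x\<bar>" for k
      by (intro AE_I2) (simp add: abs_mult)
  qed simp_all
  moreover have "(LINT x|lborel. indicator {s..t'} x *\<^sub>R g x * indicator {s<..t} x) = (LINT x:{s..t}|lborel. g x)"
  proof -
    have "(LINT x|lborel. indicator {s..t'} x *\<^sub>R g x * indicator {s<..t} x) = (LINT x|lborel. indicator {s..t} x *\<^sub>R g x)"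
    proof (rule integral_cong_AE)
      have eq': "(\<lambda>x. indicator {s..t} x *\<^sub>R g x) = (\<lambda>x. indicator {s..t} x * (indicator {s..t'} x *\<^sub>R g x))"
        using *(1) by (auto simp: indicator_def fun_eq_iff)
      show "(\<lambda>x. indicator {s..t} x *\<^sub>R g x) \<in> borel_measurable lborel"
        unfolding eq' by simp
      show "AE x in lborel. indicator {s..t'} x *\<^sub>R g x * indicator {s<..t} x = indicator {s..t} x *\<^sub>R g x"
        using AE_lborel_singleton[of s]
        by eventually_elim (use *(1) in \<open>auto simp: indicator_def\<close>)
    qed simp
    then show ?thesis by (simp add: set_lebesgue_integral_def)
  qed
  ultimately have "(\<lambda>k. LINT x:U|lborel. g x * \<theta> k x) \<longlonglongrightarrow> (LINT x:{s..t}|lborel. g x)"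
    by (simp add: set_lebesgue_integral_def eq del: real_scaleR_def)
  then have "(\<lambda>k. - (LINT x:U|lborel. g x * \<theta> k x)) \<longlonglongrightarrow> - (LINT x:{s..t}|lborel. g x)"
    by (rule tendsto_minus)
  then have "(\<lambda>k. LINT x:U|lborel. f x * deriv (\<theta> k) x) \<longlonglongrightarrow> - (LINT x:{s..t}|lborel. g x)"
    using w *(3) by (simp add: weak_deriv_def)
  then have "f s - f t = - (LINT x:{s..t}|lborel. g x)"
    using LIMSEQ_unique *(6)[OF f] by blast
  then show ?thesis by simp
qed

text \<open>The sets on which the integral of \<open>f\<close> vanishes form a Dynkin system. It
  contains the half-lines, which are closed under intersection and generate the Borel sets; so all
  set integrals vanish, and with them the density.\<close>

lemma AE_eq_0_if_interval_integrals_0: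
  fixes f :: "real \<Rightarrow> real"
  assumes f: "set_integrable lborel {c..d} f"
    and 0: "\<And>t. t \<in> {c..d} \<Longrightarrow> (LINT x:{c..t}|lborel. f x) = 0"
  shows "AE x in lborel. x \<in> {c..d} \<longrightarrow> f x = 0"
proof (cases "c \<le> d")
  case True
  let ?f = "\<lambda>x. indicator {c..d} x *\<^sub>R f x"
  have int: "integrable lborel ?f" using f by (simp add: set_integrable_def)
  have setint: "set_integrable lborel A ?f" if "A \<in> sets borel" for A
    using integrable_mult_indicator[OF _ int, of A] that by (simp add: set_integrable_def)
  have "AE x in lborel. ?f x = 0"
  proof (rule sigma_finite_measure.density_zero[OF sigma_finite_lborel int])
    fix A :: "real set" assume "A \<in> sets lborel"
    then have A: "A \<in> sigma_sets UNIV (range (\<lambda>a::real. {..a}))"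
      by (simp add: borel_eq_atMost)
    have "Int_stable (range (\<lambda>a::real. {..a}))" "range (\<lambda>a::real. {..a}) \<subseteq> Pow UNIV"
      by (auto simp: Int_stable_def)
    from this A show "(LINT x:A|lborel. ?f x) = 0"
    proof (induction A rule: sigma_sets_induct_disjoint)
      case (basic A)
      then obtain t where A: "A = {..t}" by auto
      have "(LINT x:A|lborel. ?f x) = (LINT x:{c..min t d}|lborel. f x)"
        unfolding set_lebesgue_integral_def A by (intro Bochner_Integration.integral_cong) (auto simp: indicator_def)
      also have "\<dots> = 0"
        using 0[of "min t d"] True by (cases "c \<le> t") (auto simp: set_lebesgue_integral_def)
      finally show ?case .
    next
      case empty
      then show ?case by (simp add: set_lebesgue_integral_def)
    next
      case (compl A)
      then have A: "A \<in> sets borel" by (simp add: borel_eq_atMost)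
      have "(LINT x:UNIV|lborel. ?f x) = (LINT x:A \<union> (UNIV - A)|lborel. ?f x)" by simp
      also have "\<dots> = (LINT x:A|lborel. ?f x) + (LINT x:(UNIV - A)|lborel. ?f x)"
        by (rule set_integral_Un) (use A setint in auto)
      finally show ?case
        using 0[of d] True compl by (simp add: set_lebesgue_integral_def)
    next
      case (union A)
      then have A: "A i \<in> sets borel" for i by (auto simp: borel_eq_atMost)
      have "(LINT x:(\<Union>i. A i)|lborel. ?f x) = (\<Sum>i. LINT x:A i|lborel. ?f x)"
        by (rule lebesgue_integral_countable_add)
          (use A union setint in \<open>auto simp: disjoint_family_on_def\<close>)
      then show ?case using union by simp
    qed
  qed
  then show ?thesis by eventually_elim (auto simp: indicator_def split: if_splits)
qed auto

text \<open>On every compact subinterval \<open>g\<close> and \<open>f'\<close> have the same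
  primitive \<open>f\<close>, and countably many such intervals exhaust \<open>{a<..<b}\<close>.
  This ties the arbitrary representative \<open>ux\<close> of the weak derivative to the classical
  derivative, whose boundary values are known.\<close>

lemma weak_deriv_C1_AE:
  assumes w: "weak_deriv {a<..<b} f g"
    and f': "\<And>x. x \<in> {a<..<b} \<Longrightarrow> (f has_real_derivative f' x) (at x)" and c: "continuous_on {a<..<b} f'"
  shows "AE x in lborel. x \<in> {a<..<b} \<longrightarrow> g x = f' x"
proof -
  have cf: "continuous_on {a<..<b} f"
    using f' DERIV_isCont continuous_at_imp_continuous_on by blast
  have *: "AE x in lborel. x \<in> {p..q} \<longrightarrow> g x - f' x = 0" if pq: "{p..q} \<subseteq> {a<..<b}" for p q
  proof (rule AE_eq_0_if_interval_integrals_0)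
    have g: "set_integrable lborel {p..q} g"
      using w pq unfolding weak_deriv_def loc_integrable_def by blast
    have f: "set_integrable lborel {p..q} f'"
      unfolding set_integrable_def
      by (rule borel_integrable_compact) (use c pq continuous_on_subset in auto)
    show "set_integrable lborel {p..q} (\<lambda>x. g x - f' x)"
      using g f by (rule set_integral_diff)
    fix t assume t: "t \<in> {p..q}"
    then have sub: "{p..t} \<subseteq> {a<..<b}" using pq by auto
    have "(LINT x:{p..t}|lborel. g x) = f t - f p"
      using weak_deriv_FTC[OF _ cf w _ sub] t by simp
    moreover have "(LINT x:{p..t}|lborel. f' x) = f t - f p"
      unfolding set_lebesgue_integral_def
    proof (rule integral_FTC_atLeastAtMost)
      show "(f has_vector_derivative f' x) (at x within {p..t})" if "p \<le> x" "x \<le> t" for x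
        using DERIV_subset[OF f'] that sub
        by (auto simp: has_real_derivative_iff_has_vector_derivative[symmetric] subset_eq)
    qed (use t continuous_on_subset[OF c sub] in auto)
    moreover have "(LINT x:{p..t}|lborel. g x - f' x) = (LINT x:{p..t}|lborel. g x) - (LINT x:{p..t}|lborel. f' x)"
      by (rule set_integral_diff) (use g f t in \<open>auto intro: set_integrable_subset\<close>)
    ultimately show "(LINT x:{p..t}|lborel. g x - f' x) = 0" by simp
  qed
  then have *: "AE x in lborel. \<forall>k::nat. x \<in> {a + 1 / Suc k..b - 1 / Suc k} \<longrightarrow> g x - f' x = 0"
  proof (intro AE_all_countable[THEN iffD2] allI)
    fix k :: nat
    have "{a + d..b - d} \<subseteq> {a<..<b}" if "0 < d" for d
      using that by auto
    from this[of "1 / Suc k"] have "{a + 1 / Suc k..b - 1 / Suc k} \<subseteq> {a<..<b}" by simp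
    then show "AE x in lborel. x \<in> {a + 1 / Suc k..b - 1 / Suc k} \<longrightarrow> g x - f' x = 0" by (rule *)
  qed
  show ?thesis
  proof (use * in eventually_elim, intro impI)
    fix x assume H: "\<forall>k::nat. x \<in> {a + 1 / Suc k..b - 1 / Suc k} \<longrightarrow> g x - f' x = 0" and x: "x \<in> {a<..<b}"
    obtain k :: nat where "1 / Suc k < min (x - a) (b - x)"
      using x nat_approx_posE[of "min (x - a) (b - x)"] by auto
    then show "g x = f' x" using H[rule_format, of k] by auto
  qed
qed

section \<open>Integration on products and approximation in \<open>L\<^sup>1\<close>\<close>

lemma Lp_on_1_iff: "f \<in> Lp_on 1 U \<longleftrightarrow> set_integrable lborel U f"
proof
  assume "f \<in> Lp_on 1 U"
  then have m: "set_borel_measurable lborel U f" and i: "set_integrable lborel U (\<lambda>x. \<bar>f x\<bar>)"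
    by (auto simp: Lp_on_def)
  from set_integrable_abs_iff[OF m] i show "set_integrable lborel U f" by simp
next
  assume i: "set_integrable lborel U f"
  then have "set_borel_measurable lborel U f"
    unfolding set_integrable_def set_borel_measurable_def by (rule borel_measurable_integrable)
  with set_integrable_abs[OF i] show "f \<in> Lp_on 1 U" by (simp add: Lp_on_def)
qed

lemma set_integrable_const_Ioo: "set_integrable lborel {a<..<b :: real} (\<lambda>_. c :: real)"
proof (cases "a \<le> b")
  case True
  then have "integrable lborel (indicator {a<..<b} :: real \<Rightarrow> real)"
    by (intro integrable_real_indicator) auto
  then show ?thesis unfolding set_integrable_def by simp
qed (simp add: set_integrable_def)

lemma indicator_Times_scaleR:
  fixes f :: "'a \<times> 'b \<Rightarrow> real"
  shows "indicator (A \<times> C) (t, x) *\<^sub>R f (t, x) = indicator A t *\<^sub>R (indicator C x *\<^sub>R f (t, x))"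
  by (simp add: indicator_times)

lemma set_integrable_prodD:
  fixes f :: "real \<times> real \<Rightarrow> real"
  assumes f: "set_integrable lborel (A \<times> C) f"
  shows "AE t in lborel. t \<in> A \<longrightarrow> set_integrable lborel C (\<lambda>x. f (t, x))"
    and "set_integrable lborel A (\<lambda>t. LINT x:C|lborel. f (t, x))"
    and "(LINT z:A \<times> C|lborel. f z) = (LINT t:A|lborel. LINT x:C|lborel. f (t, x))"
proof -
  let ?F = "\<lambda>z. indicator (A \<times> C) z *\<^sub>R f z"
  have F: "integrable (lborel \<Otimes>\<^sub>M lborel) ?F"
    using f by (simp add: set_integrable_def lborel_prod)
  have eq: "(LINT x|lborel. ?F (t, x)) = indicator A t *\<^sub>R (LINT x:C|lborel. f (t, x))" for t
    unfolding indicator_Times_scaleR set_lebesgue_integral_def by simp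
  from lborel_pair.AE_integrable_fst'[OF F]
  show "AE t in lborel. t \<in> A \<longrightarrow> set_integrable lborel C (\<lambda>x. f (t, x))"
    by eventually_elim (auto simp: set_integrable_def indicator_times)
  show "set_integrable lborel A (\<lambda>t. LINT x:C|lborel. f (t, x))"
    using lborel_pair.integrable_fst'[OF F] unfolding eq set_integrable_def .
  show "(LINT z:A \<times> C|lborel. f z) = (LINT t:A|lborel. LINT x:C|lborel. f (t, x))"
    using lborel_pair.integral_fst'[OF F] unfolding eq set_lebesgue_integral_def lborel_prod by simp
qed

lemma set_integrable_prod_swap:
  fixes f :: "real \<times> real \<Rightarrow> real"
  assumes f: "set_integrable lborel (A \<times> C) f"
  shows "set_integrable lborel (C \<times> A) (\<lambda>z. f (snd z, fst z))"
    and "(LINT z:C \<times> A|lborel. f (snd z, fst z)) = (LINT z:A \<times> C|lborel. f z)"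
proof -
  let ?F = "\<lambda>z. indicator (A \<times> C) z *\<^sub>R f z"
  have F: "integrable (lborel \<Otimes>\<^sub>M lborel) ?F"
    using f by (simp add: set_integrable_def lborel_prod)
  have eq: "(\<lambda>(x, y). ?F (y, x)) = (\<lambda>z. indicator (C \<times> A) z *\<^sub>R f (snd z, fst z))"
    by (auto simp: fun_eq_iff indicator_times)
  show "set_integrable lborel (C \<times> A) (\<lambda>z. f (snd z, fst z))"
    using lborel_pair.integrable_product_swap[OF F] unfolding eq set_integrable_def lborel_prod .
  show "(LINT z:C \<times> A|lborel. f (snd z, fst z)) = (LINT z:A \<times> C|lborel. f z)"
    using lborel_pair.integral_product_swap[of ?F] F
    unfolding eq set_lebesgue_integral_def lborel_prod by (simp add: lborel_prod)
qed

text \<open>Tonelli's theorem in the form used later: the estimates hold at almost every fixed time,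
  with a bound \<open>m t\<close> that is integrable in time but need not be bounded.\<close>

lemma set_integrable_prodI:
  fixes f :: "real \<times> real \<Rightarrow> real"
  assumes f: "set_borel_measurable lborel (A \<times> C) f"
    and A: "A \<in> sets borel"
    and i: "AE t in lborel. t \<in> A \<longrightarrow> set_integrable lborel C (\<lambda>x. f (t, x)) \<and> (LINT x:C|lborel. \<bar>f (t, x)\<bar>) \<le> m t"
    and m: "set_integrable lborel A m"
  shows "set_integrable lborel (A \<times> C) f"
proof -
  let ?F = "\<lambda>z. indicator (A \<times> C) z *\<^sub>R f z"
  have F[measurable]: "?F \<in> borel_measurable (lborel \<Otimes>\<^sub>M lborel)"
    using f by (simp add: set_borel_measurable_def lborel_prod)
  have eq: "(LINT x|lborel. norm (?F (t, x))) = indicator A t *\<^sub>R (LINT x:C|lborel. \<bar>f (t, x)\<bar>)" for t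
    by (auto simp: indicator_Times_scaleR set_lebesgue_integral_def indicator_def abs_mult
        intro!: Bochner_Integration.integral_cong)
  have "integrable (lborel \<Otimes>\<^sub>M lborel) ?F"
  proof (rule lborel_pair.Fubini_integrable[OF F])
    show "integrable lborel (\<lambda>t. LINT x|lborel. norm (?F (t, x)))"
    proof (rule Bochner_Integration.integrable_bound)
      show "integrable lborel (\<lambda>t. indicator A t *\<^sub>R m t)" using m by (simp add: set_integrable_def)
      show "AE t in lborel. norm (LINT x|lborel. norm (?F (t, x))) \<le> norm (indicator A t *\<^sub>R m t)"
        using i unfolding eq
      proof eventually_elim
        case (elim t)
        have "0 \<le> (LINT x:C|lborel. \<bar>f (t, x)\<bar>)"
          unfolding set_lebesgue_integral_def by (intro Bochner_Integration.integral_nonneg) simp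
        then show ?case using elim by (auto simp: indicator_def)
      qed
    qed measurable
    show "AE t in lborel. integrable lborel (\<lambda>x. ?F (t, x))"
      using i
    proof eventually_elim
      case (elim t)
      then show ?case
        by (cases "t \<in> A") (simp_all add: indicator_times set_integrable_def)
    qed
  qed
  then show ?thesis by (simp add: set_integrable_def lborel_prod)
qed

text \<open>By monotone convergence the sum of the \<open>D k\<close> has a finite integral, so it
  is finite almost everywhere and its terms tend to zero.\<close>

lemma AE_tendsto_0_if_summable_integrals:
  fixes D :: "nat \<Rightarrow> 'a \<Rightarrow> real"
  assumes D: "\<And>k. integrable M (D k)" "\<And>k t. 0 \<le> D k t"
    and s: "summable (\<lambda>k. integral\<^sup>L M (D k))"
  shows "AE t in M. (\<lambda>k. D k t) \<longlonglongrightarrow> 0"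
proof -
  have [measurable]: "D k \<in> borel_measurable M" for k using D(1) by (rule borel_measurable_integrable)
  have "(\<integral>\<^sup>+t. (\<Sum>k. ennreal (D k t)) \<partial>M) = (\<Sum>k. \<integral>\<^sup>+t. ennreal (D k t) \<partial>M)"
    by (rule nn_integral_suminf) measurable
  also have "\<dots> = (\<Sum>k. ennreal (integral\<^sup>L M (D k)))"
    using D by (simp add: nn_integral_eq_integral)
  also have "\<dots> = ennreal (\<Sum>k. integral\<^sup>L M (D k))"
    by (rule suminf_ennreal2[OF _ s]) (simp add: D(2) Bochner_Integration.integral_nonneg)
  also have "\<dots> \<noteq> \<infinity>" by simp
  finally have "AE t in M. (\<Sum>k. ennreal (D k t)) \<noteq> \<infinity>"
    by (intro nn_integral_PInf_AE) measurable
  then show ?thesis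
  proof eventually_elim
    case (elim t)
    then have "summable (\<lambda>k. D k t)"
      using D(2) by (intro summable_suminf_not_top) auto
    then show ?case by (rule summable_LIMSEQ_zero)
  qed
qed

text \<open>Truncation comes before approximation: a measurable function is an almost-everywhere
  limit of continuous ones, and clipping these at the level \<open>k\<close> supplies the dominating
  constant on the set \<open>S\<close> of finite measure.\<close>

lemma L1_approx_bounded_continuous:
  fixes f :: "'a::euclidean_space \<Rightarrow> real"
  assumes f: "set_integrable lborel S f" and S: "S \<in> sets borel" "emeasure lborel S < \<infinity>" and e: "0 < e"
  obtains h M where "continuous_on UNIV h" "\<And>x. \<bar>h x\<bar> \<le> M" "(LINT x:S|lborel. \<bar>f x - h x\<bar>) < e"
proof -
  define F where "F x = indicator S x *\<^sub>R f x" for x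
  have F: "integrable lborel F" using f by (simp add: set_integrable_def F_def[abs_def])
  then have [measurable]: "F \<in> borel_measurable borel" using borel_measurable_integrable by fastforce
  define clip where "clip c y = max (- c) (min c y)" for c y :: real
  have clip: "\<bar>clip c y\<bar> \<le> c" "\<bar>y - clip c y\<bar> \<le> \<bar>y\<bar>" if "0 \<le> c" for c y
    using that by (auto simp: clip_def max_def min_def)
  have clip_cont: "continuous_on UNIV (clip c)" for c
    unfolding clip_def by (intro continuous_intros)
  then have [measurable]: "clip c \<in> borel_measurable borel" for c
    by (rule borel_measurable_continuous_onI)
  have S': "integrable lborel (indicator S :: 'a \<Rightarrow> real)" using S by simp
  have "(\<lambda>k. LINT x|lborel. \<bar>F x - clip (real k) (F x)\<bar>) \<longlonglongrightarrow> (LINT x|(lborel :: 'a measure). 0)"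
  proof (rule integral_dominated_convergence[where w = "\<lambda>x. \<bar>F x\<bar>"])
    show "AE x in lborel. (\<lambda>k. \<bar>F x - clip (real k) (F x)\<bar>) \<longlonglongrightarrow> 0"
    proof (rule AE_I2)
      fix x
      obtain n :: nat where n: "\<bar>F x\<bar> \<le> n" using real_arch_simple by blast
      have "\<bar>F x - clip (real k) (F x)\<bar> = 0" if "k \<ge> n" for k
      proof -
        have "\<bar>F x\<bar> \<le> real k" using n that by linarith
        then show ?thesis by (auto simp: clip_def max_def min_def)
      qed
      then show "(\<lambda>k. \<bar>F x - clip (real k) (F x)\<bar>) \<longlonglongrightarrow> 0"
        by (intro tendsto_eventually eventually_sequentiallyI)
    qed
  qed (use F clip(2) in auto)
  then have "\<forall>\<^sub>F k in sequentially. (LINT x|lborel. \<bar>F x - clip (real k) (F x)\<bar>) < e / 2"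
    using e by (intro order_tendstoD(2)) auto
  then obtain k where k: "(LINT x|lborel. \<bar>F x - clip (real k) (F x)\<bar>) < e / 2"
    using eventually_happens by fastforce
  \<comment> \<open>The continuous functions extracted from this converge only off a negligible set
    and come without any bound; the clipping provides the bound.\<close>
  have "F measurable_on UNIV"
    by (rule lebesgue_measurable_imp_measurable_on_real) (auto intro: measurable_completion)
  then obtain N g where N: "negligible N" and g: "\<And>n. continuous_on UNIV (g n)"
    "\<And>x. x \<notin> N \<Longrightarrow> (\<lambda>n. g n x) \<longlonglongrightarrow> F x"
    unfolding measurable_on_def by auto
  have "AE x in lebesgue. x \<notin> N" using N by (intro AE_not_in) (simp add: negligible_iff_null_sets)
  then have AE: "AE x in lborel. x \<notin> N" by (simp add: AE_completion_iff)
  have [measurable]: "g n \<in> borel_measurable borel" for n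
    using g(1) by (rule borel_measurable_continuous_onI)
  have "(\<lambda>n. LINT x|lborel. indicator S x * \<bar>clip k (F x) - clip k (g n x)\<bar>) \<longlonglongrightarrow> (LINT x|(lborel :: 'a measure). 0)"
  proof (rule integral_dominated_convergence[where w = "\<lambda>x. indicator S x * (2 * real k)"])
    show "integrable lborel (\<lambda>x. indicator S x * (2 * real k))" using S' by (rule integrable_mult_left)
    show "AE x in lborel. (\<lambda>n. indicator S x * \<bar>clip k (F x) - clip k (g n x)\<bar>) \<longlonglongrightarrow> 0"
      using AE
    proof eventually_elim
      case (elim x)
      have "(\<lambda>n. clip k (g n x)) \<longlonglongrightarrow> clip k (F x)"
        using continuous_on_tendsto_compose[OF clip_cont g(2)[OF elim]] by simp
      show ?case
        using tendsto_mult[OF tendsto_const[of "indicator S x"] tendsto_rabs[OF tendsto_diff[OF tendsto_const[of "clip k (F x)"] \<open>(\<lambda>n. clip k (g n x)) \<longlonglongrightarrow> clip k (F x)\<close>]]]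
        by simp
    qed
    show "AE x in lborel. norm (indicator S x * \<bar>clip k (F x) - clip k (g n x)\<bar>) \<le> indicator S x * (2 * real k)" for n
    proof (intro AE_I2)
      fix x
      have "\<bar>clip k (F x) - clip k (g n x)\<bar> \<le> 2 * real k"
        using clip(1)[of k "F x"] clip(1)[of k "g n x"] by linarith
      then show "norm (indicator S x * \<bar>clip k (F x) - clip k (g n x)\<bar>) \<le> indicator S x * (2 * real k)"
        by (simp add: indicator_def)
    qed
  qed (use S in auto)
  then have "\<forall>\<^sub>F n in sequentially. (LINT x|lborel. indicator S x * \<bar>clip k (F x) - clip k (g n x)\<bar>) < e / 2"
    using e by (intro order_tendstoD(2)) auto
  then obtain n where n: "(LINT x|lborel. indicator S x * \<bar>clip k (F x) - clip k (g n x)\<bar>) < e / 2"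
    using eventually_happens by fastforce
  let ?h = "\<lambda>x. clip k (g n x)"
  have i1: "integrable lborel (\<lambda>x. \<bar>F x - clip (real k) (F x)\<bar>)"
    by (rule Bochner_Integration.integrable_bound[OF F]) (use clip(2) in auto)
  have i2: "integrable lborel (\<lambda>x. indicator S x * \<bar>clip k (F x) - clip k (g n x)\<bar>)"
  proof (rule Bochner_Integration.integrable_bound[OF integrable_mult_left[OF S', of "2 * real k"]])
    show "AE x in lborel. norm (indicator S x * \<bar>clip k (F x) - clip k (g n x)\<bar>) \<le> norm (indicator S x * (2 * real k))"
    proof (intro AE_I2)
      fix x
      have "\<bar>clip k (F x) - clip k (g n x)\<bar> \<le> 2 * real k"
        using clip(1)[of k "F x"] clip(1)[of k "g n x"] by linarith
      then show "norm (indicator S x * \<bar>clip k (F x) - clip k (g n x)\<bar>) \<le> norm (indicator S x * (2 * real k))"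
        by (simp add: indicator_def)
    qed
  qed (use S in auto)
  have "(LINT x:S|lborel. \<bar>f x - ?h x\<bar>) \<le> (LINT x|lborel. \<bar>F x - clip (real k) (F x)\<bar> + indicator S x * \<bar>clip k (F x) - ?h x\<bar>)"
    unfolding set_lebesgue_integral_def
  proof (rule integral_mono')
    show "integrable lborel (\<lambda>x. \<bar>F x - clip (real k) (F x)\<bar> + indicator S x * \<bar>clip k (F x) - ?h x\<bar>)"
      using i1 i2 by (rule Bochner_Integration.integrable_add)
  qed (auto simp: F_def indicator_def)
  also have "\<dots> < e" using k n i1 i2 by (simp add: Bochner_Integration.integral_add)
  finally show thesis
    using clip(1)[of "real k"] continuous_on_compose2[OF clip_cont g(1)]
    by (intro that[of ?h "real k"]) auto
qed

section \<open>Sampling in time on a finite grid\<close>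

definition grid :: "real \<Rightarrow> nat \<Rightarrow> real \<Rightarrow> real" where
  "grid \<tau> N t = \<tau> * (of_int \<lfloor>t * real (Suc N) / \<tau>\<rfloor> + 1) / real (N + 2)"

text \<open>Cells have length \<open>\<tau> / (N + 1)\<close>, while the sampling points
  \<open>\<tau> * (j + 1) / (N + 2)\<close> are spaced slightly more narrowly. The shift and the
  larger denominator keep every sampling point strictly inside \<open>{0<..<\<tau>}\<close>, where
  the sampled curves are under control; the price is a distance of up to
  \<open>2 * \<tau> / (N + 1)\<close>.\<close>

lemma grid_props:
  assumes "t \<in> {0<..<\<tau>}"
  obtains j where "j \<le> N" "grid \<tau> N t = \<tau> * (real j + 1) / real (N + 2)"
    "grid \<tau> N t \<in> {0<..<\<tau>}" "\<bar>grid \<tau> N t - t\<bar> \<le> 2 * \<tau> / real (Suc N)"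
proof -
  let ?i = "\<lfloor>t * real (Suc N) / \<tau>\<rfloor>"
  have \<tau>: "0 < \<tau>" and t: "0 < t" "t < \<tau>" using assms by auto
  have "0 \<le> ?i" using t \<tau> by simp
  have "t * real (Suc N) / \<tau> < real (Suc N)"
    using t \<tau> by (simp add: divide_less_eq del: of_nat_Suc)
  then have "?i < int (Suc N)" by (simp add: floor_less_iff)
  define j where "j = nat ?i"
  have j: "?i = int j" "j \<le> N" using \<open>0 \<le> ?i\<close> \<open>?i < int (Suc N)\<close> by (auto simp: j_def)
  have g: "grid \<tau> N t = \<tau> * (real j + 1) / real (N + 2)" unfolding grid_def j(1) by simp
  have b: "real j \<le> t * real (Suc N) / \<tau>" "t * real (Suc N) / \<tau> < real j + 1"
    using floor_correct[of "t * real (Suc N) / \<tau>"] unfolding j(1) by auto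
  then have b': "\<tau> * real j \<le> t * real (Suc N)" "t * real (Suc N) < \<tau> * (real j + 1)"
    using \<tau> by (auto simp: field_simps)
  have "grid \<tau> N t * real (N + 2) = \<tau> * (real j + 1)" by (simp add: g)
  then have e: "grid \<tau> N t * real (Suc N) = \<tau> * (real j + 1) - grid \<tau> N t"
    by (simp add: algebra_simps)
  have in_I: "grid \<tau> N t \<in> {0<..<\<tau>}"
    using \<tau> j(2) by (auto simp: g divide_less_eq)
  have "(grid \<tau> N t - t) * real (Suc N) \<le> 2 * \<tau>" "(t - grid \<tau> N t) * real (Suc N) \<le> 2 * \<tau>"
    using e b' in_I unfolding left_diff_distrib by (auto simp: algebra_simps)
  then have "\<bar>grid \<tau> N t - t\<bar> * real (Suc N) \<le> 2 * \<tau>"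
    by (cases "0 \<le> grid \<tau> N t - t") (simp_all only: abs_of_nonneg abs_of_neg not_le minus_diff_eq)
  then have "\<bar>grid \<tau> N t - t\<bar> \<le> 2 * \<tau> / real (Suc N)"
    by (simp add: le_divide_eq del: of_nat_Suc)
  then show thesis using that j(2) g in_I by blast
qed

lemma grid_tendsto: "t \<in> {0<..<\<tau>} \<Longrightarrow> (\<lambda>N. grid \<tau> N t) \<longlonglongrightarrow> t"
proof (rule LIM_zero_cancel, rule Lim_null_comparison)
  assume t: "t \<in> {0<..<\<tau>}"
  have "norm (grid \<tau> N t - t) \<le> 2 * \<tau> / real (Suc N)" for N
    by (rule grid_props[OF t, of N]) simp
  then show "\<forall>\<^sub>F N in sequentially. norm (grid \<tau> N t - t) \<le> 2 * \<tau> / real (Suc N)"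
    by (intro always_eventually allI)
  show "(\<lambda>N. 2 * \<tau> / real (Suc N)) \<longlonglongrightarrow> 0"
    using LIMSEQ_Suc[OF lim_const_over_n[of "2 * \<tau>"]] by simp
qed

lemma grid_step_function:
  shows "finite ((\<lambda>t. c (grid \<tau> N t)) ` {0<..<\<tau>})"
    "{t \<in> {0<..<\<tau>}. c (grid \<tau> N t) = v} \<in> sets lebesgue"
proof -
  let ?G = "grid \<tau> N ` {0<..<\<tau>}"
  have "?G \<subseteq> (\<lambda>j. \<tau> * (real j + 1) / real (N + 2)) ` {..N}"
  proof
    fix g assume "g \<in> ?G"
    then obtain t where t: "t \<in> {0<..<\<tau>}" "g = grid \<tau> N t" by auto
    show "g \<in> (\<lambda>j. \<tau> * (real j + 1) / real (N + 2)) ` {..N}"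
      by (rule grid_props[OF t(1), of N]) (use t(2) in auto)
  qed
  then have fin: "finite ?G" by (rule finite_subset) simp
  then show "finite ((\<lambda>t. c (grid \<tau> N t)) ` {0<..<\<tau>})"
    by (metis finite_imageI image_image)
  have [measurable]: "grid \<tau> N \<in> borel_measurable borel" unfolding grid_def by measurable
  have "{t \<in> {0<..<\<tau>}. c (grid \<tau> N t) = v} = (\<Union>g\<in>{g \<in> ?G. c g = v}. {t \<in> {0<..<\<tau>}. grid \<tau> N t = g})"
    by auto
  also have "\<dots> \<in> sets borel" using fin by (intro sets.finite_UN) auto
  finally show "{t \<in> {0<..<\<tau>}. c (grid \<tau> N t) = v} \<in> sets lebesgue" by simp
qed

text \<open>The slices of \<open>f\<close> cannot be sampled at grid times, being meaningful only
  for almost every \<open>t\<close>. Sampled instead are continuous approximants \<open>h k\<close>: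
  uniform continuity controls the sampling error uniformly in \<open>x\<close>, and the space-time
  errors \<open>(1/2) ^ k\<close> are summable, so that the slice errors tend to zero at almost
  every time.\<close>

lemma strongly_measurable_L1_slices:
  fixes f :: "real \<times> real \<Rightarrow> real"
  assumes f: "set_integrable lborel ({0<..<\<tau>} \<times> {a<..<b}) f" and \<tau>: "0 < \<tau>"
  shows "strongly_measurable {0<..<\<tau>} (Lp_on 1 {a<..<b}) (L1_norm {a<..<b}) (\<lambda>t x. f (t, x))"
proof -
  let ?I = "{0<..<\<tau>}" and ?O = "{a<..<b}"
  let ?S = "?I \<times> ?O"
  have S: "?S \<in> sets borel" "emeasure lborel ?S < \<infinity>"
    by (auto intro!: borel_open open_Times) (rule emeasure_bounded_finite[unfolded infinity_ennreal_def], simp add: bounded_Times)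
  have "\<exists>h. continuous_on UNIV h \<and> (\<exists>M. \<forall>x. \<bar>h x\<bar> \<le> M) \<and> (LINT x:?S|lborel. \<bar>f x - h x\<bar>) < (1/2) ^ k" for k
    by (rule L1_approx_bounded_continuous[OF f S, of "(1/2) ^ k"]) auto
  then obtain h where h: "\<And>k. continuous_on UNIV (h k)" "\<And>k. \<exists>M. \<forall>x. \<bar>h k x\<bar> \<le> M"
    "\<And>k. (LINT x:?S|lborel. \<bar>f x - h k x\<bar>) < (1/2) ^ k" by metis
  have hm[measurable]: "h k \<in> borel_measurable borel" for k
    using h(1) by (rule borel_measurable_continuous_onI)
  have h_slice: "continuous_on A (\<lambda>x. h k (t, x))" for k t A
    by (rule continuous_on_compose2[OF h(1)]) (auto intro!: continuous_intros)
  have h_int: "set_integrable lborel ?O (\<lambda>x. h k (t, x))" for k t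
  proof (rule set_integrable_subset)
    show "set_integrable lborel {a..b} (\<lambda>x. h k (t, x))"
      unfolding set_integrable_def by (rule borel_integrable_compact) (auto intro: h_slice)
  qed auto
  have "\<exists>N. \<forall>t\<in>?I. \<forall>x\<in>?O. \<bar>h k (grid \<tau> N t, x) - h k (t, x)\<bar> \<le> 1 / real (Suc k)" for k
  proof -
    have "uniformly_continuous_on ({0..\<tau>} \<times> {a..b}) (h k)"
      by (intro compact_uniformly_continuous compact_Times continuous_on_subset[OF h(1)]) auto
    then obtain d where d: "d > 0" "\<And>z z'. z \<in> {0..\<tau>} \<times> {a..b} \<Longrightarrow> z' \<in> {0..\<tau>} \<times> {a..b} \<Longrightarrow> dist z' z < d \<Longrightarrow>
        dist (h k z') (h k z) < 1 / real (Suc k)"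
      unfolding uniformly_continuous_on_def by (metis of_nat_0_less_iff zero_less_Suc zero_less_divide_1_iff)
    have "(\<lambda>N. 2 * \<tau> / real (Suc N)) \<longlonglongrightarrow> 0"
      using LIMSEQ_Suc[OF lim_const_over_n[of "2 * \<tau>"]] by simp
    then have "\<forall>\<^sub>F N in sequentially. 2 * \<tau> / real (Suc N) < d" using d(1) by (rule order_tendstoD(2))
    then obtain N where N: "2 * \<tau> / real (Suc N) < d" using eventually_happens by fastforce
    have "\<bar>h k (grid \<tau> N t, x) - h k (t, x)\<bar> \<le> 1 / real (Suc k)" if t: "t \<in> ?I" and x: "x \<in> ?O" for t x
    proof -
      have "grid \<tau> N t \<in> ?I" "\<bar>grid \<tau> N t - t\<bar> < d" using grid_props[OF t, of N] N by (metis, fastforce)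
      then have "dist (h k (grid \<tau> N t, x)) (h k (t, x)) < 1 / real (Suc k)"
        using t x by (intro d(2)) (auto simp: dist_Pair_Pair dist_real_def)
      then show ?thesis by (simp add: dist_real_def)
    qed
    then show ?thesis by blast
  qed
  then obtain N where N: "\<And>k t x. t \<in> ?I \<Longrightarrow> x \<in> ?O \<Longrightarrow> \<bar>h k (grid \<tau> (N k) t, x) - h k (t, x)\<bar> \<le> 1 / real (Suc k)"
    by metis
  define s where "s k t = (\<lambda>x. h k (grid \<tau> (N k) t, x))" for k t
  have fh: "set_integrable lborel ?S (\<lambda>z. \<bar>f z - h k z\<bar>)" for k
  proof (intro set_integrable_abs set_integral_diff(1) f)
    obtain M where M: "\<And>x. \<bar>h k x\<bar> \<le> M" using h(2) by blast
    show "set_integrable lborel ?S (h k)"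
    proof (rule set_integrable_bound[of _ _ "\<lambda>_. M"])
      show "set_integrable lborel ?S (\<lambda>_. M)"
        using S unfolding set_integrable_def by simp
      show "set_borel_measurable lborel ?S (h k)"
        using S unfolding set_borel_measurable_def by simp
    qed (use M in \<open>auto intro!: AE_I2 order_trans[OF M]\<close>)
  qed
  define D where "D k t = indicator ?I t *\<^sub>R (LINT x:?O|lborel. \<bar>f (t, x) - h k (t, x)\<bar>)" for k t
  have D: "integrable lborel (D k)" "integral\<^sup>L lborel (D k) = (LINT z:?S|lborel. \<bar>f z - h k z\<bar>)" for k
    using set_integrable_prodD(2,3)[OF fh[of k]]
    by (auto simp: D_def[abs_def] set_integrable_def set_lebesgue_integral_def[of lborel ?I])
  have D0: "0 \<le> D k t" for k t
    unfolding D_def set_lebesgue_integral_def by (auto intro!: Bochner_Integration.integral_nonneg mult_nonneg_nonneg)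
  have "AE t in lborel. (\<lambda>k. D k t) \<longlonglongrightarrow> 0"
  proof (rule AE_tendsto_0_if_summable_integrals[OF D(1) D0])
    show "summable (\<lambda>k. integral\<^sup>L lborel (D k))"
    proof (rule summable_comparison_test'[where N = 0])
      show "summable (\<lambda>k. (1/2) ^ k :: real)" by (rule summable_geometric) simp
      show "norm (integral\<^sup>L lborel (D k)) \<le> (1/2) ^ k" for k
        using h(3)[of k] D(2)[of k] Bochner_Integration.integral_nonneg[of lborel "D k"] D0 by simp
    qed
  qed
  then have "AE t in lborel. t \<in> ?I \<longrightarrow> (\<lambda>x. f (t, x)) \<in> Lp_on 1 ?O \<and>
      (\<lambda>k. L1_norm ?O (s k t - (\<lambda>x. f (t, x)))) \<longlonglongrightarrow> 0"
    using set_integrable_prodD(1)[OF f]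
  proof (eventually_elim, intro impI conjI)
    fix t assume ft: "t \<in> ?I \<longrightarrow> set_integrable lborel ?O (\<lambda>x. f (t, x))" and lim: "(\<lambda>k. D k t) \<longlonglongrightarrow> 0" and t: "t \<in> ?I"
    then show "(\<lambda>x. f (t, x)) \<in> Lp_on 1 ?O" by (simp add: Lp_on_1_iff)
    have ft: "set_integrable lborel ?O (\<lambda>x. f (t, x))" using ft t by blast
    show "(\<lambda>k. L1_norm ?O (s k t - (\<lambda>x. f (t, x)))) \<longlonglongrightarrow> 0"
    proof (rule Lim_null_comparison)
      note c = set_integrable_const_Ioo
      have "L1_norm ?O (s k t - (\<lambda>x. f (t, x))) \<le> D k t + 1 / real (Suc k) * measure lborel ?O" for k
      proof -
        have "L1_norm ?O (s k t - (\<lambda>x. f (t, x))) \<le> (LINT x:?O|lborel. \<bar>f (t, x) - h k (t, x)\<bar> + 1 / real (Suc k))"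
          unfolding L1_norm_def
        proof (rule set_integral_mono)
          show "set_integrable lborel ?O (\<lambda>x. \<bar>(s k t - (\<lambda>x. f (t, x))) x\<bar>)"
            unfolding s_def fun_diff_def by (intro set_integrable_abs set_integral_diff(1) h_int ft)
          show "set_integrable lborel ?O (\<lambda>x. \<bar>f (t, x) - h k (t, x)\<bar> + 1 / real (Suc k))"
            by (intro set_integral_add(1) c set_integrable_abs set_integral_diff(1) h_int ft)
          show "\<bar>(s k t - (\<lambda>x. f (t, x))) x\<bar> \<le> \<bar>f (t, x) - h k (t, x)\<bar> + 1 / real (Suc k)" if "x \<in> ?O" for x
            using N[OF t that, of k] by (simp add: s_def)
        qed
        also have "\<dots> = (LINT x:?O|lborel. \<bar>f (t, x) - h k (t, x)\<bar>) + (LINT x:?O|lborel. 1 / real (Suc k))"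
          by (intro set_integral_add(2) c set_integrable_abs set_integral_diff(1) h_int ft)
        finally show ?thesis using t by (simp add: D_def set_lebesgue_integral_def mult.commute)
      qed
      moreover have "0 \<le> L1_norm ?O g" for g
        unfolding L1_norm_def set_lebesgue_integral_def by (intro Bochner_Integration.integral_nonneg) simp
      ultimately show "\<forall>\<^sub>F k in sequentially. norm (L1_norm ?O (s k t - (\<lambda>x. f (t, x)))) \<le> D k t + 1 / real (Suc k) * measure lborel ?O"
        by simp
      show "(\<lambda>k. D k t + 1 / real (Suc k) * measure lborel ?O) \<longlonglongrightarrow> 0"
        using tendsto_add[OF lim tendsto_mult[OF LIMSEQ_Suc[OF lim_const_over_n[of 1]] tendsto_const[of "measure lborel ?O"]]]
        by simp
    qed
  qed
  then have "AE t in lebesgue. t \<in> ?I \<longrightarrow> (\<lambda>x. f (t, x)) \<in> Lp_on 1 ?O \<and>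
      (\<lambda>k. L1_norm ?O (s k t - (\<lambda>x. f (t, x)))) \<longlonglongrightarrow> 0"
    by (simp add: AE_completion_iff)
  moreover have "finite (s k ` ?I)" "s k ` ?I \<subseteq> Lp_on 1 ?O" "{t \<in> ?I. s k t = v} \<in> sets lebesgue" for k v
    using grid_step_function[where c = "\<lambda>g x. h k (g, x)"] h_int by (auto simp: s_def Lp_on_1_iff)
  ultimately show ?thesis unfolding strongly_measurable_def by blast
qed

section \<open>Compactness in quasi-metric topologies and in Bochner spaces\<close>

text \<open>The \<open>p\<close>-th power of the distance in \<open>L\<^sup>p\<close> is only a quasi-metric, but that is enough for the
  equivalence of compactness and sequential compactness and avoids the Minkowski inequality.\<close>

locale quasi_metric =
  fixes S :: "'a set" and D :: "'a \<Rightarrow> 'a \<Rightarrow> real" and K :: real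
  assumes nonneg: "0 \<le> D x y"
    and refl: "x \<in> S \<Longrightarrow> D x x = 0"
    and sym: "x \<in> S \<Longrightarrow> y \<in> S \<Longrightarrow> D x y = D y x"
    and K: "1 \<le> K"
    and tri: "x \<in> S \<Longrightarrow> y \<in> S \<Longrightarrow> z \<in> S \<Longrightarrow> D x z \<le> K * (D x y + D y z)"
begin

definition is_open :: "'a set \<Rightarrow> bool" where
  "is_open V \<longleftrightarrow> V \<subseteq> S \<and> (\<forall>x\<in>V. \<exists>r>0. \<forall>y\<in>S. D y x < r \<longrightarrow> y \<in> V)"

definition T :: "'a topology" where "T = topology is_open"

lemma openin_T: "openin T = is_open"
proof -
  have "istopology is_open"
    unfolding istopology_def
  proof (intro conjI allI impI)
    fix V W assume "is_open V" "is_open W"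
    show "is_open (V \<inter> W)"
      unfolding is_open_def
    proof (intro conjI ballI)
      fix x assume x: "x \<in> V \<inter> W"
      obtain r1 where "r1 > 0" "\<And>y. y \<in> S \<Longrightarrow> D y x < r1 \<Longrightarrow> y \<in> V"
        using \<open>is_open V\<close> x unfolding is_open_def by blast
      moreover obtain r2 where "r2 > 0" "\<And>y. y \<in> S \<Longrightarrow> D y x < r2 \<Longrightarrow> y \<in> W"
        using \<open>is_open W\<close> x unfolding is_open_def by blast
      ultimately show "\<exists>r>0. \<forall>y\<in>S. D y x < r \<longrightarrow> y \<in> V \<inter> W"
        by (intro exI[of _ "min r1 r2"]) auto
    qed (use \<open>is_open V\<close> in \<open>auto simp: is_open_def\<close>)
  next
    fix \<V> assume "\<forall>V\<in>\<V>. is_open V"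
    then show "is_open (\<Union>\<V>)" unfolding is_open_def by (meson UnionE UnionI Union_least)
  qed
  then show ?thesis unfolding T_def by (rule topology_inverse')
qed

lemma topspace_T: "topspace T = S"
proof
  have "is_open S" unfolding is_open_def using zero_less_one by blast
  then show "S \<subseteq> topspace T" by (simp add: openin_T openin_subset)
  show "topspace T \<subseteq> S"
    unfolding topspace_def openin_T is_open_def by blast
qed

text \<open>In a quasi-metric the balls need not be open. The set \<open>V\<close> takes the role of
  the interior of the ball about \<open>x\<close>: it consists of the points around which some
  smaller ball stays inside. It is open because two distances below \<open>r' / (2 * K)\<close>
  combine to less than \<open>r'\<close> in the relaxed triangle inequality.\<close>

lemma in_closure_approx:
  assumes x: "x \<in> T closure_of A" and A: "A \<subseteq> S" and r: "0 < r"
  obtains y where "y \<in> A" "D y x < r"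
proof -
  have xS: "x \<in> S" using x in_closure_of topspace_T by metis
  define V where "V = {z \<in> S. \<exists>r'>0. \<forall>y\<in>S. D y z < r' \<longrightarrow> D y x < r}"
  have "is_open V"
    unfolding is_open_def
  proof (intro conjI ballI)
    fix z assume "z \<in> V"
    then obtain r' where r': "r' > 0" "\<And>y. y \<in> S \<Longrightarrow> D y z < r' \<Longrightarrow> D y x < r" and z: "z \<in> S"
      unfolding V_def by blast
    have "w \<in> V" if w: "w \<in> S" "D w z < r' / (2 * K)" for w
    proof -
      have "D y x < r" if y: "y \<in> S" "D y w < r' / (2 * K)" for y
      proof (rule r'(2)[OF y(1)])
        have "D y z \<le> K * (D y w + D w z)" using tri y w z by blast
        also have "\<dots> < K * (r' / (2 * K) + r' / (2 * K))"
          using y w K by (intro mult_strict_left_mono add_strict_mono) auto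
        also have "\<dots> = r'" using K by (simp add: field_simps)
        finally show "D y z < r'" .
      qed
      moreover have "0 < r' / (2 * K)" using r' K by simp
      ultimately show ?thesis using w unfolding V_def by blast
    qed
    moreover have "0 < r' / (2 * K)" using r' K by simp
    ultimately show "\<exists>r>0. \<forall>y\<in>S. D y z < r \<longrightarrow> y \<in> V" by blast
  qed (auto simp: V_def)
  moreover have "x \<in> V" using xS r unfolding V_def by blast
  ultimately obtain y where "y \<in> A" "y \<in> V"
    using x unfolding in_closure_of openin_T by blast
  moreover from this(2) have "D y x < r" unfolding V_def using refl by fastforce
  ultimately show thesis using that by blast
qed

lemma in_closure_if_limit:
  assumes "x \<in> S" "\<And>k. y k \<in> A" "A \<subseteq> S" "(\<lambda>k. D (y k) x) \<longlonglongrightarrow> 0"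
  shows "x \<in> T closure_of A"
  unfolding in_closure_of openin_T topspace_T
proof (intro conjI allI impI assms(1))
  fix V assume V: "x \<in> V \<and> is_open V"
  then obtain r where r: "r > 0" "\<And>y. y \<in> S \<Longrightarrow> D y x < r \<Longrightarrow> y \<in> V"
    unfolding is_open_def by blast
  have "\<forall>\<^sub>F k in sequentially. D (y k) x < r" using order_tendstoD(2)[OF assms(4) r(1)] .
  then obtain k where "D (y k) x < r" using eventually_happens by fastforce
  then show "\<exists>y. y \<in> A \<and> y \<in> V" using assms(2,3) r(2) by blast
qed

text \<open>Limits are assumed only for sequences in \<open>A\<close>; a sequence in the closure is
  shadowed by one in \<open>A\<close> at distances below \<open>1 / (k + 1)\<close>. Sequential
  compactness of the closure then gives a Lebesgue number for each open cover and excludes infinite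
  separated sets, as in a metric space, with radii shrunk by the factor
  \<open>2 * K\<close>.\<close>

theorem relatively_compact_if_seq:
  assumes A: "A \<subseteq> S"
    and seq: "\<And>f :: nat \<Rightarrow> 'a. (\<And>k. f k \<in> A) \<Longrightarrow> \<exists>l\<in>S. \<exists>r. strict_mono r \<and> (\<lambda>k. D (f (r k)) l) \<longlonglongrightarrow> 0"
  shows "relatively_compact T A"
proof -
  let ?C = "T closure_of A"
  have CS: "?C \<subseteq> S" using closure_of_subset_topspace topspace_T by metis
  have seqC: "\<exists>l\<in>?C. \<exists>r. strict_mono r \<and> (\<lambda>k. D (g (r k)) l) \<longlonglongrightarrow> 0" if g: "\<And>k. g k \<in> ?C" for g :: "nat \<Rightarrow> 'a"
  proof -
    have "\<exists>y. y \<in> A \<and> D y (g k) < 1 / real (Suc k)" for k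
    proof -
      have "0 < 1 / real (Suc k)" by simp
      then show ?thesis using in_closure_approx[OF g[of k] A] by blast
    qed
    then obtain f where f: "\<And>k. f k \<in> A" "\<And>k. D (f k) (g k) < 1 / real (Suc k)" by metis
    obtain l r where l: "l \<in> S" "strict_mono r" "(\<lambda>k. D (f (r k)) l) \<longlonglongrightarrow> 0"
      using seq[of f] f(1) by auto
    have "(\<lambda>k. D (g (r k)) l) \<longlonglongrightarrow> 0"
    proof (rule Lim_null_comparison)
      have "D (g (r k)) l \<le> K * (1 / real (Suc k) + D (f (r k)) l)" for k
      proof -
        have "D (g (r k)) l \<le> K * (D (g (r k)) (f (r k)) + D (f (r k)) l)"
          using tri g f(1) l(1) CS A by blast
        also have "D (g (r k)) (f (r k)) = D (f (r k)) (g (r k))" using sym g f(1) CS A by blast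
        also have "\<dots> \<le> 1 / real (Suc (r k))" using f(2) by (rule less_imp_le)
        also have "\<dots> \<le> 1 / real (Suc k)"
          using seq_suble[OF l(2), of k] by (intro divide_left_mono) auto
        finally show ?thesis using K by (auto intro: mult_left_mono)
      qed
      then show "\<forall>\<^sub>F k in sequentially. norm (D (g (r k)) l) \<le> K * (1 / real (Suc k) + D (f (r k)) l)"
        using nonneg by simp
      show "(\<lambda>k. K * (1 / real (Suc k) + D (f (r k)) l)) \<longlonglongrightarrow> 0"
        using tendsto_mult[OF tendsto_const[of K] tendsto_add[OF LIMSEQ_Suc[OF lim_const_over_n[of 1]] l(3)]] by simp
    qed
    moreover have "l \<in> ?C" using in_closure_if_limit[OF l(1) _ A l(3)] f(1) by blast
    ultimately show ?thesis using l(2) by blast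
  qed
  have "compactin T ?C"
    unfolding compactin_def
  proof (intro conjI allI impI)
    show "?C \<subseteq> topspace T" by (rule closure_of_subset_topspace)
    fix \<U> assume U: "Ball \<U> (openin T) \<and> ?C \<subseteq> \<Union>\<U>"
    \<comment> \<open>A Lebesgue number of the cover. If none existed, the centres of bad balls with
      radii \<open>1 / (k + 1)\<close> would accumulate at a point, and a ball about that point
      inside one member of the cover would contain one of the bad balls.\<close>
    have "\<exists>d>0. \<forall>x\<in>?C. \<exists>U\<in>\<U>. \<forall>y\<in>S. D y x < d \<longrightarrow> y \<in> U"
    proof (rule ccontr)
      assume "\<not> ?thesis"
      then have "\<exists>x\<in>?C. \<forall>U\<in>\<U>. \<exists>y\<in>S. D y x < 1 / real (Suc k) \<and> y \<notin> U" for k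
        by (metis of_nat_0_less_iff zero_less_Suc zero_less_divide_1_iff)
      then obtain g where g: "\<And>k. g k \<in> ?C" "\<And>k U. U \<in> \<U> \<Longrightarrow> \<exists>y\<in>S. D y (g k) < 1 / real (Suc k) \<and> y \<notin> U"
        by metis
      obtain l r where l: "l \<in> ?C" "strict_mono r" "(\<lambda>k. D (g (r k)) l) \<longlonglongrightarrow> 0" using seqC[of g] g(1) by auto
      obtain V where V: "V \<in> \<U>" "l \<in> V" using l(1) U by blast
      then have "is_open V" using U openin_T by auto
      then obtain e where e: "e > 0" "\<And>y. y \<in> S \<Longrightarrow> D y l < e \<Longrightarrow> y \<in> V"
        using V(2) unfolding is_open_def by blast
      have e2: "0 < e / (2 * K)" using e K by simp
      have "(\<lambda>k. 1 / real (Suc k)) \<longlonglongrightarrow> 0" using LIMSEQ_Suc[OF lim_const_over_n[of 1]] by simp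
      then have "\<forall>\<^sub>F k in sequentially. D (g (r k)) l < e / (2 * K) \<and> 1 / real (Suc k) < e / (2 * K)"
        using order_tendstoD(2)[OF l(3) e2] order_tendstoD(2)[OF _ e2] eventually_conj by blast
      then obtain k where k: "D (g (r k)) l < e / (2 * K)" "1 / real (Suc k) < e / (2 * K)"
        using eventually_happens by fastforce
      obtain y where y: "y \<in> S" "D y (g (r k)) < 1 / real (Suc (r k))" "y \<notin> V" using g(2)[OF V(1)] by blast
      have "1 / real (Suc (r k)) \<le> 1 / real (Suc k)"
        using seq_suble[OF l(2), of k] by (intro divide_left_mono) auto
      then have "D y (g (r k)) < e / (2 * K)" using y(2) k(2) by linarith
      then have "K * (D y (g (r k)) + D (g (r k)) l) < K * (e / (2 * K) + e / (2 * K))"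
        using k K by (intro mult_strict_left_mono add_strict_mono) auto
      also have "\<dots> = e" using K by (simp add: field_simps)
      finally have "D y l < e" using tri[OF y(1), of "g (r k)" l] g(1) l(1) CS by force
      then show False using e(2) y by blast
    qed
    then obtain d where d: "d > 0" "\<And>x. x \<in> ?C \<Longrightarrow> \<exists>U\<in>\<U>. \<forall>y\<in>S. D y x < d \<longrightarrow> y \<in> U" by blast
    then obtain W where W: "\<And>x. x \<in> ?C \<Longrightarrow> W x \<in> \<U>" "\<And>x y. x \<in> ?C \<Longrightarrow> y \<in> S \<Longrightarrow> D y x < d \<Longrightarrow> y \<in> W x"
      by metis
    show "\<exists>\<F>. finite \<F> \<and> \<F> \<subseteq> \<U> \<and> ?C \<subseteq> \<Union>\<F>"
    proof (rule ccontr)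
      assume no: "\<not> ?thesis"
      have "\<exists>x\<in>?C. x \<notin> \<Union>(W ` F)" if "finite F" "F \<subseteq> ?C" for F
        using no that W(1) by (metis (no_types, lifting) finite_imageI image_subset_iff subset_eq)
      then have step: "\<exists>x\<in>?C. \<forall>z\<in>F. \<not> D x z < d" if "finite F" "F \<subseteq> ?C" for F
        using that W(2) CS by (metis UN_iff subsetD)
      \<comment> \<open>Greedy choice: without a finite subcover, the members of the cover attached
        to a finite set \<open>F\<close> miss some point of the closure, which therefore has
        distance at least \<open>d\<close> from all of \<open>F\<close>. Iteration gives a separated
        sequence, contradicting the existence of convergent subsequences.\<close>
      define nxt where "nxt F = (SOME x. x \<in> ?C \<and> (\<forall>z\<in>F. \<not> D x z < d))" for F
      have nxt: "nxt F \<in> ?C" "\<And>z. z \<in> F \<Longrightarrow> \<not> D (nxt F) z < d" if "finite F" "F \<subseteq> ?C" for F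
        using someI_ex[OF step[OF that, unfolded Bex_def]] unfolding nxt_def by blast+
      define F where "F = rec_nat {} (\<lambda>_ F. insert (nxt F) F)"
      have F0: "F 0 = {}" and FS: "F (Suc k) = insert (nxt (F k)) (F k)" for k by (simp_all add: F_def)
      have F: "finite (F k) \<and> F k \<subseteq> ?C" for k
        by (induction k) (auto simp: F0 FS nxt)
      define g where "g k = nxt (F k)" for k
      have gC: "g k \<in> ?C" for k using nxt F g_def by metis
      have gF: "g i \<in> F k" if "i < k" for i k
        using that by (induction k) (auto simp: FS g_def less_Suc_eq)
      have sep: "\<not> D (g k) (g i) < d" if "i < k" for i k
        using nxt(2)[of "F k"] F gF[OF that] unfolding g_def by blast
      obtain l r where l: "l \<in> ?C" "strict_mono r" "(\<lambda>k. D (g (r k)) l) \<longlonglongrightarrow> 0" using seqC[of g] gC by auto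
      have d2: "0 < d / (2 * K)" using d K by simp
      obtain N where N: "\<And>k. k \<ge> N \<Longrightarrow> D (g (r k)) l < d / (2 * K)"
        using order_tendstoD(2)[OF l(3) d2] unfolding eventually_sequentially by blast
      have "D (g (r (Suc N))) (g (r N)) \<le> K * (D (g (r (Suc N))) l + D l (g (r N)))"
        using tri gC l(1) CS by blast
      also have "D l (g (r N)) = D (g (r N)) l" using sym gC l(1) CS by blast
      also have "K * (D (g (r (Suc N))) l + D (g (r N)) l) < K * (d / (2 * K) + d / (2 * K))"
        using N K by (intro mult_strict_left_mono add_strict_mono) auto
      also have "\<dots> = d" using K by (simp add: field_simps)
      finally show False using sep[of "r N" "r (Suc N)"] strict_monoD[OF l(2)] by blast
    qed
  qed
  then show ?thesis unfolding relatively_compact_def using A topspace_T by simp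
qed

end

text \<open>The Bochner spaces are built over a type with subtraction alone, so the seminorm axioms
  are phrased through differences: \<open>N_diff_le\<close> and \<open>N_le\<close> stand in for the
  triangle inequality with sums. The identity \<open>diff_diff\<close> is what makes strongly
  measurable functions closed under differences.\<close>

locale pseudonormed =
  fixes X :: "'v::minus set" and N :: "'v \<Rightarrow> real"
  assumes N_nonneg: "v \<in> X \<Longrightarrow> 0 \<le> N v"
    and diff_closed: "v \<in> X \<Longrightarrow> w \<in> X \<Longrightarrow> v - w \<in> X"
    and N_refl: "v \<in> X \<Longrightarrow> N (v - v) = 0"
    and N_sym: "v \<in> X \<Longrightarrow> w \<in> X \<Longrightarrow> N (v - w) = N (w - v)"
    and N_tri: "v \<in> X \<Longrightarrow> w \<in> X \<Longrightarrow> z \<in> X \<Longrightarrow> N (v - z) \<le> N (v - w) + N (w - z)"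
    and N_diff_le: "v \<in> X \<Longrightarrow> w \<in> X \<Longrightarrow> N (v - w) \<le> N v + N w"
    and N_le: "v \<in> X \<Longrightarrow> w \<in> X \<Longrightarrow> N v \<le> N w + N (v - w)"
    and diff_diff: "(v - w) - (v' - w') = (v - v') - (w - w')"
begin

lemma dist_nonneg: "v \<in> X \<Longrightarrow> w \<in> X \<Longrightarrow> 0 \<le> N (v - w)"
  using N_nonneg diff_closed by blast

lemma strongly_measurable_AE_in:
  assumes "strongly_measurable I X N F"
  shows "AE t in lebesgue. t \<in> I \<longrightarrow> F t \<in> X"
proof -
  obtain s where "AE t in lebesgue. t \<in> I \<longrightarrow> F t \<in> X \<and> (\<lambda>k. N (s k t - F t)) \<longlonglongrightarrow> 0"
    using assms unfolding strongly_measurable_def by blast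
  then show ?thesis by eventually_elim simp
qed

lemma strongly_measurable_diff:
  assumes "strongly_measurable I X N F" "strongly_measurable I X N G"
  shows "strongly_measurable I X N (\<lambda>t. F t - G t)"
proof -
  obtain s where s: "\<And>k. finite (s k ` I)" "\<And>k. s k ` I \<subseteq> X" "\<And>k v. {t \<in> I. s k t = v} \<in> sets lebesgue"
    "AE t in lebesgue. t \<in> I \<longrightarrow> F t \<in> X \<and> (\<lambda>k. N (s k t - F t)) \<longlonglongrightarrow> 0"
    using assms(1) unfolding strongly_measurable_def by blast
  obtain s' where s': "\<And>k. finite (s' k ` I)" "\<And>k. s' k ` I \<subseteq> X" "\<And>k v. {t \<in> I. s' k t = v} \<in> sets lebesgue"
    "AE t in lebesgue. t \<in> I \<longrightarrow> G t \<in> X \<and> (\<lambda>k. N (s' k t - G t)) \<longlonglongrightarrow> 0"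
    using assms(2) unfolding strongly_measurable_def by blast
  show ?thesis
    unfolding strongly_measurable_def
  proof (intro exI conjI allI)
    fix k
    show "finite ((\<lambda>t. s k t - s' k t) ` I)"
      by (rule finite_subset[of _ "(\<lambda>(v, w). v - w) ` ((s k ` I) \<times> (s' k ` I))"]) (use s(1) s'(1) in auto)
    show "(\<lambda>t. s k t - s' k t) ` I \<subseteq> X" using s(2) s'(2) diff_closed by blast
    fix v
    have "{t \<in> I. s k t - s' k t = v} = (\<Union>(p, q)\<in>{(p, q) \<in> (s k ` I) \<times> (s' k ` I). p - q = v}.
        {t \<in> I. s k t = p} \<inter> {t \<in> I. s' k t = q})" by auto
    also have "\<dots> \<in> sets lebesgue"
      using s(1,3) s'(1,3) by (intro sets.finite_UN) (auto intro: finite_subset[of _ "(s k ` I) \<times> (s' k ` I)"])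
    finally show "{t \<in> I. s k t - s' k t = v} \<in> sets lebesgue" .
  next
    show "AE t in lebesgue. t \<in> I \<longrightarrow> F t - G t \<in> X \<and> (\<lambda>k. N (s k t - s' k t - (F t - G t))) \<longlonglongrightarrow> 0"
      using s(4) s'(4)
    proof (eventually_elim, intro impI conjI)
      fix t assume "t \<in> I \<longrightarrow> F t \<in> X \<and> (\<lambda>k. N (s k t - F t)) \<longlonglongrightarrow> 0"
        "t \<in> I \<longrightarrow> G t \<in> X \<and> (\<lambda>k. N (s' k t - G t)) \<longlonglongrightarrow> 0" and t: "t \<in> I"
      then have F: "F t \<in> X" "(\<lambda>k. N (s k t - F t)) \<longlonglongrightarrow> 0" and G: "G t \<in> X" "(\<lambda>k. N (s' k t - G t)) \<longlonglongrightarrow> 0"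
        by auto
      then show "F t - G t \<in> X" using diff_closed by blast
      have est: "N (s k t - s' k t - (F t - G t)) \<le> N (s k t - F t) + N (s' k t - G t)" for k
      proof -
        have "s k t \<in> X" "s' k t \<in> X" using s(2)[of k] s'(2)[of k] t by auto
        then have "s k t - F t \<in> X" "s' k t - G t \<in> X" using diff_closed F(1) G(1) by auto
        then show ?thesis
          using N_diff_le[of "s k t - F t" "s' k t - G t"] diff_diff[of "s k t" "s' k t" "F t" "G t"] by simp
      qed
      have "0 \<le> N (s k t - s' k t - (F t - G t))" for k
        using s(2)[of k] s'(2)[of k] t F(1) G(1) by (intro dist_nonneg diff_closed) auto
      then show "(\<lambda>k. N (s k t - s' k t - (F t - G t))) \<longlonglongrightarrow> 0"
        by (intro Lim_null_comparison[OF _ tendsto_add_zero[OF F(2) G(2)]]) (simp add: est)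
    qed
  qed
qed

text \<open>The norms of the approximating step functions are measurable and converge almost
  everywhere by the reverse triangle inequality. Completeness of \<open>lebesgue\<close> absorbs the
  exceptional null set, on which nothing is known about \<open>F\<close>.\<close>

lemma borel_measurable_norm:
  assumes "strongly_measurable I X N F" and I: "I \<in> sets lebesgue"
  shows "(\<lambda>t. indicator I t * N (F t)) \<in> borel_measurable lebesgue"
proof -
  obtain s where s: "\<And>k. finite (s k ` I)" "\<And>k. s k ` I \<subseteq> X" "\<And>k v. {t \<in> I. s k t = v} \<in> sets lebesgue"
    "AE t in lebesgue. t \<in> I \<longrightarrow> F t \<in> X \<and> (\<lambda>k. N (s k t - F t)) \<longlonglongrightarrow> 0"
    using assms(1) unfolding strongly_measurable_def by blast
  define g where "g k t = indicator I t * N (s k t)" for k t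
  have g: "g k \<in> borel_measurable lebesgue" for k
  proof -
    have "g k t = (\<Sum>v\<in>s k ` I. indicator {t \<in> I. s k t = v} t * N v)" for t
    proof (cases "t \<in> I")
      case True
      have "(\<Sum>v\<in>s k ` I. indicator {t \<in> I. s k t = v} t * N v) = (\<Sum>v\<in>{s k t}. N v)"
        using s(1)[of k] True by (intro sum.mono_neutral_cong_right) (auto simp: indicator_def)
      then show ?thesis using True by (simp add: g_def)
    qed (simp add: g_def)
    then have "g k = (\<lambda>t. \<Sum>v\<in>s k ` I. indicator {t \<in> I. s k t = v} t * N v)" by auto
    then show ?thesis using s(3) by (auto intro!: borel_measurable_sum borel_measurable_times)
  qed
  have "AE t in lebesgue. (\<lambda>k. g k t) \<longlonglongrightarrow> indicator I t * N (F t)"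
    using s(4)
  proof eventually_elim
    case (elim t)
    show ?case
    proof (cases "t \<in> I")
      case True
      have "(\<lambda>k. N (s k t) - N (F t)) \<longlonglongrightarrow> 0"
      proof (rule Lim_null_comparison)
        have "\<bar>N (s k t) - N (F t)\<bar> \<le> N (s k t - F t)" for k
          using N_le[of "s k t" "F t"] N_le[of "F t" "s k t"] N_sym[of "s k t" "F t"] s(2)[of k] True elim
          by (force simp: abs_le_iff)
        then show "\<forall>\<^sub>F k in sequentially. norm (N (s k t) - N (F t)) \<le> N (s k t - F t)" by simp
      qed (use elim True in auto)
      then show ?thesis using True by (simp add: g_def LIM_zero_iff)
    qed (simp add: g_def)
  qed
  then have "AE t in lebesgue. lim (\<lambda>k. g k t) = indicator I t * N (F t)"
    by eventually_elim (rule limI)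
  moreover have "(\<lambda>t. lim (\<lambda>k. g k t)) \<in> borel_measurable lebesgue"
    using g by (rule borel_measurable_lim_metric)
  ultimately show ?thesis
    by (rule borel_measurable_AE[rotated])
qed

lemma powr_integrable_if_bounded:
  assumes F: "strongly_measurable I X N F" and I: "I \<in> sets lebesgue" "emeasure lebesgue I < \<infinity>"
    and C: "AE t in lebesgue. t \<in> I \<longrightarrow> N (F t) \<le> C" and p: "1 \<le> p"
  shows "set_integrable lebesgue I (\<lambda>t. N (F t) powr p)"
  unfolding set_integrable_def
proof (rule Bochner_Integration.integrable_bound)
  show "integrable lebesgue (\<lambda>t. indicator I t * (C powr p))" using I by simp
  have [measurable]: "(\<lambda>t. indicator I t * N (F t)) \<in> borel_measurable lebesgue"
    by (rule borel_measurable_norm[OF F I(1)])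
  have "(\<lambda>t. indicator I t *\<^sub>R N (F t) powr p) = (\<lambda>t. (indicator I t * N (F t)) powr p)"
    by (auto simp: indicator_def fun_eq_iff)
  then show "(\<lambda>t. indicator I t *\<^sub>R N (F t) powr p) \<in> borel_measurable lebesgue" by simp
  show "AE t in lebesgue. norm (indicator I t *\<^sub>R N (F t) powr p) \<le> norm (indicator I t * (C powr p))"
    using C strongly_measurable_AE_in[OF F]
  proof eventually_elim
    case (elim t)
    then show ?case using N_nonneg[of "F t"] p by (auto simp: indicator_def intro!: powr_mono2)
  qed
qed

text \<open>The source is the elementary bound
  \<open>(x + y) powr p \<le> 2 powr p * (x powr p + y powr p)\<close> for nonnegative arguments,
  obtained through the maximum of \<open>x\<close> and \<open>y\<close>. The same bound produces the
  constant \<open>2 powr p\<close> of the quasi-metric below.\<close>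

lemma bochner_Lp_diff:
  assumes F: "F \<in> bochner_Lp p I X N" and G: "G \<in> bochner_Lp p I X N" and I: "I \<in> sets lebesgue" and p: "1 \<le> p"
  shows "set_integrable lebesgue I (\<lambda>t. N (F t - G t) powr p)"
    "AE t in lebesgue. t \<in> I \<longrightarrow> F t \<in> X"
proof -
  have sF: "strongly_measurable I X N F" and sG: "strongly_measurable I X N G"
    and iF: "set_integrable lebesgue I (\<lambda>t. N (F t) powr p)" and iG: "set_integrable lebesgue I (\<lambda>t. N (G t) powr p)"
    using F G by (auto simp: bochner_Lp_def)
  note XF = strongly_measurable_AE_in[OF sF] and XG = strongly_measurable_AE_in[OF sG]
  show "AE t in lebesgue. t \<in> I \<longrightarrow> F t \<in> X" by fact
  show "set_integrable lebesgue I (\<lambda>t. N (F t - G t) powr p)"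
    unfolding set_integrable_def
  proof (rule Bochner_Integration.integrable_bound)
    show "integrable lebesgue (\<lambda>t. 2 powr p * (indicator I t *\<^sub>R N (F t) powr p + indicator I t *\<^sub>R N (G t) powr p))"
      using iF iG unfolding set_integrable_def by (intro integrable_mult_right Bochner_Integration.integrable_add)
    have [measurable]: "(\<lambda>t. indicator I t * N (F t - G t)) \<in> borel_measurable lebesgue"
      by (rule borel_measurable_norm[OF strongly_measurable_diff[OF sF sG] I])
    have "(\<lambda>t. indicator I t *\<^sub>R N (F t - G t) powr p) = (\<lambda>t. (indicator I t * N (F t - G t)) powr p)"
      by (auto simp: indicator_def fun_eq_iff)
    then show "(\<lambda>t. indicator I t *\<^sub>R N (F t - G t) powr p) \<in> borel_measurable lebesgue" by simp
    show "AE t in lebesgue. norm (indicator I t *\<^sub>R N (F t - G t) powr p) \<le>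
        norm (2 powr p * (indicator I t *\<^sub>R N (F t) powr p + indicator I t *\<^sub>R N (G t) powr p))"
      using XF XG
    proof eventually_elim
      case (elim t)
      show ?case
      proof (cases "t \<in> I")
        case True
        have "N (F t - G t) \<le> N (F t) + N (G t)" using N_diff_le elim True by blast
        also have "\<dots> \<le> 2 * max (N (F t)) (N (G t))" by simp
        finally have "N (F t - G t) powr p \<le> (2 * max (N (F t)) (N (G t))) powr p"
          using p dist_nonneg elim True by (intro powr_mono2) auto
        also have "\<dots> = 2 powr p * max (N (F t)) (N (G t)) powr p"
          by (rule powr_mult)
        also have "\<dots> \<le> 2 powr p * (N (F t) powr p + N (G t) powr p)"
          by (intro mult_left_mono) (auto simp: max_def)
        finally show ?thesis using True by simp
      qed simp
    qed
  qed
qed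

lemma quasi_metric_bochner:
  assumes I: "I \<in> sets lebesgue" and p: "1 \<le> p"
  shows "quasi_metric (bochner_Lp p I X N) (\<lambda>F G. LINT t:I|lebesgue. N (F t - G t) powr p) (2 powr p)"
proof
  let ?D = "\<lambda>F G. LINT t:I|lebesgue. N (F t - G t) powr p"
  note Lp = bochner_Lp_diff[OF _ _ I p]
  show "0 \<le> ?D F G" for F G
    unfolding set_lebesgue_integral_def by (intro Bochner_Integration.integral_nonneg) simp
  show "?D F F = 0" if F: "F \<in> bochner_Lp p I X N" for F
    unfolding set_lebesgue_integral_def using Lp(2)[OF F F]
    by (intro integral_eq_zero_AE) (auto elim!: eventually_mono simp: N_refl indicator_def)
  show "?D F G = ?D G F" if F: "F \<in> bochner_Lp p I X N" and G: "G \<in> bochner_Lp p I X N" for F G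
    unfolding set_lebesgue_integral_def
  proof (rule integral_cong_AE)
    show "AE t in lebesgue. indicator I t *\<^sub>R N (F t - G t) powr p = indicator I t *\<^sub>R N (G t - F t) powr p"
      using Lp(2)[OF F F] Lp(2)[OF G G]
      by eventually_elim (auto simp: indicator_def N_sym)
  qed (use Lp(1)[OF F G] Lp(1)[OF G F] in \<open>auto simp: set_integrable_def dest: borel_measurable_integrable\<close>)
  show "1 \<le> 2 powr p" using p by (simp add: ge_one_powr_ge_zero)
  show "?D F H \<le> 2 powr p * (?D F G + ?D G H)"
    if F: "F \<in> bochner_Lp p I X N" and G: "G \<in> bochner_Lp p I X N" and H: "H \<in> bochner_Lp p I X N" for F G H
  proof -
    have i: "set_integrable lebesgue I (\<lambda>t. N (F t - G t) powr p + N (G t - H t) powr p)"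
      by (intro set_integral_add(1) Lp(1) F G H)
    have "?D F H \<le> (LINT t:I|lebesgue. 2 powr p * (N (F t - G t) powr p + N (G t - H t) powr p))"
    proof (rule set_integral_mono_AE)
      show "set_integrable lebesgue I (\<lambda>t. 2 powr p * (N (F t - G t) powr p + N (G t - H t) powr p))"
        using i by (rule set_integrable_mult_right)
      show "AE t\<in>I in lebesgue. N (F t - H t) powr p \<le> 2 powr p * (N (F t - G t) powr p + N (G t - H t) powr p)"
        using Lp(2)[OF F F] Lp(2)[OF G G] Lp(2)[OF H H]
      proof (eventually_elim, intro impI)
        fix t assume mem: "t \<in> I \<longrightarrow> F t \<in> X" "t \<in> I \<longrightarrow> G t \<in> X" "t \<in> I \<longrightarrow> H t \<in> X" "t \<in> I"
        then have "N (F t - H t) \<le> N (F t - G t) + N (G t - H t)" using N_tri by blast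
        also have "\<dots> \<le> 2 * max (N (F t - G t)) (N (G t - H t))" by simp
        finally have "N (F t - H t) powr p \<le> (2 * max (N (F t - G t)) (N (G t - H t))) powr p"
          using p dist_nonneg mem by (intro powr_mono2) auto
        also have "\<dots> = 2 powr p * max (N (F t - G t)) (N (G t - H t)) powr p"
          by (rule powr_mult)
        also have "\<dots> \<le> 2 powr p * (N (F t - G t) powr p + N (G t - H t) powr p)"
          by (intro mult_left_mono) (auto simp: max_def)
        finally show "N (F t - H t) powr p \<le> 2 powr p * (N (F t - G t) powr p + N (G t - H t) powr p)" .
      qed
    qed (use Lp(1)[OF F H] in auto)
    also have "\<dots> = 2 powr p * (?D F G + ?D G H)"
      using set_integral_add(2)[OF Lp(1)[OF F G] Lp(1)[OF G H]] by simp
    finally show ?thesis .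
  qed
qed

text \<open>Passing to the \<open>p\<close>-th power turns balls of radius \<open>r\<close> into
  balls of radius \<open>r powr p\<close>, so \<open>bochner_norm\<close> and the quasi-metric
  define the same open sets.\<close>

theorem relatively_compact_bochner_if_seq:
  assumes I: "I \<in> sets lebesgue" and p: "1 \<le> p" and A: "A \<subseteq> bochner_Lp p I X N"
    and seq: "\<And>f :: nat \<Rightarrow> real \<Rightarrow> 'v. (\<And>k. f k \<in> A) \<Longrightarrow> \<exists>l\<in>bochner_Lp p I X N. \<exists>r. strict_mono r \<and>
       (\<lambda>k. LINT t:I|lebesgue. N (f (r k) t - l t) powr p) \<longlonglongrightarrow> 0"
  shows "relatively_compact (bochner_topology p I X N) A"
proof -
  let ?D = "\<lambda>F G. LINT t:I|lebesgue. N (F t - G t) powr p"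
  interpret Q: quasi_metric "bochner_Lp p I X N" ?D "2 powr p"
    by (rule quasi_metric_bochner[OF I p])
  have "(\<exists>r>0. \<forall>G\<in>bochner_Lp p I X N. bochner_norm p I N (\<lambda>t. G t - F t) < r \<longrightarrow> G \<in> V) \<longleftrightarrow>
      (\<exists>r>0. \<forall>G\<in>bochner_Lp p I X N. ?D G F < r \<longrightarrow> G \<in> V)" for F V
  proof -
    have "bochner_norm p I N (\<lambda>t. G t - F t) < r \<longleftrightarrow> ?D G F < r powr p" if "r > 0" for r G
    proof -
      have "?D G F powr (1 / p) < (r powr p) powr (1 / p) \<longleftrightarrow> ?D G F < r powr p"
        using p Q.nonneg[of G F] powr_less_mono2[of "1 / p" "?D G F" "r powr p"] powr_mono2[of "1 / p" "r powr p" "?D G F"]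
        by (auto simp: not_le[symmetric])
      then show ?thesis using that p by (simp add: bochner_norm_def powr_powr)
    qed
    note eq = this
    have "?D G F < r \<longleftrightarrow> bochner_norm p I N (\<lambda>t. G t - F t) < r powr (1 / p)" if "r > 0" for r G
      using eq[of "r powr (1 / p)" G] that p by (simp add: powr_powr)
    note eq' = this
    show ?thesis
    proof
      assume "\<exists>r>0. \<forall>G\<in>bochner_Lp p I X N. bochner_norm p I N (\<lambda>t. G t - F t) < r \<longrightarrow> G \<in> V"
      then obtain r where "r > 0" "\<forall>G\<in>bochner_Lp p I X N. bochner_norm p I N (\<lambda>t. G t - F t) < r \<longrightarrow> G \<in> V" by blast
      then show "\<exists>r>0. \<forall>G\<in>bochner_Lp p I X N. ?D G F < r \<longrightarrow> G \<in> V"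
        using eq[of r] by (intro exI[of _ "r powr p"]) simp
    next
      assume "\<exists>r>0. \<forall>G\<in>bochner_Lp p I X N. ?D G F < r \<longrightarrow> G \<in> V"
      then obtain r where "r > 0" "\<forall>G\<in>bochner_Lp p I X N. ?D G F < r \<longrightarrow> G \<in> V" by blast
      then show "\<exists>r>0. \<forall>G\<in>bochner_Lp p I X N. bochner_norm p I N (\<lambda>t. G t - F t) < r \<longrightarrow> G \<in> V"
        using eq'[of r] by (intro exI[of _ "r powr (1 / p)"]) simp
    qed
  qed
  then have "bochner_topology p I X N = Q.T"
    unfolding bochner_topology_def Q.T_def Q.is_open_def by (intro arg_cong[of _ _ topology] ext) simp
  then show ?thesis using Q.relatively_compact_if_seq[OF A seq] by simp
qed

end

section \<open>Curves of bounded variation and Helly selection\<close>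

context pseudonormed
begin

text \<open>Rational times are requested because a diagonal subsequence is arranged to converge
  there. They bracket a continuity point so tightly that the monotone function hardly grows between
  them.\<close>

lemma mono_cont_sandwich:
  fixes \<mu> :: "real \<Rightarrow> real"
  assumes t: "t \<in> {0<..<\<tau>}" and c: "isCont \<mu> t" and e: "0 < e"
  obtains q q' where "q \<in> \<rat>" "q' \<in> \<rat>" "q \<in> {0<..<t}" "q' \<in> {t<..<\<tau>}" "\<mu> q' - \<mu> q < e"
proof -
  obtain d where d: "d > 0" "\<And>s. \<bar>s - t\<bar> < d \<Longrightarrow> \<bar>\<mu> s - \<mu> t\<bar> < e / 2"
    using c e unfolding continuous_at_eps_delta dist_real_def
    by (metis half_gt_zero)
  obtain q where q: "q \<in> \<rat>" "max 0 (t - d) < q" "q < t"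
    using Rats_dense_in_real[of "max 0 (t - d)" t] t d by auto
  obtain q' where q': "q' \<in> \<rat>" "t < q'" "q' < min \<tau> (t + d)"
    using Rats_dense_in_real[of t "min \<tau> (t + d)"] t d by auto
  have "\<bar>\<mu> q - \<mu> t\<bar> < e / 2" "\<bar>\<mu> q' - \<mu> t\<bar> < e / 2" using d(2) q q' by auto
  then have "\<mu> q' - \<mu> q < e" by linarith
  then show thesis using q q' by (intro that[of q q']) auto
qed

lemma AE_mono_cont:
  fixes \<mu> :: "real \<Rightarrow> real"
  assumes "mono_on {0<..<\<tau>} \<mu>"
  shows "AE t in lebesgue. t \<in> {0<..<\<tau>} \<longrightarrow> isCont \<mu> t"
proof -
  have "countable {t \<in> {0<..<\<tau>}. \<not> isCont \<mu> t}"
    by (rule mono_on_ctble_discont_open[OF _ assms]) simp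
  then have "{t \<in> {0<..<\<tau>}. \<not> isCont \<mu> t} \<in> null_sets lebesgue"
    using countable_imp_null_set_lborel null_sets_completionI by blast
  from AE_not_in[OF this] show ?thesis by eventually_elim auto
qed

text \<open>The step functions sample \<open>f k\<close> at grid points. Near a time
  \<open>t\<close> around which the variation functions eventually grow little, the sampled value is
  close to \<open>f k t\<close>, and this is close to \<open>l t\<close>. The statement is about
  sequences so that it serves twice: with a constant sequence for a single curve, and for the limit
  of a Helly subsequence.\<close>

lemma strongly_measurable_BV_limit:
  assumes X: "\<And>k t. t \<in> {0<..<\<tau>} \<Longrightarrow> f k t \<in> X"
    and d: "\<And>k s t. s \<in> {0<..<\<tau>} \<Longrightarrow> t \<in> {0<..<\<tau>} \<Longrightarrow> s \<le> t \<Longrightarrow> N (f k t - f k s) \<le> \<mu> k t - \<mu> k s"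
    and mono: "\<And>k s t. s \<in> {0<..<\<tau>} \<Longrightarrow> t \<in> {0<..<\<tau>} \<Longrightarrow> s \<le> t \<Longrightarrow> \<mu> k s \<le> \<mu> k t"
    and osc: "AE t in lebesgue. t \<in> {0<..<\<tau>} \<longrightarrow> l t \<in> X \<and> (\<lambda>k. N (f k t - l t)) \<longlonglongrightarrow> 0 \<and>
      (\<forall>e>0. \<exists>q\<in>{0<..<t}. \<exists>q'\<in>{t<..<\<tau>}. \<forall>\<^sub>F k in sequentially. \<mu> k q' - \<mu> k q < e)"
  shows "strongly_measurable {0<..<\<tau>} X N l"
  unfolding strongly_measurable_def
proof (intro exI conjI allI)
  let ?I = "{0<..<\<tau>}"
  let ?s = "\<lambda>k t. f k (grid \<tau> k t)"
  fix k v
  show "finite (?s k ` ?I)" "{t \<in> ?I. ?s k t = v} \<in> sets lebesgue"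
    by (rule grid_step_function)+
  have gridI: "grid \<tau> k t \<in> ?I" if "t \<in> ?I" for k t
    by (rule grid_props[OF that, of k]) simp
  then show "?s k ` ?I \<subseteq> X" using X by auto
  show "AE t in lebesgue. t \<in> ?I \<longrightarrow> l t \<in> X \<and> (\<lambda>k. N (?s k t - l t)) \<longlonglongrightarrow> 0"
    using osc
  proof (eventually_elim, intro impI conjI)
    fix t assume A: "t \<in> ?I \<longrightarrow> l t \<in> X \<and> (\<lambda>k. N (f k t - l t)) \<longlonglongrightarrow> 0 \<and>
      (\<forall>e>0. \<exists>q\<in>{0<..<t}. \<exists>q'\<in>{t<..<\<tau>}. \<forall>\<^sub>F k in sequentially. \<mu> k q' - \<mu> k q < e)" and t: "t \<in> ?I"
    then show lX: "l t \<in> X" by blast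
    show "(\<lambda>k. N (?s k t - l t)) \<longlonglongrightarrow> 0"
    proof (rule tendstoI)
      fix e :: real assume "e > 0"
      then obtain q q' where q: "q \<in> {0<..<t}" "q' \<in> {t<..<\<tau>}" "\<forall>\<^sub>F k in sequentially. \<mu> k q' - \<mu> k q < e / 2"
        using A t half_gt_zero by metis
      have "\<forall>\<^sub>F k in sequentially. grid \<tau> k t \<in> {q<..<q'}"
        using order_tendstoD[OF grid_tendsto[OF t]] q by (auto simp: eventually_conj_iff)
      moreover have "\<forall>\<^sub>F k in sequentially. N (f k t - l t) < e / 2"
        using A t \<open>e > 0\<close> by (intro order_tendstoD(2)) auto
      ultimately show "\<forall>\<^sub>F k in sequentially. dist (N (?s k t - l t)) 0 < e"
        using q(3)
      proof eventually_elim
        case (elim k)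
        let ?g = "grid \<tau> k t"
        have m: "N (f k v - f k w) \<le> \<mu> k q' - \<mu> k q" if "v \<in> {q<..<q'}" "w \<in> {q<..<q'}" "w \<le> v" for v w
          using d[of w v k] mono[of q w k] mono[of v q' k] that q(1,2) t by auto
        have "N (?s k t - f k t) \<le> \<mu> k q' - \<mu> k q"
          using m[of ?g t] m[of t ?g] elim(1) q(1,2) N_sym[of "?s k t" "f k t"] X[OF t] X[OF gridI[OF t]]
          by (cases "t \<le> ?g") auto
        moreover have "N (?s k t - l t) \<le> N (?s k t - f k t) + N (f k t - l t)"
          using N_tri X[OF t] X[OF gridI[OF t]] lX by blast
        ultimately have "N (?s k t - l t) < e" using elim by linarith
        then show ?case using dist_nonneg[OF X[OF gridI[OF t]] lX] by (simp add: dist_real_def)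
      qed
    qed
  qed
qed

lemma BV_strongly_measurable:
  assumes X: "\<And>t. t \<in> {0<..<\<tau>} \<Longrightarrow> f t \<in> X"
    and d: "\<And>s t. s \<in> {0<..<\<tau>} \<Longrightarrow> t \<in> {0<..<\<tau>} \<Longrightarrow> s \<le> t \<Longrightarrow> N (f t - f s) \<le> \<mu> t - \<mu> s"
    and mono: "mono_on {0<..<\<tau>} \<mu>"
  shows "strongly_measurable {0<..<\<tau>} X N f"
proof (rule strongly_measurable_BV_limit[where f = "\<lambda>_. f" and \<mu> = "\<lambda>_. \<mu>"])
  show "AE t in lebesgue. t \<in> {0<..<\<tau>} \<longrightarrow> f t \<in> X \<and> (\<lambda>k. N (f t - f t)) \<longlonglongrightarrow> 0 \<and>
      (\<forall>e>0. \<exists>q\<in>{0<..<t}. \<exists>q'\<in>{t<..<\<tau>}. \<forall>\<^sub>F k in sequentially. \<mu> q' - \<mu> q < e)"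
    using AE_mono_cont[OF mono]
  proof (eventually_elim, intro impI conjI allI)
    fix t and e :: real assume c: "t \<in> {0<..<\<tau>} \<longrightarrow> isCont \<mu> t" and t: "t \<in> {0<..<\<tau>}"
    show "f t \<in> X" using X t by blast
    then show "(\<lambda>k. N (f t - f t)) \<longlonglongrightarrow> 0" by (simp add: N_refl)
    assume "0 < e"
    show "\<exists>q\<in>{0<..<t}. \<exists>q'\<in>{t<..<\<tau>}. \<forall>\<^sub>F k in sequentially. \<mu> q' - \<mu> q < e"
      by (rule mono_cont_sandwich[OF t _ \<open>0 < e\<close>, of \<mu>]) (use c t in \<open>simp, metis always_eventually\<close>)
  qed
qed (use X d mono in \<open>auto simp: mono_on_def\<close>)

text \<open>The variation functions are selected along with the curves, so that both converge at
  rational times. The limit of the variation functions extends to a monotone function with countably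
  many jumps; away from the jumps the curves vary little near \<open>t\<close>, uniformly for large
  \<open>k\<close>, and convergence at nearby rationals carries over to \<open>t\<close>.\<close>

lemma Helly_subsequence:
  fixes f :: "nat \<Rightarrow> real \<Rightarrow> 'v" and \<mu> :: "nat \<Rightarrow> real \<Rightarrow> real"
  assumes \<tau>: "0 < \<tau>"
    and V: "\<And>k t. t \<in> {0<..<\<tau>} \<Longrightarrow> f k t \<in> V" "V \<subseteq> X"
    and d: "\<And>k s t. s \<in> {0<..<\<tau>} \<Longrightarrow> t \<in> {0<..<\<tau>} \<Longrightarrow> s \<le> t \<Longrightarrow> N (f k t - f k s) \<le> \<mu> k t - \<mu> k s"
    and mono: "\<And>k. mono_on {0<..<\<tau>} (\<mu> k)"
    and bnd: "\<And>k t. t \<in> {0<..<\<tau>} \<Longrightarrow> \<mu> k t \<in> {0..M}"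
    and cpt: "\<And>g :: nat \<Rightarrow> 'v. (\<And>j. g j \<in> V) \<Longrightarrow> \<exists>l\<in>X. \<exists>r. strict_mono r \<and> (\<lambda>j. N (g (r j) - l)) \<longlonglongrightarrow> 0"
  obtains r l where "strict_mono r" "AE t in lebesgue. t \<in> {0<..<\<tau>} \<longrightarrow> l t \<in> X \<and> (\<lambda>k. N (f (r k) t - l t)) \<longlonglongrightarrow> 0"
    "strongly_measurable {0<..<\<tau>} X N l"
proof -
  let ?I = "{0<..<\<tau>}"
  let ?Q = "?I \<inter> \<rat>"
  have "countable ?Q" using countable_rat by blast
  moreover have "?Q \<noteq> {}" using Rats_dense_in_real[OF \<tau>] by auto
  ultimately have "range (from_nat_into ?Q) = ?Q" by (rule range_from_nat_into[rotated])
  then obtain q :: "nat \<Rightarrow> real" where q: "range q = ?Q" ..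
  have qI: "q n \<in> ?I" for n using q by auto
  define P where "P n s \<longleftrightarrow> convergent (\<lambda>k. \<mu> (s k) (q n)) \<and> (\<exists>l\<in>X. (\<lambda>k. N (f (s k) (q n) - l)) \<longlonglongrightarrow> 0)" for n s
  interpret subseqs P
  proof
    fix n and s :: "nat \<Rightarrow> nat" assume s: "strict_mono s"
    obtain l r1 where r1: "l \<in> X" "strict_mono r1" "(\<lambda>j. N (f (s (r1 j)) (q n) - l)) \<longlonglongrightarrow> 0"
      using cpt[of "\<lambda>j. f (s j) (q n)"] V(1) qI by auto
    have "seq_compact {0..M}" using compact_Icc compact_eq_seq_compact_metric by blast
    from this[unfolded seq_compact_def, rule_format, of "\<lambda>j. \<mu> (s (r1 j)) (q n)"] bnd[OF qI]
    have "\<exists>m\<in>{0..M}. \<exists>r2. strict_mono r2 \<and> ((\<lambda>j. \<mu> (s (r1 j)) (q n)) \<circ> r2) \<longlonglongrightarrow> m"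
      by blast
    then obtain m r2 where r2: "strict_mono r2" "((\<lambda>j. \<mu> (s (r1 j)) (q n)) \<circ> r2) \<longlonglongrightarrow> m"
      by auto
    have "P n (s \<circ> (r1 \<circ> r2))"
      unfolding P_def convergent_def
      using r2 r1(1) LIMSEQ_subseq_LIMSEQ[OF r1(3) r2(1)] by (auto simp: o_def)
    then show "\<exists>r'. strict_mono r' \<and> P n (s \<circ> r')"
      using strict_mono_o[OF r1(2) r2(1)] by blast
  qed
  define r where "r = diagseq"
  have r: "strict_mono r" unfolding r_def by (rule subseq_diagseq)
  have Pr: "P n r" for n
  proof -
    \<comment> \<open>The diagonal sequence is known to satisfy \<open>P n\<close> after dropping
      its first \<open>n + 1\<close> terms; limits are not affected by the shift.\<close>
    have "P n (r \<circ> (+) (Suc n))"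
      unfolding r_def
    proof (rule diagseq_holds)
      fix r s :: "nat \<Rightarrow> nat" and n assume "strict_mono r" "P n s"
      then show "P n (s \<circ> r)"
        unfolding P_def convergent_def using LIMSEQ_subseq_LIMSEQ[OF _ \<open>strict_mono r\<close>]
        by (fastforce simp: o_def)
    qed
    then show ?thesis
      unfolding P_def convergent_def o_def
      using LIMSEQ_offset[of "\<lambda>k. \<mu> (r k) (q n)" "Suc n"] LIMSEQ_offset[of "\<lambda>k. N (f (r k) (q n) - _)" "Suc n"]
      by (auto simp: add.commute)
  qed
  define L where "L t = lim (\<lambda>k. \<mu> (r k) t)" for t
  have L: "(\<lambda>k. \<mu> (r k) t) \<longlonglongrightarrow> L t" if "t \<in> ?Q" for t
    using Pr that q unfolding P_def L_def convergent_LIMSEQ_iff by (metis rangeE)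
  have Lmono: "L s \<le> L t" if "s \<in> ?Q" "t \<in> ?Q" "s \<le> t" for s t
    using LIMSEQ_le[OF L[OF that(1)] L[OF that(2)]] mono that by (auto simp: mono_on_def)
  have LM: "L t \<le> M" if "t \<in> ?Q" for t
    using LIMSEQ_le_const2[OF L[OF that]] bnd that by auto
  \<comment> \<open>\<open>L\<close> is controlled only at rational times. The supremum over
    rationals up to \<open>t\<close> extends it to a monotone function on the whole interval, to
    which the countability of jumps applies.\<close>
  define G where "G t = (SUP q\<in>{q \<in> ?Q. q \<le> t}. L q)" for t
  have Gbdd: "bdd_above (L ` {q \<in> ?Q. q \<le> t})" for t using LM by (auto intro!: bdd_aboveI)
  have Gne: "{q \<in> ?Q. q \<le> t} \<noteq> {}" if "t \<in> ?I" for t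
  proof -
    have "0 < t" using that by simp
    from Rats_dense_in_real[OF this] obtain p where "p \<in> \<rat>" "0 < p" "p < t" by blast
    then have "p \<in> {q \<in> ?Q. q \<le> t}" using that by auto
    then show ?thesis by blast
  qed
  have G: "mono_on ?I G"
    unfolding mono_on_def G_def using Gbdd Gne by (auto intro!: cSUP_subset_mono)
  have GL: "G t = L t" if "t \<in> ?Q" for t
    unfolding G_def
  proof (rule antisym)
    show "(SUP q\<in>{q \<in> ?Q. q \<le> t}. L q) \<le> L t" using Gne that Lmono by (intro cSUP_least) auto
    show "L t \<le> (SUP q\<in>{q \<in> ?Q. q \<le> t}. L q)" using that Gbdd by (intro cSUP_upper) auto
  qed
  have osc: "\<exists>q\<in>?Q. \<exists>q'\<in>{t<..<\<tau>}. q < t \<and> (\<forall>\<^sub>F k in sequentially. \<mu> (r k) q' - \<mu> (r k) q < e)"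
    if t: "t \<in> ?I" "isCont G t" and e: "0 < e" for t e
  proof (rule mono_cont_sandwich[OF t e])
    fix q q' assume q: "q \<in> \<rat>" "q' \<in> \<rat>" "q \<in> {0<..<t}" "q' \<in> {t<..<\<tau>}" "G q' - G q < e"
    then have Q: "q \<in> ?Q" "q' \<in> ?Q" using t by auto
    have "(\<lambda>k. \<mu> (r k) q' - \<mu> (r k) q) \<longlonglongrightarrow> L q' - L q" by (intro tendsto_diff L Q)
    then have "\<forall>\<^sub>F k in sequentially. \<mu> (r k) q' - \<mu> (r k) q < e"
      by (rule order_tendstoD(2)) (use q(5) GL Q in auto)
    then show ?thesis using Q q(3,4) by (intro bexI[of _ q] bexI[of _ q']) auto
  qed
  have ex: "\<exists>l\<in>X. (\<lambda>k. N (f (r k) t - l)) \<longlonglongrightarrow> 0" if t: "t \<in> ?I" "isCont G t" for t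
  proof -
    have ft: "f k t \<in> X" for k using V t(1) by blast
    \<comment> \<open>The limit \<open>l\<close> at a rational time \<open>p\<close> slightly before
      \<open>t\<close> serves as a bridge: all late curves at time \<open>t\<close> lie within
      \<open>e / 2\<close> of this one element of \<open>X\<close>.\<close>
    have Cauchy: "\<exists>K. \<forall>k\<ge>K. \<forall>j\<ge>K. N (f (r k) t - f (r j) t) < e" if "e > 0" for e
    proof -
      obtain p p' where p: "p \<in> ?Q" "p < t" "p' \<in> {t<..<\<tau>}" "\<forall>\<^sub>F k in sequentially. \<mu> (r k) p' - \<mu> (r k) p < e / 4"
        using osc[OF t, of "e / 4"] \<open>e > 0\<close> by auto
      obtain n where n: "p = q n" using p(1) q by (metis rangeE)
      obtain l where l: "l \<in> X" "(\<lambda>k. N (f (r k) p - l)) \<longlonglongrightarrow> 0" using Pr[of n] unfolding P_def n by blast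
      have "\<forall>\<^sub>F k in sequentially. N (f (r k) p - l) < e / 4"
        using l(2) \<open>e > 0\<close> by (intro order_tendstoD(2)) auto
      then have "\<forall>\<^sub>F k in sequentially. N (f (r k) t - l) < e / 2"
        using p(4)
      proof eventually_elim
        case (elim k)
        have "N (f (r k) t - f (r k) p) \<le> \<mu> (r k) t - \<mu> (r k) p" using d p t by auto
        also have "\<dots> \<le> \<mu> (r k) p' - \<mu> (r k) p" using mono[of "r k"] p t by (auto simp: mono_on_def)
        finally have "N (f (r k) t - f (r k) p) < e / 4" using elim by simp
        moreover have "N (f (r k) t - l) \<le> N (f (r k) t - f (r k) p) + N (f (r k) p - l)"
          using N_tri ft l(1) V p(1) by blast
        ultimately show ?case using elim by simp
      qed
      then obtain K where K: "\<And>k. k \<ge> K \<Longrightarrow> N (f (r k) t - l) < e / 2"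
        unfolding eventually_sequentially by blast
      have "N (f (r k) t - f (r j) t) < e" if "k \<ge> K" "j \<ge> K" for k j
        using N_tri[of "f (r k) t" l "f (r j) t"] N_sym[of l "f (r j) t"] K[OF that(1)] K[OF that(2)] ft l(1) by auto
      then show ?thesis by blast
    qed
    \<comment> \<open>\<open>X\<close> is not assumed complete. The compactness hypothesis provides
      a limit along a subsequence, and the Cauchy property extends the convergence to the whole
      sequence.\<close>
    obtain l r' where l: "l \<in> X" "strict_mono r'" "(\<lambda>j. N (f (r (r' j)) t - l)) \<longlonglongrightarrow> 0"
      using cpt[of "\<lambda>j. f (r j) t"] V(1) t(1) by auto
    have "(\<lambda>k. N (f (r k) t - l)) \<longlonglongrightarrow> 0"
    proof (rule tendstoI)
      fix e :: real assume "e > 0"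
      obtain K where K: "\<And>k j. k \<ge> K \<Longrightarrow> j \<ge> K \<Longrightarrow> N (f (r k) t - f (r j) t) < e / 2"
        using Cauchy[of "e / 2"] \<open>e > 0\<close> by auto
      have "\<forall>\<^sub>F j in sequentially. N (f (r (r' j)) t - l) < e / 2 \<and> j \<ge> K"
        using order_tendstoD(2)[OF l(3), of "e / 2"] \<open>e > 0\<close> eventually_ge_at_top by (auto simp: eventually_conj_iff)
      then obtain j where j: "N (f (r (r' j)) t - l) < e / 2" "j \<ge> K" using eventually_happens by fastforce
      have "N (f (r k) t - l) < e" if "k \<ge> K" for k
        using N_tri[OF ft ft l(1), of "r k" "r (r' j)"] K[OF that, of "r' j"] j seq_suble[OF l(2), of j] by auto
      then show "\<forall>\<^sub>F k in sequentially. dist (N (f (r k) t - l)) 0 < e"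
        unfolding eventually_sequentially using dist_nonneg[OF ft l(1)] by (auto simp: dist_real_def)
    qed
    then show ?thesis using l(1) by blast
  qed
  then obtain l where l: "\<And>t. t \<in> ?I \<Longrightarrow> isCont G t \<Longrightarrow> l t \<in> X \<and> (\<lambda>k. N (f (r k) t - l t)) \<longlonglongrightarrow> 0" by metis
  show thesis
  proof (rule that[OF r])
    show "AE t in lebesgue. t \<in> ?I \<longrightarrow> l t \<in> X \<and> (\<lambda>k. N (f (r k) t - l t)) \<longlonglongrightarrow> 0"
      using AE_mono_cont[OF G] by eventually_elim (use l in auto)
    show "strongly_measurable ?I X N l"
    proof (rule strongly_measurable_BV_limit[where f = "\<lambda>k. f (r k)" and \<mu> = "\<lambda>k. \<mu> (r k)"])
      show "AE t in lebesgue. t \<in> ?I \<longrightarrow> l t \<in> X \<and> (\<lambda>k. N (f (r k) t - l t)) \<longlonglongrightarrow> 0 \<and>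
        (\<forall>e>0. \<exists>q\<in>{0<..<t}. \<exists>q'\<in>{t<..<\<tau>}. \<forall>\<^sub>F k in sequentially. \<mu> (r k) q' - \<mu> (r k) q < e)"
        using AE_mono_cont[OF G]
      proof (eventually_elim, intro impI)
        fix t assume c: "t \<in> ?I \<longrightarrow> isCont G t" and t: "t \<in> ?I"
        have "\<exists>q\<in>{0<..<t}. \<exists>q'\<in>{t<..<\<tau>}. \<forall>\<^sub>F k in sequentially. \<mu> (r k) q' - \<mu> (r k) q < e" if "0 < e" for e
          using osc[OF t _ that] c t by fastforce
        then show "l t \<in> X \<and> (\<lambda>k. N (f (r k) t - l t)) \<longlonglongrightarrow> 0 \<and>
          (\<forall>e>0. \<exists>q\<in>{0<..<t}. \<exists>q'\<in>{t<..<\<tau>}. \<forall>\<^sub>F k in sequentially. \<mu> (r k) q' - \<mu> (r k) q < e)"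
          using l c t by blast
      qed
    qed (use V d mono in \<open>auto simp: mono_on_def\<close>)
  qed
qed

text \<open>Helly selection gives convergence at almost every time. The bound \<open>C\<close> on
  the values passes to the limit, and \<open>(2 * C) powr p\<close> dominates the
  \<open>p\<close>-th powers of the distances. The common bound \<open>M\<close> on the variation
  functions is what allows these to be selected too.\<close>

theorem BV_relatively_compact:
  fixes A :: "(real \<Rightarrow> 'v) set"
  assumes \<tau>: "0 < \<tau>" and p: "1 \<le> p"
    and V: "\<And>f t. f \<in> A \<Longrightarrow> t \<in> {0<..<\<tau>} \<Longrightarrow> f t \<in> V" "V \<subseteq> X" "\<And>v. v \<in> V \<Longrightarrow> N v \<le> C"
    and BV: "\<And>f. f \<in> A \<Longrightarrow> \<exists>\<mu>. mono_on {0<..<\<tau>} \<mu> \<and> (\<forall>t\<in>{0<..<\<tau>}. \<mu> t \<in> {0..M}) \<and>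
      (\<forall>s\<in>{0<..<\<tau>}. \<forall>t\<in>{0<..<\<tau>}. s \<le> t \<longrightarrow> N (f t - f s) \<le> \<mu> t - \<mu> s)"
    and cpt: "\<And>g :: nat \<Rightarrow> 'v. (\<And>j. g j \<in> V) \<Longrightarrow> \<exists>l\<in>X. \<exists>r. strict_mono r \<and> (\<lambda>j. N (g (r j) - l)) \<longlonglongrightarrow> 0"
  shows "relatively_compact (bochner_topology p {0<..<\<tau>} X N) A"
proof (rule relatively_compact_bochner_if_seq[OF _ p])
  let ?I = "{0<..<\<tau>}"
  show I: "?I \<in> sets lebesgue" by simp
  have Ifin: "emeasure lebesgue ?I < \<infinity>" using \<tau> by simp
  have sm: "strongly_measurable ?I X N f" if f: "f \<in> A" for f
  proof -
    obtain \<mu> where "mono_on ?I \<mu>" "\<forall>s\<in>?I. \<forall>t\<in>?I. s \<le> t \<longrightarrow> N (f t - f s) \<le> \<mu> t - \<mu> s"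
      using BV[OF f] by blast
    then show ?thesis using V f by (intro BV_strongly_measurable[of \<tau> f \<mu>]) blast+
  qed
  have Lp: "f \<in> bochner_Lp p ?I X N" if "f \<in> A" for f
    unfolding bochner_Lp_def
    using sm[OF that] powr_integrable_if_bounded[OF sm[OF that] I Ifin _ p, of C] V that by auto
  then show "A \<subseteq> bochner_Lp p ?I X N" by blast
  fix f :: "nat \<Rightarrow> real \<Rightarrow> 'v" assume f: "\<And>k. f k \<in> A"
  obtain \<mu> where \<mu>: "\<And>k. mono_on ?I (\<mu> k)" "\<And>k t. t \<in> ?I \<Longrightarrow> \<mu> k t \<in> {0..M}"
    "\<And>k s t. s \<in> ?I \<Longrightarrow> t \<in> ?I \<Longrightarrow> s \<le> t \<Longrightarrow> N (f k t - f k s) \<le> \<mu> k t - \<mu> k s"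
    using BV[OF f] by metis
  have fV: "f k t \<in> V" if "t \<in> ?I" for k t using V(1) f that by blast
  show "\<exists>l\<in>bochner_Lp p ?I X N. \<exists>r. strict_mono r \<and> (\<lambda>k. LINT t:?I|lebesgue. N (f (r k) t - l t) powr p) \<longlonglongrightarrow> 0"
  proof (rule Helly_subsequence[OF \<tau> fV V(2) \<mu>(3) \<mu>(1) \<mu>(2) cpt])
    fix r l assume r: "strict_mono r" and AE: "AE t in lebesgue. t \<in> ?I \<longrightarrow> l t \<in> X \<and> (\<lambda>k. N (f (r k) t - l t)) \<longlonglongrightarrow> 0"
      and sl: "strongly_measurable ?I X N l"
    have lC: "AE t in lebesgue. t \<in> ?I \<longrightarrow> N (l t) \<le> C"
      using AE
    proof (eventually_elim, intro impI)
      fix t assume A: "t \<in> ?I \<longrightarrow> l t \<in> X \<and> (\<lambda>k. N (f (r k) t - l t)) \<longlonglongrightarrow> 0" and t: "t \<in> ?I"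
      have "N (l t) \<le> C + N (f (r k) t - l t)" for k
        using N_le[of "l t" "f (r k) t"] N_sym[of "l t" "f (r k) t"] A t fV[OF t, of "r k"] V(2,3) by force
      moreover have "(\<lambda>k. C + N (f (r k) t - l t)) \<longlonglongrightarrow> C + 0" using A t by (intro tendsto_add tendsto_const) auto
      ultimately show "N (l t) \<le> C" using LIMSEQ_le_const by fastforce
    qed
    have l: "l \<in> bochner_Lp p ?I X N"
      unfolding bochner_Lp_def using sl powr_integrable_if_bounded[OF sl I Ifin lC p] by simp
    have "(\<lambda>k. LINT t:?I|lebesgue. N (f (r k) t - l t) powr p) \<longlonglongrightarrow> (LINT t|(lebesgue :: real measure). 0)"
      unfolding set_lebesgue_integral_def
    proof (rule integral_dominated_convergence[where w = "\<lambda>t. indicator ?I t * (2 * C) powr p"])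
      show "integrable lebesgue (\<lambda>t. indicator ?I t * (2 * C) powr p)" using Ifin by simp
      show "(\<lambda>t. indicator ?I t *\<^sub>R N (f (r k) t - l t) powr p) \<in> borel_measurable lebesgue" for k
        using bochner_Lp_diff(1)[OF Lp[OF f] l I p] unfolding set_integrable_def by (rule borel_measurable_integrable)
      show "AE t in lebesgue. (\<lambda>k. indicator ?I t *\<^sub>R N (f (r k) t - l t) powr p) \<longlonglongrightarrow> 0"
        using AE
      proof eventually_elim
        case (elim t)
        show ?case
        proof (cases "t \<in> ?I")
          case True
          have "(\<lambda>k. N (f (r k) t - l t) powr p) \<longlonglongrightarrow> 0 powr p"
            using elim True p dist_nonneg fV[OF True] V(2)
            by (intro tendsto_powr2) (auto intro!: always_eventually)
          then show ?thesis using True by simp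
        qed simp
      qed
      show "AE t in lebesgue. norm (indicator ?I t *\<^sub>R N (f (r k) t - l t) powr p) \<le> indicator ?I t * (2 * C) powr p" for k
        using lC AE
      proof eventually_elim
        case (elim t)
        show ?case
        proof (cases "t \<in> ?I")
          case True
          have "N (f (r k) t - l t) \<le> N (f (r k) t) + N (l t)"
            using N_diff_le fV[OF True] V(2) elim True by blast
          also have "\<dots> \<le> 2 * C" using V(3)[OF fV[OF True, of "r k"]] elim True by simp
          finally show ?thesis using True p dist_nonneg[of "f (r k) t" "l t"] fV[OF True, of "r k"] V(2) elim
            by (auto intro!: powr_mono2)
        qed simp
      qed
    qed simp
    then show ?thesis using r l by auto
  qed
qed

end

section \<open>The space \<open>W\<^sup>-\<^sup>1\<^sup>,\<^sup>1\<close>\<close>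

lemma set_integrable_mult_test:
  fixes f \<phi> :: "'a::euclidean_space \<Rightarrow> real"
  assumes f: "set_integrable lborel U f" and \<phi>: "\<phi> \<in> test_functions V"
  shows "set_integrable lborel U (\<lambda>x. f x * \<phi> x)"
proof -
  obtain M where M: "0 < M" "\<And>z. \<bar>\<phi> z\<bar> \<le> M" using test_functions_bounded[OF \<phi>] by metis
  have [measurable]: "(\<lambda>x. indicator U x * f x) \<in> borel_measurable borel"
    using f borel_measurable_integrable unfolding set_integrable_def by fastforce
  have [measurable]: "\<phi> \<in> borel_measurable borel" using test_functions_measurable[OF \<phi>] .
  have "integrable lborel (\<lambda>x. (indicator U x * f x) * \<phi> x)"
  proof (rule Bochner_Integration.integrable_bound)
    show "integrable lborel (\<lambda>x. M * (indicator U x * f x))"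
      using f by (simp add: set_integrable_def)
    show "AE x in lborel. norm ((indicator U x * f x) * \<phi> x) \<le> norm (M * (indicator U x * f x))"
    proof (rule AE_I2)
      fix x
      have "\<bar>\<phi> x\<bar> * \<bar>indicator U x * f x\<bar> \<le> M * \<bar>indicator U x * f x\<bar>"
        by (rule mult_right_mono[OF M(2)]) simp
      then show "norm ((indicator U x * f x) * \<phi> x) \<le> norm (M * (indicator U x * f x))"
        using M(1) by (simp add: abs_mult mult.commute)
    qed
  qed simp
  then show ?thesis by (simp add: set_integrable_def mult.assoc)
qed

lemma L1_norm_nonneg: "0 \<le> L1_norm U f"
  unfolding L1_norm_def set_lebesgue_integral_def by (intro Bochner_Integration.integral_nonneg) simp

lemma L1_norm_uminus: "L1_norm U (\<lambda>x. - f x) = L1_norm U f"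
  by (simp add: L1_norm_def)

lemma L1_norm_add_le:
  assumes "set_integrable lborel U f" "set_integrable lborel U g"
  shows "L1_norm U (\<lambda>x. f x + g x) \<le> L1_norm U f + L1_norm U g"
proof -
  have "L1_norm U (\<lambda>x. f x + g x) \<le> (LINT x:U|lborel. \<bar>f x\<bar> + \<bar>g x\<bar>)"
    unfolding L1_norm_def using assms
    by (intro set_integral_mono set_integrable_abs set_integral_add(1)) auto
  also have "\<dots> = L1_norm U f + L1_norm U g"
    unfolding L1_norm_def using assms by (intro set_integral_add(2) set_integrable_abs)
  finally show ?thesis .
qed

text \<open>The distribution \<open>f0 + \<partial>f1/\<partial>x\<close>, with the minus sign of
  integration by parts. It vanishes off \<open>test_functions U\<close>, in accordance with the
  convention for \<open>distr\<close>.\<close>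

definition W11_functional :: "real set \<Rightarrow> (real \<Rightarrow> real) \<Rightarrow> (real \<Rightarrow> real) \<Rightarrow> distr" where
  "W11_functional U f0 f1 = (\<lambda>\<phi>. if \<phi> \<in> test_functions U
     then (LINT x:U|lborel. f0 x * \<phi> x) - (LINT x:U|lborel. f1 x * deriv \<phi> x) else 0)"

lemma W11_dual_rep_iff:
  "W11_dual_rep U F f0 f1 \<longleftrightarrow> set_integrable lborel U f0 \<and> set_integrable lborel U f1 \<and> F = W11_functional U f0 f1"
proof -
  have "distr_of U f0 \<phi> + distr_deriv U (distr_of U f1) \<phi> = W11_functional U f0 f1 \<phi>" for \<phi>
    by (simp add: distr_of_def distr_deriv_def W11_functional_def test_functions_deriv)
  then show ?thesis by (simp add: W11_dual_rep_def Lp_on_1_iff fun_eq_iff)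
qed

lemma W11_functional_add:
  assumes "set_integrable lborel U f0" "set_integrable lborel U f1" "set_integrable lborel U g0" "set_integrable lborel U g1"
  shows "W11_functional U (\<lambda>x. f0 x + g0 x) (\<lambda>x. f1 x + g1 x) = (\<lambda>\<phi>. W11_functional U f0 f1 \<phi> + W11_functional U g0 g1 \<phi>)"
proof
  fix \<phi>
  show "W11_functional U (\<lambda>x. f0 x + g0 x) (\<lambda>x. f1 x + g1 x) \<phi> = W11_functional U f0 f1 \<phi> + W11_functional U g0 g1 \<phi>"
  proof (cases "\<phi> \<in> test_functions U")
    case True
    note i = set_integrable_mult_test[OF _ True] set_integrable_mult_test[OF _ test_functions_deriv[OF True]]
    show ?thesis
      using i(1)[OF assms(1)] i(2)[OF assms(2)] i(1)[OF assms(3)] i(2)[OF assms(4)] True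
      by (simp add: W11_functional_def distrib_right)
  qed (simp add: W11_functional_def)
qed

lemma W11_functional_uminus:
  "W11_functional U (\<lambda>x. - f0 x) (\<lambda>x. - f1 x) = (\<lambda>\<phi>. - W11_functional U f0 f1 \<phi>)"
  by (auto simp: W11_functional_def fun_eq_iff set_lebesgue_integral_def)

lemma W11_functional_diff:
  assumes "set_integrable lborel U f0" "set_integrable lborel U f1" "set_integrable lborel U g0" "set_integrable lborel U g1"
  shows "W11_functional U f0 f1 - W11_functional U g0 g1 = W11_functional U (\<lambda>x. f0 x - g0 x) (\<lambda>x. f1 x - g1 x)"
proof
  fix \<phi>
  show "(W11_functional U f0 f1 - W11_functional U g0 g1) \<phi> = W11_functional U (\<lambda>x. f0 x - g0 x) (\<lambda>x. f1 x - g1 x) \<phi>"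
  proof (cases "\<phi> \<in> test_functions U")
    case True
    note i = set_integrable_mult_test[OF _ True] set_integrable_mult_test[OF _ test_functions_deriv[OF True]]
    show ?thesis
      using i(1)[OF assms(1)] i(2)[OF assms(2)] i(1)[OF assms(3)] i(2)[OF assms(4)] True
      by (simp add: W11_functional_def left_diff_distrib)
  qed (simp add: W11_functional_def)
qed

lemma Wm11_cases:
  assumes "F \<in> Wm11 U"
  obtains f0 f1 where "set_integrable lborel U f0" "set_integrable lborel U f1" "F = W11_functional U f0 f1"
  using assms unfolding Wm11_def W11_dual_rep_iff by blast

lemma Wm11_I: "set_integrable lborel U f0 \<Longrightarrow> set_integrable lborel U f1 \<Longrightarrow> W11_functional U f0 f1 \<in> Wm11 U"
  unfolding Wm11_def W11_dual_rep_iff by blast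

lemma Wm11_norm_le:
  assumes "set_integrable lborel U f0" "set_integrable lborel U f1"
  shows "Wm11_norm U (W11_functional U f0 f1) \<le> L1_norm U f0 + L1_norm U f1"
  unfolding Wm11_norm_def
proof (rule cInf_lower)
  show "bdd_below {L1_norm U g0 + L1_norm U g1 |g0 g1. W11_dual_rep U (W11_functional U f0 f1) g0 g1}"
    by (rule bdd_belowI[of _ 0]) (auto intro: add_nonneg_nonneg L1_norm_nonneg)
qed (use assms in \<open>auto simp: W11_dual_rep_iff\<close>)

lemma Wm11_norm_nonneg: "F \<in> Wm11 U \<Longrightarrow> 0 \<le> Wm11_norm U F"
  unfolding Wm11_norm_def Wm11_def
  by (rule cInf_greatest) (auto intro: add_nonneg_nonneg L1_norm_nonneg)

lemma Wm11_norm_approx: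
  assumes "F \<in> Wm11 U" "0 < e"
  obtains f0 f1 where "set_integrable lborel U f0" "set_integrable lborel U f1" "F = W11_functional U f0 f1"
    "L1_norm U f0 + L1_norm U f1 < Wm11_norm U F + e"
proof -
  have "{L1_norm U g0 + L1_norm U g1 |g0 g1. W11_dual_rep U F g0 g1} \<noteq> {}"
    using assms(1) unfolding Wm11_def by auto
  moreover have "Inf {L1_norm U g0 + L1_norm U g1 |g0 g1. W11_dual_rep U F g0 g1} < Wm11_norm U F + e"
    using assms(2) by (simp add: Wm11_norm_def)
  ultimately have "\<exists>y\<in>{L1_norm U g0 + L1_norm U g1 |g0 g1. W11_dual_rep U F g0 g1}. y < Wm11_norm U F + e"
    by (rule cInf_lessD)
  then obtain g0 g1 where g: "W11_dual_rep U F g0 g1" "L1_norm U g0 + L1_norm U g1 < Wm11_norm U F + e"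
    by blast
  show thesis by (rule that[of g0 g1]) (use g in \<open>simp_all add: W11_dual_rep_iff\<close>)
qed

lemma Wm11_norm_add:
  assumes "F \<in> Wm11 U" "G \<in> Wm11 U"
  shows "Wm11_norm U (\<lambda>\<phi>. F \<phi> + G \<phi>) \<le> Wm11_norm U F + Wm11_norm U G" "(\<lambda>\<phi>. F \<phi> + G \<phi>) \<in> Wm11 U"
proof -
  obtain f0 f1 where f: "set_integrable lborel U f0" "set_integrable lborel U f1" "F = W11_functional U f0 f1"
    by (rule Wm11_cases[OF assms(1)])
  obtain g0 g1 where g: "set_integrable lborel U g0" "set_integrable lborel U g1" "G = W11_functional U g0 g1"
    by (rule Wm11_cases[OF assms(2)])
  show "(\<lambda>\<phi>. F \<phi> + G \<phi>) \<in> Wm11 U"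
    unfolding f(3) g(3) W11_functional_add[OF f(1,2) g(1,2), symmetric]
    by (intro Wm11_I set_integral_add(1) f g)
  show "Wm11_norm U (\<lambda>\<phi>. F \<phi> + G \<phi>) \<le> Wm11_norm U F + Wm11_norm U G"
  proof (rule field_le_epsilon)
    fix e :: real assume "0 < e"
    obtain f0 f1 where f: "set_integrable lborel U f0" "set_integrable lborel U f1" "F = W11_functional U f0 f1"
      "L1_norm U f0 + L1_norm U f1 < Wm11_norm U F + e / 2"
      by (rule Wm11_norm_approx[OF assms(1), of "e / 2"]) (use \<open>0 < e\<close> in auto)
    obtain g0 g1 where g: "set_integrable lborel U g0" "set_integrable lborel U g1" "G = W11_functional U g0 g1"
      "L1_norm U g0 + L1_norm U g1 < Wm11_norm U G + e / 2"
      by (rule Wm11_norm_approx[OF assms(2), of "e / 2"]) (use \<open>0 < e\<close> in auto)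
    have "Wm11_norm U (\<lambda>\<phi>. F \<phi> + G \<phi>) \<le> L1_norm U (\<lambda>x. f0 x + g0 x) + L1_norm U (\<lambda>x. f1 x + g1 x)"
      unfolding f(3) g(3) W11_functional_add[OF f(1,2) g(1,2), symmetric]
      by (intro Wm11_norm_le set_integral_add(1) f g)
    also have "\<dots> \<le> (L1_norm U f0 + L1_norm U g0) + (L1_norm U f1 + L1_norm U g1)"
      by (intro add_mono L1_norm_add_le f g)
    finally show "Wm11_norm U (\<lambda>\<phi>. F \<phi> + G \<phi>) \<le> Wm11_norm U F + Wm11_norm U G + e"
      using f(4) g(4) by simp
  qed
qed

lemma Wm11_norm_uminus:
  assumes "F \<in> Wm11 U"
  shows "Wm11_norm U (\<lambda>\<phi>. - F \<phi>) = Wm11_norm U F" "(\<lambda>\<phi>. - F \<phi>) \<in> Wm11 U"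
proof -
  have mem: "(\<lambda>\<phi>. - F \<phi>) \<in> Wm11 U" if "F \<in> Wm11 U" for F
    using that by (auto elim!: Wm11_cases simp: W11_functional_uminus[symmetric] set_integrable_def intro!: Wm11_I)
  then show "(\<lambda>\<phi>. - F \<phi>) \<in> Wm11 U" using assms by blast
  have le: "Wm11_norm U (\<lambda>\<phi>. - F \<phi>) \<le> Wm11_norm U F" if F: "F \<in> Wm11 U" for F
  proof (rule field_le_epsilon)
    fix e :: real assume "0 < e"
    obtain f0 f1 where f: "set_integrable lborel U f0" "set_integrable lborel U f1" "F = W11_functional U f0 f1"
      "L1_norm U f0 + L1_norm U f1 < Wm11_norm U F + e"
      by (rule Wm11_norm_approx[OF F \<open>0 < e\<close>])
    have "set_integrable lborel U (\<lambda>x. - f0 x)" "set_integrable lborel U (\<lambda>x. - f1 x)"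
      using f(1,2) by (auto simp: set_integrable_def)
    from Wm11_norm_le[OF this] show "Wm11_norm U (\<lambda>\<phi>. - F \<phi>) \<le> Wm11_norm U F + e"
      using f(3,4) by (simp add: W11_functional_uminus L1_norm_uminus)
  qed
  show "Wm11_norm U (\<lambda>\<phi>. - F \<phi>) = Wm11_norm U F"
    using le[OF assms] le[OF mem[OF assms]] by simp
qed

interpretation Wm11: pseudonormed "Wm11 U" "Wm11_norm U" for U
proof
  fix F G H F' G' :: distr
  show "0 \<le> Wm11_norm U F" if "F \<in> Wm11 U" using that by (rule Wm11_norm_nonneg)
  have diff: "F - G = (\<lambda>\<phi>. F \<phi> + - G \<phi>)" for F G :: distr by (simp add: fun_eq_iff)
  show mem: "F - G \<in> Wm11 U" if "F \<in> Wm11 U" "G \<in> Wm11 U" for F G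
    unfolding diff using that by (intro Wm11_norm_add(2) Wm11_norm_uminus(2))
  show "Wm11_norm U (F - F) = 0" if "F \<in> Wm11 U"
  proof -
    have "F - F = W11_functional U (\<lambda>_. 0) (\<lambda>_. 0)" by (simp add: W11_functional_def fun_eq_iff)
    moreover have "set_integrable lborel U (\<lambda>_. 0 :: real)" by (simp add: set_integrable_def)
    ultimately have "Wm11_norm U (F - F) \<le> L1_norm U (\<lambda>_. 0) + L1_norm U (\<lambda>_. 0)"
      using Wm11_norm_le[of U "\<lambda>_. 0" "\<lambda>_. 0"] by simp
    then show ?thesis using Wm11_norm_nonneg[OF mem[OF that that]] by (simp add: L1_norm_def)
  qed
  show "Wm11_norm U (F - G) = Wm11_norm U (G - F)" if "F \<in> Wm11 U" "G \<in> Wm11 U"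
  proof -
    have "F - G = (\<lambda>\<phi>. - (G - F) \<phi>)" by (simp add: fun_eq_iff)
    then show ?thesis using Wm11_norm_uminus(1)[OF mem[OF that(2,1)]] by simp
  qed
  show "Wm11_norm U (F - H) \<le> Wm11_norm U (F - G) + Wm11_norm U (G - H)"
    if "F \<in> Wm11 U" "G \<in> Wm11 U" "H \<in> Wm11 U"
  proof -
    have "F - H = (\<lambda>\<phi>. (F - G) \<phi> + (G - H) \<phi>)" by (simp add: fun_eq_iff)
    then show ?thesis using Wm11_norm_add(1)[OF mem[OF that(1,2)] mem[OF that(2,3)]] by simp
  qed
  show "Wm11_norm U (F - G) \<le> Wm11_norm U F + Wm11_norm U G" if "F \<in> Wm11 U" "G \<in> Wm11 U"
    using Wm11_norm_add(1)[OF that(1) Wm11_norm_uminus(2)[OF that(2)]] Wm11_norm_uminus(1)[OF that(2)]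
    unfolding diff by simp
  show "Wm11_norm U F \<le> Wm11_norm U G + Wm11_norm U (F - G)" if "F \<in> Wm11 U" "G \<in> Wm11 U"
    using Wm11_norm_add(1)[OF that(2) mem[OF that]] by simp
  show "(F - G) - (F' - G') = (F - F') - (G - G')" by (simp add: fun_eq_iff)
qed

section \<open>Bounded densities and their primitives\<close>

lemma distr_of_eq_W11_functional: "distr_of U f = W11_functional U f (\<lambda>_. 0)"
  by (auto simp: distr_of_def W11_functional_def)

text \<open>A density is the derivative of its primitive, and a test function kills the boundary
  terms. With everything moved into the second slot, uniform closeness of primitives implies
  closeness in the dual norm; this is where spatial compactness comes from.\<close>

lemma distr_of_primitive:
  assumes f: "continuous_on {a..b} f"
  shows "distr_of {a<..<b} f = W11_functional {a<..<b} (\<lambda>_. 0) (\<lambda>x. integral {a..x} f)"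
proof
  fix \<phi>
  let ?F = "\<lambda>x. integral {a..x} f"
  show "distr_of {a<..<b} f \<phi> = W11_functional {a<..<b} (\<lambda>_. 0) ?F \<phi>"
  proof (cases "\<phi> \<in> test_functions {a<..<b} \<and> a \<le> b")
    case True
    then have \<phi>: "\<phi> \<in> test_functions {a<..<b}" and ab: "a \<le> b" by auto
    have vanish: "\<psi> a = 0" "\<psi> b = 0" if "\<psi> \<in> test_functions {a<..<b}" for \<psi> :: "real \<Rightarrow> real"
      using that by (auto elim!: test_functions_support simp: subset_eq)
    have DF: "(?F has_vector_derivative f x) (at x within {a..b})" if "x \<in> {a..b}" for x
      by (rule integral_has_vector_derivative[OF f that])
    have D\<phi>: "(\<phi> has_vector_derivative deriv \<phi> x) (at x within {a..b})" for x
      using smooth_real_DERIV[OF test_functions_smooth[OF \<phi>]]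
      by (auto simp: has_real_derivative_iff_has_vector_derivative[symmetric] intro: DERIV_subset)
    have cF: "continuous_on {a..b} ?F"
      using DF has_vector_derivative_continuous continuous_on_eq_continuous_within by blast
    have c\<phi>: "continuous_on {a..b} \<phi>" "continuous_on {a..b} (deriv \<phi>)"
      using test_functions_continuous \<phi> test_functions_deriv by blast+
    have i: "set_integrable lborel {a..b} (\<lambda>x. f x * \<phi> x)" "set_integrable lborel {a..b} (\<lambda>x. ?F x * deriv \<phi> x)"
      unfolding set_integrable_def by (rule borel_integrable_compact; auto intro!: continuous_intros f cF c\<phi>)+
    have "(LINT x|lborel. indicator {a..b} x *\<^sub>R (?F x * deriv \<phi> x + f x * \<phi> x)) = ?F b * \<phi> b - ?F a * \<phi> a"
    proof (rule integral_FTC_atLeastAtMost[OF ab])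
      show "((\<lambda>x. ?F x * \<phi> x) has_vector_derivative ?F x * deriv \<phi> x + f x * \<phi> x) (at x within {a..b})"
        if "a \<le> x" "x \<le> b" for x
        using has_vector_derivative_mult[OF DF D\<phi>] that by auto
      show "continuous_on {a..b} (\<lambda>x. ?F x * deriv \<phi> x + f x * \<phi> x)"
        by (intro continuous_intros f cF c\<phi>)
    qed
    also have "\<dots> = 0" using vanish[OF \<phi>] by simp
    finally have "(LINT x:{a..b}|lborel. ?F x * deriv \<phi> x) + (LINT x:{a..b}|lborel. f x * \<phi> x) = 0"
      using set_integral_add(2)[OF i(2,1)] by (simp add: set_lebesgue_integral_def)
    moreover have "(LINT x:{a..b}|lborel. g x * \<psi> x) = (LINT x:{a<..<b}|lborel. g x * \<psi> x)"
      if "\<psi> \<in> test_functions {a<..<b}" for g \<psi> :: "real \<Rightarrow> real"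
      unfolding set_lebesgue_integral_def using vanish[OF that]
      by (intro Bochner_Integration.integral_cong) (auto simp: indicator_def)
    ultimately show ?thesis
      using \<phi> test_functions_deriv[OF \<phi>] by (simp add: distr_of_def W11_functional_def)
  next
    \<comment> \<open>Either \<open>\<phi>\<close> is no test function, or \<open>b < a\<close> and
      all the integrals run over the empty set.\<close>
    case False
    then have "\<phi> \<in> test_functions {a<..<b} \<Longrightarrow> {a<..<b} = {}" by auto
    then show ?thesis by (auto simp: distr_of_def W11_functional_def set_lebesgue_integral_def)
  qed
qed

lemma set_integrable_continuous_Ioo:
  fixes f :: "real \<Rightarrow> real"
  assumes "continuous_on {a..b} f"
  shows "set_integrable lborel {a<..<b} f"
proof (rule set_integrable_subset)
  show "set_integrable lborel {a..b} f"
    unfolding set_integrable_def by (rule borel_integrable_compact) (auto intro: assms)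
qed auto

lemma L1_norm_le_sup:
  assumes f: "set_integrable lborel {a<..<b} f" and C: "\<And>x. x \<in> {a<..<b} \<Longrightarrow> \<bar>f x\<bar> \<le> C" and "a \<le> b"
  shows "L1_norm {a<..<b} f \<le> C * (b - a)"
proof -
  have "L1_norm {a<..<b} f \<le> (LINT x:{a<..<b}|lborel. C)"
    unfolding L1_norm_def by (intro set_integral_mono set_integrable_abs f set_integrable_const_Ioo C)
  also have "\<dots> = C * (b - a)"
    using \<open>a \<le> b\<close> by (simp add: set_lebesgue_integral_def)
  finally show ?thesis .
qed

definition bounded_densities :: "real \<Rightarrow> real \<Rightarrow> real \<Rightarrow> distr set" where
  "bounded_densities a b C = {distr_of {a<..<b} f | f. continuous_on {a..b} f \<and> (\<forall>x\<in>{a..b}. \<bar>f x\<bar> \<le> C)}"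

lemma bounded_densities_Wm11: "bounded_densities a b C \<subseteq> Wm11 {a<..<b}"
  unfolding bounded_densities_def distr_of_eq_W11_functional
  by (auto intro!: Wm11_I set_integrable_continuous_Ioo set_integrable_const_Ioo)

lemma bounded_densities_norm:
  assumes "F \<in> bounded_densities a b C" "a \<le> b"
  shows "Wm11_norm {a<..<b} F \<le> C * (b - a)"
proof -
  obtain f where f: "F = distr_of {a<..<b} f" "continuous_on {a..b} f" "\<And>x. x \<in> {a..b} \<Longrightarrow> \<bar>f x\<bar> \<le> C"
    using assms(1) unfolding bounded_densities_def by blast
  have "Wm11_norm {a<..<b} F \<le> L1_norm {a<..<b} f + L1_norm {a<..<b} (\<lambda>_. 0)"
    unfolding f(1) distr_of_eq_W11_functional
    by (intro Wm11_norm_le set_integrable_continuous_Ioo f set_integrable_const_Ioo)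
  also have "\<dots> \<le> C * (b - a)"
    using L1_norm_le_sup[OF set_integrable_continuous_Ioo[OF f(2)], of C] f(3) assms(2)
    by (auto simp: L1_norm_def)
  finally show ?thesis .
qed

lemma primitive_Lipschitz:
  fixes f :: "real \<Rightarrow> real"
  assumes f: "continuous_on {a..b} f" "\<And>x. x \<in> {a..b} \<Longrightarrow> \<bar>f x\<bar> \<le> C" and xy: "x \<in> {a..b}" "y \<in> {a..b}"
  shows "\<bar>integral {a..x} f - integral {a..y} f\<bar> \<le> C * \<bar>x - y\<bar>"
proof -
  have *: "\<bar>integral {a..x} f - integral {a..y} f\<bar> \<le> C * \<bar>x - y\<bar>" if "x \<in> {a..b}" "y \<in> {a..b}" "y \<le> x" for x y
  proof -
    have "integral {a..y} f + integral {y..x} f = integral {a..x} f"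
      using that by (intro Henstock_Kurzweil_Integration.integral_combine integrable_continuous_interval continuous_on_subset[OF f(1)]) auto
    moreover have "norm (integral {y..x} f) \<le> C * (x - y)"
      using that f(2) by (intro integral_bound continuous_on_subset[OF f(1)]) auto
    ultimately show ?thesis using that by simp
  qed
  show ?thesis using *[of x y] *[of y x] xy by (cases "y \<le> x") (auto simp: abs_minus_commute)
qed

text \<open>A bounded density has a Lipschitz primitive, so Arzela--Ascoli applies to the primitives.\<close>

lemma bounded_densities_seq_compact:
  assumes ab: "a < b" and g: "\<And>j :: nat. g j \<in> bounded_densities a b C"
  shows "\<exists>l\<in>Wm11 {a<..<b}. \<exists>r. strict_mono r \<and> (\<lambda>j. Wm11_norm {a<..<b} (g (r j) - l)) \<longlonglongrightarrow> 0"
proof -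
  let ?U = "{a<..<b}"
  obtain f where f: "\<And>j. g j = distr_of ?U (f j)" "\<And>j. continuous_on {a..b} (f j)"
    "\<And>j x. x \<in> {a..b} \<Longrightarrow> \<bar>f j x\<bar> \<le> C"
    using g unfolding bounded_densities_def by (simp only: mem_Collect_eq) metis
  have "0 \<le> C" using f(3)[of a 0] ab by auto
  define F where "F j x = integral {a..x} (f j)" for j x
  have Lip: "\<bar>F j x - F j y\<bar> \<le> C * \<bar>x - y\<bar>" if "x \<in> {a..b}" "y \<in> {a..b}" for j x y
    unfolding F_def by (rule primitive_Lipschitz[OF f(2,3) that])
  have Fa: "F j a = 0" for j by (simp add: F_def)
  have Fbd: "norm (F j x) \<le> C * (b - a)" if x: "x \<in> {a..b}" for j x
  proof -
    have "\<bar>F j x - F j a\<bar> \<le> C * \<bar>x - a\<bar>" using Lip[of x a j] x ab by simp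
    also have "\<dots> \<le> C * (b - a)" using x \<open>0 \<le> C\<close> by (intro mult_left_mono) auto
    finally show ?thesis by (simp add: Fa)
  qed
  have eq: "\<exists>d. 0 < d \<and> (\<forall>j y. y \<in> {a..b} \<and> norm (x - y) < d \<longrightarrow> norm (F j x - F j y) < e)"
    if x: "x \<in> {a..b}" and e: "0 < e" for x e
  \<comment> \<open>The denominator \<open>C + 1\<close> also covers the case
    \<open>C = 0\<close>.\<close>
  proof (intro exI[of _ "e / (C + 1)"] conjI allI impI)
    show "0 < e / (C + 1)" using e \<open>0 \<le> C\<close> by simp
    fix j y assume y: "y \<in> {a..b} \<and> norm (x - y) < e / (C + 1)"
    have "norm (F j x - F j y) \<le> C * \<bar>x - y\<bar>" using Lip x y by simp
    also have "\<dots> \<le> C * (e / (C + 1))" using y \<open>0 \<le> C\<close> by (intro mult_left_mono) auto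
    also have "\<dots> < e" using e \<open>0 \<le> C\<close> by (simp add: field_simps)
    finally show "norm (F j x - F j y) < e" .
  qed
  have cF: "continuous_on {a..b} (F j)" for j
    unfolding F_def by (intro indefinite_integral_continuous_1 integrable_continuous_interval f)
  show ?thesis
  proof (rule Arzela_Ascoli[OF compact_Icc[of a b] Fbd eq])
    fix H r assume H: "continuous_on {a..b} H" "strict_mono (r :: nat \<Rightarrow> nat)"
      "\<And>e. 0 < e \<Longrightarrow> \<exists>N. \<forall>n x. n \<ge> N \<and> x \<in> {a..b} \<longrightarrow> norm (F (r n) x - H x) < e"
    \<comment> \<open>The limit is the derivative of the uniform limit \<open>H\<close> of the
      primitives. It is kept in this form, since membership in \<open>Wm11\<close> is all that is
      asked of it.\<close>
    let ?l = "W11_functional ?U (\<lambda>_. 0) H"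
    have l: "?l \<in> Wm11 ?U" by (intro Wm11_I set_integrable_const_Ioo set_integrable_continuous_Ioo H)
    have "(\<lambda>j. Wm11_norm ?U (g (r j) - ?l)) \<longlonglongrightarrow> 0"
    proof (rule tendstoI)
      fix e :: real assume "0 < e"
      then obtain N where N: "\<And>n x. n \<ge> N \<Longrightarrow> x \<in> {a..b} \<Longrightarrow> \<bar>F (r n) x - H x\<bar> < e / (2 * (b - a))"
        using H(3)[of "e / (2 * (b - a))"] ab by auto
      have "Wm11_norm ?U (g (r n) - ?l) < e" if "n \<ge> N" for n
      proof -
        have "g (r n) - ?l = W11_functional ?U (\<lambda>x. 0 - 0) (\<lambda>x. F (r n) x - H x)"
          unfolding f(1) distr_of_primitive[OF f(2)] F_def[symmetric]
          by (intro W11_functional_diff set_integrable_const_Ioo set_integrable_continuous_Ioo H cF)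
        then have "Wm11_norm ?U (g (r n) - ?l) \<le> L1_norm ?U (\<lambda>x. 0 - 0) + L1_norm ?U (\<lambda>x. F (r n) x - H x)"
          by (simp only:) (intro Wm11_norm_le set_integral_diff(1) set_integrable_const_Ioo set_integrable_continuous_Ioo H cF)
        also have "\<dots> = L1_norm ?U (\<lambda>x. F (r n) x - H x)" by (simp add: L1_norm_def)
        also have "\<dots> \<le> e / (2 * (b - a)) * (b - a)"
          using N[OF that] ab
          by (intro L1_norm_le_sup set_integral_diff(1) set_integrable_continuous_Ioo H cF less_imp_le) auto
        also have "\<dots> = e / 2"
        proof -
          have half: "e / (2 * d) * d = e / 2" if "d \<noteq> 0" for d :: real using that by simp
          show ?thesis by (rule half) (use ab in simp)
        qed
        also have "\<dots> < e" using \<open>0 < e\<close> by simp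
        finally show ?thesis .
      qed
      moreover have "0 \<le> Wm11_norm ?U (g (r n) - ?l)" for n
        using Wm11.dist_nonneg[OF _ l] g bounded_densities_Wm11 by blast
      ultimately show "\<forall>\<^sub>F n in sequentially. dist (Wm11_norm ?U (g (r n) - ?l)) 0 < e"
        unfolding eventually_sequentially by (auto simp: dist_real_def)
    qed
    then show ?thesis using l H(2) by blast
  qed
qed

text \<open>Step functions approximating the two densities combine into step functions approximating
  the functional, because the dual norm is at most the sum of the two \<open>L\<^sup>1\<close>
  norms. The same inequality, integrated in time, bounds the Bochner norm; the pair
  \<open>f0\<close>, \<open>f1\<close> need not be optimal for this.\<close>

lemma W11_functional_slices:
  assumes f0: "set_integrable lborel ({0<..<\<tau>} \<times> {a<..<b}) f0"
    and f1: "set_integrable lborel ({0<..<\<tau>} \<times> {a<..<b}) f1" and \<tau>: "0 < \<tau>"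
  defines "G \<equiv> \<lambda>t. W11_functional {a<..<b} (\<lambda>x. f0 (t, x)) (\<lambda>x. f1 (t, x))"
  shows "G \<in> bochner_Lp 1 {0<..<\<tau>} (Wm11 {a<..<b}) (Wm11_norm {a<..<b})"
    and "bochner_norm 1 {0<..<\<tau>} (Wm11_norm {a<..<b}) G \<le>
      L1_norm ({0<..<\<tau>} \<times> {a<..<b}) f0 + L1_norm ({0<..<\<tau>} \<times> {a<..<b}) f1"
proof -
  let ?I = "{0<..<\<tau>}" and ?U = "{a<..<b}"
  obtain s0 where s0: "\<And>k. finite (s0 k ` ?I)" "\<And>k. s0 k ` ?I \<subseteq> Lp_on 1 ?U" "\<And>k v. {t \<in> ?I. s0 k t = v} \<in> sets lebesgue"
    "AE t in lebesgue. t \<in> ?I \<longrightarrow> (\<lambda>x. f0 (t, x)) \<in> Lp_on 1 ?U \<and> (\<lambda>k. L1_norm ?U (s0 k t - (\<lambda>x. f0 (t, x)))) \<longlonglongrightarrow> 0"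
    using strongly_measurable_L1_slices[OF f0 \<tau>] unfolding strongly_measurable_def by blast
  obtain s1 where s1: "\<And>k. finite (s1 k ` ?I)" "\<And>k. s1 k ` ?I \<subseteq> Lp_on 1 ?U" "\<And>k v. {t \<in> ?I. s1 k t = v} \<in> sets lebesgue"
    "AE t in lebesgue. t \<in> ?I \<longrightarrow> (\<lambda>x. f1 (t, x)) \<in> Lp_on 1 ?U \<and> (\<lambda>k. L1_norm ?U (s1 k t - (\<lambda>x. f1 (t, x)))) \<longlonglongrightarrow> 0"
    using strongly_measurable_L1_slices[OF f1 \<tau>] unfolding strongly_measurable_def by blast
  have sm: "strongly_measurable ?I (Wm11 ?U) (Wm11_norm ?U) G"
    unfolding strongly_measurable_def
  proof (intro exI conjI allI)
    let ?s = "\<lambda>k t. W11_functional ?U (s0 k t) (s1 k t)"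
    fix k
    show "finite (?s k ` ?I)"
      by (rule finite_subset[of _ "(\<lambda>(v, w). W11_functional ?U v w) ` ((s0 k ` ?I) \<times> (s1 k ` ?I))"]) (use s0(1) s1(1) in auto)
    show "?s k ` ?I \<subseteq> Wm11 ?U" using s0(2)[of k] s1(2)[of k] by (auto simp: Lp_on_1_iff intro!: Wm11_I)
    fix v
    have "{t \<in> ?I. ?s k t = v} = (\<Union>p\<in>s0 k ` ?I. \<Union>q\<in>{q \<in> s1 k ` ?I. W11_functional ?U p q = v}.
        {t \<in> ?I. s0 k t = p} \<inter> {t \<in> ?I. s1 k t = q})" by auto
    also have "\<dots> \<in> sets lebesgue"
      using s0(1,3) s1(1,3) by (intro sets.finite_UN sets.Int) auto
    finally show "{t \<in> ?I. ?s k t = v} \<in> sets lebesgue" .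
  next
    let ?s = "\<lambda>k t. W11_functional ?U (s0 k t) (s1 k t)"
    show "AE t in lebesgue. t \<in> ?I \<longrightarrow> G t \<in> Wm11 ?U \<and> (\<lambda>k. Wm11_norm ?U (?s k t - G t)) \<longlonglongrightarrow> 0"
      using s0(4) s1(4)
    proof (eventually_elim, intro impI conjI)
      fix t assume A: "t \<in> ?I \<longrightarrow> (\<lambda>x. f0 (t, x)) \<in> Lp_on 1 ?U \<and> (\<lambda>k. L1_norm ?U (s0 k t - (\<lambda>x. f0 (t, x)))) \<longlonglongrightarrow> 0"
        "t \<in> ?I \<longrightarrow> (\<lambda>x. f1 (t, x)) \<in> Lp_on 1 ?U \<and> (\<lambda>k. L1_norm ?U (s1 k t - (\<lambda>x. f1 (t, x)))) \<longlonglongrightarrow> 0" and t: "t \<in> ?I"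
      have i: "set_integrable lborel ?U (\<lambda>x. f0 (t, x))" "set_integrable lborel ?U (\<lambda>x. f1 (t, x))"
        using A t by (auto simp: Lp_on_1_iff)
      then show GW: "G t \<in> Wm11 ?U" unfolding G_def by (rule Wm11_I)
      have j: "set_integrable lborel ?U (s0 k t)" "set_integrable lborel ?U (s1 k t)" for k
        unfolding Lp_on_1_iff[symmetric] using s0(2)[of k] s1(2)[of k] t by auto
      have le: "Wm11_norm ?U (?s k t - G t) \<le> L1_norm ?U (s0 k t - (\<lambda>x. f0 (t, x))) + L1_norm ?U (s1 k t - (\<lambda>x. f1 (t, x)))" for k
      proof -
        have e: "?s k t - G t = W11_functional ?U (\<lambda>x. s0 k t x - f0 (t, x)) (\<lambda>x. s1 k t x - f1 (t, x))"
          unfolding G_def by (rule W11_functional_diff[OF j i])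
        show ?thesis unfolding e unfolding fun_diff_def
          by (intro Wm11_norm_le set_integral_diff(1) i j)
      qed
      have "0 \<le> Wm11_norm ?U (?s k t - G t)" for k
        by (intro Wm11.dist_nonneg Wm11_I j GW)
      note nonneg = this
      have l0: "(\<lambda>k. L1_norm ?U (s0 k t - (\<lambda>x. f0 (t, x)))) \<longlonglongrightarrow> 0"
        and l1: "(\<lambda>k. L1_norm ?U (s1 k t - (\<lambda>x. f1 (t, x)))) \<longlonglongrightarrow> 0"
        using A t by blast+
      show "(\<lambda>k. Wm11_norm ?U (?s k t - G t)) \<longlonglongrightarrow> 0"
        by (rule Lim_null_comparison[OF _ tendsto_add_zero[OF l0 l1]]) (simp only: real_norm_def abs_of_nonneg[OF nonneg] le always_eventually simp_thms)
    qed
  qed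
  define m where "m t = L1_norm ?U (\<lambda>x. f0 (t, x)) + L1_norm ?U (\<lambda>x. f1 (t, x))" for t
  note a0 = set_integrable_prodD[OF set_integrable_abs[OF f0]] and a1 = set_integrable_prodD[OF set_integrable_abs[OF f1]]
  have mi: "set_integrable lborel ?I m"
    unfolding m_def[abs_def] L1_norm_def by (intro set_integral_add(1) a0 a1)
  have ml: "(LINT t:?I|lborel. m t) = L1_norm (?I \<times> ?U) f0 + L1_norm (?I \<times> ?U) f1"
    unfolding m_def L1_norm_def a0(3) a1(3) by (intro set_integral_add(2) a0 a1)
  have mi': "set_integrable lebesgue ?I m" and ml': "(LINT t:?I|lebesgue. m t) = (LINT t:?I|lborel. m t)"
    using mi borel_measurable_integrable[OF mi[unfolded set_integrable_def]]
    unfolding set_integrable_def set_lebesgue_integral_def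
    by (auto simp: integrable_completion integral_completion)
  have GX: "AE t in lebesgue. t \<in> ?I \<longrightarrow> G t \<in> Wm11 ?U" by (rule Wm11.strongly_measurable_AE_in[OF sm])
  have Gm: "AE t in lebesgue. t \<in> ?I \<longrightarrow> Wm11_norm ?U (G t) \<le> m t"
    using s0(4) s1(4) by eventually_elim (auto simp: G_def m_def Lp_on_1_iff intro!: Wm11_norm_le)
  have powr1: "AE t in lebesgue. t \<in> ?I \<longrightarrow> Wm11_norm ?U (G t) powr 1 = Wm11_norm ?U (G t)"
    using GX by eventually_elim (use Wm11_norm_nonneg in auto)
  have meas: "(\<lambda>t. indicator ?I t * Wm11_norm ?U (G t)) \<in> borel_measurable lebesgue"
    by (rule Wm11.borel_measurable_norm[OF sm]) simp
  have p1: "(\<lambda>t. indicator ?I t *\<^sub>R (Wm11_norm ?U (G t) powr 1)) \<in> borel_measurable lebesgue"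
  proof -
    have "(\<lambda>t. indicator ?I t *\<^sub>R (Wm11_norm ?U (G t) powr 1)) = (\<lambda>t. (indicator ?I t * Wm11_norm ?U (G t)) powr 1)"
      by (auto simp: indicator_def fun_eq_iff)
    then show ?thesis using meas by simp
  qed
  have int: "set_integrable lebesgue ?I (\<lambda>t. Wm11_norm ?U (G t) powr 1)"
    unfolding set_integrable_def
  proof (rule Bochner_Integration.integrable_bound[OF mi'[unfolded set_integrable_def] p1])
    show "AE t in lebesgue. norm (indicator ?I t *\<^sub>R (Wm11_norm ?U (G t) powr 1)) \<le> norm (indicator ?I t *\<^sub>R m t)"
      using Gm powr1 GX by eventually_elim (use Wm11_norm_nonneg in \<open>auto simp: indicator_def\<close>)
  qed
  show "G \<in> bochner_Lp 1 ?I (Wm11 ?U) (Wm11_norm ?U)" using sm int by (simp add: bochner_Lp_def)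
  have "(LINT t:?I|lebesgue. Wm11_norm ?U (G t) powr 1) \<le> (LINT t:?I|lebesgue. m t)"
  proof (rule set_integral_mono_AE[OF int mi'])
    show "AE t\<in>?I in lebesgue. Wm11_norm ?U (G t) powr 1 \<le> m t"
      using Gm powr1 by eventually_elim auto
  qed
  moreover have "0 \<le> (LINT t:?I|lebesgue. Wm11_norm ?U (G t) powr 1)"
    unfolding set_lebesgue_integral_def by (intro Bochner_Integration.integral_nonneg) simp
  ultimately show "bochner_norm 1 ?I (Wm11_norm ?U) G \<le> L1_norm (?I \<times> ?U) f0 + L1_norm (?I \<times> ?U) f1"
    unfolding bochner_norm_def using ml ml' by simp
qed

section \<open>The entropy function \<open>B\<close>\<close>

definition weight :: "real \<Rightarrow> real \<Rightarrow> real" where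
  "weight n v = 1 / (v powr (n - 1) + v\<^sup>2)"

text \<open>On the positive half-line this is the derivative of \<open>B n\<close>, and
  \<open>- weight n\<close> is the second derivative.\<close>

definition tail :: "real \<Rightarrow> real \<Rightarrow> real" where
  "tail n r = (LINT v:{r<..}|lborel. weight n v)"

lemma B_eq_tail: "B n s = (LINT r:{0<..<s}|lborel. tail n r)"
  by (simp add: B_def tail_def weight_def)

lemma set_integrable_powr_tail:
  assumes "e < -1" "0 < (r::real)"
  shows "set_integrable lborel {r<..} (\<lambda>v. v powr e)"
    and "(LINT v:{r<..}|lborel. v powr e) = - (r powr (e + 1)) / (e + 1)"
proof -
  have h: "((\<lambda>v. v powr e) has_integral - (r powr (e + 1)) / (e + 1)) {r..}"
    by (rule has_integral_powr_to_inf[OF assms])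
  have "(\<lambda>v. v powr e) absolutely_integrable_on {r..}"
    using h by (intro nonnegative_absolutely_integrable_1) auto
  then have i: "set_integrable lborel {r..} (\<lambda>v. v powr e)"
    unfolding set_integrable_def by (subst (asm) integrable_completion) auto
  then show "set_integrable lborel {r<..} (\<lambda>v. v powr e)" by (rule set_integrable_subset) auto
  have "(LINT v:{r<..}|lborel. v powr e) = (LINT v:{r..}|lborel. v powr e)"
    unfolding set_lebesgue_integral_def
    by (rule integral_cong_AE) (use AE_lborel_singleton[of r] in \<open>auto elim!: eventually_mono simp: indicator_def\<close>)
  also have "\<dots> = - (r powr (e + 1)) / (e + 1)"
    using set_borel_integral_eq_integral(2)[OF i] h by (simp add: integral_unique)
  finally show "(LINT v:{r<..}|lborel. v powr e) = - (r powr (e + 1)) / (e + 1)" .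
qed

lemma set_integrable_powr_0:
  assumes "-1 < e" "0 \<le> (s::real)"
  shows "set_integrable lborel {0<..<s} (\<lambda>v. v powr e)"
    and "(LINT v:{0<..<s}|lborel. v powr e) = s powr (e + 1) / (e + 1)"
proof -
  have h: "((\<lambda>v. v powr e) has_integral (s powr (e + 1)) / (e + 1)) {0..s}"
    by (rule has_integral_powr_from_0[OF assms])
  have "(\<lambda>v. v powr e) absolutely_integrable_on {0..s}"
    using h by (intro nonnegative_absolutely_integrable_1) auto
  then have i: "set_integrable lborel {0..s} (\<lambda>v. v powr e)"
    unfolding set_integrable_def by (subst (asm) integrable_completion) auto
  then show "set_integrable lborel {0<..<s} (\<lambda>v. v powr e)" by (rule set_integrable_subset) auto
  have "(LINT v:{0<..<s}|lborel. v powr e) = (LINT v:{0..s}|lborel. v powr e)"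
    unfolding set_lebesgue_integral_def
    by (rule integral_cong_AE) (use AE_lborel_singleton[of 0] AE_lborel_singleton[of s] in \<open>auto elim!: eventually_elim2 simp: indicator_def\<close>)
  also have "\<dots> = s powr (e + 1) / (e + 1)"
    using set_borel_integral_eq_integral(2)[OF i] h by (simp add: integral_unique)
  finally show "(LINT v:{0<..<s}|lborel. v powr e) = s powr (e + 1) / (e + 1)" .
qed

locale mobility_exponent =
  fixes n :: real
  assumes n: "0 < n" "n < 3"
begin

lemma weight_nonneg: "0 \<le> weight n v"
  by (simp add: weight_def)

text \<open>The exponent \<open>1 + n/3\<close> lies in \<open>(1, 2)\<close> and between the two exponents of the weight.\<close>

lemma weight_le:
  assumes "0 < v"
  shows "weight n v \<le> v powr (- (1 + n / 3))" "weight n v \<le> v powr (-2)"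
proof -
  have "v powr (1 + n / 3) \<le> v powr (n - 1) + v\<^sup>2"
  proof (cases "v \<le> 1")
    case True
    have "v powr (1 + n / 3) \<le> v powr (n - 1)" using True assms n by (intro powr_mono') auto
    then show ?thesis by (simp add: add_increasing2)
  next
    case False
    have "v powr (1 + n / 3) \<le> v powr 2" using False n by (intro powr_mono) auto
    then show ?thesis using assms by (simp add: add_increasing)
  qed
  then have "1 / (v powr (n - 1) + v\<^sup>2) \<le> 1 / v powr (1 + n / 3)"
    using assms by (intro divide_left_mono) (auto intro!: mult_pos_pos add_pos_pos)
  then show "weight n v \<le> v powr (- (1 + n / 3))" by (simp only: weight_def powr_minus_divide)
  have "1 / (v powr (n - 1) + v\<^sup>2) \<le> 1 / v powr 2"
    using assms by (intro divide_left_mono) (auto intro!: mult_pos_pos add_pos_pos)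
  then show "weight n v \<le> v powr (-2)" by (simp only: weight_def powr_minus_divide)
qed

lemma weight_continuous: "continuous_on {0<..} (weight n)"
  unfolding weight_def
  by (intro continuous_intros) (auto intro!: less_imp_neq[symmetric] add_pos_pos)

lemma weight_measurable [measurable]: "weight n \<in> borel_measurable borel"
  unfolding weight_def by measurable

lemma weight_integrable: "0 < r \<Longrightarrow> set_integrable lborel {r<..} (weight n)"
proof (rule set_integrable_bound[OF set_integrable_powr_tail(1)[of "-2" r]])
  show "AE v in lborel. v \<in> {r<..} \<longrightarrow> norm (weight n v) \<le> norm (v powr (-2))" if "0 < r"
    using weight_le(2) weight_nonneg that by (intro AE_I2) auto
qed (auto simp: set_borel_measurable_def)

lemma tail_nonneg: "0 \<le> tail n r"
  unfolding tail_def set_lebesgue_integral_def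
  by (intro Bochner_Integration.integral_nonneg) (simp add: weight_nonneg)

text \<open>Both bounds on the weight are integrated. The first result is integrable at
  \<open>0\<close> because \<open>n / 3 < 1\<close>, which makes \<open>B\<close> finite and
  continuous there; the second gives the logarithmic growth at infinity. The constant
  \<open>3 / n\<close> is the reciprocal of the exponent \<open>n / 3\<close>.\<close>

lemma tail_le:
  assumes "0 < r"
  shows "tail n r \<le> 3 / n * r powr (- (n / 3))" "tail n r \<le> 1 / r"
proof -
  have "tail n r \<le> (LINT v:{r<..}|lborel. v powr (- (1 + n / 3)))"
    unfolding tail_def using assms n weight_le
    by (intro set_integral_mono weight_integrable set_integrable_powr_tail) auto
  also have "\<dots> = 3 / n * r powr (- (n / 3))"
    using n by (subst set_integrable_powr_tail(2)) (use assms in \<open>auto simp: field_simps\<close>)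
  finally show "tail n r \<le> 3 / n * r powr (- (n / 3))" .
  have "tail n r \<le> (LINT v:{r<..}|lborel. v powr (-2))"
    unfolding tail_def using assms weight_le
    by (intro set_integral_mono weight_integrable set_integrable_powr_tail) auto
  also have "\<dots> = 1 / r"
    using assms by (subst set_integrable_powr_tail(2)) (auto simp: powr_minus_divide)
  finally show "tail n r \<le> 1 / r" .
qed

lemma tail_eq:
  assumes "0 < c" "c \<le> r"
  shows "tail n r = tail n c - integral {c..r} (weight n)"
proof -
  have i: "set_integrable lborel {c..r} (weight n)"
    unfolding set_integrable_def
    by (rule borel_integrable_compact) (use assms in \<open>auto intro: continuous_on_subset[OF weight_continuous]\<close>)
  have "tail n c = (LINT v:({c<..r} \<union> {r<..})|lborel. weight n v)"
    unfolding tail_def using assms by (intro arg_cong[of _ _ "\<lambda>S. set_lebesgue_integral lborel S _"]) auto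
  also have "\<dots> = (LINT v:{c<..r}|lborel. weight n v) + tail n r"
    unfolding tail_def
  proof (rule set_integral_Un)
    show "set_integrable lborel {c<..r} (weight n)" by (rule set_integrable_subset[OF i]) auto
    show "set_integrable lborel {r<..} (weight n)" using assms by (intro weight_integrable) simp
  qed auto
  also have "(LINT v:{c<..r}|lborel. weight n v) = (LINT v:{c..r}|lborel. weight n v)"
    unfolding set_lebesgue_integral_def
    by (rule integral_cong_AE) (use AE_lborel_singleton[of c] in \<open>auto elim!: eventually_mono simp: indicator_def\<close>)
  also have "\<dots> = integral {c..r} (weight n)" by (rule set_borel_integral_eq_integral(2)[OF i])
  finally show ?thesis by simp
qed

lemma tail_continuous: "continuous_on {0<..} (tail n)"
proof (rule continuous_at_imp_continuous_on, rule ballI)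
  fix r :: real assume "r \<in> {0<..}"
  then have r: "0 < r" by simp
  have "continuous_on {r/2..r+1} (\<lambda>s. tail n (r/2) - integral {r/2..s} (weight n))"
    using r by (intro continuous_intros indefinite_integral_continuous_1 integrable_continuous_interval
        continuous_on_subset[OF weight_continuous]) auto
  then have "continuous_on {r/2..r+1} (tail n)"
    by (rule continuous_on_eq) (rule tail_eq[symmetric], use r in auto)
  then have "continuous_on {r/2<..<r+1} (tail n)" by (rule continuous_on_subset) auto
  then show "isCont (tail n) r" using r by (simp add: continuous_on_eq_continuous_at)
qed

lemma tail_measurable [measurable]: "(\<lambda>r. indicator {0<..} r * tail n r) \<in> borel_measurable borel"
  using borel_measurable_continuous_on_indicator[OF _ tail_continuous] by simp

lemma tail_integrable: "set_integrable lborel {0<..<s} (tail n)"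
proof (cases "0 \<le> s")
  case True
  have i: "set_integrable lborel {0<..<s} (\<lambda>r. 3 / n * r powr (- (n / 3)))"
    using n True by (intro set_integrable_mult_right set_integrable_powr_0(1)) auto
  show ?thesis
  proof (rule set_integrable_bound[OF i])
    have "(\<lambda>r. indicator {0<..<s} r *\<^sub>R tail n r) = (\<lambda>r. indicator {0<..<s} r * (indicator {0<..} r * tail n r))"
      by (auto simp: indicator_def fun_eq_iff)
    then show "set_borel_measurable lborel {0<..<s} (tail n)" by (simp add: set_borel_measurable_def)
    show "AE r in lborel. r \<in> {0<..<s} \<longrightarrow> norm (tail n r) \<le> norm (3 / n * r powr (- (n / 3)))"
      using tail_le(1) tail_nonneg n by (intro AE_I2) auto
  qed
qed (simp add: set_integrable_def)

lemma B_0: "B n 0 = 0"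
  by (simp add: B_eq_tail set_lebesgue_integral_def)

lemma B_mono: "s \<le> t \<Longrightarrow> B n s \<le> B n t"
  unfolding B_eq_tail set_lebesgue_integral_def
  using tail_integrable[unfolded set_integrable_def] tail_nonneg
  by (intro integral_mono) (auto simp: indicator_def)

lemma B_nonneg: "0 \<le> B n s"
  unfolding B_eq_tail set_lebesgue_integral_def
  by (intro Bochner_Integration.integral_nonneg) (simp add: tail_nonneg)

lemma B_le: "0 \<le> s \<Longrightarrow> B n s \<le> 3 / n * (s powr (1 - n / 3) / (1 - n / 3))"
proof -
  assume s: "0 \<le> s"
  have "B n s \<le> (LINT r:{0<..<s}|lborel. 3 / n * r powr (- (n / 3)))"
    unfolding B_eq_tail using n s tail_le(1)
    by (intro set_integral_mono tail_integrable set_integrable_mult_right set_integrable_powr_0(1)) auto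
  also have "\<dots> = 3 / n * (s powr (1 - n / 3) / (1 - n / 3))"
    using set_integrable_powr_0(2)[of "- (n / 3)" s] n s by simp
  finally show ?thesis .
qed

text \<open>Near \<open>s\<close> the integral is started at \<open>s / 2\<close>, since
  \<open>tail n\<close> may blow up at \<open>0\<close> while the fundamental theorem wants a
  continuous integrand on a closed interval.\<close>

lemma B_DERIV:
  assumes s: "0 < s"
  shows "(B n has_real_derivative tail n s) (at s)"
proof -
  let ?c = "s / 2"
  have cont: "continuous_on {?c..r} (tail n)" for r
    using tail_continuous s by (auto intro: continuous_on_subset)
  have eq: "B n r = B n ?c + integral {?c..r} (tail n)" if "?c \<le> r" for r
  proof -
    have i: "set_integrable lborel {?c..r} (tail n)"
      unfolding set_integrable_def by (rule borel_integrable_compact) (use cont in auto)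
    have i': "set_integrable lborel {?c..<r} (tail n)" by (rule set_integrable_subset[OF i]) auto
    have "(LINT t:{?c..<r}|lborel. tail n t) = (LINT t:{?c..r}|lborel. tail n t)"
      unfolding set_lebesgue_integral_def
    proof (rule integral_cong_AE)
      show "AE t in lborel. indicator {?c..<r} t *\<^sub>R tail n t = indicator {?c..r} t *\<^sub>R tail n t"
        using AE_lborel_singleton[of r] by eventually_elim (auto simp: indicator_def)
      show "(\<lambda>t. indicator {?c..<r} t *\<^sub>R tail n t) \<in> borel_measurable lborel"
        using i' unfolding set_integrable_def by (rule borel_measurable_integrable)
    qed (use i in \<open>auto simp: set_integrable_def dest: borel_measurable_integrable\<close>)
    moreover have "(LINT t:({0<..<?c} \<union> {?c..<r})|lborel. tail n t) = B n ?c + (LINT t:{?c..<r}|lborel. tail n t)"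
      unfolding B_eq_tail by (intro set_integral_Un tail_integrable set_integrable_subset[OF i]) auto
    moreover have "{0<..<?c} \<union> {?c..<r} = {0<..<r}" using s that by auto
    ultimately show ?thesis using set_borel_integral_eq_integral(2)[OF i] by (simp add: B_eq_tail)
  qed
  have "((\<lambda>r. integral {?c..r} (tail n)) has_real_derivative tail n s) (at s within {?c..s+1})"
    by (rule integral_has_real_derivative[OF cont]) (use s in auto)
  then have "((\<lambda>r. integral {?c..r} (tail n)) has_real_derivative tail n s) (at s)"
    using s by (subst (asm) at_within_Icc_at) auto
  from DERIV_add[OF DERIV_const[of "B n ?c"] this]
  have "((\<lambda>r. B n ?c + integral {?c..r} (tail n)) has_real_derivative tail n s) (at s)" by simp
  moreover have "\<forall>\<^sub>F r in nhds s. B n ?c + integral {?c..r} (tail n) = B n r"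
  proof (rule eventually_mono[OF eventually_nhds_in_open[of "{?c<..}" s]])
    show "B n ?c + integral {?c..r} (tail n) = B n r" if "r \<in> {?c<..}" for r
      by (rule eq[symmetric]) (use that in simp)
  qed (use s in auto)
  ultimately show ?thesis
    using DERIV_cong_ev[of s s "\<lambda>r. B n ?c + integral {?c..r} (tail n)" "B n"] by auto
qed

lemma B_continuous: "continuous_on {0..} (B n)"
  unfolding continuous_on_eq_continuous_within
proof
  fix s :: real assume "s \<in> {0..}"
  show "continuous (at s within {0..}) (B n)"
  proof (cases "s = 0")
    case True
    \<comment> \<open>At \<open>0\<close> the derivative may be infinite, so continuity comes from
      squeezing \<open>B n\<close> between \<open>0\<close> and a multiple of
      \<open>r powr (1 - n / 3)\<close>, whose exponent is positive.\<close>
    have "((\<lambda>r. 3 / n * (r powr (1 - n / 3) / (1 - n / 3))) \<longlongrightarrow> 3 / n * (0 powr (1 - n / 3) / (1 - n / 3))) (at 0 within {0..})"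
      using n by (intro tendsto_intros tendsto_powr2) (auto simp: eventually_at_filter)
    then have "(B n \<longlongrightarrow> 0) (at 0 within {0..})"
      by (intro Lim_null_comparison[of "B n"]) (use B_le B_nonneg n in \<open>auto simp: eventually_at_filter\<close>)
    then show ?thesis using True by (simp add: continuous_within B_0)
  next
    case False
    then show ?thesis
      using DERIV_isCont[OF B_DERIV, of s] \<open>s \<in> {0..}\<close> by (simp add: continuous_at_imp_continuous_at_within)
  qed
qed

text \<open>The difference \<open>B n - ln\<close> is nonincreasing to the right of
  \<open>1\<close>, because its derivative is \<open>tail n x - 1 / x\<close>.\<close>

lemma B_le_ln:
  assumes "1 \<le> s"
  shows "B n s \<le> B n 1 + ln s"
proof -
  have "B n s - ln s \<le> B n 1 - ln 1"
  proof (rule DERIV_nonpos_imp_nonincreasing[OF assms])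
    fix x :: real assume "1 \<le> x" "x \<le> s"
    then show "\<exists>y. ((\<lambda>s. B n s - ln s) has_real_derivative y) (at x) \<and> y \<le> 0"
      using tail_le(2)[of x] by (intro exI[of _ "tail n x - 1 / x"] conjI DERIV_diff B_DERIV DERIV_ln_divide) auto
  qed
  then show ?thesis by simp
qed

lemma abs_ln_ge: "\<epsilon> \<in> {0<..1/2 :: real} \<Longrightarrow> ln 2 \<le> \<bar>ln \<epsilon>\<bar>"
proof -
  assume e: "\<epsilon> \<in> {0<..1/2}"
  then have "ln \<epsilon> \<le> ln (1 / 2)" by (subst ln_le_cancel_iff) auto
  then have "ln \<epsilon> \<le> - ln 2" by (simp add: ln_div)
  then show ?thesis by simp
qed

text \<open>The logarithm splits as
  \<open>ln (s / \<epsilon>) = ln s + \<bar>ln \<epsilon>\<bar>\<close>. The second term divided by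
  \<open>\<bar>ln \<epsilon>\<bar>\<close> gives the summand \<open>1\<close>; the rest is divided
  by at least \<open>ln 2\<close>, because \<open>\<epsilon> \<le> 1/2\<close>.\<close>

lemma B_eps_bounds:
  assumes e: "\<epsilon> \<in> {0<..1/2}" and s: "0 \<le> s" "s \<le> S" and S: "1 \<le> S"
  shows "0 \<le> B_eps n \<epsilon> s" "B_eps n \<epsilon> s \<le> (B n 1 + ln S) / ln 2 + 1"
proof -
  let ?L = "\<bar>ln \<epsilon>\<bar>"
  have L: "ln 2 \<le> ?L" "0 < ?L" using abs_ln_ge[OF e] by (auto intro: less_le_trans[OF ln_gt_zero[of 2]])
  show "0 \<le> B_eps n \<epsilon> s" by (simp add: B_eps_def B_nonneg)
  have S0: "0 \<le> ln S" using S by simp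
  have "B n (s / \<epsilon>) \<le> B n 1 + ln S + ?L"
  proof (cases "s / \<epsilon> \<le> 1")
    case True
    then show ?thesis using B_mono[OF True] S0 L by linarith
  next
    case False
    then have "0 < s" using e by (cases "s = 0") (use s in auto)
    have "B n (s / \<epsilon>) \<le> B n 1 + ln (s / \<epsilon>)" using False by (intro B_le_ln) auto
    also have "ln (s / \<epsilon>) = ln s - ln \<epsilon>" using \<open>0 < s\<close> e by (simp add: ln_div)
    also have "ln s \<le> ln S" using \<open>0 < s\<close> s by simp
    finally show ?thesis by simp
  qed
  then have "B_eps n \<epsilon> s \<le> (B n 1 + ln S + ?L) / ?L"
    unfolding B_eps_def using L by (intro divide_right_mono) auto
  also have "\<dots> = (B n 1 + ln S) / ?L + 1" using L by (simp add: add_divide_distrib)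
  also have "(B n 1 + ln S) / ?L \<le> (B n 1 + ln S) / ln 2"
    using L B_nonneg S0 by (intro divide_left_mono mult_pos_pos) auto
  finally show "B_eps n \<epsilon> s \<le> (B n 1 + ln S) / ln 2 + 1" by simp
qed

lemma B_eps_continuous:
  assumes e: "\<epsilon> \<in> {0<..1/2}"
  shows "continuous_on {0..} (B_eps n \<epsilon>)"
  unfolding B_eps_def
  by (intro continuous_intros continuous_on_compose2[OF B_continuous]) (use e abs_ln_ge[OF e] ln_gt_zero[of "2::real"] in auto)

lemma B_eps_deriv:
  assumes e: "\<epsilon> \<in> {0<..1/2}" and s: "0 < s"
  shows "deriv (B_eps n \<epsilon>) s = tail n (s / \<epsilon>) / (\<epsilon> * \<bar>ln \<epsilon>\<bar>)"
proof -
  have "((\<lambda>s. s / \<epsilon>) has_real_derivative 1 / \<epsilon>) (at s)"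
    using e by (auto intro!: derivative_eq_intros)
  moreover have "(B n has_real_derivative tail n (s / \<epsilon>)) (at (s / \<epsilon>))" using e s by (intro B_DERIV) auto
  ultimately have "((\<lambda>s. B n (s / \<epsilon>)) has_real_derivative tail n (s / \<epsilon>) * (1 / \<epsilon>)) (at s)"
    by (rule DERIV_chain2[rotated])
  then have "((\<lambda>s. B n (s / \<epsilon>) / \<bar>ln \<epsilon>\<bar>) has_real_derivative tail n (s / \<epsilon>) * (1 / \<epsilon>) / \<bar>ln \<epsilon>\<bar>) (at s)"
    by (rule DERIV_cdivide)
  then show ?thesis unfolding B_eps_def[abs_def] by (simp add: DERIV_imp_deriv)
qed

section \<open>The flux as a function of \<open>u\<close> times the third derivative\<close>

definition R_factor :: "real \<Rightarrow> real \<Rightarrow> real" where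
  "R_factor \<epsilon> s = (if s > 0 then - \<bar>ln \<epsilon>\<bar> * deriv (B_eps n \<epsilon>) s * (\<epsilon> powr (3 - n) * s powr (n - 1) + s\<^sup>2) * s else 0)"

lemma R_eps_eq: "R_eps n \<epsilon> u uxxx z = R_factor \<epsilon> (u z) * uxxx z"
  by (simp add: R_eps_def on_pos_def R_factor_def)

lemma R_factor_measurable:
  assumes e: "\<epsilon> \<in> {0<..1/2}"
  shows "R_factor \<epsilon> \<in> borel_measurable borel"
proof -
  have "R_factor \<epsilon> = (\<lambda>s. if s > 0 then - \<bar>ln \<epsilon>\<bar> * ((indicator {0<..} (s / \<epsilon>) * tail n (s / \<epsilon>)) / (\<epsilon> * \<bar>ln \<epsilon>\<bar>)) * (\<epsilon> powr (3 - n) * s powr (n - 1) + s\<^sup>2) * s else 0)"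
    using e by (auto simp: R_factor_def B_eps_deriv fun_eq_iff)
  moreover have "(\<lambda>s. indicator {0<..} (s / \<epsilon>) * tail n (s / \<epsilon>)) \<in> borel_measurable borel"
    using measurable_compose[OF _ tail_measurable, of "\<lambda>s. s / \<epsilon>" borel] by simp
  ultimately show ?thesis by simp
qed

text \<open>With \<open>v = s / \<epsilon>\<close>, \<open>P = v powr (n - 1) + v\<^sup>2\<close>
  and \<open>t = tail n v\<close>, the logarithm cancels and the powers of \<open>\<epsilon>\<close>
  combine: the factor is \<open>- \<epsilon>\<^sup>2 * t * P * v\<close>, and the mobility is
  \<open>\<epsilon> ^ 3 * v * P\<close>. The square divided by the mobility is
  \<open>\<epsilon> * t\<^sup>2 * v * P\<close>, to which the two decay rates of \<open>t\<close>
  apply, one for each summand of \<open>P\<close>.\<close>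

lemma R_factor_bound:
  assumes e: "\<epsilon> \<in> {0<..1/2}" and s: "0 \<le> s"
  shows "(R_factor \<epsilon> s)\<^sup>2 \<le> (1 + 9 / n\<^sup>2) * (1 + s) * mobility n \<epsilon> s"
proof (cases "s = 0")
  case True
  then show ?thesis by (simp add: R_factor_def mobility_def)
next
  case False
  then have s: "0 < s" using s by simp
  define v where "v = s / \<epsilon>"
  define P where "P = v powr (n - 1) + v\<^sup>2"
  define t where "t = tail n v"
  have e0: "0 < \<epsilon>" "\<epsilon> \<le> 1" using e by auto
  have L: "0 < \<bar>ln \<epsilon>\<bar>" using abs_ln_ge[OF e] by (auto intro: less_le_trans[OF ln_gt_zero[of 2]])
  have v: "0 < v" and sv: "s = \<epsilon> * v" using s e0 by (auto simp: v_def)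
  have P: "0 \<le> P" by (simp add: P_def)
  have vP: "v * P = v powr n + v ^ 3"
    using v powr_mult_base[of v "n - 1"] by (simp add: P_def algebra_simps power3_eq_cube power2_eq_square)
  have "\<epsilon> powr (3 - n) * s powr (n - 1) = (\<epsilon> powr (3 - n) * \<epsilon> powr (n - 1)) * v powr (n - 1)"
    using e0 v by (simp add: sv powr_mult)
  also have "\<epsilon> powr (3 - n) * \<epsilon> powr (n - 1) = \<epsilon>\<^sup>2"
    using e0 by (simp add: powr_add[symmetric])
  finally have c: "\<epsilon> powr (3 - n) * s powr (n - 1) + s\<^sup>2 = \<epsilon>\<^sup>2 * P"
    by (simp add: P_def sv power_mult_distrib distrib_left)
  have mob: "mobility n \<epsilon> s = \<epsilon> ^ 3 * (v * P)"
  proof -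
    have "s powr n = s * s powr (n - 1)" using s powr_mult_base[of s "n - 1"] by simp
    then have "mobility n \<epsilon> s = s * (\<epsilon> powr (3 - n) * s powr (n - 1) + s\<^sup>2)"
      by (simp add: mobility_def algebra_simps power3_eq_cube power2_eq_square)
    then show ?thesis unfolding c by (simp add: sv power3_eq_cube power2_eq_square)
  qed
  have "deriv (B_eps n \<epsilon>) s = t / (\<epsilon> * \<bar>ln \<epsilon>\<bar>)" using B_eps_deriv[OF e s] by (simp add: t_def v_def)
  then have "R_factor \<epsilon> s = - \<bar>ln \<epsilon>\<bar> * (t / (\<epsilon> * \<bar>ln \<epsilon>\<bar>)) * (\<epsilon>\<^sup>2 * P) * s"
    using s by (simp add: R_factor_def c)
  also have "\<dots> = - (\<epsilon>\<^sup>2 * t * P * v)" using L e0 by (simp add: sv power2_eq_square)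
  finally have "(R_factor \<epsilon> s)\<^sup>2 = (\<epsilon> ^ 3 * (v * P)) * (\<epsilon> * (t\<^sup>2 * (v * P)))"
    by (simp add: power2_eq_square power3_eq_cube)
  also have "\<dots> \<le> (\<epsilon> ^ 3 * (v * P)) * ((1 + 9 / n\<^sup>2) * (1 + s))"
  proof (rule mult_left_mono)
    have t0: "0 \<le> t" unfolding t_def by (rule tail_nonneg)
    \<comment> \<open>The summand \<open>v powr n\<close> of \<open>v * P\<close> takes the first
      decay rate, which leaves \<open>v powr (n / 3) \<le> 1 + v\<close>; the constant
      \<open>9 / n\<^sup>2\<close> is the square of \<open>3 / n\<close>.\<close>
    have "t\<^sup>2 \<le> (3 / n * v powr (- (n / 3)))\<^sup>2"
      unfolding t_def using tail_le(1)[OF v] tail_nonneg by (intro power_mono) auto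
    also have "\<dots> = 9 / n\<^sup>2 * v powr (- (2 * n / 3))"
      using v by (simp add: power_mult_distrib power_divide powr_power)
    finally have "t\<^sup>2 * v powr n \<le> 9 / n\<^sup>2 * v powr (- (2 * n / 3)) * v powr n"
      by (intro mult_right_mono) auto
    also have "\<dots> = 9 / n\<^sup>2 * v powr (n / 3)"
      by (simp add: mult.assoc powr_add[symmetric])
    finally have "t\<^sup>2 * v powr n \<le> 9 / n\<^sup>2 * v powr (n / 3)" .
    moreover have "v powr (n / 3) \<le> 1 + v"
    proof (cases "v \<le> 1")
      case True
      have "v powr (n / 3) \<le> 1" using v True n by (intro powr_le1) auto
      then show ?thesis using v by simp
    next
      case False
      have "v powr (n / 3) \<le> v powr 1" using False n by (intro powr_mono) auto
      then show ?thesis using v by simp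
    qed
    then have "9 / n\<^sup>2 * v powr (n / 3) \<le> 9 / n\<^sup>2 * (1 + v)" by (rule mult_left_mono) simp
    ultimately have 1: "t\<^sup>2 * v powr n \<le> 9 / n\<^sup>2 * (1 + v)" by linarith
    \<comment> \<open>The summand \<open>v ^ 3\<close> takes the second rate. The first would leave
      the power \<open>3 - 2 * n / 3\<close>, which exceeds \<open>1\<close>.\<close>
    have "t\<^sup>2 \<le> (1 / v)\<^sup>2" unfolding t_def using tail_le(2)[OF v] tail_nonneg by (intro power_mono) auto
    then have "t\<^sup>2 * v ^ 3 \<le> (1 / v)\<^sup>2 * v ^ 3" using v by (intro mult_right_mono) auto
    also have "\<dots> = v" using v by (simp add: power2_eq_square power3_eq_cube)
    finally have "t\<^sup>2 * (v * P) \<le> 9 / n\<^sup>2 * (1 + v) + v" unfolding vP distrib_left[of "t\<^sup>2"] using 1 by linarith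
    also have "\<dots> \<le> (1 + 9 / n\<^sup>2) * (1 + v)" by (simp add: algebra_simps)
    finally have "\<epsilon> * (t\<^sup>2 * (v * P)) \<le> \<epsilon> * ((1 + 9 / n\<^sup>2) * (1 + v))" using e0 by (intro mult_left_mono) auto
    \<comment> \<open>The prefactor \<open>\<epsilon>\<close> undoes the scaling:
      \<open>\<epsilon> * v = s\<close> is bounded uniformly, although \<open>v\<close> is
      not.\<close>
    also have "\<dots> = (1 + 9 / n\<^sup>2) * (\<epsilon> + s)" by (simp add: sv algebra_simps)
    also have "\<dots> \<le> (1 + 9 / n\<^sup>2) * (1 + s)" using e0 by (intro mult_left_mono) auto
    finally show "\<epsilon> * (t\<^sup>2 * (v * P)) \<le> (1 + 9 / n\<^sup>2) * (1 + s)" .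
    show "0 \<le> \<epsilon> ^ 3 * (v * P)" using e0 v P by simp
  qed
  finally show ?thesis unfolding mob by (simp add: mult.commute)
qed

end

section \<open>Integration by parts on the positivity set at a fixed time\<close>

text \<open>\<open>g\<close> is merely absolutely continuous, with density \<open>h\<close>.
  Continuous approximations \<open>k j\<close> of \<open>h\<close> in \<open>L\<^sup>1\<close> have
  continuously differentiable primitives \<open>G j\<close> that are uniformly close to
  \<open>g\<close>; the classical fundamental theorem for \<open>p * H (G j)\<close> then passes to
  the limit.\<close>

lemma AC_chain_rule:
  fixes g h p p' H H' :: "real \<Rightarrow> real"
  assumes cd: "c \<le> d" and h: "set_integrable lborel {c..d} h"
    and g: "continuous_on {c..d} g" "\<And>x. x \<in> {c..d} \<Longrightarrow> g x = g c + (LINT y:{c..x}|lborel. h y)"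
    and p: "\<And>x. x \<in> {c..d} \<Longrightarrow> (p has_real_derivative p' x) (at x within {c..d})" "continuous_on {c..d} p'"
    and H: "\<And>s. (H has_real_derivative H' s) (at s)" "continuous_on UNIV H'"
  shows "p d * H (g d) - p c * H (g c) = (LINT x:{c..d}|lborel. p' x * H (g x) + p x * H' (g x) * h x)"
proof -
  let ?J = "{c..d}"
  have cp: "continuous_on ?J p" using p(1) DERIV_continuous_on by blast
  have cH: "continuous_on A H" for A using H(1) DERIV_continuous_on has_field_derivative_at_within by blast
  have cH': "continuous_on A H'" for A using H(2) continuous_on_subset by blast
  have "\<exists>k. continuous_on UNIV k \<and> (LINT x:?J|lborel. \<bar>h x - k x\<bar>) < 1 / real (Suc j)" for j
    by (rule L1_approx_bounded_continuous[OF h _ _, of "1 / real (Suc j)"]) (use cd in auto)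
  then obtain k where k: "\<And>j. continuous_on UNIV (k j)" "\<And>j. (LINT x:?J|lborel. \<bar>h x - k j x\<bar>) < 1 / real (Suc j)"
    by metis
  have ck: "continuous_on A (k j)" for j A using k(1) continuous_on_subset by blast
  have ik: "set_integrable lborel ?J (k j)" for j
    unfolding set_integrable_def by (rule borel_integrable_compact) (auto intro: ck)
  define G where "G j x = g c + integral {c..x} (k j)" for j x
  have DG: "(G j has_vector_derivative k j x) (at x within ?J)" if "x \<in> ?J" for j x
    unfolding G_def using integral_has_vector_derivative[OF ck that, of j] by (auto intro!: derivative_eq_intros)
  have cG: "continuous_on ?J (G j)" for j
    unfolding G_def by (intro continuous_intros indefinite_integral_continuous_1 integrable_continuous_interval ck)
  have Gg: "\<bar>G j x - g x\<bar> \<le> 1 / real (Suc j)" if x: "x \<in> ?J" for j x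
  proof -
    have sub: "set_integrable lborel {c..x} f" if "set_integrable lborel ?J f" for f :: "real \<Rightarrow> real"
      by (rule set_integrable_subset[OF that]) (use x in auto)
    have "integral {c..x} (k j) = (LINT y:{c..x}|lborel. k j y)"
      by (rule set_borel_integral_eq_integral(2)[symmetric, OF sub[OF ik]])
    then have "G j x - g x = (LINT y:{c..x}|lborel. k j y - h y)"
      using g(2)[OF x] set_integral_diff(2)[OF sub[OF ik[of j]] sub[OF h]] by (simp add: G_def)
    also have "\<bar>\<dots>\<bar> \<le> (LINT y:{c..x}|lborel. \<bar>k j y - h y\<bar>)"
      unfolding set_lebesgue_integral_def
      by (rule order_trans[OF integral_abs_bound]) (simp add: abs_mult)
    also have "\<dots> \<le> (LINT y:?J|lborel. \<bar>h y - k j y\<bar>)"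
      unfolding set_lebesgue_integral_def
    proof (rule integral_mono)
      show "integrable lborel (\<lambda>y. indicator {c..x} y *\<^sub>R \<bar>k j y - h y\<bar>)"
        using set_integrable_abs[OF set_integral_diff(1)[OF sub[OF ik[of j]] sub[OF h]]] by (simp add: set_integrable_def)
      show "integrable lborel (\<lambda>y. indicator ?J y *\<^sub>R \<bar>h y - k j y\<bar>)"
        using set_integrable_abs[OF set_integral_diff(1)[OF h ik[of j]]] by (simp add: set_integrable_def)
    qed (use x in \<open>auto simp: indicator_def abs_minus_commute\<close>)
    finally show ?thesis using k(2)[of j] by simp
  qed
  have Glim: "(\<lambda>j. G j x) \<longlonglongrightarrow> g x" if "x \<in> ?J" for x
    by (rule LIM_zero_cancel, rule Lim_null_comparison[of _ "\<lambda>j. 1 / real (Suc j)"])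
      (use Gg[OF that] LIMSEQ_Suc[OF lim_const_over_n[of 1]] in \<open>auto intro!: always_eventually\<close>)
  have "compact (g ` ?J)" using g(1) by (intro compact_continuous_image) auto
  then obtain M where M: "\<And>x. x \<in> ?J \<Longrightarrow> \<bar>g x\<bar> \<le> M"
    using compact_imp_bounded bounded_iff by (metis image_eqI real_norm_def)
  \<comment> \<open>All the primitives stay within distance \<open>1\<close> of \<open>g\<close>, so
    \<open>H\<close> and \<open>H'\<close> have to be bounded only on one compact interval
    independent of \<open>j\<close>.\<close>
  have GM: "G j x \<in> {- M - 1..M + 1}" if "x \<in> ?J" for j x
  proof -
    have "\<bar>G j x - g x\<bar> \<le> 1" by (rule order_trans[OF Gg[OF that]]) simp
    then show ?thesis using M[OF that] unfolding atLeastAtMost_iff by linarith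
  qed
  have bdd: "\<exists>C. \<forall>x\<in>S. \<bar>f x\<bar> \<le> C" if "compact S" "continuous_on S f" for S and f :: "real \<Rightarrow> real"
    using compact_imp_bounded[OF compact_continuous_image[OF that(2,1)]] unfolding bounded_iff by auto
  obtain C1 where C1: "\<And>s. s \<in> {- M - 1..M + 1} \<Longrightarrow> \<bar>H s\<bar> \<le> C1" using bdd[OF compact_Icc cH] by blast
  obtain C2 where C2: "\<And>s. s \<in> {- M - 1..M + 1} \<Longrightarrow> \<bar>H' s\<bar> \<le> C2" using bdd[OF compact_Icc cH'] by blast
  obtain C3 where C3: "\<And>x. x \<in> ?J \<Longrightarrow> \<bar>p x\<bar> \<le> C3" using bdd[OF compact_Icc cp] by blast
  obtain C4 where C4: "\<And>x. x \<in> ?J \<Longrightarrow> \<bar>p' x\<bar> \<le> C4" using bdd[OF compact_Icc p(2)] by blast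
  have C0: "0 \<le> C1" "0 \<le> C2" "0 \<le> C3" "0 \<le> C4"
    using C1[OF GM[of c 0]] C2[OF GM[of c 0]] C3[of c] C4[of c] cd by (auto intro: order_trans[OF abs_ge_zero])
  have hm: "(\<lambda>x. indicator ?J x * h x) \<in> borel_measurable borel"
    using h borel_measurable_integrable unfolding set_integrable_def by fastforce
  have cmeas: "(\<lambda>x. indicator ?J x * f x) \<in> borel_measurable borel" if "continuous_on ?J f" for f :: "real \<Rightarrow> real"
    using borel_measurable_continuous_on_indicator[OF _ that] by simp
  have cHG: "continuous_on ?J (\<lambda>x. H (f x))" "continuous_on ?J (\<lambda>x. H' (f x))" if "continuous_on ?J f" for f
    by (auto intro!: continuous_on_compose2[OF cH[of UNIV]] continuous_on_compose2[OF H(2)] that)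
  \<comment> \<open>The density \<open>h\<close> is held fixed and only the argument of
    \<open>H\<close> and \<open>H'\<close> varies. Replacing \<open>k j\<close> by \<open>h\<close>
    in the classical formula costs at most \<open>C3 * C2\<close> times the \<open>L\<^sup>1\<close>
    error.\<close>
  define q where "q f x = p' x * H (f x) + p x * H' (f x) * h x" for f x
  have qm: "(\<lambda>x. indicator ?J x * q f x) \<in> borel_measurable borel" if f: "continuous_on ?J f" for f
  proof -
    have "(\<lambda>x. indicator ?J x * q f x) = (\<lambda>x. indicator ?J x * (p' x * H (f x)) + (indicator ?J x * (p x * H' (f x))) * (indicator ?J x * h x))"
      by (auto simp: q_def indicator_def fun_eq_iff)
    then show ?thesis
      using cmeas[OF continuous_on_mult[OF p(2) cHG(1)[OF f]]] cmeas[OF continuous_on_mult[OF cp cHG(2)[OF f]]] hm by simp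
  qed
  have q_bound: "\<bar>q f x\<bar> \<le> C4 * C1 + C3 * C2 * \<bar>h x\<bar>" if "x \<in> ?J" "f x \<in> {- M - 1..M + 1}" for f x
  proof -
    have "\<bar>p' x * H (f x)\<bar> \<le> C4 * C1" unfolding abs_mult by (intro mult_mono C4 C1 that C0) auto
    moreover have "\<bar>p x * H' (f x) * h x\<bar> \<le> C3 * C2 * \<bar>h x\<bar>"
      unfolding abs_mult by (intro mult_mono C3 C2 that C0 mult_nonneg_nonneg) auto
    ultimately show ?thesis unfolding q_def by linarith
  qed
  have dom: "integrable lborel (\<lambda>x. indicator ?J x * (C4 * C1 + C3 * C2 * \<bar>h x\<bar>))"
  proof -
    have c: "set_integrable lborel ?J (\<lambda>_. C4 * C1)"
      unfolding set_integrable_def by (rule borel_integrable_compact) auto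
    have "set_integrable lborel ?J (\<lambda>x. C4 * C1 + C3 * C2 * \<bar>h x\<bar>)"
      by (rule set_integral_add(1)[OF c set_integrable_mult_right[OF set_integrable_abs[OF h]]])
    then show ?thesis by (simp add: set_integrable_def)
  qed
  have gM: "g x \<in> {- M - 1..M + 1}" if "x \<in> ?J" for x using M[OF that] by (auto simp: abs_le_iff)
  have qi: "set_integrable lborel ?J (q f)" if "continuous_on ?J f" "\<And>x. x \<in> ?J \<Longrightarrow> f x \<in> {- M - 1..M + 1}" for f
    unfolding set_integrable_def
    by (rule Bochner_Integration.integrable_bound[OF dom])
      (use qm[OF that(1)] q_bound that(2) C0 in \<open>auto intro!: AE_I2 simp: indicator_def\<close>)
  have "(\<lambda>j. LINT x|lborel. indicator ?J x * q (G j) x) \<longlonglongrightarrow> (LINT x|lborel. indicator ?J x * q g x)"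
  proof (rule integral_dominated_convergence[OF _ _ dom])
    show "AE x in lborel. (\<lambda>j. indicator ?J x * q (G j) x) \<longlonglongrightarrow> indicator ?J x * q g x"
    proof (rule AE_I2)
      fix x
      have "(\<lambda>j. q (G j) x) \<longlonglongrightarrow> q g x" if "x \<in> ?J"
        unfolding q_def
        by (intro tendsto_intros continuous_on_tendsto_compose[OF cH[of UNIV] Glim[OF that]]
            continuous_on_tendsto_compose[OF H(2) Glim[OF that]]) auto
      then show "(\<lambda>j. indicator ?J x * q (G j) x) \<longlonglongrightarrow> indicator ?J x * q g x"
        by (cases "x \<in> ?J") auto
    qed
    show "AE x in lborel. norm (indicator ?J x * q (G j) x) \<le> indicator ?J x * (C4 * C1 + C3 * C2 * \<bar>h x\<bar>)" for j
      using q_bound GM by (intro AE_I2) (auto simp: indicator_def)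
  qed (use qm g(1) cG in auto)
  then have lim1: "(\<lambda>j. LINT x:?J|lborel. q (G j) x) \<longlonglongrightarrow> (LINT x:?J|lborel. q g x)"
    by (simp add: set_lebesgue_integral_def)
  have FTC: "\<bar>p d * H (G j d) - p c * H (G j c) - (LINT x:?J|lborel. q (G j) x)\<bar> \<le> C3 * C2 * (1 / real (Suc j))" for j
  proof -
    let ?r = "\<lambda>x. p' x * H (G j x) + p x * H' (G j x) * k j x"
    have cr: "continuous_on ?J ?r" by (intro continuous_intros p(2) cHG cG cp ck)
    have ir: "set_integrable lborel ?J ?r"
      unfolding set_integrable_def by (rule borel_integrable_compact[OF compact_Icc cr])
    have "(LINT x|lborel. indicator ?J x *\<^sub>R ?r x) = p d * H (G j d) - p c * H (G j c)"
    proof (rule integral_FTC_atLeastAtMost[OF cd _ cr])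
      fix x assume "c \<le> x" "x \<le> d"
      then have x: "x \<in> ?J" by auto
      have "(G j has_real_derivative k j x) (at x within ?J)"
        using DG[OF x] by (simp add: has_real_derivative_iff_has_vector_derivative)
      from DERIV_mult[OF p(1)[OF x] DERIV_chain2[OF H(1) this]]
      show "((\<lambda>x. p x * H (G j x)) has_vector_derivative ?r x) (at x within ?J)"
        by (simp add: has_real_derivative_iff_has_vector_derivative algebra_simps)
    qed
    then have eq: "p d * H (G j d) - p c * H (G j c) - (LINT x:?J|lborel. q (G j) x) = (LINT x:?J|lborel. ?r x - q (G j) x)"
      using set_integral_diff(2)[OF ir qi[OF cG GM]] by (simp add: set_lebesgue_integral_def)
    have "\<bar>LINT x:?J|lborel. ?r x - q (G j) x\<bar> \<le> (LINT x:?J|lborel. \<bar>?r x - q (G j) x\<bar>)"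
      unfolding set_lebesgue_integral_def by (rule order_trans[OF integral_abs_bound]) (simp add: abs_mult)
    also have "\<dots> \<le> (LINT x:?J|lborel. C3 * C2 * \<bar>h x - k j x\<bar>)"
    proof (rule set_integral_mono)
      show "set_integrable lborel ?J (\<lambda>x. \<bar>?r x - q (G j) x\<bar>)"
        by (intro set_integrable_abs set_integral_diff(1) ir qi[OF cG GM])
      show "set_integrable lborel ?J (\<lambda>x. C3 * C2 * \<bar>h x - k j x\<bar>)"
        by (intro set_integrable_mult_right set_integrable_abs set_integral_diff(1) h ik)
      show "\<bar>?r x - q (G j) x\<bar> \<le> C3 * C2 * \<bar>h x - k j x\<bar>" if x: "x \<in> ?J" for x
      proof -
        have "?r x - q (G j) x = (p x * H' (G j x)) * (k j x - h x)" by (simp add: q_def algebra_simps)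
        then have "\<bar>?r x - q (G j) x\<bar> = \<bar>p x\<bar> * \<bar>H' (G j x)\<bar> * \<bar>h x - k j x\<bar>"
          by (simp only: abs_mult abs_minus_commute[of "k j x" "h x"])
        also have "\<dots> \<le> C3 * C2 * \<bar>h x - k j x\<bar>"
          by (rule mult_right_mono[OF mult_mono[OF C3[OF x] C2[OF GM[OF x]] C0(3) abs_ge_zero] abs_ge_zero])
        finally show ?thesis .
      qed
    qed
    also have "\<dots> = C3 * C2 * (LINT x:?J|lborel. \<bar>h x - k j x\<bar>)" by simp
    also have "\<dots> \<le> C3 * C2 * (1 / real (Suc j))"
      using k(2)[of j] C0 by (intro mult_left_mono) auto
    finally show ?thesis unfolding eq .
  qed
  have "(\<lambda>j. p d * H (G j d) - p c * H (G j c) - (LINT x:?J|lborel. q (G j) x)) \<longlonglongrightarrow> 0"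
  proof (rule Lim_null_comparison)
    show "\<forall>\<^sub>F j in sequentially. norm (p d * H (G j d) - p c * H (G j c) - (LINT x:?J|lborel. q (G j) x)) \<le> C3 * C2 * (1 / real (Suc j))"
      using FTC by (intro always_eventually allI) simp
    show "(\<lambda>j. C3 * C2 * (1 / real (Suc j))) \<longlonglongrightarrow> 0"
      using tendsto_mult[OF tendsto_const[of "C3 * C2"] LIMSEQ_Suc[OF lim_const_over_n[of 1]]] by simp
  qed
  moreover have "(\<lambda>j. p d * H (G j d) - p c * H (G j c) - (LINT x:?J|lborel. q (G j) x)) \<longlonglongrightarrow>
      p d * H (g d) - p c * H (g c) - (LINT x:?J|lborel. q g x)"
    using cd by (intro tendsto_intros lim1 continuous_on_tendsto_compose[OF cH[of UNIV] Glim]) auto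
  ultimately have "p d * H (g d) - p c * H (g c) - (LINT x:?J|lborel. q g x) = 0"
    using LIMSEQ_unique by blast
  then show ?thesis by (simp add: q_def)
qed

section \<open>Integration over an open set through its components\<close>

lemma open_interval_component:
  fixes U :: "real set"
  assumes U: "open U" "U \<subseteq> {a<..<b}" and C: "C \<in> components U"
  obtains c d where "C = {c<..<d}" "c < d" "c \<in> {a..b} - U" "d \<in> {a..b} - U"
proof -
  have C': "open C" "connected C" "C \<noteq> {}" "C \<subseteq> U"
    using open_components[OF U(1) C] in_components_connected[OF C] in_components_nonempty[OF C] in_components_subset[OF C]
    by auto
  have bdd: "bdd_below C" "bdd_above C" using C'(4) U(2) by (auto intro!: bdd_belowI[of _ a] bdd_aboveI[of _ b] less_imp_le)
  define c d where "c = Inf C" and "d = Sup C"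
  have inC: "c \<notin> C" "d \<notin> C"
  proof -
    show "c \<notin> C"
    proof
      assume "c \<in> C"
      then obtain e where "e > 0" "ball c e \<subseteq> C" using C'(1) open_contains_ball by blast
      then have "c - e / 2 \<in> C" by (auto simp: subset_eq dist_real_def)
      then show False using cInf_lower[OF _ bdd(1), of "c - e / 2"] \<open>e > 0\<close> by (simp add: c_def)
    qed
    show "d \<notin> C"
    proof
      assume "d \<in> C"
      then obtain e where "e > 0" "ball d e \<subseteq> C" using C'(1) open_contains_ball by blast
      then have "d + e / 2 \<in> C" by (auto simp: subset_eq dist_real_def)
      then show False using cSup_upper[OF _ bdd(2), of "d + e / 2"] \<open>e > 0\<close> by (simp add: d_def)
    qed
  qed
  have "C = {c<..<d}"
  proof
    show "C \<subseteq> {c<..<d}"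
    proof
      fix x assume x: "x \<in> C"
      have "c \<le> x" "x \<le> d" using cInf_lower[OF x bdd(1)] cSup_upper[OF x bdd(2)] by (auto simp: c_def d_def)
      moreover have "x \<noteq> c" "x \<noteq> d" using x inC by auto
      ultimately show "x \<in> {c<..<d}" by auto
    qed
    show "{c<..<d} \<subseteq> C"
    proof
      fix x assume "x \<in> {c<..<d}"
      then obtain y z where yz: "y \<in> C" "y < x" "z \<in> C" "x < z"
        using cInf_less_iff[OF C'(3) bdd(1)] less_cSup_iff[OF C'(3) bdd(2)] by (auto simp: c_def d_def)
      then show "x \<in> C" using connected_contains_Icc[OF C'(2) yz(1,3)] by auto
    qed
  qed
  moreover from this have "c < d" using C'(3) by auto
  moreover have "frontier C \<subseteq> frontier U" by (rule frontier_of_components_subset[OF C])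
  moreover have "frontier C = {c, d}" using calculation by (auto simp: frontier_def)
  moreover have "frontier U \<subseteq> {a..b} - U"
  proof -
    have "closure U \<subseteq> {a..b}" using U(2) by (intro closure_minimal) auto
    then show ?thesis using interior_open[OF U(1)] by (auto simp: frontier_def)
  qed
  ultimately show thesis by (intro that[of c d]) auto
qed

text \<open>On a component with ends \<open>c\<close> and \<open>d\<close> the integral of
  \<open>q\<close> is \<open>W d - W c = 0\<close>, as both ends lie outside \<open>U\<close>.
  \<open>FTC\<close> is available only on compact intervals inside \<open>U\<close>, so the ends are
  reached through shrinking margins and continuity of \<open>W\<close>. Integrability of
  \<open>q\<close> on all of \<open>U\<close> permits summation over possibly infinitely many
  components.\<close>

lemma integral_positivity_set_eq_0:
  fixes U :: "real set" and q W :: "real \<Rightarrow> real"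
  assumes U: "open U" "U \<subseteq> {a<..<b}" and q: "set_integrable lborel U q"
    and W: "continuous_on {a..b} W" "\<And>x. x \<in> {a..b} - U \<Longrightarrow> W x = 0"
    and FTC: "\<And>c d. c \<le> d \<Longrightarrow> {c..d} \<subseteq> U \<Longrightarrow> W d - W c = (LINT x:{c..d}|lborel. q x)"
  shows "(LINT x:U|lborel. q x) = 0"
proof -
  have comp: "(LINT x:C|lborel. q x) = 0" if C: "C \<in> components U" for C
  proof (rule open_interval_component[OF U C])
    fix c d assume cd: "C = {c<..<d}" "c < d" "c \<in> {a..b} - U" "d \<in> {a..b} - U"
    have CU: "{c<..<d} \<subseteq> U" using in_components_subset[OF C] cd(1) by simp
    define e where "e k = (d - c) / 2 / real (Suc k)" for k
    have e: "0 < e k" "e k \<le> (d - c) / 2" for k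
    proof -
      show "0 < e k" using cd(2) by (simp add: e_def)
      have "(d - c) / 2 / real (Suc k) \<le> (d - c) / 2 / 1"
        using cd(2) by (intro divide_left_mono) auto
      then show "e k \<le> (d - c) / 2" by (simp add: e_def)
    qed
    have "(\<lambda>k. (d - c) / 2 / real (Suc k)) \<longlonglongrightarrow> 0" by (rule LIMSEQ_Suc[OF lim_const_over_n])
    then have e0: "e \<longlonglongrightarrow> 0" unfolding e_def[abs_def] .
    define A where "A k = {c + e k..d - e k}" for k
    have AU: "A k \<subseteq> {c<..<d}" for k
    proof
      fix x assume "x \<in> A k"
      then show "x \<in> {c<..<d}" using e(1)[of k] unfolding A_def by (simp only: atLeastAtMost_iff greaterThanLessThan_iff) linarith
    qed
    have mono: "A i \<subseteq> A j" if "i \<le> j" for i j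
    proof -
      have "e j \<le> e i" using that cd(2) unfolding e_def by (intro divide_left_mono) auto
      then show ?thesis by (auto simp: A_def)
    qed
    have UA: "(\<Union>k. A k) = {c<..<d}"
    proof
      show "(\<Union>k. A k) \<subseteq> {c<..<d}" using AU by blast
      show "{c<..<d} \<subseteq> (\<Union>k. A k)"
      proof
        fix x assume x: "x \<in> {c<..<d}"
        have "\<forall>\<^sub>F k in sequentially. e k < min (x - c) (d - x)"
          using x by (intro order_tendstoD(2)[OF e0]) auto
        then obtain k where "e k < min (x - c) (d - x)" using eventually_happens by fastforce
        then show "x \<in> (\<Union>k. A k)" by (auto simp: A_def intro!: exI[of _ k])
      qed
    qed
    have "set_integrable lborel (\<Union>k. A k) q"
      unfolding UA by (rule set_integrable_subset[OF q _ CU]) auto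
    then have "(\<lambda>k. LINT x:A k|lborel. q x) \<longlonglongrightarrow> (LINT x:(\<Union>k. A k)|lborel. q x)"
    proof (rule set_integral_cont_up[rotated 2])
      show "A k \<in> sets lborel" for k by (simp add: A_def)
      show "incseq A" unfolding incseq_def using mono by blast
    qed
    moreover have "(LINT x:A k|lborel. q x) = W (d - e k) - W (c + e k)" for k
      unfolding A_def
    proof (rule FTC[symmetric])
      show "c + e k \<le> d - e k" using e(2)[of k] by (simp add: field_simps)
      show "{c + e k..d - e k} \<subseteq> U" using AU[of k] CU unfolding A_def by blast
    qed
    moreover have "(\<lambda>k. W (d - e k) - W (c + e k)) \<longlonglongrightarrow> W d - W c"
    proof -
      have 1: "(\<lambda>k. d - e k) \<longlonglongrightarrow> d - 0" "(\<lambda>k. c + e k) \<longlonglongrightarrow> c + 0"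
        by (intro tendsto_intros e0)+
      have 2: "d - e k \<in> {a..b}" "c + e k \<in> {a..b}" for k
      proof -
        have *: "x \<in> {a..b}" if "x \<in> {c<..<d}" for x
          using subsetD[OF subset_trans[OF CU U(2)] that] by auto
        have m: "d - e k \<in> {c<..<d}" "c + e k \<in> {c<..<d}"
          using e[of k] cd(2) by (auto simp: field_simps)
        show "d - e k \<in> {a..b}" by (rule *[OF m(1)])
        show "c + e k \<in> {a..b}" by (rule *[OF m(2)])
      qed
      show ?thesis using 1 2 cd(3,4)
        by (intro tendsto_diff continuous_on_tendsto_compose[OF W(1)]) (auto intro!: always_eventually)
    qed
    ultimately have "(LINT x:{c<..<d}|lborel. q x) = W d - W c" unfolding UA using LIMSEQ_unique by simp
    then show ?thesis using W(2)[OF cd(3)] W(2)[OF cd(4)] cd(1) by simp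
  qed
  let ?\<C> = "components U"
  have cnt: "countable ?\<C>"
    by (rule countable_disjoint_open_subsets)
      (use open_components[OF U(1)] pairwise_disjoint_components[of U] in \<open>auto simp: disjoint_def pairwise_def disjnt_def\<close>)
  define A where "A i = \<Union>{C \<in> ?\<C>. to_nat_on ?\<C> C = i}" for i
  have A_cases: "A i = {} \<or> A i \<in> ?\<C>" for i
  proof (cases "\<exists>C\<in>?\<C>. to_nat_on ?\<C> C = i")
    case True
    then obtain C where C: "C \<in> ?\<C>" "to_nat_on ?\<C> C = i" by blast
    then have "{C \<in> ?\<C>. to_nat_on ?\<C> C = i} = {C}"
      using inj_onD[OF inj_on_to_nat_on[OF cnt]] by blast
    then have "A i = C" by (simp add: A_def)
    then show ?thesis using C by simp
  next
    case False
    then have "{C \<in> ?\<C>. to_nat_on ?\<C> C = i} = {}" by blast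
    then have "A i = {}" by (simp only: A_def Union_empty)
    then show ?thesis ..
  qed
  have UA: "(\<Union>i. A i) = U"
    unfolding A_def using Union_components[of U] by blast
  have Am: "A i \<in> sets lborel" for i
    using A_cases[of i] open_components[OF U(1)] by auto
  have disj: "A i \<inter> A j = {}" if "i \<noteq> j" for i j
  proof (rule ccontr)
    assume "A i \<inter> A j \<noteq> {}"
    then obtain x C D where "C \<in> ?\<C>" "D \<in> ?\<C>" "to_nat_on ?\<C> C = i" "to_nat_on ?\<C> D = j" "x \<in> C" "x \<in> D"
      unfolding A_def by blast
    moreover from this have "C = D" using components_nonoverlap[of C U D] by blast
    ultimately show False using that by simp
  qed
  have "(LINT x:(\<Union>i. A i)|lborel. q x) = (\<Sum>i. LINT x:A i|lborel. q x)"
    using Am disj q UA by (intro lebesgue_integral_countable_add) auto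
  also have "\<dots> = 0"
  proof -
    have "(LINT x:A i|lborel. q x) = 0" for i
      using A_cases[of i] comp[of "A i"] by (auto simp: set_lebesgue_integral_def)
    then show ?thesis by simp
  qed
  finally show ?thesis unfolding UA .
qed

text \<open>The situation at one good time: \<open>w\<close> is the profile and \<open>g\<close> its
  classical derivative, while \<open>wx\<close> and \<open>h\<close> are the given representatives
  of the first and second weak derivatives. The second derivative lives on the positivity set only,
  and the weighted bound \<open>energy\<close> is the only information about it up to the zeros of
  \<open>w\<close>.\<close>

locale slice =
  fixes a b :: real and w g wx h :: "real \<Rightarrow> real"
  assumes ab: "a < b"
    and w_deriv: "\<And>x. x \<in> {a..b} \<Longrightarrow> (w has_real_derivative g x) (at x within {a..b})"
    and g_cont: "continuous_on {a..b} g" and g_ends: "g a = 0" "g b = 0"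
    and w_nonneg: "\<And>x. x \<in> {a..b} \<Longrightarrow> 0 \<le> w x"
    and wx: "weak_deriv {a<..<b} w wx" "wx \<in> borel_measurable borel"
    and wxx: "weak_deriv {x \<in> {a<..<b}. w x > 0} wx h" "h \<in> borel_measurable borel"
    and energy: "set_integrable lborel {a<..<b} (\<lambda>x. if w x > 0 then w x * (h x)\<^sup>2 else 0)"
begin

abbreviation "U \<equiv> {x \<in> {a<..<b}. w x > 0}"

lemma w_cont: "continuous_on {a..b} w"
  using w_deriv DERIV_continuous_on by blast

lemma w_DERIV: "x \<in> {a<..<b} \<Longrightarrow> (w has_real_derivative g x) (at x)"
  using w_deriv[of x] at_within_Icc_at[of a x b] by auto

lemma open_U: "open U"
proof -
  have "open ({a<..<b} \<inter> w -` {0<..})"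
    by (rule continuous_open_preimage) (auto intro: continuous_on_subset[OF w_cont])
  moreover have "U = {a<..<b} \<inter> w -` {0<..}" by auto
  ultimately show ?thesis by simp
qed

lemma wx_eq: "AE x in lborel. x \<in> {a<..<b} \<longrightarrow> wx x = g x"
  by (rule weak_deriv_C1_AE[OF wx(1) w_DERIV continuous_on_subset[OF g_cont]]) auto

text \<open>An interior zero of the nonnegative \<open>w\<close> is a minimum; at the end points
  this is the boundary condition.\<close>

lemma g_zero:
  assumes x: "x \<in> {a..b}" "x \<notin> U"
  shows "g x = 0"
proof (cases "x \<in> {a<..<b}")
  case True
  then have "w x = 0" using x w_nonneg[of x] by fastforce
  show ?thesis
  proof (rule DERIV_local_min[OF w_DERIV[OF True]])
    show "0 < min (x - a) (b - x)" using True by auto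
    show "\<forall>y. \<bar>x - y\<bar> < min (x - a) (b - x) \<longrightarrow> w x \<le> w y"
      using \<open>w x = 0\<close> w_nonneg by (auto simp: abs_less_iff)
  qed
next
  case False
  then have "x = a \<or> x = b" using x by auto
  then show ?thesis using g_ends by auto
qed

text \<open>The fundamental theorem for weak derivatives wants a continuous primitive, so
  \<open>h\<close> is read as the weak derivative of \<open>g\<close> instead of \<open>wx\<close>;
  the two agree almost everywhere.\<close>

lemma weak_deriv_g: "weak_deriv U g h"
proof -
  have AE: "AE x in lborel. x \<in> U \<longrightarrow> wx x = g x" using wx_eq by eventually_elim auto
  have gm: "(\<lambda>x. indicator {a<..<b} x * g x) \<in> borel_measurable borel"
  proof -
    have "continuous_on {a<..<b} g" by (rule continuous_on_subset[OF g_cont]) auto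
    from borel_measurable_continuous_on_indicator[OF _ this] show ?thesis by simp
  qed
  have loc: "loc_integrable U g"
    unfolding loc_integrable_def
  proof (intro allI impI)
    fix K assume K: "compact K \<and> K \<subseteq> U"
    then have "K \<subseteq> {a..b}" by force
    then show "set_integrable lborel K g"
      unfolding set_integrable_def
      using K by (intro borel_integrable_compact continuous_on_subset[OF g_cont]) auto
  qed
  have eq_test: "(LINT x:U|lborel. g x * \<phi> x) = (LINT x:U|lborel. wx x * \<phi> x)" if "\<phi> \<in> test_functions V" for \<phi> V
    unfolding set_lebesgue_integral_def
  proof (rule integral_cong_AE)
    have fm: "\<phi> \<in> borel_measurable borel" using test_functions_measurable[OF that] .
    have Ub: "U \<in> sets borel" using open_U by (rule borel_open)
    have eq: "(\<lambda>x. indicator U x *\<^sub>R (g x * \<phi> x)) = (\<lambda>x. indicator U x * (indicator {a<..<b} x * g x) * \<phi> x)"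
      by (auto simp: indicator_def fun_eq_iff)
    show "(\<lambda>x. indicator U x *\<^sub>R (g x * \<phi> x)) \<in> borel_measurable lborel"
      unfolding eq measurable_lborel2 by (intro borel_measurable_times borel_measurable_indicator Ub gm fm)
    show "(\<lambda>x. indicator U x *\<^sub>R (wx x * \<phi> x)) \<in> borel_measurable lborel"
      unfolding measurable_lborel2 real_scaleR_def
      by (intro borel_measurable_times borel_measurable_indicator Ub wx(2) fm)
    show "AE x in lborel. indicator U x *\<^sub>R (g x * \<phi> x) = indicator U x *\<^sub>R (wx x * \<phi> x)"
      using AE by eventually_elim (auto simp: indicator_def)
  qed
  have "(LINT x:U|lborel. g x * deriv \<phi> x) = - (LINT x:U|lborel. h x * \<phi> x)" if "\<phi> \<in> test_functions U" for \<phi>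
    using wxx(1) that unfolding weak_deriv_def by (simp only: eq_test[OF test_functions_deriv[OF that]])
  then show ?thesis using loc wxx(1) unfolding weak_deriv_def by blast
qed

lemma energy_U: "set_integrable lborel U (\<lambda>x. w x * (h x)\<^sup>2)"
proof -
  have "(\<lambda>x. indicator U x *\<^sub>R (w x * (h x)\<^sup>2)) = (\<lambda>x. indicator {a<..<b} x *\<^sub>R (if w x > 0 then w x * (h x)\<^sup>2 else 0))"
    by (auto simp: indicator_def fun_eq_iff)
  then show ?thesis using energy by (simp add: set_integrable_def)
qed

lemma cont_integrable_U: "continuous_on {a..b} f \<Longrightarrow> set_integrable lborel U (f :: real \<Rightarrow> real)"
  using open_U by (intro set_integrable_subset[OF borel_integrable_atLeastAtMost'[of a b f]]) auto

text \<open>Young's inequality with the weight left in place: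
  \<open>w * \<bar>f * h\<bar> \<le> w * f\<^sup>2 + w * h\<^sup>2\<close>. The factor
  \<open>w\<close> is essential, because \<open>h\<close> itself may fail to be integrable up to the
  zeros of \<open>w\<close>.\<close>

lemma product_integrable:
  assumes f: "continuous_on {a..b} f"
  shows "set_integrable lborel U (\<lambda>x. w x * f x * h x)"
proof (rule set_integrable_bound)
  show "set_integrable lborel U (\<lambda>x. w x * (f x)\<^sup>2 + w x * (h x)\<^sup>2)"
    by (intro set_integral_add(1) energy_U cont_integrable_U continuous_intros w_cont f)
  have eq: "(\<lambda>x. indicator U x *\<^sub>R (w x * f x * h x)) = (\<lambda>x. (indicator U x *\<^sub>R (w x * f x)) * h x)"
    by (simp add: fun_eq_iff)
  have "(\<lambda>x. indicator U x *\<^sub>R (w x * f x)) \<in> borel_measurable borel"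
    using cont_integrable_U[OF continuous_on_mult[OF w_cont f]] borel_measurable_integrable
    unfolding set_integrable_def by fastforce
  from borel_measurable_times[OF this wxx(2)]
  show "set_borel_measurable lborel U (\<lambda>x. w x * f x * h x)"
    unfolding set_borel_measurable_def eq measurable_lborel2 .
  show "AE x in lborel. x \<in> U \<longrightarrow> norm (w x * f x * h x) \<le> norm (w x * (f x)\<^sup>2 + w x * (h x)\<^sup>2)"
  proof (intro AE_I2 impI)
    fix x assume x: "x \<in> U"
    have "0 \<le> (\<bar>f x\<bar> - \<bar>h x\<bar>)\<^sup>2" by simp
    then have "2 * (\<bar>f x\<bar> * \<bar>h x\<bar>) \<le> (f x)\<^sup>2 + (h x)\<^sup>2" by (simp add: power2_diff)
    moreover have "0 \<le> \<bar>f x\<bar> * \<bar>h x\<bar>" by simp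
    ultimately have "\<bar>f x * h x\<bar> \<le> (f x)\<^sup>2 + (h x)\<^sup>2" unfolding abs_mult by linarith
    then have "w x * \<bar>f x * h x\<bar> \<le> w x * ((f x)\<^sup>2 + (h x)\<^sup>2)" using x by (intro mult_left_mono) auto
    then show "norm (w x * f x * h x) \<le> norm (w x * (f x)\<^sup>2 + w x * (h x)\<^sup>2)"
      using x by (simp add: abs_mult distrib_left mult.assoc)
  qed
qed

text \<open>The field \<open>w \<psi> H(w')\<close> vanishes on the boundary of every component of \<open>{w > 0}\<close>, because \<open>w'\<close>
  vanishes at the end points of the interval and at the interior zeros of \<open>w\<close>.\<close>

lemma integration_by_parts:
  fixes \<psi> H H' :: "real \<Rightarrow> real"
  assumes \<psi>: "\<And>x. (\<psi> has_real_derivative \<psi>' x) (at x)" "continuous_on UNIV \<psi>'"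
    and H: "\<And>s. (H has_real_derivative H' s) (at s)" "continuous_on UNIV H'" "H 0 = 0"
  shows "(LINT x:{a<..<b}|lborel. w x * H (g x) * \<psi>' x) =
    - (LINT x:{a<..<b}|lborel. g x * H (g x) * \<psi> x) - (LINT x:U|lborel. w x * (\<psi> x * H' (g x)) * h x)"
proof -
  have c\<psi>: "continuous_on A \<psi>" "continuous_on A \<psi>'" for A
    by (rule DERIV_continuous_on[where D = \<psi>'], rule has_field_derivative_at_within, rule \<psi>(1))
      (rule continuous_on_subset[OF \<psi>(2)], simp)
  have cH: "continuous_on A H" for A using H(1) DERIV_continuous_on has_field_derivative_at_within by blast
  have cHg: "continuous_on {a..b} (\<lambda>x. H (g x))" "continuous_on {a..b} (\<lambda>x. H' (g x))"
    by (auto intro!: continuous_on_compose2[OF cH[of UNIV]] continuous_on_compose2[OF H(2)] g_cont)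
  let ?p' = "\<lambda>x. g x * \<psi> x + w x * \<psi>' x"
  let ?q = "\<lambda>x. ?p' x * H (g x) + w x * \<psi> x * H' (g x) * h x"
  have c1: "continuous_on {a..b} (\<lambda>x. ?p' x * H (g x))"
    by (intro continuous_intros g_cont w_cont c\<psi> cHg)
  have i1: "set_integrable lborel U (\<lambda>x. ?p' x * H (g x))" by (rule cont_integrable_U[OF c1])
  have i2: "set_integrable lborel U (\<lambda>x. w x * (\<psi> x * H' (g x)) * h x)"
    by (intro product_integrable continuous_intros c\<psi> cHg)
  have "(LINT x:U|lborel. ?p' x * H (g x) + w x * (\<psi> x * H' (g x)) * h x) = 0"
  proof (rule integral_positivity_set_eq_0[OF open_U, of a b, where W = "\<lambda>x. w x * \<psi> x * H (g x)"])
    show "set_integrable lborel U (\<lambda>x. ?p' x * H (g x) + w x * (\<psi> x * H' (g x)) * h x)"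
      by (intro set_integral_add(1) i1 i2)
    show "continuous_on {a..b} (\<lambda>x. w x * \<psi> x * H (g x))" by (intro continuous_intros w_cont c\<psi> cHg)
    show "w x * \<psi> x * H (g x) = 0" if "x \<in> {a..b} - U" for x
      using g_zero[of x] that H(3) by simp
    fix c d assume cd: "c \<le> d" "{c..d} \<subseteq> U"
    then have sub: "{c..d} \<subseteq> {a..b}" by auto
    have hi: "set_integrable lborel {c..d} h"
      using wxx(1) cd(2) unfolding weak_deriv_def loc_integrable_def by blast
    have "w d * \<psi> d * H (g d) - w c * \<psi> c * H (g c) = (LINT x:{c..d}|lborel. ?p' x * H (g x) + w x * \<psi> x * H' (g x) * h x)"
    proof (rule AC_chain_rule[OF cd(1) hi, where p = "\<lambda>x. w x * \<psi> x"])
      show "continuous_on {c..d} g" by (rule continuous_on_subset[OF g_cont sub])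
      show "g x = g c + (LINT y:{c..x}|lborel. h y)" if "x \<in> {c..d}" for x
      proof -
        have gU: "continuous_on U g" by (rule continuous_on_subset[OF g_cont]) auto
        have "{c..x} \<subseteq> {c..d}" using that by auto
        then have "{c..x} \<subseteq> U" using cd(2) by (rule subset_trans)
        from weak_deriv_FTC[OF open_U gU weak_deriv_g _ this] that show ?thesis by simp
      qed
      show "((\<lambda>x. w x * \<psi> x) has_real_derivative ?p' x) (at x within {c..d})" if "x \<in> {c..d}" for x
        using DERIV_mult[OF DERIV_subset[OF w_deriv sub] has_field_derivative_at_within[OF \<psi>(1)]] that sub
        by (simp add: subset_eq algebra_simps)
      show "continuous_on {c..d} ?p'"
        by (rule continuous_on_subset[OF _ sub]) (intro continuous_intros g_cont w_cont c\<psi>)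
    qed (use H in auto)
    then show "w d * \<psi> d * H (g d) - w c * \<psi> c * H (g c) = (LINT x:{c..d}|lborel. ?p' x * H (g x) + w x * (\<psi> x * H' (g x)) * h x)"
      by (simp add: mult.assoc)
  qed auto
  then have "(LINT x:U|lborel. ?p' x * H (g x)) + (LINT x:U|lborel. w x * (\<psi> x * H' (g x)) * h x) = 0"
    using set_integral_add(2)[OF i1 i2] by simp
  \<comment> \<open>Off the positivity set \<open>g\<close> vanishes, and \<open>H 0 = 0\<close>
    removes the integrand there.\<close>
  moreover have "(LINT x:U|lborel. ?p' x * H (g x)) = (LINT x:{a<..<b}|lborel. ?p' x * H (g x))"
    unfolding set_lebesgue_integral_def
  proof (intro Bochner_Integration.integral_cong refl)
    fix x
    show "indicator U x *\<^sub>R (?p' x * H (g x)) = indicator {a<..<b} x *\<^sub>R (?p' x * H (g x))"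
      using g_zero[of x] H(3) by (cases "x \<in> {a<..<b}"; cases "x \<in> U") auto
  qed
  moreover have "(LINT x:{a<..<b}|lborel. ?p' x * H (g x)) =
      (LINT x:{a<..<b}|lborel. g x * H (g x) * \<psi> x) + (LINT x:{a<..<b}|lborel. w x * H (g x) * \<psi>' x)"
  proof -
    have ci: "set_integrable lborel {a<..<b} f" if "continuous_on {a..b} f" for f :: "real \<Rightarrow> real"
      by (rule set_integrable_subset[OF borel_integrable_atLeastAtMost'[OF that]]) auto
    have "?p' x * H (g x) = g x * H (g x) * \<psi> x + w x * H (g x) * \<psi>' x" for x by (simp add: algebra_simps)
    then show ?thesis
      by (simp only:) (intro set_integral_add(2) ci continuous_intros g_cont w_cont c\<psi> cHg)
  qed
  ultimately show ?thesis by simp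
qed

text \<open>The function \<open>s * \<bar>s\<bar>\<close> is an admissible nonlinearity in the
  integration by parts: its derivative is continuous, and one more factor \<open>s\<close> turns it
  into \<open>\<bar>s\<bar> ^ 3\<close>, which has a sign.\<close>

lemma DERIV_mult_abs: "((\<lambda>s::real. s * \<bar>s\<bar>) has_real_derivative 2 * \<bar>s\<bar>) (at s)"
proof -
  consider "s > 0" | "s < 0" | "s = 0" by linarith
  then show ?thesis
  proof cases
    case 1
    have "((\<lambda>s::real. s * s) has_real_derivative 2 * \<bar>s\<bar>) (at s)" using 1 by (auto intro!: derivative_eq_intros)
    moreover have "\<forall>\<^sub>F y in nhds s. y * y = y * \<bar>y\<bar>"
      by (rule eventually_mono[OF eventually_nhds_in_open[of "{0<..}" s]]) (use 1 in auto)
    ultimately show ?thesis using DERIV_cong_ev[of s s "\<lambda>s. s * s" "\<lambda>s. s * \<bar>s\<bar>"] by auto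
  next
    case 2
    have "((\<lambda>s::real. - (s * s)) has_real_derivative 2 * \<bar>s\<bar>) (at s)" using 2 by (auto intro!: derivative_eq_intros)
    moreover have "\<forall>\<^sub>F y in nhds s. - (y * y) = y * \<bar>y\<bar>"
      by (rule eventually_mono[OF eventually_nhds_in_open[of "{..<0}" s]]) (use 2 in auto)
    ultimately show ?thesis using DERIV_cong_ev[of s s "\<lambda>s. - (s * s)" "\<lambda>s. s * \<bar>s\<bar>"] by auto
  next
    case 3
    have "((\<lambda>h::real. \<bar>h\<bar>) \<longlongrightarrow> 0) (at 0)" by (rule tendsto_rabs_zero) (rule tendsto_ident_at)
    then have "((\<lambda>h::real. h * \<bar>h\<bar> / h) \<longlongrightarrow> 0) (at 0)"
      by (rule Lim_transform_eventually) (auto simp: eventually_at_filter)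
    then show ?thesis using 3 by (simp add: DERIV_def)
  qed
qed

abbreviation "dissipation \<equiv> (LINT x:{a<..<b}|lborel. if w x > 0 then w x * (h x)\<^sup>2 else 0)"

lemma cont_integrable: "continuous_on {a..b} f \<Longrightarrow> set_integrable lborel {a<..<b} (f :: real \<Rightarrow> real)"
  by (rule set_integrable_subset[OF borel_integrable_atLeastAtMost']) auto

text \<open>Identities are proved for the continuous \<open>g\<close> and transferred by this to
  \<open>wx\<close>, the representative that the properties of the solution speak about.\<close>

lemma wx_cong:
  fixes F :: "real \<Rightarrow> real \<Rightarrow> real"
  assumes c: "continuous_on {a..b} (\<lambda>x. F x (g x))"
    and m: "(\<lambda>x. indicator {a<..<b} x * F x (wx x)) \<in> borel_measurable borel"
  shows "(LINT x:{a<..<b}|lborel. F x (wx x)) = (LINT x:{a<..<b}|lborel. F x (g x))"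
    and "set_integrable lborel {a<..<b} (\<lambda>x. F x (wx x))"
proof -
  have gi: "integrable lborel (\<lambda>x. indicator {a<..<b} x * F x (g x))"
    using cont_integrable[OF c] by (simp add: set_integrable_def)
  have AE: "AE x in lborel. indicator {a<..<b} x * F x (wx x) = indicator {a<..<b} x * F x (g x)"
    using wx_eq by eventually_elim (auto simp: indicator_def)
  have m': "(\<lambda>x. indicator {a<..<b} x * F x (wx x)) \<in> borel_measurable lborel" using m by simp
  show "(LINT x:{a<..<b}|lborel. F x (wx x)) = (LINT x:{a<..<b}|lborel. F x (g x))"
    using integral_cong_AE[OF m' borel_measurable_integrable[OF gi] AE] by (simp add: set_lebesgue_integral_def)
  show "set_integrable lborel {a<..<b} (\<lambda>x. F x (wx x))"
    using integrable_cong_AE[OF m' borel_measurable_integrable[OF gi] AE] gi by (simp add: set_integrable_def)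
qed

lemma w_measurable: "(\<lambda>x. indicator {a<..<b} x * w x) \<in> borel_measurable borel"
proof -
  have "continuous_on {a<..<b} w" by (rule continuous_on_subset[OF w_cont]) auto
  from borel_measurable_continuous_on_indicator[OF _ this] show ?thesis by simp
qed

lemma U_to_interval:
  fixes f :: "real \<Rightarrow> real"
  shows "(LINT x:U|lborel. f x) = (LINT x:{a<..<b}|lborel. if w x > 0 then f x else 0)"
    and "set_integrable lborel U f \<longleftrightarrow> set_integrable lborel {a<..<b} (\<lambda>x. if w x > 0 then f x else 0)"
proof -
  have "(\<lambda>x. indicator U x *\<^sub>R f x) = (\<lambda>x. indicator {a<..<b} x *\<^sub>R (if w x > 0 then f x else 0))"
    by (auto simp: indicator_def fun_eq_iff)
  then show "(LINT x:U|lborel. f x) = (LINT x:{a<..<b}|lborel. if w x > 0 then f x else 0)"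
    "set_integrable lborel U f \<longleftrightarrow> set_integrable lborel {a<..<b} (\<lambda>x. if w x > 0 then f x else 0)"
    by (simp_all add: set_lebesgue_integral_def set_integrable_def)
qed

lemma w_wx2:
  "(LINT x:{a<..<b}|lborel. w x * (wx x)\<^sup>2) = (LINT x:{a<..<b}|lborel. w x * (g x)\<^sup>2)"
  "set_integrable lborel {a<..<b} (\<lambda>x. w x * (wx x)\<^sup>2)"
proof -
  have "(\<lambda>x. (indicator {a<..<b} x * w x) * (wx x)\<^sup>2) \<in> borel_measurable borel"
    using w_measurable wx(2) by measurable
  then have m: "(\<lambda>x. indicator {a<..<b} x * (w x * (wx x)\<^sup>2)) \<in> borel_measurable borel" by (simp add: mult.assoc)
  have c: "continuous_on {a..b} (\<lambda>x. w x * (g x)\<^sup>2)" by (intro continuous_intros w_cont g_cont)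
  show "(LINT x:{a<..<b}|lborel. w x * (wx x)\<^sup>2) = (LINT x:{a<..<b}|lborel. w x * (g x)\<^sup>2)"
    "set_integrable lborel {a<..<b} (\<lambda>x. w x * (wx x)\<^sup>2)"
    using wx_cong[where F = "\<lambda>x y. w x * y\<^sup>2", OF c m] by auto
qed

text \<open>Integration by parts with \<open>H s = s * \<bar>s\<bar>\<close> and
  \<open>\<psi> = 1\<close> equates the integral of \<open>\<bar>g\<bar> ^ 3\<close> with that of
  \<open>- 2 * w * \<bar>g\<bar> * h\<close> over the positivity set. The weight \<open>w\<close> in
  front permits Young's inequality with both squares weighted.\<close>

lemma cubic_bound:
  "set_integrable lborel {a<..<b} (\<lambda>x. (wx x) ^ 3)"
  "(LINT x:{a<..<b}|lborel. \<bar>wx x\<bar> ^ 3) \<le> dissipation + (LINT x:{a<..<b}|lborel. w x * (wx x)\<^sup>2)"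
proof -
  have m: "(\<lambda>x. indicator {a<..<b} x * (wx x) ^ 3) \<in> borel_measurable borel"
    "(\<lambda>x. indicator {a<..<b} x * \<bar>wx x\<bar> ^ 3) \<in> borel_measurable borel"
    using wx(2) by measurable
  have c: "continuous_on {a..b} (\<lambda>x. (g x) ^ 3)" "continuous_on {a..b} (\<lambda>x. \<bar>g x\<bar> ^ 3)"
    by (intro continuous_intros g_cont)+
  show "set_integrable lborel {a<..<b} (\<lambda>x. (wx x) ^ 3)"
    using wx_cong(2)[where F = "\<lambda>x y. y ^ 3", OF c(1) m(1)] .
  have ca: "continuous_on UNIV (\<lambda>s::real. 2 * \<bar>s\<bar>)" by (intro continuous_intros)
  have "0 = - (LINT x:{a<..<b}|lborel. g x * (g x * \<bar>g x\<bar>) * 1) - (LINT x:U|lborel. w x * (1 * (2 * \<bar>g x\<bar>)) * h x)"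
    using integration_by_parts[where \<psi> = "\<lambda>_. 1" and \<psi>' = "\<lambda>_. 0" and H = "\<lambda>s. s * \<bar>s\<bar>", OF _ _ DERIV_mult_abs ca]
    by simp
  moreover have "g x * (g x * \<bar>g x\<bar>) * 1 = \<bar>g x\<bar> ^ 3" for x
    by (cases "0 \<le> g x") (simp_all add: power3_eq_cube abs_if)
  ultimately have "(LINT x:{a<..<b}|lborel. \<bar>g x\<bar> ^ 3) = - (LINT x:U|lborel. w x * (1 * (2 * \<bar>g x\<bar>)) * h x)" by simp
  also have "\<dots> = (LINT x:U|lborel. - (w x * (1 * (2 * \<bar>g x\<bar>)) * h x))"
    by (simp add: set_lebesgue_integral_def)
  also have "\<dots> \<le> (LINT x:U|lborel. w x * (h x)\<^sup>2 + w x * (g x)\<^sup>2)"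
  proof (rule set_integral_mono)
    have "set_integrable lborel U (\<lambda>x. w x * (1 * (2 * \<bar>g x\<bar>)) * h x)"
      by (intro product_integrable continuous_intros g_cont)
    then show "set_integrable lborel U (\<lambda>x. - (w x * (1 * (2 * \<bar>g x\<bar>)) * h x))"
      by (simp add: set_integrable_def)
    show "set_integrable lborel U (\<lambda>x. w x * (h x)\<^sup>2 + w x * (g x)\<^sup>2)"
      by (intro set_integral_add(1) energy_U cont_integrable_U continuous_intros w_cont g_cont)
    fix x assume x: "x \<in> U"
    have "0 \<le> (\<bar>g x\<bar> + h x)\<^sup>2" by simp
    then have "- (2 * \<bar>g x\<bar> * h x) \<le> (h x)\<^sup>2 + (g x)\<^sup>2" by (simp add: power2_sum)
    then have "w x * - (2 * \<bar>g x\<bar> * h x) \<le> w x * ((h x)\<^sup>2 + (g x)\<^sup>2)" using x by (intro mult_left_mono) auto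
    then show "- (w x * (1 * (2 * \<bar>g x\<bar>)) * h x) \<le> w x * (h x)\<^sup>2 + w x * (g x)\<^sup>2"
      by (simp add: algebra_simps)
  qed
  also have "\<dots> = (LINT x:U|lborel. w x * (h x)\<^sup>2) + (LINT x:U|lborel. w x * (g x)\<^sup>2)"
    by (intro set_integral_add(2) energy_U cont_integrable_U continuous_intros w_cont g_cont)
  also have "(LINT x:U|lborel. w x * (h x)\<^sup>2) = dissipation" by (rule U_to_interval)
  also have "(LINT x:U|lborel. w x * (g x)\<^sup>2) = (LINT x:{a<..<b}|lborel. w x * (g x)\<^sup>2)"
    unfolding set_lebesgue_integral_def
  proof (intro Bochner_Integration.integral_cong refl)
    fix x
    show "indicator U x *\<^sub>R (w x * (g x)\<^sup>2) = indicator {a<..<b} x *\<^sub>R (w x * (g x)\<^sup>2)"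
      using g_zero[of x] by (cases "x \<in> {a<..<b}"; cases "x \<in> U") auto
  qed
  finally show "(LINT x:{a<..<b}|lborel. \<bar>wx x\<bar> ^ 3) \<le> dissipation + (LINT x:{a<..<b}|lborel. w x * (wx x)\<^sup>2)"
    using wx_cong(1)[where F = "\<lambda>x y. \<bar>y\<bar> ^ 3", OF c(2) m(2)] w_wx2 by simp
qed

lemma mixed_cong: "AE x in lborel. indicator {a<..<b} x *\<^sub>R (if w x > 0 then w x * wx x * h x else 0)
    = indicator {a<..<b} x *\<^sub>R (if w x > 0 then w x * g x * h x else 0)"
  using wx_eq by eventually_elim (auto simp: indicator_def)

lemma mixed_measurable:
  "(\<lambda>x. indicator {a<..<b} x *\<^sub>R (if w x > 0 then w x * wx x * h x else 0)) \<in> borel_measurable borel"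
proof -
  have [measurable]: "(\<lambda>x. indicator {a<..<b} x * w x) \<in> borel_measurable borel" by (rule w_measurable)
  have [measurable]: "wx \<in> borel_measurable borel" "h \<in> borel_measurable borel" using wx wxx by auto
  have "(\<lambda>x. indicator {a<..<b} x *\<^sub>R (if w x > 0 then w x * wx x * h x else 0)) =
      (\<lambda>x. if indicator {a<..<b} x * w x > 0 then indicator {a<..<b} x * w x * wx x * h x else 0)"
    by (auto simp: indicator_def fun_eq_iff)
  then show ?thesis by (simp only:) measurable
qed

lemma mixed_integrable: "set_integrable lborel {a<..<b} (\<lambda>x. if w x > 0 then w x * wx x * h x else 0)"
proof -
  have gi: "set_integrable lborel {a<..<b} (\<lambda>x. if w x > 0 then w x * g x * h x else 0)"
    by (rule U_to_interval(2)[THEN iffD1, OF product_integrable[OF g_cont]])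
  then show ?thesis
    using integrable_cong_AE[OF _ borel_measurable_integrable[OF gi[unfolded set_integrable_def]] mixed_cong] mixed_measurable
    unfolding set_integrable_def measurable_lborel2 by blast
qed

lemma mixed_bound:
  "(LINT x:{a<..<b}|lborel. \<bar>if w x > 0 then w x * wx x * h x else 0\<bar>) \<le>
    (dissipation + (LINT x:{a<..<b}|lborel. w x * (wx x)\<^sup>2)) / 2"
proof -
  have "(LINT x:{a<..<b}|lborel. \<bar>if w x > 0 then w x * wx x * h x else 0\<bar>) \<le>
      (LINT x:{a<..<b}|lborel. ((if w x > 0 then w x * (h x)\<^sup>2 else 0) + w x * (wx x)\<^sup>2) / 2)"
  proof (rule set_integral_mono)
    show "set_integrable lborel {a<..<b} (\<lambda>x. \<bar>if w x > 0 then w x * wx x * h x else 0\<bar>)"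
      by (rule set_integrable_abs[OF mixed_integrable])
    show "set_integrable lborel {a<..<b} (\<lambda>x. ((if w x > 0 then w x * (h x)\<^sup>2 else 0) + w x * (wx x)\<^sup>2) / 2)"
      by (intro set_integrable_divide set_integral_add(1) energy w_wx2)
    fix x assume x: "x \<in> {a<..<b}"
    show "\<bar>if w x > 0 then w x * wx x * h x else 0\<bar> \<le> ((if w x > 0 then w x * (h x)\<^sup>2 else 0) + w x * (wx x)\<^sup>2) / 2"
    proof (cases "w x > 0")
      case True
      have "0 \<le> (\<bar>wx x\<bar> - \<bar>h x\<bar>)\<^sup>2" by simp
      then have "2 * (\<bar>wx x\<bar> * \<bar>h x\<bar>) \<le> (h x)\<^sup>2 + (wx x)\<^sup>2" by (simp add: power2_diff)
      then have "w x * (2 * (\<bar>wx x\<bar> * \<bar>h x\<bar>)) \<le> w x * ((h x)\<^sup>2 + (wx x)\<^sup>2)" using True by (intro mult_left_mono) auto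
      then show ?thesis using True by (simp add: abs_mult algebra_simps)
    next
      case False
      then show ?thesis using w_nonneg[of x] x by simp
    qed
  qed
  also have "\<dots> = (dissipation + (LINT x:{a<..<b}|lborel. w x * (wx x)\<^sup>2)) / 2"
    using set_integral_add(2)[OF energy w_wx2(2)] by simp
  finally show ?thesis .
qed

text \<open>Integration by parts with \<open>H s = s\<^sup>2\<close> and
  \<open>\<psi> = deriv \<phi>\<close>. The test function loses one derivative, at the price of a
  cubic term and the mixed term \<open>w * wx * h\<close>; both are integrable by the preceding
  bounds.\<close>

lemma second_order_term:
  assumes \<phi>: "smooth \<phi>"
  shows "(LINT x:{a<..<b}|lborel. w x * (wx x)\<^sup>2 * deriv (deriv \<phi>) x) =
    - (LINT x:{a<..<b}|lborel. (wx x) ^ 3 * deriv \<phi> x)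
    - 2 * (LINT x:{a<..<b}|lborel. (if w x > 0 then w x * wx x * h x else 0) * deriv \<phi> x)"
proof -
  have s: "smooth (deriv \<phi>)" "smooth (deriv (deriv \<phi>))" using \<phi> smooth_deriv by auto
  have c: "continuous_on A (deriv \<phi>)" "continuous_on A (deriv (deriv \<phi>))" for A
    using s smooth_imp_continuous continuous_on_subset by blast+
  have [measurable]: "deriv \<phi> \<in> borel_measurable borel" "deriv (deriv \<phi>) \<in> borel_measurable borel"
    using c by (auto intro: borel_measurable_continuous_onI)
  have sq: "((\<lambda>s::real. s\<^sup>2) has_real_derivative 2 * s) (at s)" for s by (auto intro!: derivative_eq_intros)
  have c2: "continuous_on UNIV (\<lambda>s::real. 2 * s)" by (intro continuous_intros)
  have "(LINT x:{a<..<b}|lborel. w x * (g x)\<^sup>2 * deriv (deriv \<phi>) x) =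
      - (LINT x:{a<..<b}|lborel. g x * (g x)\<^sup>2 * deriv \<phi> x) - (LINT x:U|lborel. w x * (deriv \<phi> x * (2 * g x)) * h x)"
    using integration_by_parts[where H = "\<lambda>s. s\<^sup>2", OF smooth_real_DERIV[OF s(1)] c(2) sq c2] by simp
  moreover have "(LINT x:U|lborel. w x * (deriv \<phi> x * (2 * g x)) * h x) =
      2 * (LINT x:{a<..<b}|lborel. (if w x > 0 then w x * wx x * h x else 0) * deriv \<phi> x)"
  proof -
    have "(LINT x:U|lborel. w x * (deriv \<phi> x * (2 * g x)) * h x) =
        (LINT x:{a<..<b}|lborel. 2 * ((if w x > 0 then w x * g x * h x else 0) * deriv \<phi> x))"
      unfolding U_to_interval(1) set_lebesgue_integral_def
      by (intro Bochner_Integration.integral_cong) (auto simp: indicator_def)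
    also have "\<dots> = 2 * (LINT x:{a<..<b}|lborel. (if w x > 0 then w x * g x * h x else 0) * deriv \<phi> x)" by simp
    also have "(LINT x:{a<..<b}|lborel. (if w x > 0 then w x * g x * h x else 0) * deriv \<phi> x) =
        (LINT x:{a<..<b}|lborel. (if w x > 0 then w x * wx x * h x else 0) * deriv \<phi> x)"
    proof -
      have gi: "set_integrable lborel {a<..<b} (\<lambda>x. if w x > 0 then w x * g x * h x else 0)"
        by (rule U_to_interval(2)[THEN iffD1, OF product_integrable[OF g_cont]])
      have gm: "(\<lambda>x. indicator {a<..<b} x *\<^sub>R (if w x > 0 then w x * g x * h x else 0)) \<in> borel_measurable borel"
        using borel_measurable_integrable[OF gi[unfolded set_integrable_def]] by simp
      have "(LINT x|lborel. (indicator {a<..<b} x *\<^sub>R (if w x > 0 then w x * g x * h x else 0)) * deriv \<phi> x) =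
          (LINT x|lborel. (indicator {a<..<b} x *\<^sub>R (if w x > 0 then w x * wx x * h x else 0)) * deriv \<phi> x)"
      proof (rule integral_cong_AE)
        show "AE x in lborel. (indicator {a<..<b} x *\<^sub>R (if w x > 0 then w x * g x * h x else 0)) * deriv \<phi> x =
          (indicator {a<..<b} x *\<^sub>R (if w x > 0 then w x * wx x * h x else 0)) * deriv \<phi> x"
          using mixed_cong by eventually_elim (simp only:)
      qed (use borel_measurable_times[OF gm] borel_measurable_times[OF mixed_measurable] in auto)
      then show ?thesis by (simp add: set_lebesgue_integral_def mult.assoc)
    qed
    finally show ?thesis .
  qed
  moreover have "(LINT x:{a<..<b}|lborel. w x * (wx x)\<^sup>2 * deriv (deriv \<phi>) x) = (LINT x:{a<..<b}|lborel. w x * (g x)\<^sup>2 * deriv (deriv \<phi>) x)"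
  proof (rule wx_cong(1)[where F = "\<lambda>x y. w x * y\<^sup>2 * deriv (deriv \<phi>) x"])
    show "continuous_on {a..b} (\<lambda>x. w x * (g x)\<^sup>2 * deriv (deriv \<phi>) x)" by (intro continuous_intros w_cont g_cont c)
    have "(\<lambda>x. (indicator {a<..<b} x * w x) * (wx x)\<^sup>2 * deriv (deriv \<phi>) x) \<in> borel_measurable borel"
      using w_measurable wx(2) by measurable
    then show "(\<lambda>x. indicator {a<..<b} x * (w x * (wx x)\<^sup>2 * deriv (deriv \<phi>) x)) \<in> borel_measurable borel"
      by (simp add: mult.assoc)
  qed
  moreover have "(LINT x:{a<..<b}|lborel. (wx x) ^ 3 * deriv \<phi> x) = (LINT x:{a<..<b}|lborel. (g x) ^ 3 * deriv \<phi> x)"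
  proof (rule wx_cong(1)[where F = "\<lambda>x y. y ^ 3 * deriv \<phi> x"])
    show "continuous_on {a..b} (\<lambda>x. (g x) ^ 3 * deriv \<phi> x)" by (intro continuous_intros g_cont c)
    show "(\<lambda>x. indicator {a<..<b} x * ((wx x) ^ 3 * deriv \<phi> x)) \<in> borel_measurable borel" using wx(2) by measurable
  qed
  moreover have "g x * (g x)\<^sup>2 = (g x) ^ 3" for x by (simp add: power2_eq_square power3_eq_cube)
  ultimately show ?thesis by simp
qed

end

section \<open>Uniform estimates for the thin film solutions\<close>

text \<open>A single \<open>\<epsilon>\<close> is fixed here, but the constants defined in the
  locale involve only \<open>n\<close>, \<open>a\<close>, \<open>b\<close>, \<open>uin\<close> and
  possibly a time horizon. They stay the same when the locale is entered for another
  \<open>\<epsilon>\<close>; this is how uniformity is tracked.\<close>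

locale thin_film = mobility_exponent n for n :: real +
  fixes a b \<epsilon> :: real and uin :: "real \<Rightarrow> real" and u ux uxx uxxx :: "real \<times> real \<Rightarrow> real"
  assumes ab: "a < b" and eps: "\<epsilon> \<in> {0<..1/2}"
    and mass: "(LINT x:{a<..<b}|lborel. uin x) = 1"
    and sol: "thin_film_solution a b n uin \<epsilon> u ux uxx uxxx"
begin

abbreviation "\<Omega> \<equiv> {a<..<b}"

definition "E0 = (LINT x:\<Omega>|lborel. (wd \<Omega> uin x)\<^sup>2)"

text \<open>The summand \<open>1 / (b - a)\<close> is the mean of a profile of unit mass, the last
  summand bounds its oscillation, and the leading \<open>1\<close> ensures
  \<open>1 \<le> S0\<close>, as the entropy bound requires.\<close>

definition "S0 = 1 + 1 / (b - a) + ((b - a) + E0) / 2"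

definition "C\<rho> = (B n 1 + ln S0) / ln 2 + 1"

lemma E0_nonneg: "0 \<le> E0"
  unfolding E0_def set_lebesgue_integral_def by (intro Bochner_Integration.integral_nonneg) simp

lemma S0_ge: "1 \<le> S0"
  using ab E0_nonneg by (simp add: S0_def)

lemma u_cont: "continuous_on ({0..} \<times> {a..b}) u"
  and u_nonneg: "z \<in> {0..} \<times> {a..b} \<Longrightarrow> 0 \<le> u z"
  using sol unfolding thin_film_solution_def by blast+

lemma derivs: "x_derivatives a b u ux uxx uxxx"
  and pii: "prop_ii a b uin u" and piii: "prop_iii a b n uin \<epsilon> u ux uxxx"
  and piv: "prop_iv a b n \<epsilon> u uxx"
  and p\<tau>: "0 < \<tau> \<Longrightarrow> prop_i a b u uxxx \<tau> \<and> prop_v a b n u \<tau> \<and> prop_vi a b n \<epsilon> u ux uxx uxxx \<tau>"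
  using sol unfolding thin_film_solution_def by blast+

lemma deriv_measurable [measurable]:
  "ux \<in> borel_measurable borel" "uxx \<in> borel_measurable borel" "uxxx \<in> borel_measurable borel"
  using derivs unfolding x_derivatives_def by blast+

lemma slice_measurable:
  fixes f :: "real \<times> real \<Rightarrow> real"
  assumes [measurable]: "f \<in> borel_measurable borel"
  shows "(\<lambda>x. f (t, x)) \<in> borel_measurable borel"
  by measurable

lemma u_slice_cont: "0 \<le> t \<Longrightarrow> continuous_on {a..b} (\<lambda>x. u (t, x))"
  by (rule continuous_on_compose2[OF u_cont]) (auto intro!: continuous_intros)

lemma ux_energy:
  assumes t: "0 < t"
  shows "set_integrable lborel \<Omega> (\<lambda>x. (ux (t, x))\<^sup>2)" "(LINT x:\<Omega>|lborel. (ux (t, x))\<^sup>2) \<le> E0"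
    "(LINT z:{z \<in> {0<..<t} \<times> \<Omega>. u z > 0}|lborel. \<bar>ln \<epsilon>\<bar> * mobility n \<epsilon> (u z) * (uxxx z)\<^sup>2) \<le> E0 / 2"
    "set_integrable lborel {z \<in> {0<..<t} \<times> \<Omega>. u z > 0} (\<lambda>z. \<bar>ln \<epsilon>\<bar> * mobility n \<epsilon> (u z) * (uxxx z)\<^sup>2)"
proof -
  note p = piii[unfolded prop_iii_def, rule_format, OF t]
  have "set_integrable lborel \<Omega> (\<lambda>x. \<bar>ux (t, x)\<bar> powr 2)"
    using p unfolding Lp_on_def by (simp add: curry_def)
  then show "set_integrable lborel \<Omega> (\<lambda>x. (ux (t, x))\<^sup>2)" by simp
  show "set_integrable lborel {z \<in> {0<..<t} \<times> \<Omega>. u z > 0} (\<lambda>z. \<bar>ln \<epsilon>\<bar> * mobility n \<epsilon> (u z) * (uxxx z)\<^sup>2)"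
    using p by blast
  have le: "1 / 2 * (LINT x:\<Omega>|lborel. (ux (t, x))\<^sup>2) + (LINT z:{z \<in> {0<..<t} \<times> \<Omega>. u z > 0}|lborel. \<bar>ln \<epsilon>\<bar> * mobility n \<epsilon> (u z) * (uxxx z)\<^sup>2) \<le> 1 / 2 * E0"
    using p unfolding E0_def by blast
  have 1: "0 \<le> (LINT x:\<Omega>|lborel. (ux (t, x))\<^sup>2)"
    unfolding set_lebesgue_integral_def by (intro Bochner_Integration.integral_nonneg) simp
  have 2: "0 \<le> (LINT z:{z \<in> {0<..<t} \<times> \<Omega>. u z > 0}|lborel. \<bar>ln \<epsilon>\<bar> * mobility n \<epsilon> (u z) * (uxxx z)\<^sup>2)"
    unfolding set_lebesgue_integral_def
    by (intro Bochner_Integration.integral_nonneg) (auto simp: indicator_def mobility_def)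
  show "(LINT x:\<Omega>|lborel. (ux (t, x))\<^sup>2) \<le> E0" using le 2 by linarith
  show "(LINT z:{z \<in> {0<..<t} \<times> \<Omega>. u z > 0}|lborel. \<bar>ln \<epsilon>\<bar> * mobility n \<epsilon> (u z) * (uxxx z)\<^sup>2) \<le> E0 / 2"
    using le 1 by linarith
qed

text \<open>The bound \<open>\<bar>ux\<bar> \<le> (1 + ux\<^sup>2) / 2\<close> takes the place of
  the Cauchy--Schwarz inequality and explains the constant.\<close>

lemma u_increment:
  assumes t: "0 < t" and xy: "a < x" "x \<le> y" "y < b"
  shows "\<bar>u (t, y) - u (t, x)\<bar> \<le> ((b - a) + E0) / 2"
proof -
  have w: "weak_deriv \<Omega> (\<lambda>x. u (t, x)) (\<lambda>x. ux (t, x))"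
    using derivs t unfolding x_derivatives_def curry_def by blast
  have c: "continuous_on \<Omega> (\<lambda>x. u (t, x))"
    by (rule continuous_on_subset[OF u_slice_cont]) (use t in auto)
  have sub: "{x..y} \<subseteq> \<Omega>" using xy by auto
  have i: "set_integrable lborel {x..y} (\<lambda>x. ux (t, x))"
    using w sub unfolding weak_deriv_def loc_integrable_def by blast
  have "u (t, y) - u (t, x) = (LINT s:{x..y}|lborel. ux (t, s))"
    by (rule weak_deriv_FTC[OF _ c w xy(2) sub]) simp
  also have "\<bar>\<dots>\<bar> \<le> (LINT s:{x..y}|lborel. \<bar>ux (t, s)\<bar>)"
    unfolding set_lebesgue_integral_def by (rule order_trans[OF integral_abs_bound]) (simp add: abs_mult)
  finally have le: "\<bar>u (t, y) - u (t, x)\<bar> \<le> (LINT s:{x..y}|lborel. \<bar>ux (t, s)\<bar>)" .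
  have j: "set_integrable lborel \<Omega> (\<lambda>s. (1 + (ux (t, s))\<^sup>2) / 2)"
    by (intro set_integrable_divide set_integral_add(1) set_integrable_const_Ioo ux_energy t)
  have "(LINT s:{x..y}|lborel. \<bar>ux (t, s)\<bar>) \<le> (LINT s:\<Omega>|lborel. (1 + (ux (t, s))\<^sup>2) / 2)"
    unfolding set_lebesgue_integral_def
  proof (rule integral_mono)
    show "integrable lborel (\<lambda>s. indicator {x..y} s *\<^sub>R \<bar>ux (t, s)\<bar>)"
      using set_integrable_abs[OF i] by (simp add: set_integrable_def)
    show "integrable lborel (\<lambda>s. indicator \<Omega> s *\<^sub>R ((1 + (ux (t, s))\<^sup>2) / 2))"
      using j by (simp add: set_integrable_def)
    fix s
    have "0 \<le> (\<bar>ux (t, s)\<bar> - 1)\<^sup>2" by simp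
    then have "\<bar>ux (t, s)\<bar> \<le> (1 + (ux (t, s))\<^sup>2) / 2" by (simp add: power2_diff)
    then show "indicator {x..y} s *\<^sub>R \<bar>ux (t, s)\<bar> \<le> indicator \<Omega> s *\<^sub>R ((1 + (ux (t, s))\<^sup>2) / 2)"
      using sub by (auto simp: indicator_def)
  qed
  also have "\<dots> = ((LINT s:\<Omega>|lborel. 1) + (LINT s:\<Omega>|lborel. (ux (t, s))\<^sup>2)) / 2"
    using set_integral_add(2)[OF set_integrable_const_Ioo[of a b 1] ux_energy(1)[OF t]] by simp
  also have "\<dots> \<le> ((b - a) + E0) / 2"
    using ux_energy(2)[OF t] ab by (simp add: set_lebesgue_integral_def)
  finally show ?thesis using le by simp
qed

text \<open>Averaging the oscillation bound over \<open>y\<close> brings in the conserved mass. The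
  estimate is made at interior points, and continuity extends it to the end points.\<close>

lemma u_bound:
  assumes t: "0 < t" and x: "x \<in> {a..b}"
  shows "u (t, x) \<le> S0"
proof (rule continuous_le_on_closure[of \<Omega> "\<lambda>x. u (t, x)"])
  show "continuous_on (closure \<Omega>) (\<lambda>x. u (t, x))" using u_slice_cont[of t] t ab by simp
  show "x \<in> closure \<Omega>" using x ab by simp
  fix x assume x: "x \<in> \<Omega>"
  let ?K = "((b - a) + E0) / 2"
  have ui: "set_integrable lborel \<Omega> (\<lambda>y. u (t, y))"
    using t by (intro set_integrable_continuous_Ioo u_slice_cont) simp
  have "(LINT y:\<Omega>|lborel. u (t, x)) \<le> (LINT y:\<Omega>|lborel. u (t, y) + ?K)"
  proof (rule set_integral_mono)
    show "set_integrable lborel \<Omega> (\<lambda>y. u (t, x))" by (rule set_integrable_const_Ioo)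
    show "set_integrable lborel \<Omega> (\<lambda>y. u (t, y) + ?K)" by (intro set_integral_add(1) ui set_integrable_const_Ioo)
    fix y assume y: "y \<in> \<Omega>"
    have "\<bar>u (t, y) - u (t, x)\<bar> \<le> ?K"
    proof (cases "x \<le> y")
      case True
      then show ?thesis using u_increment[OF t] x y by auto
    next
      case False
      then have "\<bar>u (t, x) - u (t, y)\<bar> \<le> ?K" using u_increment[OF t, of y x] x y by auto
      then show ?thesis by (simp only: abs_minus_commute)
    qed
    then show "u (t, x) \<le> u (t, y) + ?K" by linarith
  qed
  also have "\<dots> = 1 + (LINT y:\<Omega>|lborel. ?K)"
    using set_integral_add(2)[OF ui set_integrable_const_Ioo] pii[unfolded prop_ii_def] t mass by simp
  finally have "(b - a) * u (t, x) \<le> 1 + (b - a) * ?K" using ab by (simp add: set_lebesgue_integral_def)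
  then have "u (t, x) \<le> (1 + (b - a) * ?K) / (b - a)" using ab by (simp add: pos_le_divide_eq mult.commute)
  also have "\<dots> = 1 / (b - a) + ?K" using ab by (simp add: add_divide_distrib)
  finally show "u (t, x) \<le> S0" by (simp add: S0_def)
qed

lemma rho_bounds: "0 < t \<Longrightarrow> x \<in> {a..b} \<Longrightarrow> 0 \<le> rho n \<epsilon> u (t, x) \<and> rho n \<epsilon> u (t, x) \<le> C\<rho>"
  unfolding rho_def C\<rho>_def using B_eps_bounds[OF eps _ u_bound S0_ge] u_nonneg by auto

lemma rho_cont: "continuous_on ({0..} \<times> {a..b}) (rho n \<epsilon> u)"
  unfolding rho_def[abs_def]
  by (rule continuous_on_compose2[OF B_eps_continuous[OF eps] u_cont]) (use u_nonneg in auto)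

lemma rho_slice_cont: "0 \<le> t \<Longrightarrow> continuous_on {a..b} (\<lambda>x. rho n \<epsilon> u (t, x))"
  by (rule continuous_on_compose2[OF rho_cont]) (auto intro!: continuous_intros)

lemma rho_bounded_densities:
  "0 < t \<Longrightarrow> distr_of \<Omega> (\<lambda>x. rho n \<epsilon> u (t, x)) \<in> bounded_densities a b C\<rho>"
  unfolding bounded_densities_def using rho_slice_cont[of t] rho_bounds[of t] by fastforce

section \<open>The densities representing the time derivative\<close>

lemma Q_borel [measurable]: "{0<..<\<tau> :: real} \<times> \<Omega> \<in> sets borel"
  by (intro borel_open open_Times) auto

lemma cont_measurable_Q:
  fixes f :: "real \<times> real \<Rightarrow> real"
  assumes "continuous_on ({0..} \<times> {a..b}) f"
  shows "(\<lambda>z. indicator ({0<..<\<tau>} \<times> \<Omega>) z * f z) \<in> borel_measurable borel"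
proof -
  have "continuous_on ({0<..<\<tau>} \<times> \<Omega>) f" by (rule continuous_on_subset[OF assms]) auto
  from borel_measurable_continuous_on_indicator[OF Q_borel this] show ?thesis by simp
qed

text \<open>In the representation
  \<open>\<partial>\<rho>/\<partial>t = f0 + \<partial>f1/\<partial>x\<close>, \<open>f0\<close> is
  the entropy dissipation density and \<open>f1\<close> the total flux. The part \<open>f2\<close>
  of the flux comes from rewriting \<open>T\<close>; its coefficient \<open>1/3\<close> is
  \<open>5/6\<close> from the given formula for \<open>T\<close> minus \<open>1/2\<close> returned
  by the integration by parts.\<close>

definition "f0 = on_pos u (\<lambda>z. u z * (uxx z)\<^sup>2)"
definition "mixed = on_pos u (\<lambda>z. u z * ux z * uxx z)"
definition "f2 = (\<lambda>z. 1 / 3 * (ux z) ^ 3 - mixed z)"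
definition "f1 = (\<lambda>z. R_eps n \<epsilon> u uxxx z + f2 z)"

lemma f0_integrable: "0 < \<tau> \<Longrightarrow> set_integrable lborel ({0<..<\<tau>} \<times> \<Omega>) f0"
  using piv unfolding prop_iv_def f0_def by blast

lemma f0_nonneg: "z \<in> {0..} \<times> {a..b} \<Longrightarrow> 0 \<le> f0 z"
  by (simp add: f0_def on_pos_def)

text \<open>The entropy inequality bounds the dissipation by the entropy at time
  \<open>\<tau>\<close>, because the initial entropy is nonnegative.\<close>

lemma f0_L1: "0 < \<tau> \<Longrightarrow> (LINT z:{0<..<\<tau>} \<times> \<Omega>|lborel. f0 z) \<le> C\<rho> * (b - a)"
proof -
  assume \<tau>: "0 < \<tau>"
  have nn: "0 \<le> (LINT x:\<Omega>|lborel. rho n \<epsilon> u (0, x))"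
    unfolding set_lebesgue_integral_def rho_def B_eps_def
    by (intro Bochner_Integration.integral_nonneg) (simp add: B_nonneg)
  have "(LINT z:{0<..<\<tau>} \<times> \<Omega>|lborel. f0 z) \<le> (LINT x:\<Omega>|lborel. rho n \<epsilon> u (\<tau>, x)) - (LINT x:\<Omega>|lborel. rho n \<epsilon> u (0, x))"
    using piv \<tau> unfolding prop_iv_def f0_def by (simp add: algebra_simps)
  also have "\<dots> \<le> (LINT x:\<Omega>|lborel. rho n \<epsilon> u (\<tau>, x))" using nn by simp
  also have "\<dots> \<le> (LINT x:\<Omega>|lborel. C\<rho>)"
    using \<tau> rho_bounds[OF \<tau>]
    by (intro set_integral_mono set_integrable_continuous_Ioo rho_slice_cont set_integrable_const_Ioo) auto
  also have "\<dots> = C\<rho> * (b - a)" using ab by (simp add: set_lebesgue_integral_def)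
  finally show ?thesis .
qed

text \<open>Three almost-everywhere facts meet here: the classical derivative with its boundary
  values, the second weak derivative on the positivity set, and the finiteness of the dissipation at
  time \<open>t\<close>, which is Fubini applied to \<open>f0\<close>.\<close>

lemma slice_AE:
  assumes \<tau>: "0 < \<tau>"
  shows "AE t in lborel. t \<in> {0<..<\<tau>} \<longrightarrow>
    (\<exists>g. slice a b (\<lambda>x. u (t, x)) g (\<lambda>x. ux (t, x)) (\<lambda>x. uxx (t, x)))"
proof -
  have 1: "AE t in lborel. t \<in> {0<..<\<tau>} \<longrightarrow> (\<exists>g. continuous_on {a..b} g \<and> g a = 0 \<and> g b = 0 \<and>
           (\<forall>x\<in>{a..b}. (curry u t has_real_derivative g x) (at x within {a..b})))"
    using p\<tau>[OF \<tau>] unfolding prop_v_def by blast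
  have 2: "AE t in lborel. t > 0 \<longrightarrow>
        weak_deriv {x \<in> \<Omega>. u (t, x) > 0} (curry ux t) (curry uxx t) \<and>
        weak_deriv {x \<in> \<Omega>. u (t, x) > 0} (curry uxx t) (curry uxxx t)"
    using derivs unfolding x_derivatives_def by blast
  show ?thesis
    using 1 2 set_integrable_prodD(1)[OF f0_integrable[OF \<tau>]]
  proof (eventually_elim, intro impI)
    fix t assume A: "t \<in> {0<..<\<tau>} \<longrightarrow> (\<exists>g. continuous_on {a..b} g \<and> g a = 0 \<and> g b = 0 \<and>
           (\<forall>x\<in>{a..b}. (curry u t has_real_derivative g x) (at x within {a..b})))"
      "t > 0 \<longrightarrow> weak_deriv {x \<in> \<Omega>. u (t, x) > 0} (curry ux t) (curry uxx t) \<and>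
        weak_deriv {x \<in> \<Omega>. u (t, x) > 0} (curry uxx t) (curry uxxx t)"
      "t \<in> {0<..<\<tau>} \<longrightarrow> set_integrable lborel \<Omega> (\<lambda>x. f0 (t, x))"
      and t: "t \<in> {0<..<\<tau>}"
    then obtain g where g: "continuous_on {a..b} g" "g a = 0" "g b = 0"
      "\<And>x. x \<in> {a..b} \<Longrightarrow> (curry u t has_real_derivative g x) (at x within {a..b})" by blast
    have "slice a b (\<lambda>x. u (t, x)) g (\<lambda>x. ux (t, x)) (\<lambda>x. uxx (t, x))"
    proof
      show "weak_deriv \<Omega> (\<lambda>x. u (t, x)) (\<lambda>x. ux (t, x))"
        using derivs t unfolding x_derivatives_def curry_def by auto
      show "weak_deriv {x \<in> \<Omega>. 0 < u (t, x)} (\<lambda>x. ux (t, x)) (\<lambda>x. uxx (t, x))"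
        using A(2) t unfolding curry_def by auto
      show "set_integrable lborel \<Omega> (\<lambda>x. if 0 < u (t, x) then u (t, x) * (uxx (t, x))\<^sup>2 else 0)"
        using A(3) t by (simp add: f0_def on_pos_def)
      show "(\<lambda>x. ux (t, x)) \<in> borel_measurable borel" "(\<lambda>x. uxx (t, x)) \<in> borel_measurable borel"
        by (rule slice_measurable deriv_measurable)+
    qed (use ab g t u_nonneg in \<open>auto simp: curry_def\<close>)
    then show "\<exists>g. slice a b (\<lambda>x. u (t, x)) g (\<lambda>x. ux (t, x)) (\<lambda>x. uxx (t, x))" by blast
  qed
qed

definition "dissip t = (LINT x:\<Omega>|lborel. f0 (t, x))"

lemma dissip_integrable: "0 < \<tau> \<Longrightarrow> set_integrable lborel {0<..<\<tau>} dissip"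
  and dissip_integral: "0 < \<tau> \<Longrightarrow> (LINT t:{0<..<\<tau>}|lborel. dissip t) \<le> C\<rho> * (b - a)"
  unfolding dissip_def[abs_def] using set_integrable_prodD(2,3)[OF f0_integrable] f0_L1 by auto

lemma u_ux2_le:
  assumes "0 < t" and i: "set_integrable lborel \<Omega> (\<lambda>x. u (t, x) * (ux (t, x))\<^sup>2)"
  shows "(LINT x:\<Omega>|lborel. u (t, x) * (ux (t, x))\<^sup>2) \<le> S0 * E0"
proof -
  have "(LINT x:\<Omega>|lborel. u (t, x) * (ux (t, x))\<^sup>2) \<le> (LINT x:\<Omega>|lborel. S0 * (ux (t, x))\<^sup>2)"
    by (intro set_integral_mono i set_integrable_mult_right ux_energy(1) assms(1) mult_right_mono u_bound) auto
  also have "\<dots> = S0 * (LINT x:\<Omega>|lborel. (ux (t, x))\<^sup>2)" by simp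
  also have "\<dots> \<le> S0 * E0" using S0_ge ux_energy(2)[OF assms(1)] by (intro mult_left_mono) auto
  finally show ?thesis .
qed

lemma slice_bounds:
  assumes \<tau>: "0 < \<tau>"
  shows "AE t in lborel. t \<in> {0<..<\<tau>} \<longrightarrow> set_integrable lborel \<Omega> (\<lambda>x. (ux (t, x)) ^ 3) \<and>
      (LINT x:\<Omega>|lborel. \<bar>(ux (t, x)) ^ 3\<bar>) \<le> dissip t + S0 * E0"
    and "AE t in lborel. t \<in> {0<..<\<tau>} \<longrightarrow> set_integrable lborel \<Omega> (\<lambda>x. mixed (t, x)) \<and>
      (LINT x:\<Omega>|lborel. \<bar>mixed (t, x)\<bar>) \<le> (dissip t + S0 * E0) / 2"
    and "AE t in lborel. t \<in> {0<..<\<tau>} \<longrightarrow> (\<forall>\<phi>. smooth \<phi> \<longrightarrow>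
      (LINT x:\<Omega>|lborel. u (t, x) * (ux (t, x))\<^sup>2 * deriv (deriv \<phi>) x) =
      - (LINT x:\<Omega>|lborel. (ux (t, x)) ^ 3 * deriv \<phi> x) - 2 * (LINT x:\<Omega>|lborel. mixed (t, x) * deriv \<phi> x))"
proof -
  have m: "mixed (t, x) = (if 0 < u (t, x) then u (t, x) * ux (t, x) * uxx (t, x) else 0)" for t x
    by (simp add: mixed_def on_pos_def)
  have ds: "dissip t = (LINT x:\<Omega>|lborel. if 0 < u (t, x) then u (t, x) * (uxx (t, x))\<^sup>2 else 0)" for t
    by (simp add: dissip_def f0_def on_pos_def)
  show "AE t in lborel. t \<in> {0<..<\<tau>} \<longrightarrow> set_integrable lborel \<Omega> (\<lambda>x. (ux (t, x)) ^ 3) \<and>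
      (LINT x:\<Omega>|lborel. \<bar>(ux (t, x)) ^ 3\<bar>) \<le> dissip t + S0 * E0"
    using slice_AE[OF \<tau>]
  proof (eventually_elim, intro impI)
    fix t assume "t \<in> {0<..<\<tau>} \<longrightarrow> (\<exists>g. slice a b (\<lambda>x. u (t, x)) g (\<lambda>x. ux (t, x)) (\<lambda>x. uxx (t, x)))" and t: "t \<in> {0<..<\<tau>}"
    then obtain g where "slice a b (\<lambda>x. u (t, x)) g (\<lambda>x. ux (t, x)) (\<lambda>x. uxx (t, x))" by blast
    then interpret slice a b "\<lambda>x. u (t, x)" g "\<lambda>x. ux (t, x)" "\<lambda>x. uxx (t, x)" .
    show "set_integrable lborel \<Omega> (\<lambda>x. (ux (t, x)) ^ 3) \<and> (LINT x:\<Omega>|lborel. \<bar>(ux (t, x)) ^ 3\<bar>) \<le> dissip t + S0 * E0"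
      using cubic_bound u_ux2_le[OF _ w_wx2(2)] t by (simp add: ds power_abs)
  qed
  show "AE t in lborel. t \<in> {0<..<\<tau>} \<longrightarrow> set_integrable lborel \<Omega> (\<lambda>x. mixed (t, x)) \<and>
      (LINT x:\<Omega>|lborel. \<bar>mixed (t, x)\<bar>) \<le> (dissip t + S0 * E0) / 2"
    using slice_AE[OF \<tau>]
  proof (eventually_elim, intro impI)
    fix t assume "t \<in> {0<..<\<tau>} \<longrightarrow> (\<exists>g. slice a b (\<lambda>x. u (t, x)) g (\<lambda>x. ux (t, x)) (\<lambda>x. uxx (t, x)))" and t: "t \<in> {0<..<\<tau>}"
    then obtain g where "slice a b (\<lambda>x. u (t, x)) g (\<lambda>x. ux (t, x)) (\<lambda>x. uxx (t, x))" by blast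
    then interpret slice a b "\<lambda>x. u (t, x)" g "\<lambda>x. ux (t, x)" "\<lambda>x. uxx (t, x)" .
    show "set_integrable lborel \<Omega> (\<lambda>x. mixed (t, x)) \<and> (LINT x:\<Omega>|lborel. \<bar>mixed (t, x)\<bar>) \<le> (dissip t + S0 * E0) / 2"
      using mixed_integrable mixed_bound u_ux2_le[OF _ w_wx2(2)] t unfolding m ds by simp
  qed
  show "AE t in lborel. t \<in> {0<..<\<tau>} \<longrightarrow> (\<forall>\<phi>. smooth \<phi> \<longrightarrow>
      (LINT x:\<Omega>|lborel. u (t, x) * (ux (t, x))\<^sup>2 * deriv (deriv \<phi>) x) =
      - (LINT x:\<Omega>|lborel. (ux (t, x)) ^ 3 * deriv \<phi> x) - 2 * (LINT x:\<Omega>|lborel. mixed (t, x) * deriv \<phi> x))"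
    using slice_AE[OF \<tau>]
  proof (eventually_elim, intro impI allI)
    fix t and \<phi> :: "real \<Rightarrow> real"
    assume "t \<in> {0<..<\<tau>} \<longrightarrow> (\<exists>g. slice a b (\<lambda>x. u (t, x)) g (\<lambda>x. ux (t, x)) (\<lambda>x. uxx (t, x)))"
      and t: "t \<in> {0<..<\<tau>}" and \<phi>: "smooth \<phi>"
    then obtain g where "slice a b (\<lambda>x. u (t, x)) g (\<lambda>x. ux (t, x)) (\<lambda>x. uxx (t, x))" by blast
    then interpret slice a b "\<lambda>x. u (t, x)" g "\<lambda>x. ux (t, x)" "\<lambda>x. uxx (t, x)" .
    show "(LINT x:\<Omega>|lborel. u (t, x) * (ux (t, x))\<^sup>2 * deriv (deriv \<phi>) x) =
      - (LINT x:\<Omega>|lborel. (ux (t, x)) ^ 3 * deriv \<phi> x) - 2 * (LINT x:\<Omega>|lborel. mixed (t, x) * deriv \<phi> x)"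
      using second_order_term[OF \<phi>] unfolding m .
  qed
qed

lemma mixed_measurable_Q: "set_borel_measurable lborel ({0<..<\<tau>} \<times> \<Omega>) mixed"
proof -
  have [measurable]: "(\<lambda>z. indicator ({0<..<\<tau>} \<times> \<Omega>) z * u z) \<in> borel_measurable borel"
    by (rule cont_measurable_Q[OF u_cont])
  have "(\<lambda>z. indicator ({0<..<\<tau>} \<times> \<Omega>) z *\<^sub>R mixed z) =
      (\<lambda>z. if 0 < indicator ({0<..<\<tau>} \<times> \<Omega>) z * u z then indicator ({0<..<\<tau>} \<times> \<Omega>) z * u z * ux z * uxx z else 0)"
    by (auto simp: mixed_def on_pos_def indicator_def fun_eq_iff)
  then show ?thesis unfolding set_borel_measurable_def by (simp only: measurable_lborel2) measurable
qed

lemma bound_integrable: "0 < \<tau> \<Longrightarrow> set_integrable lborel {0<..<\<tau>} (\<lambda>t. dissip t + S0 * E0)"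
  by (intro set_integral_add(1) dissip_integrable set_integrable_const_Ioo)

lemma bound_integral: "0 < \<tau> \<Longrightarrow> (LINT t:{0<..<\<tau>}|lborel. dissip t + S0 * E0) \<le> C\<rho> * (b - a) + S0 * E0 * \<tau>"
  using set_integral_add(2)[OF dissip_integrable set_integrable_const_Ioo, of \<tau> "S0 * E0"] dissip_integral[of \<tau>]
  by (simp add: set_lebesgue_integral_def mult.commute)

lemma cubic_integrable:
  assumes \<tau>: "0 < \<tau>"
  shows "set_integrable lborel ({0<..<\<tau>} \<times> \<Omega>) (\<lambda>z. (ux z) ^ 3)"
proof (rule set_integrable_prodI[OF _ _ slice_bounds(1)[OF \<tau>] bound_integrable[OF \<tau>]])
  show "set_borel_measurable lborel ({0<..<\<tau>} \<times> \<Omega>) (\<lambda>z. (ux z) ^ 3)"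
    using Q_borel unfolding set_borel_measurable_def by simp
qed simp

lemma mixed_integrable_Q:
  assumes \<tau>: "0 < \<tau>"
  shows "set_integrable lborel ({0<..<\<tau>} \<times> \<Omega>) mixed"
  by (rule set_integrable_prodI[OF mixed_measurable_Q _ slice_bounds(2)[OF \<tau>] set_integrable_divide[OF bound_integrable[OF \<tau>]]]) simp

lemma f2_integrable: "0 < \<tau> \<Longrightarrow> set_integrable lborel ({0<..<\<tau>} \<times> \<Omega>) f2"
  unfolding f2_def by (intro set_integral_diff(1) set_integrable_mult_right cubic_integrable mixed_integrable_Q)

lemma f2_L1:
  assumes \<tau>: "0 < \<tau>"
  shows "L1_norm ({0<..<\<tau>} \<times> \<Omega>) f2 \<le> C\<rho> * (b - a) + S0 * E0 * \<tau>"
proof -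
  let ?I = "{0<..<\<tau>}"
  have i: "set_integrable lborel (?I \<times> \<Omega>) (\<lambda>z. \<bar>f2 z\<bar>)" by (intro set_integrable_abs f2_integrable \<tau>)
  have "L1_norm (?I \<times> \<Omega>) f2 = (LINT t:?I|lborel. LINT x:\<Omega>|lborel. \<bar>f2 (t, x)\<bar>)"
    unfolding L1_norm_def by (rule set_integrable_prodD(3)[OF i])
  also have "\<dots> \<le> (LINT t:?I|lborel. dissip t + S0 * E0)"
  proof (rule set_integral_mono_AE[OF set_integrable_prodD(2)[OF i] bound_integrable[OF \<tau>]])
    show "AE t\<in>?I in lborel. (LINT x:\<Omega>|lborel. \<bar>f2 (t, x)\<bar>) \<le> dissip t + S0 * E0"
      using slice_bounds(1)[OF \<tau>] slice_bounds(2)[OF \<tau>]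
    proof (eventually_elim, intro impI)
      fix t assume A: "t \<in> ?I \<longrightarrow> set_integrable lborel \<Omega> (\<lambda>x. (ux (t, x)) ^ 3) \<and>
          (LINT x:\<Omega>|lborel. \<bar>(ux (t, x)) ^ 3\<bar>) \<le> dissip t + S0 * E0"
        "t \<in> ?I \<longrightarrow> set_integrable lborel \<Omega> (\<lambda>x. mixed (t, x)) \<and>
          (LINT x:\<Omega>|lborel. \<bar>mixed (t, x)\<bar>) \<le> (dissip t + S0 * E0) / 2" and t: "t \<in> ?I"
      have i1: "set_integrable lborel \<Omega> (\<lambda>x. 1 / 3 * \<bar>(ux (t, x)) ^ 3\<bar>)"
        and i2: "set_integrable lborel \<Omega> (\<lambda>x. \<bar>mixed (t, x)\<bar>)"
        using A t by (auto intro!: set_integrable_mult_right set_integrable_abs)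
      have i3: "set_integrable lborel \<Omega> (\<lambda>x. \<bar>f2 (t, x)\<bar>)"
        unfolding f2_def using A t by (intro set_integrable_abs set_integral_diff(1) set_integrable_mult_right) auto
      have "(LINT x:\<Omega>|lborel. \<bar>f2 (t, x)\<bar>) \<le> (LINT x:\<Omega>|lborel. 1 / 3 * \<bar>(ux (t, x)) ^ 3\<bar> + \<bar>mixed (t, x)\<bar>)"
      proof (rule set_integral_mono[OF i3 set_integral_add(1)[OF i1 i2]])
        fix x
        have "\<bar>1 / 3 * (ux (t, x)) ^ 3\<bar> = 1 / 3 * \<bar>(ux (t, x)) ^ 3\<bar>" by (simp add: abs_mult)
        then show "\<bar>f2 (t, x)\<bar> \<le> 1 / 3 * \<bar>(ux (t, x)) ^ 3\<bar> + \<bar>mixed (t, x)\<bar>"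
          unfolding f2_def using abs_triangle_ineq4[of "1 / 3 * (ux (t, x)) ^ 3" "mixed (t, x)"] by linarith
      qed
      also have "\<dots> = 1 / 3 * (LINT x:\<Omega>|lborel. \<bar>(ux (t, x)) ^ 3\<bar>) + (LINT x:\<Omega>|lborel. \<bar>mixed (t, x)\<bar>)"
        using set_integral_add(2)[OF i1 i2] by simp
      also have "\<dots> \<le> 1 / 3 * (dissip t + S0 * E0) + (dissip t + S0 * E0) / 2"
        using A t by (intro add_mono mult_left_mono) auto
      \<comment> \<open>The coefficients add up to \<open>5/6\<close>. Rounding up to
        \<open>1\<close> uses that the bound is nonnegative, since it dominates the integral of an
        absolute value.\<close>
      also have "\<dots> \<le> dissip t + S0 * E0"
      proof -
        have "0 \<le> (LINT x:\<Omega>|lborel. \<bar>(ux (t, x)) ^ 3\<bar>)"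
          unfolding set_lebesgue_integral_def by (intro Bochner_Integration.integral_nonneg) simp
        then have "0 \<le> dissip t + S0 * E0" using A(1) t by force
        then have "1 / 3 * X + X / 2 \<le> X" if "X = dissip t + S0 * E0" for X using that by linarith
        then show ?thesis by blast
      qed
      finally show "(LINT x:\<Omega>|lborel. \<bar>f2 (t, x)\<bar>) \<le> dissip t + S0 * E0" .
    qed
  qed
  also have "\<dots> \<le> C\<rho> * (b - a) + S0 * E0 * \<tau>" by (rule bound_integral[OF \<tau>])
  finally show ?thesis .
qed

definition "K\<^sub>R = (1 + 9 / n\<^sup>2) * (1 + S0) / ln 2"

text \<open>The square of the flux is at most \<open>K\<^sub>R\<close> times the energy dissipation
  density: \<open>u \<le> S0\<close> bounds the factor \<open>1 + u\<close>, and the division by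
  \<open>ln 2\<close> in \<open>K\<^sub>R\<close> pays for inserting
  \<open>\<bar>ln \<epsilon>\<bar> \<ge> ln 2\<close>. Then
  \<open>\<bar>R\<bar> \<le> 1 + R\<^sup>2\<close> is integrated over the bounded cylinder.\<close>

lemma R_bounds:
  assumes \<tau>: "0 < \<tau>"
  shows "set_integrable lborel ({0<..<\<tau>} \<times> \<Omega>) (R_eps n \<epsilon> u uxxx)"
    and "L1_norm ({0<..<\<tau>} \<times> \<Omega>) (R_eps n \<epsilon> u uxxx) \<le> \<tau> * (b - a) + K\<^sub>R * E0"
proof -
  let ?Q = "{0<..<\<tau>} \<times> \<Omega>"
  let ?P = "{z \<in> ?Q. u z > 0}"
  let ?e = "\<lambda>z. \<bar>ln \<epsilon>\<bar> * mobility n \<epsilon> (u z) * (uxxx z)\<^sup>2"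
  have L: "ln 2 \<le> \<bar>ln \<epsilon>\<bar>" "0 < ln (2::real)" using abs_ln_ge[OF eps] by auto
  have K: "0 \<le> K\<^sub>R" unfolding K\<^sub>R_def using S0_ge by simp
  have pw: "(R_eps n \<epsilon> u uxxx z)\<^sup>2 \<le> K\<^sub>R * (if u z > 0 then ?e z else 0)" if z: "z \<in> ?Q" for z
  proof (cases "u z > 0")
    case True
    have uz: "0 \<le> u z" "u z \<le> S0" using u_nonneg[of z] u_bound[of "fst z" "snd z"] z by (auto simp: mem_Times_iff)
    have mob: "0 \<le> mobility n \<epsilon> (u z)" using uz by (simp add: mobility_def)
    have "(R_factor \<epsilon> (u z))\<^sup>2 \<le> (1 + 9 / n\<^sup>2) * (1 + u z) * mobility n \<epsilon> (u z)" by (rule R_factor_bound[OF eps uz(1)])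
    also have "\<dots> \<le> (1 + 9 / n\<^sup>2) * (1 + S0) * mobility n \<epsilon> (u z)"
      using uz mob by (intro mult_right_mono mult_left_mono) auto
    also have "\<dots> = K\<^sub>R * (ln 2 * mobility n \<epsilon> (u z))" using L by (simp add: K\<^sub>R_def)
    also have "\<dots> \<le> K\<^sub>R * (\<bar>ln \<epsilon>\<bar> * mobility n \<epsilon> (u z))"
      using L mob K by (intro mult_left_mono mult_right_mono) auto
    finally have "(R_factor \<epsilon> (u z))\<^sup>2 * (uxxx z)\<^sup>2 \<le> K\<^sub>R * (\<bar>ln \<epsilon>\<bar> * mobility n \<epsilon> (u z)) * (uxxx z)\<^sup>2"
      by (intro mult_right_mono) auto
    then show ?thesis using True by (simp add: R_eps_eq power_mult_distrib mult.assoc)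
  next
    case False
    then show ?thesis by (simp add: R_eps_def on_pos_def)
  qed
  have eP: "(\<lambda>z. indicator ?P z *\<^sub>R ?e z) = (\<lambda>z. indicator ?Q z *\<^sub>R (if u z > 0 then ?e z else 0))"
    by (auto simp: indicator_def fun_eq_iff)
  have ei: "set_integrable lborel ?Q (\<lambda>z. if u z > 0 then ?e z else 0)"
    using ux_energy(4)[OF \<tau>] unfolding set_integrable_def eP .
  have el: "(LINT z:?Q|lborel. if u z > 0 then ?e z else 0) \<le> E0 / 2"
    using ux_energy(3)[OF \<tau>] unfolding set_lebesgue_integral_def eP .
  have one: "set_integrable lborel ?Q (\<lambda>_. 1 :: real)"
  proof -
    have "emeasure lborel ?Q < \<infinity>" by (rule emeasure_bounded_finite) (simp add: bounded_Times)
    then show ?thesis using Q_borel[of \<tau>] unfolding set_integrable_def by simp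
  qed
  have Rm: "set_borel_measurable lborel ?Q (R_eps n \<epsilon> u uxxx)"
  proof -
    have [measurable]: "R_factor \<epsilon> \<in> borel_measurable borel" by (rule R_factor_measurable[OF eps])
    have [measurable]: "(\<lambda>z. indicator ?Q z * u z) \<in> borel_measurable borel" by (rule cont_measurable_Q[OF u_cont])
    have "(\<lambda>z. indicator ?Q z *\<^sub>R R_eps n \<epsilon> u uxxx z) = (\<lambda>z. R_factor \<epsilon> (indicator ?Q z * u z) * uxxx z)"
      by (auto simp: R_eps_eq indicator_def fun_eq_iff R_factor_def)
    then show ?thesis unfolding set_borel_measurable_def by (simp only: measurable_lborel2) measurable
  qed
  have dom: "set_integrable lborel ?Q (\<lambda>z. 1 + K\<^sub>R * (if u z > 0 then ?e z else 0))"
    by (intro set_integral_add(1) one set_integrable_mult_right ei)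
  have ab_le: "\<bar>R_eps n \<epsilon> u uxxx z\<bar> \<le> 1 + K\<^sub>R * (if u z > 0 then ?e z else 0)" if z: "z \<in> ?Q" for z
  proof -
    have "0 \<le> (\<bar>R_eps n \<epsilon> u uxxx z\<bar> - 1)\<^sup>2" by simp
    then have "2 * \<bar>R_eps n \<epsilon> u uxxx z\<bar> \<le> 1 + (R_eps n \<epsilon> u uxxx z)\<^sup>2" by (simp add: power2_diff)
    then show ?thesis using pw[OF z] by (smt (verit) zero_le_power2)
  qed
  show Ri: "set_integrable lborel ?Q (R_eps n \<epsilon> u uxxx)"
  proof (rule set_integrable_bound[OF dom Rm], intro AE_I2 impI)
    fix z assume "z \<in> ?Q"
    from ab_le[OF this] show "norm (R_eps n \<epsilon> u uxxx z) \<le> norm (1 + K\<^sub>R * (if u z > 0 then ?e z else 0))"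
      unfolding real_norm_def by linarith
  qed
  have "L1_norm ?Q (R_eps n \<epsilon> u uxxx) \<le> (LINT z:?Q|lborel. 1 + K\<^sub>R * (if u z > 0 then ?e z else 0))"
    unfolding L1_norm_def by (rule set_integral_mono[OF set_integrable_abs[OF Ri] dom ab_le])
  also have "\<dots> = (LINT z:?Q|lborel. 1) + K\<^sub>R * (LINT z:?Q|lborel. if u z > 0 then ?e z else 0)"
    using set_integral_add(2)[OF one set_integrable_mult_right[OF ei, of K\<^sub>R]] by simp
  also have "(LINT z:?Q|lborel. 1) = \<tau> * (b - a)"
    using set_integrable_prodD(3)[OF one] \<tau> ab by (simp add: set_lebesgue_integral_def)
  also have "K\<^sub>R * (LINT z:?Q|lborel. if u z > 0 then ?e z else 0) \<le> K\<^sub>R * (E0 / 2)"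
    by (rule mult_left_mono[OF el K])
  also have "K\<^sub>R * (E0 / 2) \<le> K\<^sub>R * E0" using K E0_nonneg by (intro mult_left_mono) auto
  finally show "L1_norm ?Q (R_eps n \<epsilon> u uxxx) \<le> \<tau> * (b - a) + K\<^sub>R * E0" by simp
qed

lemma f1_integrable: "0 < \<tau> \<Longrightarrow> set_integrable lborel ({0<..<\<tau>} \<times> \<Omega>) f1"
  unfolding f1_def by (intro set_integral_add(1) R_bounds(1) f2_integrable)

text \<open>The sum of the bounds for \<open>f0\<close>, \<open>f2\<close> and \<open>R_eps\<close>.
  The term \<open>C\<rho> * (b - a)\<close> occurs twice: once for \<open>f0\<close>, once for the
  dissipation that bounds \<open>f2\<close>.\<close>

definition "M1 \<tau> = 2 * (C\<rho> * (b - a)) + S0 * E0 * \<tau> + \<tau> * (b - a) + K\<^sub>R * E0"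

lemma total_L1:
  assumes \<tau>: "0 < \<tau>"
  shows "L1_norm ({0<..<\<tau>} \<times> \<Omega>) f0 + L1_norm ({0<..<\<tau>} \<times> \<Omega>) f1 \<le> M1 \<tau>"
proof -
  let ?Q = "{0<..<\<tau>} \<times> \<Omega>"
  have "L1_norm ?Q f0 = (LINT z:?Q|lborel. f0 z)"
    unfolding L1_norm_def set_lebesgue_integral_def
  proof (intro Bochner_Integration.integral_cong refl)
    fix z show "indicator ?Q z *\<^sub>R \<bar>f0 z\<bar> = indicator ?Q z *\<^sub>R f0 z"
      using f0_nonneg[of z] by (cases "z \<in> ?Q") (auto simp: mem_Times_iff)
  qed
  moreover have "L1_norm ?Q f1 \<le> L1_norm ?Q (R_eps n \<epsilon> u uxxx) + L1_norm ?Q f2"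
  proof -
    have "L1_norm ?Q f1 \<le> (LINT z:?Q|lborel. \<bar>R_eps n \<epsilon> u uxxx z\<bar> + \<bar>f2 z\<bar>)"
      unfolding L1_norm_def using R_bounds(1)[OF \<tau>] f2_integrable[OF \<tau>] f1_integrable[OF \<tau>]
      by (intro set_integral_mono set_integral_add(1) set_integrable_abs) (auto simp: f1_def)
    also have "\<dots> = L1_norm ?Q (R_eps n \<epsilon> u uxxx) + L1_norm ?Q f2"
      unfolding L1_norm_def using R_bounds(1)[OF \<tau>] f2_integrable[OF \<tau>]
      by (intro set_integral_add(2) set_integrable_abs)
    finally show ?thesis .
  qed
  ultimately show ?thesis using f0_L1[OF \<tau>] f2_L1[OF \<tau>] R_bounds(2)[OF \<tau>] by (simp add: M1_def)
qed

text \<open>The estimate \<open>\<bar>T\<bar> \<le> ux\<^sup>2 + (u * uxxx)\<^sup>2\<close> gives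
  integrability on the cylinder, as Fubini requires below. No bound uniform in
  \<open>\<epsilon>\<close> is drawn from it; uniformity goes through the representation of
  \<open>T\<close> by \<open>f0\<close> and \<open>f2\<close>.\<close>

lemma T_integrable:
  assumes \<tau>: "0 < \<tau>"
  shows "set_integrable lborel ({0<..<\<tau>} \<times> \<Omega>) (T_eps u ux uxxx)"
proof -
  let ?Q = "{0<..<\<tau>} \<times> \<Omega>"
  let ?v = "on_pos u (\<lambda>z. u z * uxxx z)"
  have "?v \<in> Lp_on 2 ?Q" using p\<tau>[OF \<tau>] unfolding prop_i_def by blast
  then have v: "set_borel_measurable lborel ?Q ?v" "set_integrable lborel ?Q (\<lambda>z. (?v z)\<^sup>2)"
    unfolding Lp_on_def by auto
  have x: "set_integrable lborel ?Q (\<lambda>z. (ux z)\<^sup>2)"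
  proof (rule set_integrable_prodI[where m = "\<lambda>_. E0"])
    show "set_borel_measurable lborel ?Q (\<lambda>z. (ux z)\<^sup>2)"
      using Q_borel unfolding set_borel_measurable_def by simp
    show "AE t in lborel. t \<in> {0<..<\<tau>} \<longrightarrow> set_integrable lborel \<Omega> (\<lambda>x. (ux (t, x))\<^sup>2) \<and>
        (LINT x:\<Omega>|lborel. \<bar>(ux (t, x))\<^sup>2\<bar>) \<le> E0"
      using ux_energy(1,2) by (intro AE_I2) auto
  qed (auto intro: set_integrable_const_Ioo)
  have T: "T_eps u ux uxxx z = - ux z * ?v z" for z by (simp add: T_eps_def on_pos_def)
  show ?thesis
  proof (rule set_integrable_bound[OF set_integral_add(1)[OF x v(2)]])
    have "(\<lambda>z. indicator ?Q z *\<^sub>R T_eps u ux uxxx z) = (\<lambda>z. - ux z * (indicator ?Q z *\<^sub>R ?v z))"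
      by (simp add: T fun_eq_iff)
    then show "set_borel_measurable lborel ?Q (T_eps u ux uxxx)"
      using v(1) unfolding set_borel_measurable_def by simp
    show "AE z in lborel. z \<in> ?Q \<longrightarrow> norm (T_eps u ux uxxx z) \<le> norm ((ux z)\<^sup>2 + (?v z)\<^sup>2)"
    proof (intro AE_I2 impI)
      fix z
      have "0 \<le> (\<bar>ux z\<bar> - \<bar>?v z\<bar>)\<^sup>2" by simp
      then have "2 * (\<bar>ux z\<bar> * \<bar>?v z\<bar>) \<le> (ux z)\<^sup>2 + (?v z)\<^sup>2" by (simp add: power2_diff)
      moreover have "0 \<le> \<bar>ux z\<bar> * \<bar>?v z\<bar>" by simp
      ultimately show "norm (T_eps u ux uxxx z) \<le> norm ((ux z)\<^sup>2 + (?v z)\<^sup>2)" unfolding T real_norm_def abs_mult abs_minus_cancel by linarith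
    qed
  qed
qed

end

text \<open>A test function of \<open>x\<close> alone, seen as a function on space-time, need not
  have compact support, so its boundedness and continuity are used directly.\<close>

lemma set_integrable_mult_test_snd:
  fixes f :: "real \<times> real \<Rightarrow> real"
  assumes f: "set_integrable lborel A f" and \<psi>: "\<psi> \<in> test_functions V"
  shows "set_integrable lborel A (\<lambda>z. f z * \<psi> (snd z))"
proof -
  obtain M where M: "0 < M" "\<And>z. \<bar>\<psi> z\<bar> \<le> M" using test_functions_bounded[OF \<psi>] by metis
  have m1: "(\<lambda>z. indicator A z * f z) \<in> borel_measurable borel"
    using f borel_measurable_integrable unfolding set_integrable_def by fastforce
  have m2: "(\<lambda>z :: real \<times> real. \<psi> (snd z)) \<in> borel_measurable borel"
    by (intro borel_measurable_continuous_onI continuous_on_compose2[OF test_functions_continuous[OF \<psi>]] continuous_intros) auto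
  show ?thesis
  proof (rule set_integrable_bound[OF set_integrable_mult_right[OF f, of M]])
    show "set_borel_measurable lborel A (\<lambda>z. f z * \<psi> (snd z))"
      using borel_measurable_times[OF m1 m2] unfolding set_borel_measurable_def by (simp add: mult.assoc)
    show "AE z in lborel. z \<in> A \<longrightarrow> norm (f z * \<psi> (snd z)) \<le> norm (M * f z)"
    proof (intro AE_I2 impI)
      fix z
      have "\<bar>\<psi> (snd z)\<bar> * \<bar>f z\<bar> \<le> M * \<bar>f z\<bar>" by (rule mult_right_mono[OF M(2)]) simp
      then show "norm (f z * \<psi> (snd z)) \<le> norm (M * f z)" using M(1) by (simp add: abs_mult mult.commute)
    qed
  qed
qed

section \<open>The distributional equation for the entropy density\<close>

context thin_film
begin

lemma rho_Phi_integrable: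
  assumes "\<Phi> \<in> test_functions V"
  shows "set_integrable lborel ({0<..<\<tau>} \<times> \<Omega>) (\<lambda>z. rho n \<epsilon> u z * \<Phi> z)"
proof (rule set_integrable_mult_test[OF _ assms])
  let ?Q = "{0<..<\<tau>} \<times> \<Omega>"
  have "emeasure lborel ?Q < \<infinity>" by (rule emeasure_bounded_finite) (simp add: bounded_Times)
  then have c: "set_integrable lborel ?Q (\<lambda>_. C\<rho>)" using Q_borel[of \<tau>] unfolding set_integrable_def by simp
  show "set_integrable lborel ?Q (rho n \<epsilon> u)"
  proof (rule set_integrable_bound[OF c])
    show "set_borel_measurable lborel ?Q (rho n \<epsilon> u)"
      using cont_measurable_Q[OF rho_cont] unfolding set_borel_measurable_def by simp
    show "AE z in lborel. z \<in> ?Q \<longrightarrow> norm (rho n \<epsilon> u z) \<le> norm C\<rho>"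
    proof (intro AE_I2 impI)
      fix z assume "z \<in> ?Q"
      then have "0 \<le> rho n \<epsilon> u z \<and> rho n \<epsilon> u z \<le> C\<rho>"
        using rho_bounds[of "fst z" "snd z"] by (auto simp: mem_Times_iff)
      then show "norm (rho n \<epsilon> u z) \<le> norm C\<rho>" by simp
    qed
  qed
qed

text \<open>The term with two derivatives on the test function has weight \<open>-1/2\<close> and
  becomes \<open>+1/2\<close> of the cubic term plus the full mixed term, so
  \<open>-5/6 + 1/2 = -1/3\<close> of the cubic term remains. The quantifier over test functions
  stands inside the almost-everywhere statements, as it must: the slice of \<open>\<Phi>\<close>
  changes with \<open>t\<close>.\<close>

lemma T_slice_identity:
  assumes \<tau>: "0 < \<tau>" and \<Phi>: "\<Phi> \<in> test_functions ({0<..<\<tau>} \<times> \<Omega>)"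
  shows "AE t in lborel. t \<in> {0<..<\<tau>} \<longrightarrow>
    (LINT x:\<Omega>|lborel. T_eps u ux uxxx (t, x) * \<Phi> (t, x)) =
    (LINT x:\<Omega>|lborel. f0 (t, x) * \<Phi> (t, x)) - (LINT x:\<Omega>|lborel. f2 (t, x) * partial_x \<Phi> (t, x))"
proof -
  have vi: "AE t in lborel. t \<in> {0<..<\<tau>} \<longrightarrow> (\<forall>\<phi>. smooth \<phi> \<longrightarrow>
        (LINT x:\<Omega>|lborel. T_eps u ux uxxx (t, x) * \<phi> x)
        = (LINT x:\<Omega>|lborel. on_pos u (\<lambda>z. u z * (uxx z)\<^sup>2) (t, x) * \<phi> x)
          - 5/6 * (LINT x:\<Omega>|lborel. (ux (t, x)) ^ 3 * deriv \<phi> x)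
          - 1/2 * (LINT x:\<Omega>|lborel. u (t, x) * (ux (t, x))\<^sup>2 * deriv (deriv \<phi>) x))"
    using p\<tau>[OF \<tau>] unfolding prop_vi_def by blast
  show ?thesis
    using vi slice_bounds(1)[OF \<tau>] slice_bounds(2)[OF \<tau>] slice_bounds(3)[OF \<tau>]
  proof (eventually_elim, intro impI)
    fix t
    let ?\<phi> = "curry \<Phi> t"
    assume A1: "t \<in> {0<..<\<tau>} \<longrightarrow> (\<forall>\<phi>. smooth \<phi> \<longrightarrow>
        (LINT x:\<Omega>|lborel. T_eps u ux uxxx (t, x) * \<phi> x)
        = (LINT x:\<Omega>|lborel. on_pos u (\<lambda>z. u z * (uxx z)\<^sup>2) (t, x) * \<phi> x)
          - 5/6 * (LINT x:\<Omega>|lborel. (ux (t, x)) ^ 3 * deriv \<phi> x)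
          - 1/2 * (LINT x:\<Omega>|lborel. u (t, x) * (ux (t, x))\<^sup>2 * deriv (deriv \<phi>) x))"
      and A2: "t \<in> {0<..<\<tau>} \<longrightarrow> set_integrable lborel \<Omega> (\<lambda>x. (ux (t, x)) ^ 3) \<and>
          (LINT x:\<Omega>|lborel. \<bar>(ux (t, x)) ^ 3\<bar>) \<le> dissip t + S0 * E0"
      and A3: "t \<in> {0<..<\<tau>} \<longrightarrow> set_integrable lborel \<Omega> (\<lambda>x. mixed (t, x)) \<and>
          (LINT x:\<Omega>|lborel. \<bar>mixed (t, x)\<bar>) \<le> (dissip t + S0 * E0) / 2"
      and A4: "t \<in> {0<..<\<tau>} \<longrightarrow> (\<forall>\<phi>. smooth \<phi> \<longrightarrow>
          (LINT x:\<Omega>|lborel. u (t, x) * (ux (t, x))\<^sup>2 * deriv (deriv \<phi>) x) =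
          - (LINT x:\<Omega>|lborel. (ux (t, x)) ^ 3 * deriv \<phi> x) - 2 * (LINT x:\<Omega>|lborel. mixed (t, x) * deriv \<phi> x))"
      and t: "t \<in> {0<..<\<tau>}"
    have \<phi>: "?\<phi> \<in> test_functions \<Omega>" by (rule test_functions_slice[OF \<Phi>])
    note s = test_functions_smooth[OF \<phi>]
    have d: "deriv ?\<phi> x = partial_x \<Phi> (t, x)" for x by (rule deriv_slice[OF test_functions_smooth[OF \<Phi>]])
    let ?A = "LINT x:\<Omega>|lborel. (ux (t, x)) ^ 3 * deriv ?\<phi> x"
    let ?M = "LINT x:\<Omega>|lborel. mixed (t, x) * deriv ?\<phi> x"
    have i1: "set_integrable lborel \<Omega> (\<lambda>x. (ux (t, x)) ^ 3 * deriv ?\<phi> x)"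
      and i2: "set_integrable lborel \<Omega> (\<lambda>x. mixed (t, x) * deriv ?\<phi> x)"
      using A2 A3 t by (auto intro!: set_integrable_mult_test[OF _ test_functions_deriv[OF \<phi>]])
    have "(LINT x:\<Omega>|lborel. f2 (t, x) * deriv ?\<phi> x) = (LINT x:\<Omega>|lborel. 1 / 3 * ((ux (t, x)) ^ 3 * deriv ?\<phi> x) - mixed (t, x) * deriv ?\<phi> x)"
      by (simp add: f2_def left_diff_distrib)
    also have "\<dots> = 1 / 3 * ?A - ?M"
      using set_integral_diff(2)[OF set_integrable_mult_right[OF i1, of "1 / 3"] i2] by simp
    finally have f2: "(LINT x:\<Omega>|lborel. f2 (t, x) * deriv ?\<phi> x) = 1 / 3 * ?A - ?M" .
    have T: "(LINT x:\<Omega>|lborel. T_eps u ux uxxx (t, x) * ?\<phi> x) = (LINT x:\<Omega>|lborel. f0 (t, x) * ?\<phi> x) - 5 / 6 * ?A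
        - 1 / 2 * (LINT x:\<Omega>|lborel. u (t, x) * (ux (t, x))\<^sup>2 * deriv (deriv ?\<phi>) x)"
      using A1 t s unfolding f0_def by blast
    have U: "(LINT x:\<Omega>|lborel. u (t, x) * (ux (t, x))\<^sup>2 * deriv (deriv ?\<phi>) x) = - ?A - 2 * ?M"
      using A4 t s by blast
    have "(LINT x:\<Omega>|lborel. T_eps u ux uxxx (t, x) * ?\<phi> x) = (LINT x:\<Omega>|lborel. f0 (t, x) * ?\<phi> x) - (LINT x:\<Omega>|lborel. f2 (t, x) * deriv ?\<phi> x)"
      unfolding T U f2 by (simp add: algebra_simps)
    then show "(LINT x:\<Omega>|lborel. T_eps u ux uxxx (t, x) * \<Phi> (t, x)) =
        (LINT x:\<Omega>|lborel. f0 (t, x) * \<Phi> (t, x)) - (LINT x:\<Omega>|lborel. f2 (t, x) * partial_x \<Phi> (t, x))"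
      by (simp add: d)
  qed
qed

text \<open>The slice identity for \<open>T\<close> is integrated in time and inserted into
  \<open>\<partial>\<rho>/\<partial>t = T + \<partial>R/\<partial>x\<close>; \<open>R_eps\<close>
  and \<open>f2\<close> merge into the single flux \<open>f1\<close>.\<close>

lemma rho_equation:
  assumes \<tau>: "0 < \<tau>" and \<Phi>: "\<Phi> \<in> test_functions ({0<..<\<tau>} \<times> \<Omega>)"
  shows "- (LINT z:{0<..<\<tau>} \<times> \<Omega>|lborel. rho n \<epsilon> u z * partial_t \<Phi> z) =
    (LINT z:{0<..<\<tau>} \<times> \<Omega>|lborel. f0 z * \<Phi> z) - (LINT z:{0<..<\<tau>} \<times> \<Omega>|lborel. f1 z * partial_x \<Phi> z)"
proof -
  let ?I = "{0<..<\<tau>}"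
  let ?Q = "?I \<times> \<Omega>"
  have dx: "partial_x \<Phi> \<in> test_functions ?Q" by (rule test_functions_partial[OF \<Phi>]) (simp add: Basis_prod_def)
  note i0 = set_integrable_mult_test[OF f0_integrable[OF \<tau>] \<Phi>]
    and i2 = set_integrable_mult_test[OF f2_integrable[OF \<tau>] dx]
    and iR = set_integrable_mult_test[OF R_bounds(1)[OF \<tau>] dx]
    and iT = set_integrable_mult_test[OF T_integrable[OF \<tau>] \<Phi>]
  have "(LINT z:?Q|lborel. T_eps u ux uxxx z * \<Phi> z) = (LINT t:?I|lborel. LINT x:\<Omega>|lborel. T_eps u ux uxxx (t, x) * \<Phi> (t, x))"
    by (rule set_integrable_prodD(3)[OF iT])
  also have "\<dots> = (LINT t:?I|lborel. (LINT x:\<Omega>|lborel. f0 (t, x) * \<Phi> (t, x)) - (LINT x:\<Omega>|lborel. f2 (t, x) * partial_x \<Phi> (t, x)))"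
    unfolding set_lebesgue_integral_def[of lborel ?I]
  proof (rule integral_cong_AE)
    show "AE t in lborel. indicator ?I t *\<^sub>R (LINT x:\<Omega>|lborel. T_eps u ux uxxx (t, x) * \<Phi> (t, x)) =
        indicator ?I t *\<^sub>R ((LINT x:\<Omega>|lborel. f0 (t, x) * \<Phi> (t, x)) - (LINT x:\<Omega>|lborel. f2 (t, x) * partial_x \<Phi> (t, x)))"
      using T_slice_identity[OF \<tau> \<Phi>] by eventually_elim (auto simp: indicator_def)
    show "(\<lambda>t. indicator ?I t *\<^sub>R (LINT x:\<Omega>|lborel. T_eps u ux uxxx (t, x) * \<Phi> (t, x))) \<in> borel_measurable lborel"
      using set_integrable_prodD(2)[OF iT] unfolding set_integrable_def by (rule borel_measurable_integrable)
    show "(\<lambda>t. indicator ?I t *\<^sub>R ((LINT x:\<Omega>|lborel. f0 (t, x) * \<Phi> (t, x)) - (LINT x:\<Omega>|lborel. f2 (t, x) * partial_x \<Phi> (t, x)))) \<in> borel_measurable lborel"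
      using set_integral_diff(1)[OF set_integrable_prodD(2)[OF i0] set_integrable_prodD(2)[OF i2]]
      unfolding set_integrable_def by (rule borel_measurable_integrable)
  qed
  also have "\<dots> = (LINT z:?Q|lborel. f0 z * \<Phi> z) - (LINT z:?Q|lborel. f2 z * partial_x \<Phi> z)"
    using set_integral_diff(2)[OF set_integrable_prodD(2)[OF i0] set_integrable_prodD(2)[OF i2]]
    by (simp add: set_integrable_prodD(3)[OF i0] set_integrable_prodD(3)[OF i2])
  finally have T: "(LINT z:?Q|lborel. T_eps u ux uxxx z * \<Phi> z) = (LINT z:?Q|lborel. f0 z * \<Phi> z) - (LINT z:?Q|lborel. f2 z * partial_x \<Phi> z)" .
  have F: "(LINT z:?Q|lborel. f1 z * partial_x \<Phi> z) = (LINT z:?Q|lborel. R_eps n \<epsilon> u uxxx z * partial_x \<Phi> z) + (LINT z:?Q|lborel. f2 z * partial_x \<Phi> z)"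
    using set_integral_add(2)[OF iR i2] by (simp add: f1_def distrib_right)
  have "- (LINT z:?Q|lborel. rho n \<epsilon> u z * partial_t \<Phi> z) = (LINT z:?Q|lborel. T_eps u ux uxxx z * \<Phi> z) - (LINT z:?Q|lborel. R_eps n \<epsilon> u uxxx z * partial_x \<Phi> z)"
    using p\<tau>[OF \<tau>] \<Phi> unfolding prop_vi_def by blast
  then show ?thesis unfolding T F by simp
qed

definition "G t = W11_functional \<Omega> (\<lambda>x. f0 (t, x)) (\<lambda>x. f1 (t, x))"

lemma G_bounds:
  assumes \<tau>: "0 < \<tau>"
  shows "G \<in> bochner_Lp 1 {0<..<\<tau>} (Wm11 \<Omega>) (Wm11_norm \<Omega>)" "bochner_norm 1 {0<..<\<tau>} (Wm11_norm \<Omega>) G \<le> M1 \<tau>"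
  using W11_functional_slices[OF f0_integrable[OF \<tau>] f1_integrable[OF \<tau>] \<tau>] total_L1[OF \<tau>]
  unfolding G_def[abs_def] by auto

lemma G_time_deriv:
  assumes \<tau>: "0 < \<tau>"
  shows "time_deriv {0<..<\<tau>} \<Omega> (rho n \<epsilon> u) G"
  unfolding time_deriv_def
proof (intro ballI conjI)
  let ?I = "{0<..<\<tau>}"
  fix \<Phi> assume \<Phi>: "\<Phi> \<in> test_functions (?I \<times> \<Omega>)"
  have dx: "partial_x \<Phi> \<in> test_functions (?I \<times> \<Omega>)" by (rule test_functions_partial[OF \<Phi>]) (simp add: Basis_prod_def)
  note i0 = set_integrable_prodD[OF set_integrable_mult_test[OF f0_integrable[OF \<tau>] \<Phi>]]
    and i1 = set_integrable_prodD[OF set_integrable_mult_test[OF f1_integrable[OF \<tau>] dx]]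
  have G: "G t (curry \<Phi> t) = (LINT x:\<Omega>|lborel. f0 (t, x) * \<Phi> (t, x)) - (LINT x:\<Omega>|lborel. f1 (t, x) * partial_x \<Phi> (t, x))" for t
    unfolding G_def W11_functional_def using test_functions_slice[OF \<Phi>] deriv_slice[OF test_functions_smooth[OF \<Phi>]] by simp
  have i: "set_integrable lborel ?I (\<lambda>t. G t (curry \<Phi> t))"
    unfolding G by (rule set_integral_diff(1)[OF i0(2) i1(2)])
  then show "set_integrable lebesgue ?I (\<lambda>t. G t (curry \<Phi> t))"
    unfolding set_integrable_def by (subst integrable_completion) (auto dest: borel_measurable_integrable)
  have "(LINT t:?I|lebesgue. G t (curry \<Phi> t)) = (LINT t:?I|lborel. G t (curry \<Phi> t))"
    using i unfolding set_integrable_def set_lebesgue_integral_def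
    by (intro integral_completion) (auto dest: borel_measurable_integrable)
  also have "\<dots> = (LINT z:?I \<times> \<Omega>|lborel. f0 z * \<Phi> z) - (LINT z:?I \<times> \<Omega>|lborel. f1 z * partial_x \<Phi> z)"
    unfolding G i0(3) i1(3) by (rule set_integral_diff(2)[OF i0(2) i1(2)])
  finally show "- (LINT z:?I \<times> \<Omega>|lborel. rho n \<epsilon> u z * partial_t \<Phi> z) = (LINT t:?I|lebesgue. G t (curry \<Phi> t))"
    using rho_equation[OF \<tau> \<Phi>] by simp
qed

section \<open>Variation of the entropy density in time\<close>

definition "m t = L1_norm \<Omega> (\<lambda>x. f0 (t, x)) + L1_norm \<Omega> (\<lambda>x. f1 (t, x))"

lemma m_nonneg: "0 \<le> m t"
  unfolding m_def by (intro add_nonneg_nonneg L1_norm_nonneg)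

lemma m_integrable: "0 < \<tau> \<Longrightarrow> set_integrable lborel {0<..<\<tau>} m"
  unfolding m_def[abs_def] L1_norm_def
  by (intro set_integral_add(1) set_integrable_prodD(2) set_integrable_abs f0_integrable f1_integrable)

lemma m_integral: "0 < \<tau> \<Longrightarrow> (LINT t:{0<..<\<tau>}|lborel. m t) \<le> M1 \<tau>"
proof -
  assume \<tau>: "0 < \<tau>"
  note i0 = set_integrable_prodD[OF set_integrable_abs[OF f0_integrable[OF \<tau>]]]
    and i1 = set_integrable_prodD[OF set_integrable_abs[OF f1_integrable[OF \<tau>]]]
  have "(LINT t:{0<..<\<tau>}|lborel. m t) = L1_norm ({0<..<\<tau>} \<times> \<Omega>) f0 + L1_norm ({0<..<\<tau>} \<times> \<Omega>) f1"
    unfolding m_def L1_norm_def i0(3) i1(3) by (rule set_integral_add(2)[OF i0(2) i1(2)])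
  then show ?thesis using total_L1[OF \<tau>] by simp
qed

text \<open>Tensor products of a function of time with \<open>\<phi>\<close>, tested in the
  distributional equation, give the pairing with \<open>\<phi>\<close> a weak time derivative. The
  pairing is continuous in time, so the fundamental theorem for weak derivatives yields the
  increment for every pair of times rather than almost every one.\<close>

lemma rho_pairing_increment:
  assumes st: "0 < s" "s \<le> t" and \<phi>: "\<phi> \<in> test_functions \<Omega>"
  shows "(LINT x:\<Omega>|lborel. rho n \<epsilon> u (t, x) * \<phi> x) - (LINT x:\<Omega>|lborel. rho n \<epsilon> u (s, x) * \<phi> x) =
    (LINT r:{s..t}|lborel. (LINT x:\<Omega>|lborel. f0 (r, x) * \<phi> x) - (LINT x:\<Omega>|lborel. f1 (r, x) * deriv \<phi> x))"
proof -
  \<comment> \<open>Any horizon beyond \<open>t\<close> would do: \<open>{s..t}\<close> has to lie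
    inside the open time interval.\<close>
  define \<tau> where "\<tau> = t + 1"
  let ?I = "{0<..<\<tau>}"
  let ?Q = "?I \<times> \<Omega>"
  have \<tau>: "0 < \<tau>" using st by (simp add: \<tau>_def)
  define P where "P r = (LINT x:\<Omega>|lborel. rho n \<epsilon> u (r, x) * \<phi> x)" for r
  define q where "q r = (LINT x:\<Omega>|lborel. f0 (r, x) * \<phi> x) - (LINT x:\<Omega>|lborel. f1 (r, x) * deriv \<phi> x)" for r
  note d\<phi> = test_functions_deriv[OF \<phi>]
  note i0 = set_integrable_prodD[OF set_integrable_mult_test_snd[OF f0_integrable[OF \<tau>] \<phi>], unfolded snd_conv]
    and i1 = set_integrable_prodD[OF set_integrable_mult_test_snd[OF f1_integrable[OF \<tau>] d\<phi>], unfolded snd_conv]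
  have qi: "set_integrable lborel ?I q"
    unfolding q_def[abs_def] by (rule set_integral_diff(1)[OF i0(2) i1(2)])
  have cP: "continuous_on ?I P"
  proof -
    have "continuous_on ({0..} \<times> cbox a b) (\<lambda>(r, x). rho n \<epsilon> u (r, x) * \<phi> x)"
      unfolding case_prod_beta
      by (intro continuous_intros continuous_on_compose2[OF rho_cont] continuous_on_compose2[OF test_functions_continuous[OF \<phi>]]) auto
    then have "continuous_on ({0..} :: real set) (\<lambda>r. integral (cbox a b) (\<lambda>x. rho n \<epsilon> u (r, x) * \<phi> x))"
      by (rule integral_continuous_on_param)
    then have c: "continuous_on ?I (\<lambda>r. integral {a..b} (\<lambda>x. rho n \<epsilon> u (r, x) * \<phi> x))"
      unfolding cbox_interval by (rule continuous_on_subset) auto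
    have eqP: "P r = integral {a..b} (\<lambda>x. rho n \<epsilon> u (r, x) * \<phi> x)" if "r \<in> ?I" for r
    proof -
      have ci: "set_integrable lborel {a..b} (\<lambda>x. rho n \<epsilon> u (r, x) * \<phi> x)"
        using that by (intro borel_integrable_atLeastAtMost' continuous_intros rho_slice_cont test_functions_continuous[OF \<phi>]) auto
      have ends: "\<phi> a = 0" "\<phi> b = 0" using \<phi> by (auto elim!: test_functions_support simp: subset_eq)
      have "P r = (LINT x:{a..b}|lborel. rho n \<epsilon> u (r, x) * \<phi> x)"
        unfolding P_def set_lebesgue_integral_def
      proof (intro Bochner_Integration.integral_cong refl)
        fix x
        show "indicator \<Omega> x *\<^sub>R (rho n \<epsilon> u (r, x) * \<phi> x) = indicator {a..b} x *\<^sub>R (rho n \<epsilon> u (r, x) * \<phi> x)"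
          using ends by (cases "x = a \<or> x = b") (auto simp: indicator_def)
      qed
      then show ?thesis using set_borel_integral_eq_integral(2)[OF ci] by simp
    qed
    show ?thesis by (rule continuous_on_eq[OF c]) (rule eqP[symmetric])
  qed
  have loc: "loc_integrable ?I P" "loc_integrable ?I q"
    unfolding loc_integrable_def
  proof (safe)
    fix K :: "real set" assume K: "compact K" "K \<subseteq> ?I"
    show "set_integrable lborel K P"
      unfolding set_integrable_def using K by (intro borel_integrable_compact continuous_on_subset[OF cP])
    show "set_integrable lborel K q"
      by (rule set_integrable_subset[OF qi]) (use K in \<open>auto intro: borel_compact\<close>)
  qed
  have "weak_deriv ?I P q"
    unfolding weak_deriv_def
  proof (intro conjI ballI loc)
    fix \<theta> assume \<theta>: "\<theta> \<in> test_functions ?I"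
    define \<Phi> where "\<Phi> z = \<theta> (fst z) * \<phi> (snd z)" for z
    have \<Phi>: "\<Phi> \<in> test_functions ?Q" "partial_t \<Phi> = (\<lambda>z. deriv \<theta> (fst z) * \<phi> (snd z))"
      using test_functions_tensor[OF \<theta> \<phi>] unfolding \<Phi>_def[abs_def] by auto
    have dx: "partial_x \<Phi> \<in> test_functions ?Q" and dt: "partial_t \<Phi> \<in> test_functions ?Q"
      by (rule test_functions_partial[OF \<Phi>(1)]; simp add: Basis_prod_def)+
    have px: "partial_x \<Phi> (r, x) = \<theta> r * deriv \<phi> x" for r x
    proof -
      have "deriv (curry \<Phi> r) x = \<theta> r * deriv \<phi> x"
        unfolding \<Phi>_def curry_def fst_conv snd_conv
        by (rule DERIV_imp_deriv) (rule DERIV_cmult[OF smooth_real_DERIV[OF test_functions_smooth[OF \<phi>]]])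
      then show ?thesis using deriv_slice[OF test_functions_smooth[OF \<Phi>(1)], of r x] by simp
    qed
    have 1: "(LINT z:?Q|lborel. rho n \<epsilon> u z * partial_t \<Phi> z) = (LINT r:?I|lborel. P r * deriv \<theta> r)"
    proof -
      have e: "(LINT z:?Q|lborel. rho n \<epsilon> u z * partial_t \<Phi> z) = (LINT r:?I|lborel. LINT x:\<Omega>|lborel. rho n \<epsilon> u (r, x) * partial_t \<Phi> (r, x))"
        by (rule set_integrable_prodD(3)[OF rho_Phi_integrable[OF dt]])
      have s: "(LINT x:\<Omega>|lborel. rho n \<epsilon> u (r, x) * partial_t \<Phi> (r, x)) = P r * deriv \<theta> r" for r
      proof -
        have "rho n \<epsilon> u (r, x) * partial_t \<Phi> (r, x) = (rho n \<epsilon> u (r, x) * \<phi> x) * deriv \<theta> r" for x by (simp add: \<Phi>(2))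
        then show ?thesis unfolding P_def by (simp only: set_integral_mult_left)
      qed
      show ?thesis unfolding e s ..
    qed
    have 2: "(LINT z:?Q|lborel. f0 z * \<Phi> z) - (LINT z:?Q|lborel. f1 z * partial_x \<Phi> z) = (LINT r:?I|lborel. q r * \<theta> r)"
    proof -
      note j0 = set_integrable_prodD[OF set_integrable_mult_test[OF f0_integrable[OF \<tau>] \<Phi>(1)]]
        and j1 = set_integrable_prodD[OF set_integrable_mult_test[OF f1_integrable[OF \<tau>] dx]]
      have "(LINT x:\<Omega>|lborel. f0 (r, x) * \<Phi> (r, x)) - (LINT x:\<Omega>|lborel. f1 (r, x) * partial_x \<Phi> (r, x)) = q r * \<theta> r" for r
      proof -
        have "f0 (r, x) * \<Phi> (r, x) = (f0 (r, x) * \<phi> x) * \<theta> r" "f1 (r, x) * partial_x \<Phi> (r, x) = (f1 (r, x) * deriv \<phi> x) * \<theta> r" for x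
          by (simp_all add: \<Phi>_def px)
        then show ?thesis unfolding q_def by (simp only: set_integral_mult_left left_diff_distrib)
      qed
      then show ?thesis unfolding j0(3) j1(3) using set_integral_diff(2)[OF j0(2) j1(2)] by simp
    qed
    show "(LINT r:?I|lborel. P r * deriv \<theta> r) = - (LINT r:?I|lborel. q r * \<theta> r)"
      using rho_equation[OF \<tau> \<Phi>(1)] unfolding 1 2 by simp
  qed
  from weak_deriv_FTC[OF _ cP this st(2)] have "P t - P s = (LINT r:{s..t}|lborel. q r)"
    using st by (auto simp: \<tau>_def subset_eq)
  then show ?thesis unfolding P_def q_def .
qed

text \<open>The time integrals of the two densities over \<open>{s..t}\<close> form a pair
  representing the increment, so the norm bound is read off from the infimum and no integral with
  values in the dual space is needed. Fubini exchanges the time integral with the pairing and with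
  the \<open>L\<^sup>1\<close> norms.\<close>

lemma rho_increment:
  assumes st: "0 < s" "s \<le> t"
  shows "Wm11_norm \<Omega> (distr_of \<Omega> (\<lambda>x. rho n \<epsilon> u (t, x)) - distr_of \<Omega> (\<lambda>x. rho n \<epsilon> u (s, x))) \<le> (LINT r:{s..t}|lborel. m r)"
proof -
  define \<tau> where "\<tau> = t + 1"
  let ?J = "{s..t}"
  have \<tau>: "0 < \<tau>" using st by (simp add: \<tau>_def)
  have JI: "?J \<subseteq> {0<..<\<tau>}" using st by (auto simp: \<tau>_def)
  have J: "set_integrable lborel (?J \<times> \<Omega>) f" if "set_integrable lborel ({0<..<\<tau>} \<times> \<Omega>) f" for f :: "real \<times> real \<Rightarrow> real"
    by (rule set_integrable_subset[OF that]) (use JI in \<open>auto intro!: borel_Times\<close>)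
  define F where "F f x = (LINT r:?J|lborel. f (r, x))" for f :: "real \<times> real \<Rightarrow> real" and x
  have F: "set_integrable lborel \<Omega> (F f)" "L1_norm \<Omega> (F f) \<le> (LINT r:?J|lborel. L1_norm \<Omega> (\<lambda>x. f (r, x)))"
    "\<psi> \<in> test_functions \<Omega> \<Longrightarrow> (LINT x:\<Omega>|lborel. F f x * \<psi> x) = (LINT r:?J|lborel. LINT x:\<Omega>|lborel. f (r, x) * \<psi> x)"
    "\<psi> \<in> test_functions \<Omega> \<Longrightarrow> set_integrable lborel ?J (\<lambda>r. LINT x:\<Omega>|lborel. f (r, x) * \<psi> x)"
    if f: "set_integrable lborel ({0<..<\<tau>} \<times> \<Omega>) f" for f :: "real \<times> real \<Rightarrow> real" and \<psi>
  proof -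
    note i = J[OF f]
    note sw = set_integrable_prod_swap[OF i]
    show Fi: "set_integrable lborel \<Omega> (F f)"
      using set_integrable_prodD(2)[OF sw(1)] by (simp add: F_def[abs_def])
    note ai = set_integrable_abs[OF i]
    note asw = set_integrable_prod_swap[OF ai]
    have Ai: "set_integrable lborel \<Omega> (\<lambda>x. LINT r:?J|lborel. \<bar>f (r, x)\<bar>)"
      using set_integrable_prodD(2)[OF asw(1)] by simp
    have "L1_norm \<Omega> (F f) \<le> (LINT x:\<Omega>|lborel. LINT r:?J|lborel. \<bar>f (r, x)\<bar>)"
      unfolding L1_norm_def
    proof (rule set_integral_mono[OF set_integrable_abs[OF Fi] Ai])
      fix x show "\<bar>F f x\<bar> \<le> (LINT r:?J|lborel. \<bar>f (r, x)\<bar>)"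
        unfolding F_def set_lebesgue_integral_def by (rule order_trans[OF integral_abs_bound]) (simp add: abs_mult)
    qed
    also have "\<dots> = (LINT z:\<Omega> \<times> ?J|lborel. \<bar>f (snd z, fst z)\<bar>)"
      using set_integrable_prodD(3)[OF asw(1)] by simp
    also have "\<dots> = (LINT r:?J|lborel. LINT x:\<Omega>|lborel. \<bar>f (r, x)\<bar>)"
      unfolding asw(2) by (rule set_integrable_prodD(3)[OF ai])
    finally show "L1_norm \<Omega> (F f) \<le> (LINT r:?J|lborel. L1_norm \<Omega> (\<lambda>x. f (r, x)))" by (simp add: L1_norm_def)
    assume \<psi>: "\<psi> \<in> test_functions \<Omega>"
    note k = set_integrable_mult_test_snd[OF i \<psi>]
    note ksw = set_integrable_prod_swap[OF k]
    have "(LINT x:\<Omega>|lborel. F f x * \<psi> x) = (LINT x:\<Omega>|lborel. LINT r:?J|lborel. f (r, x) * \<psi> x)"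
      by (simp add: F_def)
    also have "\<dots> = (LINT z:\<Omega> \<times> ?J|lborel. f (snd z, fst z) * \<psi> (fst z))"
      using set_integrable_prodD(3)[OF ksw(1)] by simp
    also have "\<dots> = (LINT r:?J|lborel. LINT x:\<Omega>|lborel. f (r, x) * \<psi> x)"
      using ksw(2) set_integrable_prodD(3)[OF k] by simp
    finally show "(LINT x:\<Omega>|lborel. F f x * \<psi> x) = (LINT r:?J|lborel. LINT x:\<Omega>|lborel. f (r, x) * \<psi> x)" .
    show "set_integrable lborel ?J (\<lambda>r. LINT x:\<Omega>|lborel. f (r, x) * \<psi> x)"
      using set_integrable_prodD(2)[OF k] by simp
  qed
  note F0 = F[OF f0_integrable[OF \<tau>]] and F1 = F[OF f1_integrable[OF \<tau>]]
  have "distr_of \<Omega> (\<lambda>x. rho n \<epsilon> u (t, x)) - distr_of \<Omega> (\<lambda>x. rho n \<epsilon> u (s, x)) = W11_functional \<Omega> (F f0) (F f1)"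
  proof
    fix \<phi>
    show "(distr_of \<Omega> (\<lambda>x. rho n \<epsilon> u (t, x)) - distr_of \<Omega> (\<lambda>x. rho n \<epsilon> u (s, x))) \<phi> = W11_functional \<Omega> (F f0) (F f1) \<phi>"
    proof (cases "\<phi> \<in> test_functions \<Omega>")
      case True
      note d = test_functions_deriv[OF True]
      show ?thesis
        using rho_pairing_increment[OF st True] set_integral_diff(2)[OF F0(4)[OF True] F1(4)[OF d]] True
        by (simp add: distr_of_def W11_functional_def F0(3)[OF True] F1(3)[OF d])
    qed (simp add: distr_of_def W11_functional_def)
  qed
  then have "Wm11_norm \<Omega> (distr_of \<Omega> (\<lambda>x. rho n \<epsilon> u (t, x)) - distr_of \<Omega> (\<lambda>x. rho n \<epsilon> u (s, x))) \<le> L1_norm \<Omega> (F f0) + L1_norm \<Omega> (F f1)"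
    using Wm11_norm_le[OF F0(1) F1(1)] by simp
  also have "\<dots> \<le> (LINT r:?J|lborel. L1_norm \<Omega> (\<lambda>x. f0 (r, x))) + (LINT r:?J|lborel. L1_norm \<Omega> (\<lambda>x. f1 (r, x)))"
    by (intro add_mono F0(2) F1(2))
  also have "\<dots> = (LINT r:?J|lborel. m r)"
    unfolding m_def L1_norm_def
    by (rule set_integral_add(2)[symmetric])
      (rule set_integrable_prodD(2)[OF set_integrable_abs[OF J[OF f0_integrable[OF \<tau>]]]],
       rule set_integrable_prodD(2)[OF set_integrable_abs[OF J[OF f1_integrable[OF \<tau>]]]])
  finally show ?thesis .
qed

text \<open>The variation function is the integral of \<open>m\<close> over \<open>{0<..t}\<close>.
  Its bound \<open>M1 \<tau>\<close> does not involve \<open>\<epsilon>\<close>, which is what Helly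
  selection asks for; a modulus of continuity common to all \<open>\<epsilon>\<close> would not
  follow from a bound in \<open>L\<^sup>1\<close>.\<close>

lemma rho_BV:
  assumes \<tau>: "0 < \<tau>"
  shows "\<exists>\<mu>. mono_on {0<..<\<tau>} \<mu> \<and> (\<forall>t\<in>{0<..<\<tau>}. \<mu> t \<in> {0..M1 \<tau>}) \<and>
    (\<forall>s\<in>{0<..<\<tau>}. \<forall>t\<in>{0<..<\<tau>}. s \<le> t \<longrightarrow>
      Wm11_norm \<Omega> (distr_of \<Omega> (\<lambda>x. rho n \<epsilon> u (t, x)) - distr_of \<Omega> (\<lambda>x. rho n \<epsilon> u (s, x))) \<le> \<mu> t - \<mu> s)"
proof -
  let ?I = "{0<..<\<tau>}"
  define \<mu> where "\<mu> t = (LINT r:{0<..t}|lborel. m r)" for t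
  have sub: "set_integrable lborel A m" if "A \<subseteq> ?I" "A \<in> sets borel" for A
    by (rule set_integrable_subset[OF m_integrable[OF \<tau>]]) (use that in auto)
  have nn: "0 \<le> (LINT r:A|lborel. m r)" for A
    unfolding set_lebesgue_integral_def by (intro Bochner_Integration.integral_nonneg) (simp add: m_nonneg)
  have diff: "\<mu> t - \<mu> s = (LINT r:{s..t}|lborel. m r)" if "s \<in> ?I" "t \<in> ?I" "s \<le> t" for s t
  proof -
    have "{0<..t} = {0<..s} \<union> {s<..t}" using that by auto
    then have "\<mu> t = \<mu> s + (LINT r:{s<..t}|lborel. m r)"
      unfolding \<mu>_def using that by (simp only:) (rule set_integral_Un; (rule sub)?; auto)
    moreover have "(LINT r:{s<..t}|lborel. m r) = (LINT r:{s..t}|lborel. m r)"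
      unfolding set_lebesgue_integral_def
    proof (rule integral_cong_AE)
      show "AE r in lborel. indicator {s<..t} r *\<^sub>R m r = indicator {s..t} r *\<^sub>R m r"
        using AE_lborel_singleton[of s] by eventually_elim (auto simp: indicator_def)
      have "set_integrable lborel {s<..t} m" "set_integrable lborel {s..t} m" using that by (auto intro!: sub)
      then show "(\<lambda>r. indicator {s<..t} r *\<^sub>R m r) \<in> borel_measurable lborel" "(\<lambda>r. indicator {s..t} r *\<^sub>R m r) \<in> borel_measurable lborel"
        unfolding set_integrable_def by (auto dest: borel_measurable_integrable)
    qed
    ultimately show ?thesis by simp
  qed
  show ?thesis
  proof (intro exI[of _ \<mu>] conjI ballI impI)
    show "mono_on ?I \<mu>"
      unfolding mono_on_def
    proof (intro allI impI)
      fix s t assume "s \<in> ?I \<and> t \<in> ?I \<and> s \<le> t"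
      then show "\<mu> s \<le> \<mu> t" using diff[of s t] nn[of "{s..t}"] by simp
    qed
    show "\<mu> t \<in> {0..M1 \<tau>}" if t: "t \<in> ?I" for t
    proof -
      have "\<mu> t \<le> (LINT r:?I|lborel. m r)"
        unfolding \<mu>_def set_lebesgue_integral_def
      proof (rule integral_mono)
        show "integrable lborel (\<lambda>r. indicator {0<..t} r *\<^sub>R m r)" "integrable lborel (\<lambda>r. indicator ?I r *\<^sub>R m r)"
          unfolding set_integrable_def[symmetric] using t by (auto intro!: sub)
        show "indicator {0<..t} r *\<^sub>R m r \<le> indicator ?I r *\<^sub>R m r" for r
          using t m_nonneg[of r] by (auto simp: indicator_def)
      qed
      then have "\<mu> t \<le> M1 \<tau>" using m_integral[OF \<tau>] by (rule order_trans)
      moreover have "0 \<le> \<mu> t" unfolding \<mu>_def by (rule nn)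
      ultimately show ?thesis by simp
    qed
    show "Wm11_norm \<Omega> (distr_of \<Omega> (\<lambda>x. rho n \<epsilon> u (t, x)) - distr_of \<Omega> (\<lambda>x. rho n \<epsilon> u (s, x))) \<le> \<mu> t - \<mu> s"
      if "s \<in> ?I" "t \<in> ?I" "s \<le> t" for s t
      using rho_increment[of s t] diff[OF that] that by simp
  qed
qed

end

theorem proposition1p4:
  fixes a b n :: real
    and uin :: "real \<Rightarrow> real"
    and u ux uxx uxxx :: "real \<Rightarrow> real \<times> real \<Rightarrow> real"
  assumes "a < b"
    and "0 < n" and "n < 3"
    and "uin \<in> Hk 1 {a<..<b}"
    and "AE x in lborel. x \<in> {a<..<b} \<longrightarrow> 0 \<le> uin x"
    and "(LINT x:{a<..<b}|lborel. uin x) = 1"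
    and "\<And>\<epsilon>. \<epsilon> \<in> {0<..1/2} \<Longrightarrow>
           thin_film_solution a b n uin \<epsilon> (u \<epsilon>) (ux \<epsilon>) (uxx \<epsilon>) (uxxx \<epsilon>)"
  shows "(\<forall>\<tau>>0. 
            (\<exists>C. \<forall>\<epsilon>\<in>{0<..1/2}.
               ess_bounded_by ({0<..<\<tau>} \<times> {a<..<b}) (rho n \<epsilon> (u \<epsilon>)) C) \<and>
            (\<exists>C. \<forall>\<epsilon>\<in>{0<..1/2}.
               \<exists>G\<in>bochner_Lp 1 {0<..<\<tau>} (Wm11 {a<..<b}) (Wm11_norm {a<..<b}).
                 time_deriv {0<..<\<tau>} {a<..<b} (rho n \<epsilon> (u \<epsilon>)) G \<and>
                 bochner_norm 1 {0<..<\<tau>} (Wm11_norm {a<..<b}) G \<le> C)) \<and>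
         (\<forall>p\<ge>1. \<forall>\<tau>>0.
            relatively_compact
              (bochner_topology p {0<..<\<tau>} (Wm11 {a<..<b}) (Wm11_norm {a<..<b}))
              ((\<lambda>\<epsilon> t. distr_of {a<..<b} (\<lambda>x. rho n \<epsilon> (u \<epsilon>) (t, x))) ` {0<..1/2}))"
proof -
  let ?\<Omega> = "{a<..<b}"
  have tf: "thin_film n a b \<epsilon> uin (u \<epsilon>) (ux \<epsilon>) (uxx \<epsilon>) (uxxx \<epsilon>)" if "\<epsilon> \<in> {0<..1/2}" for \<epsilon>
    using assms that by unfold_locales auto
  \<comment> \<open>Outside the locale the constant shows its arguments, and
    \<open>\<epsilon>\<close> is not among them.\<close>
  let ?C = "thin_film.C\<rho> n a b uin"
  have bdd: "ess_bounded_by ({0<..<\<tau>} \<times> ?\<Omega>) (rho n \<epsilon> (u \<epsilon>)) ?C" if "\<epsilon> \<in> {0<..1/2}" for \<epsilon> \<tau>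
  proof -
    interpret thin_film n a b \<epsilon> uin "u \<epsilon>" "ux \<epsilon>" "uxx \<epsilon>" "uxxx \<epsilon>" by (rule tf[OF that])
    have "\<bar>rho n \<epsilon> (u \<epsilon>) z\<bar> \<le> C\<rho>" if "z \<in> {0<..<\<tau>} \<times> ?\<Omega>" for z
      using rho_bounds[of "fst z" "snd z"] that by (auto simp: mem_Times_iff)
    then show ?thesis
      using cont_measurable_Q[OF rho_cont] unfolding ess_bounded_by_def set_borel_measurable_def by simp
  qed
  have td: "\<exists>G\<in>bochner_Lp 1 {0<..<\<tau>} (Wm11 ?\<Omega>) (Wm11_norm ?\<Omega>).
       time_deriv {0<..<\<tau>} ?\<Omega> (rho n \<epsilon> (u \<epsilon>)) G \<and>
       bochner_norm 1 {0<..<\<tau>} (Wm11_norm ?\<Omega>) G \<le> thin_film.M1 n a b uin \<tau>"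
    if "0 < \<tau>" "\<epsilon> \<in> {0<..1/2}" for \<epsilon> \<tau>
  proof -
    interpret thin_film n a b \<epsilon> uin "u \<epsilon>" "ux \<epsilon>" "uxx \<epsilon>" "uxxx \<epsilon>" by (rule tf[OF that(2)])
    show ?thesis using G_bounds[OF that(1)] G_time_deriv[OF that(1)] by blast
  qed
  have rc: "relatively_compact (bochner_topology p {0<..<\<tau>} (Wm11 ?\<Omega>) (Wm11_norm ?\<Omega>))
      ((\<lambda>\<epsilon> t. distr_of ?\<Omega> (\<lambda>x. rho n \<epsilon> (u \<epsilon>) (t, x))) ` {0<..1/2})" if p: "1 \<le> p" and \<tau>: "0 < \<tau>" for p \<tau>
  proof (rule Wm11.BV_relatively_compact[OF \<tau> p, where V = "bounded_densities a b ?C"])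
    show "bounded_densities a b ?C \<subseteq> Wm11 ?\<Omega>" by (rule bounded_densities_Wm11)
    show "Wm11_norm ?\<Omega> v \<le> ?C * (b - a)" if "v \<in> bounded_densities a b ?C" for v
      using bounded_densities_norm[OF that] assms(1) by simp
    show "\<exists>l\<in>Wm11 ?\<Omega>. \<exists>r. strict_mono r \<and> (\<lambda>j. Wm11_norm ?\<Omega> (g (r j) - l)) \<longlonglongrightarrow> 0"
      if "\<And>j. g j \<in> bounded_densities a b ?C" for g :: "nat \<Rightarrow> distr"
      by (rule bounded_densities_seq_compact[OF assms(1) that])
    fix f assume "f \<in> (\<lambda>\<epsilon> t. distr_of ?\<Omega> (\<lambda>x. rho n \<epsilon> (u \<epsilon>) (t, x))) ` {0<..1/2}"
    then obtain \<epsilon> where \<epsilon>: "\<epsilon> \<in> {0<..1/2}" and f: "f = (\<lambda>t. distr_of ?\<Omega> (\<lambda>x. rho n \<epsilon> (u \<epsilon>) (t, x)))" by blast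
    interpret thin_film n a b \<epsilon> uin "u \<epsilon>" "ux \<epsilon>" "uxx \<epsilon>" "uxxx \<epsilon>" by (rule tf[OF \<epsilon>])
    show "f t \<in> bounded_densities a b ?C" if "t \<in> {0<..<\<tau>}" for t
      unfolding f using that by (intro rho_bounded_densities) simp
    show "\<exists>\<mu>. mono_on {0<..<\<tau>} \<mu> \<and> (\<forall>t\<in>{0<..<\<tau>}. \<mu> t \<in> {0..thin_film.M1 n a b uin \<tau>}) \<and>
        (\<forall>s\<in>{0<..<\<tau>}. \<forall>t\<in>{0<..<\<tau>}. s \<le> t \<longrightarrow> Wm11_norm ?\<Omega> (f t - f s) \<le> \<mu> t - \<mu> s)"
      unfolding f by (rule rho_BV[OF \<tau>])
  qed
  show ?thesis using bdd td rc by blast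
qed

end
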